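(* On any smooth irreducible projective complex curve $C$ there exist non-complete linear systems, i.e. a line bundle $\mathcal{L}$ and a proper subspace $V\subsetneq H^0(\mathcal{L})$ generating $\mathcal{L}$, such that $(C,\mathcal{L},V)$ is linearly stable and $M_{V,\mathcal{L}}$ is unstable (not semistable).
   Context: The dual span bundle is $M_{V,\mathcal{L}}:=\ker(V\otimes\mathcal{O}_C\to\mathcal{L})$, the kernel of the evaluation map. A vector bundle $\mathcal{E}$ with slope $\mu(\mathcal{E})=\deg\mathcal{E}/\mathrm{rank}\,\mathcal{E}$ is semistable if $\mu(\mathcal{F})\leq\mu(\mathcal{E})$ for every proper nonzero subbundle $\mathcal{F}\subset\mathcal{E}$. Linear stability: let $d=\deg\mathcal{L}$, $\dim V=r+1$. The triple $(C,\mathcal{L},V)$ is linearly stable if every linear series of degree $d'$ and dimension $r'$ contained in $|V|$ satisfies $d'/r'>d/r$; that is, for every proper subspace $V'\subsetneq V$ with $r'+1=\dim V'\geq 2$, letting $\mathcal{L}'\subseteq\mathcal{L}$ be the subsheaf (line bundle) generated by $V'$ and $d'=\deg\mathcal{L}'$, one has $d'/r'>d/r$. *)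

theory Defs
  imports
    Complex_Main
    "HOL-Library.Function_Algebras"
    "Jordan_Normal_Form.Determinant"
begin

section \<open>Complex vector spaces\<close>

class complex_vector = ab_group_add +
  fixes scaleC :: "complex \<Rightarrow> 'a \<Rightarrow> 'a" (infixr \<open>*\<^sub>C\<close> 75)
  assumes scaleC_add_right: "a *\<^sub>C (x + y) = a *\<^sub>C x + a *\<^sub>C y"
    and scaleC_add_left: "(a + b) *\<^sub>C x = a *\<^sub>C x + b *\<^sub>C x"
    and scaleC_scaleC: "a *\<^sub>C b *\<^sub>C x = (a * b) *\<^sub>C x"
    and scaleC_one: "1 *\<^sub>C x = x"

instantiation complex :: complex_vector
begin

definition scaleC_complex :: "complex \<Rightarrow> complex \<Rightarrow> complex"
  where "scaleC_complex a x = a * x"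

instance
  by standard (simp_all add: scaleC_complex_def algebra_simps)

end

instantiation "fun" :: (type, complex_vector) complex_vector
begin

definition scaleC_fun :: "complex \<Rightarrow> ('a \<Rightarrow> 'b) \<Rightarrow> 'a \<Rightarrow> 'b"
  where "scaleC_fun a f = (\<lambda>x. a *\<^sub>C f x)"

instance
  by standard
    (simp_all add: scaleC_fun_def plus_fun_def fun_eq_iff
      scaleC_add_right scaleC_add_left scaleC_scaleC scaleC_one)

end

interpretation complex_vector: vector_space "scaleC :: complex \<Rightarrow> 'a \<Rightarrow> 'a :: complex_vector"
  by standard (rule scaleC_add_right scaleC_add_left scaleC_scaleC scaleC_one)+


section \<open>Projective space and its Zariski topology\<close>

text \<open>The points of \<open>'n proj\<close> are the lines through the origin of the complex vector space
  \<open>'n \<Rightarrow> complex\<close>; this is projective space of dimension \<open>CARD('n) - 1\<close>.\<close>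

typedef (overloaded) 'n proj = "{range (\<lambda>c. c *\<^sub>C v) | v :: 'n::finite \<Rightarrow> complex. v \<noteq> 0}"
  by (rule exI[of _ "range (\<lambda>c. c *\<^sub>C (\<lambda>_. 1))"]) (auto simp: fun_eq_iff)

definition coords :: "'n::finite proj \<Rightarrow> ('n \<Rightarrow> complex) set"
  where "coords p = Rep_proj p - {0}"

text \<open>Homogeneous polynomials are represented by the functions they induce, which is harmless over
  the infinite field of complex numbers. The index set of the sum is the finite set of exponent
  vectors of total degree \<open>d\<close>.\<close>

definition homogeneous :: "nat \<Rightarrow> (('n::finite \<Rightarrow> complex) \<Rightarrow> complex) \<Rightarrow> bool"
  where "homogeneous d F \<longleftrightarrow>
    (\<exists>c. F = (\<lambda>x. \<Sum>m | (\<Sum>i\<in>UNIV. m i) = d. c m * (\<Prod>i\<in>UNIV. x i ^ m i)))"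

definition zariski_closed :: "'n::finite proj set \<Rightarrow> bool"
  where "zariski_closed Z \<longleftrightarrow>
    (\<exists>S. (\<forall>F\<in>S. \<exists>d. homogeneous d F) \<and> Z = {p. \<forall>F\<in>S. \<forall>v\<in>coords p. F v = 0})"

definition zariski_open_in :: "'n::finite proj set \<Rightarrow> 'n proj set \<Rightarrow> bool"
  where "zariski_open_in C U \<longleftrightarrow> (\<exists>Z. zariski_closed Z \<and> U = C - Z)"

definition irreducible_closed :: "'n::finite proj set \<Rightarrow> bool"
  where "irreducible_closed Z \<longleftrightarrow> zariski_closed Z \<and> Z \<noteq> {} \<and>
    (\<forall>A B. zariski_closed A \<and> zariski_closed B \<and> Z \<subseteq> A \<union> B \<longrightarrow> Z \<subseteq> A \<or> Z \<subseteq> B)"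

definition has_irreducible_chain :: "'n::finite proj set \<Rightarrow> nat \<Rightarrow> bool"
  where "has_irreducible_chain C d \<longleftrightarrow>
    (\<exists>Z. (\<forall>i\<le>d. irreducible_closed (Z i) \<and> Z i \<subseteq> C) \<and> (\<forall>i<d. Z i \<subset> Z (Suc i)))"

definition has_krull_dim :: "'n::finite proj set \<Rightarrow> nat \<Rightarrow> bool"
  where "has_krull_dim C d \<longleftrightarrow> has_irreducible_chain C d \<and> \<not> has_irreducible_chain C (Suc d)"


section \<open>Regular functions and smooth curves\<close>

text \<open>Only the values of \<open>f\<close> on \<open>U\<close> matter in \<open>regular_on C U f\<close>.\<close>

definition regular_on :: "'n::finite proj set \<Rightarrow> 'n proj set \<Rightarrow> ('n proj \<Rightarrow> complex) \<Rightarrow> bool"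
  where "regular_on C U f \<longleftrightarrow>
    (\<forall>p\<in>U. \<exists>W d F G. zariski_open_in C W \<and> p \<in> W \<and> W \<subseteq> U \<and> homogeneous d F \<and> homogeneous d G \<and>
      (\<forall>q\<in>W. \<forall>v\<in>coords q. G v \<noteq> 0 \<and> f q = F v / G v))"

definition regular_at :: "'n::finite proj set \<Rightarrow> 'n proj \<Rightarrow> ('n proj \<Rightarrow> complex) \<Rightarrow> bool"
  where "regular_at C p f \<longleftrightarrow> (\<exists>W. zariski_open_in C W \<and> p \<in> W \<and> regular_on C W f)"

text \<open>The germs of \<open>x 0, \<dots>, x (d - 1)\<close> generate the maximal ideal of the local ring of \<open>C\<close>
  at \<open>p\<close>; elements of the local ring are represented by functions regular near \<open>p\<close>,
  compared near \<open>p\<close>.\<close>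

definition generates_max_ideal ::
    "'n::finite proj set \<Rightarrow> 'n proj \<Rightarrow> nat \<Rightarrow> (nat \<Rightarrow> 'n proj \<Rightarrow> complex) \<Rightarrow> bool"
  where "generates_max_ideal C p d x \<longleftrightarrow>
    (\<forall>i<d. regular_at C p (x i) \<and> x i p = 0) \<and>
    (\<forall>g. regular_at C p g \<and> g p = 0 \<longrightarrow>
      (\<exists>a W. (\<forall>i<d. regular_at C p (a i)) \<and> zariski_open_in C W \<and> p \<in> W \<and>
        (\<forall>q\<in>W. g q = (\<Sum>i<d. a i q * x i q))))"

text \<open>Smoothness over the complex numbers is regularity of all local rings: at each point of an
  irreducible variety of dimension \<open>d\<close> the maximal ideal of the (\<open>d\<close>-dimensional) local ring is
  generated by \<open>d\<close> elements.\<close>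

definition smooth_irreducible_projective_variety :: "nat \<Rightarrow> 'n::finite proj set \<Rightarrow> bool"
  where "smooth_irreducible_projective_variety d C \<longleftrightarrow>
    irreducible_closed C \<and> has_krull_dim C d \<and> (\<forall>p\<in>C. \<exists>x. generates_max_ideal C p d x)"

abbreviation smooth_irreducible_projective_curve :: "'n::finite proj set \<Rightarrow> bool"
  where "smooth_irreducible_projective_curve \<equiv> smooth_irreducible_projective_variety 1"


section \<open>Vector bundles\<close>

text \<open>A sheaf of modules over the structure sheaf of \<open>C\<close> is given by the sets \<open>E U\<close> of its
  sections, which are functions on \<open>U\<close> with values in a complex vector space, with pointwise
  operations and restriction of functions. Sections are total functions, and their values outside
  \<open>U\<close> are irrelevant, so a section over \<open>U\<close> is really a class of functions agreeing on \<open>U\<close>.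
  Up to isomorphism every vector bundle is of this form: choose a basis, not depending
  algebraically on the point, in every fibre. No condition relates the values of sections to
  fibres, so that subsheaves such as the ideal sheaf of a point are included.\<close>

type_synonym ('n, 'v) fun_sheaf = "'n proj set \<Rightarrow> ('n proj \<Rightarrow> 'v) set"

definition module_sheaf :: "'n::finite proj set \<Rightarrow> ('n, 'v::complex_vector) fun_sheaf \<Rightarrow> bool"
  where "module_sheaf C E \<longleftrightarrow> (\<forall>U. zariski_open_in C U \<longrightarrow>
    (\<forall>s t. s \<in> E U \<and> (\<forall>q\<in>U. s q = t q) \<longrightarrow> t \<in> E U) \<and>
    (\<forall>s W. s \<in> E U \<and> zariski_open_in C W \<and> W \<subseteq> U \<longrightarrow> s \<in> E W) \<and>
    (\<forall>s. (\<forall>p\<in>U. \<exists>W. zariski_open_in C W \<and> p \<in> W \<and> W \<subseteq> U \<and> s \<in> E W) \<longrightarrow> s \<in> E U) \<and>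
    (\<lambda>q. 0) \<in> E U \<and>
    (\<forall>s\<in>E U. \<forall>t\<in>E U. (\<lambda>q. s q + t q) \<in> E U) \<and>
    (\<forall>a. \<forall>s\<in>E U. regular_on C U a \<longrightarrow> (\<lambda>q. a q *\<^sub>C s q) \<in> E U))"

text \<open>\<open>e 0, \<dots>, e (r - 1)\<close> freely generate the restriction of \<open>E\<close> to \<open>U\<close>.\<close>

definition frame :: "'n::finite proj set \<Rightarrow> nat \<Rightarrow> ('n, 'v::complex_vector) fun_sheaf \<Rightarrow>
    'n proj set \<Rightarrow> (nat \<Rightarrow> 'n proj \<Rightarrow> 'v) \<Rightarrow> bool"
  where "frame C r E U e \<longleftrightarrow> zariski_open_in C U \<and> (\<forall>i<r. e i \<in> E U) \<and>
    (\<forall>W. zariski_open_in C W \<and> W \<subseteq> U \<longrightarrow>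
      (\<forall>s\<in>E W. \<exists>a. (\<forall>i<r. regular_on C W (a i)) \<and>
        (\<forall>q\<in>W. s q = (\<Sum>i<r. a i q *\<^sub>C e i q))) \<and>
      (\<forall>a. (\<forall>i<r. regular_on C W (a i)) \<and> (\<forall>q\<in>W. (\<Sum>i<r. a i q *\<^sub>C e i q) = 0) \<longrightarrow>
        (\<forall>i<r. \<forall>q\<in>W. a i q = 0)))"

definition vector_bundle_of_rank ::
    "'n::finite proj set \<Rightarrow> nat \<Rightarrow> ('n, 'v::complex_vector) fun_sheaf \<Rightarrow> bool"
  where "vector_bundle_of_rank C r E \<longleftrightarrow> module_sheaf C E \<and> (\<forall>p\<in>C. \<exists>U e. p \<in> U \<and> frame C r E U e)"

definition vector_bundle :: "'n::finite proj set \<Rightarrow> ('n, 'v::complex_vector) fun_sheaf \<Rightarrow> bool"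
  where "vector_bundle C E \<longleftrightarrow> (\<exists>r. vector_bundle_of_rank C r E)"

definition line_bundle :: "'n::finite proj set \<Rightarrow> ('n, 'v::complex_vector) fun_sheaf \<Rightarrow> bool"
  where "line_bundle C L \<longleftrightarrow> vector_bundle_of_rank C 1 L"

definition bundle_rank :: "'n::finite proj set \<Rightarrow> ('n, 'v::complex_vector) fun_sheaf \<Rightarrow> nat"
  where "bundle_rank C E = (THE r. vector_bundle_of_rank C r E)"

text \<open>A subbundle is a locally free subsheaf that is locally a direct summand: near each point
  it is spanned by the first members of a frame of \<open>E\<close>.\<close>

definition subbundle :: "'n::finite proj set \<Rightarrow> ('n, 'v::complex_vector) fun_sheaf \<Rightarrow>
    ('n, 'v) fun_sheaf \<Rightarrow> bool"
  where "subbundle C F E \<longleftrightarrow> vector_bundle C F \<and>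
    (\<forall>U. zariski_open_in C U \<longrightarrow> F U \<subseteq> E U) \<and>
    (\<forall>p\<in>C. \<exists>U e. p \<in> U \<and> frame C (bundle_rank C E) E U e \<and> frame C (bundle_rank C F) F U e)"


section \<open>Degree\<close>

text \<open>Order of vanishing at \<open>p\<close> of a rational function on a smooth curve: near \<open>p\<close> it is a unit
  times a power of a uniformizer.\<close>

definition has_order_at ::
    "'n::finite proj set \<Rightarrow> 'n proj \<Rightarrow> ('n proj \<Rightarrow> complex) \<Rightarrow> int \<Rightarrow> bool"
  where "has_order_at C p f k \<longleftrightarrow>
    (\<exists>x u W. generates_max_ideal C p 1 (\<lambda>_. x) \<and> regular_at C p u \<and> u p \<noteq> 0 \<and>
      zariski_open_in C W \<and> p \<in> W \<and> (\<forall>q\<in>W - {p}. x q \<noteq> 0 \<and> f q = u q * x q powi k))"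

text \<open>A frame \<open>t\<close> of \<open>E\<close> over a nonempty open set \<open>U\<^sub>0\<close> gives a nonzero rational section of
  the determinant line bundle of \<open>E\<close>, the wedge product of \<open>t 0, \<dots>, t (r - 1)\<close>. Near \<open>p\<close> the
  determinant bundle is generated by the wedge product of a local frame \<open>e\<close>, and the coefficient
  of the rational section is the determinant of the transition matrix.\<close>

definition has_frame_order_at :: "'n::finite proj set \<Rightarrow> nat \<Rightarrow>
    ('n, 'v::complex_vector) fun_sheaf \<Rightarrow> 'n proj set \<Rightarrow> (nat \<Rightarrow> 'n proj \<Rightarrow> 'v) \<Rightarrow>
    'n proj \<Rightarrow> int \<Rightarrow> bool"
  where "has_frame_order_at C r E U\<^sub>0 t p k \<longleftrightarrow>
    (\<exists>U e a. p \<in> U \<and> frame C r E U e \<and>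
      (\<forall>i<r. \<forall>j<r. regular_on C (U \<inter> U\<^sub>0) (a i j)) \<and>
      (\<forall>i<r. \<forall>q\<in>U \<inter> U\<^sub>0. t i q = (\<Sum>j<r. a i j q *\<^sub>C e j q)) \<and>
      has_order_at C p (\<lambda>q. det (mat r r (\<lambda>(i, j). a i j q))) k)"

definition frame_order_at :: "'n::finite proj set \<Rightarrow> nat \<Rightarrow>
    ('n, 'v::complex_vector) fun_sheaf \<Rightarrow> 'n proj set \<Rightarrow> (nat \<Rightarrow> 'n proj \<Rightarrow> 'v) \<Rightarrow> 'n proj \<Rightarrow> int"
  where "frame_order_at C r E U\<^sub>0 t p = (THE k. has_frame_order_at C r E U\<^sub>0 t p k)"

text \<open>The degree of \<open>E\<close> is the degree of the divisor of any such rational section of its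
  determinant.\<close>

definition bundle_degree :: "'n::finite proj set \<Rightarrow> ('n, 'v::complex_vector) fun_sheaf \<Rightarrow> int"
  where "bundle_degree C E = (THE d. \<exists>U\<^sub>0 t. U\<^sub>0 \<noteq> {} \<and> frame C (bundle_rank C E) E U\<^sub>0 t \<and>
    d = (\<Sum>p | p \<in> C \<and> frame_order_at C (bundle_rank C E) E U\<^sub>0 t p \<noteq> 0.
          frame_order_at C (bundle_rank C E) E U\<^sub>0 t p))"


section \<open>Semistability\<close>

definition slope :: "'n::finite proj set \<Rightarrow> ('n, 'v::complex_vector) fun_sheaf \<Rightarrow> real"
  where "slope C E = real_of_int (bundle_degree C E) / real (bundle_rank C E)"

text \<open>A subbundle is nonzero and proper exactly if its rank is positive and smaller than that of
  the ambient bundle.\<close>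

definition semistable :: "'n::finite proj set \<Rightarrow> ('n, 'v::complex_vector) fun_sheaf \<Rightarrow> bool"
  where "semistable C E \<longleftrightarrow> vector_bundle C E \<and>
    (\<forall>F. subbundle C F E \<and> 0 < bundle_rank C F \<and> bundle_rank C F < bundle_rank C E \<longrightarrow>
      slope C F \<le> slope C E)"

definition unstable :: "'n::finite proj set \<Rightarrow> ('n, 'v::complex_vector) fun_sheaf \<Rightarrow> bool"
  where "unstable C E \<longleftrightarrow> vector_bundle C E \<and> \<not> semistable C E"


section \<open>Linear systems\<close>

text \<open>Global sections are normalized to vanish outside \<open>C\<close>, so that they form a vector space
  of functions.\<close>

definition global_sections ::
    "'n::finite proj set \<Rightarrow> ('n, 'v::complex_vector) fun_sheaf \<Rightarrow> ('n proj \<Rightarrow> 'v) set"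
  where "global_sections C L = {s \<in> L C. \<forall>p. p \<notin> C \<longrightarrow> s p = 0}"

definition generated_subsheaf ::
    "'n::finite proj set \<Rightarrow> ('n proj \<Rightarrow> complex) set \<Rightarrow> ('n, complex) fun_sheaf"
  where "generated_subsheaf C V U = {s. \<forall>p\<in>U. \<exists>W B a.
    zariski_open_in C W \<and> p \<in> W \<and> W \<subseteq> U \<and> finite B \<and> B \<subseteq> V \<and> (\<forall>v\<in>B. regular_on C W (a v)) \<and>
    (\<forall>q\<in>W. s q = (\<Sum>v\<in>B. a v q * v q))}"

definition generates ::
    "'n::finite proj set \<Rightarrow> ('n, complex) fun_sheaf \<Rightarrow> ('n proj \<Rightarrow> complex) set \<Rightarrow> bool"
  where "generates C L V \<longleftrightarrow> (\<forall>U. zariski_open_in C U \<longrightarrow> generated_subsheaf C V U = L U)"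

definition linear_system ::
    "'n::finite proj set \<Rightarrow> ('n, complex) fun_sheaf \<Rightarrow> ('n proj \<Rightarrow> complex) set \<Rightarrow> bool"
  where "linear_system C L V \<longleftrightarrow> line_bundle C L \<and>
    complex_vector.subspace V \<and> (\<exists>B. finite B \<and> V = complex_vector.span B) \<and>
    V \<subseteq> global_sections C L \<and> generates C L V"

definition linearly_stable ::
    "'n::finite proj set \<Rightarrow> ('n, complex) fun_sheaf \<Rightarrow> ('n proj \<Rightarrow> complex) set \<Rightarrow> bool"
  where "linearly_stable C L V \<longleftrightarrow>
    (\<forall>V'. complex_vector.subspace V' \<and> V' \<subset> V \<and> 2 \<le> complex_vector.dim V' \<longrightarrow>
      real_of_int (bundle_degree C (generated_subsheaf C V')) / (real (complex_vector.dim V') - 1)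
        > real_of_int (bundle_degree C L) / (real (complex_vector.dim V) - 1))"

text \<open>Sections of the trivial bundle with fibre \<open>V\<close> over \<open>U\<close> are the regular maps from \<open>U\<close>
  to \<open>V\<close>. The evaluation map sends the section \<open>\<Sum>v. a v \<otimes> v\<close> to \<open>\<Sum>v. a v * v\<close>. As the elements
  of \<open>V\<close> are themselves functions on points, its value at \<open>q\<close> is that of the element \<open>\<sigma> q\<close>
  of \<open>V\<close> at \<open>q\<close>.\<close>

definition trivial_bundle :: "'n::finite proj set \<Rightarrow> ('n proj \<Rightarrow> complex) set \<Rightarrow>
    ('n, 'n proj \<Rightarrow> complex) fun_sheaf"
  where "trivial_bundle C V U = {\<sigma>. \<exists>B a. finite B \<and> B \<subseteq> V \<and> (\<forall>v\<in>B. regular_on C U (a v)) \<and>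
    (\<forall>q\<in>U. \<sigma> q = (\<Sum>v\<in>B. a v q *\<^sub>C v))}"

definition evaluation :: "('n::finite proj \<Rightarrow> 'n proj \<Rightarrow> complex) \<Rightarrow> 'n proj \<Rightarrow> complex"
  where "evaluation \<sigma> = (\<lambda>q. \<sigma> q q)"

definition dual_span_bundle :: "'n::finite proj set \<Rightarrow> ('n proj \<Rightarrow> complex) set \<Rightarrow>
    ('n, 'n proj \<Rightarrow> complex) fun_sheaf"
  where "dual_span_bundle C V U = {\<sigma> \<in> trivial_bundle C V U. \<forall>q\<in>U. evaluation \<sigma> q = 0}"

end

theory Submission
  imports Defs "HOL-Computational_Algebra.Fundamental_Theorem_Algebra"
begin

text \<open>Two linear forms \<open>x\<close>, \<open>y\<close> without common zero on \<open>C\<close> define a finite map to the projective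
  line, of degree \<open>m\<close> equal to the number of zeros of a linear form. Composing it with the plane
  quintic \<open>(X\<^sup>4Y, Y\<^sup>5 - X\<^sup>5, -XY\<^sup>4)\<close> gives a net \<open>V\<close> of degree \<open>5m\<close> which misses the section \<open>x\<^sup>5\<close>.
  The quintic is an immersion without triple points, so every pencil in \<open>V\<close> has a fixed divisor of
  degree at most \<open>2m\<close>, hence degree at least \<open>3m > 5m/2\<close>: the net is linearly stable. On the other
  hand the syzygy \<open>(X\<^sup>2, XY, Y\<^sup>2)\<close> of the quintic spans a line subbundle of degree
  \<open>-2m > -5m/2\<close> of the dual span bundle, which has rank \<open>2\<close> and degree \<open>-5m\<close>.

  Degrees rest on the fact that forms of equal degree have equally many zeros on \<open>C\<close>. If \<open>F\<close> and \<open>G\<close>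
  have degree \<open>d\<close> and no common zero, choose \<open>n = deg F\<close> forms \<open>u\<^sub>i\<close> of some degree \<open>e\<close> that are
  independent modulo the divisor of \<open>F\<close>. Then the \<open>n (k + 1)\<close> products \<open>u\<^sub>i F\<^sup>j G\<^bsup>k-j\<^esup>\<close> are independent on
  \<open>C\<close>, while the forms of degree \<open>e + kd\<close> have dimension at most \<open>k deg G\<close> plus a constant there, since
  a form is determined up to a scalar by its divisor; hence \<open>deg F \<le> deg G\<close>.\<close>

section \<open>Noetherian rings of functions\<close>

text \<open>Five is the least degree in which a plane curve on the projective line can do this.
  There the dual span bundle of a net of degree \<open>d\<close> is \<open>O(-a) + O(-b)\<close>
  with \<open>a \<le> b\<close> and \<open>a + b = d\<close>, unstable exactly when
  \<open>a < b\<close>, while linear stability excludes points of multiplicity \<open>d / 2\<close>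
  or more. A linear syzygy forces a point of multiplicity \<open>d - 1\<close>, so
  \<open>2 \<le> a < b\<close> and \<open>5 \<le> d\<close>. Pulling back to \<open>C\<close>
  multiplies all degrees by the same \<open>m\<close>, so both strict inequalities survive on a
  curve of any genus. The obstacle is that orders and \<open>bundle_degree\<close> are definite
  descriptions: no degree can be computed before orders are known to exist and rational functions
  are known to have divisors of degree 0. Finiteness of orders is Krull's intersection theorem,
  reached here through the Hilbert basis theorem. Degree 0 is the dimension count above, and its
  upper bound rests on the constancy of functions without poles, which is where the Nullstellensatz
  enters. All of it is phrased with homogeneous forms and identities between them on
  \<open>C\<close>.\<close>

lemma power_fun_apply [simp]: "(f ^ n) x = f x ^ n" for f :: "'a \<Rightarrow> 'b::comm_semiring_1"
  by (induction n) simp_all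

lemma sum_fun_apply [simp]: "(\<Sum>i\<in>I. f i) x = (\<Sum>i\<in>I. f i x)"
  for f :: "'i \<Rightarrow> 'a \<Rightarrow> 'b::comm_monoid_add"
  by (induction I rule: infinite_finite_induct) simp_all

lemma scaleC_complex_eq [simp]: "a *\<^sub>C (x::complex) = a * x"
  by (simp add: scaleC_complex_def)

lemma scaleC_fun_apply [simp]: "(a *\<^sub>C f) x = a *\<^sub>C f x"
  for f :: "'a \<Rightarrow> 'b::complex_vector"
  by (simp add: scaleC_fun_def)

text \<open>Rings are carrier subsets of one ambient ring, later the ring of all functions on the
  coordinate space, so that adjoining a variable enlarges the set without changing the type.\<close>

definition subring_set :: "'a::comm_ring_1 set \<Rightarrow> bool"
  where "subring_set A \<longleftrightarrow> 0 \<in> A \<and> 1 \<in> A \<and> (\<forall>x\<in>A. - x \<in> A) \<and>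
    (\<forall>x\<in>A. \<forall>y\<in>A. x + y \<in> A) \<and> (\<forall>x\<in>A. \<forall>y\<in>A. x * y \<in> A)"

lemma subring_setD:
  assumes "subring_set A"
  shows "0 \<in> A" "1 \<in> A" "x \<in> A \<Longrightarrow> - x \<in> A" "x \<in> A \<Longrightarrow> y \<in> A \<Longrightarrow> x + y \<in> A"
    "x \<in> A \<Longrightarrow> y \<in> A \<Longrightarrow> x * y \<in> A" "x \<in> A \<Longrightarrow> y \<in> A \<Longrightarrow> x - y \<in> A"
proof -
  show "0 \<in> A" "1 \<in> A" "x \<in> A \<Longrightarrow> - x \<in> A" "x \<in> A \<Longrightarrow> y \<in> A \<Longrightarrow> x + y \<in> A"
    "x \<in> A \<Longrightarrow> y \<in> A \<Longrightarrow> x * y \<in> A"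
    using assms by (auto simp: subring_set_def)
  show "x \<in> A \<Longrightarrow> y \<in> A \<Longrightarrow> x - y \<in> A"
    using assms by (metis add_uminus_conv_diff subring_set_def)
qed

lemma subring_set_sum: "subring_set A \<Longrightarrow> (\<And>i. i \<in> I \<Longrightarrow> f i \<in> A) \<Longrightarrow> (\<Sum>i\<in>I. f i) \<in> A"
  by (induction I rule: infinite_finite_induct) (auto intro: subring_setD)

lemma subring_set_power: "subring_set A \<Longrightarrow> x \<in> A \<Longrightarrow> x ^ n \<in> A"
  by (induction n) (auto intro: subring_setD)

inductive_set ideal_gen :: "'a::comm_ring_1 set \<Rightarrow> 'a set \<Rightarrow> 'a set" for A S
  where
    ideal_gen_zero: "0 \<in> ideal_gen A S"
  | ideal_gen_step: "g \<in> ideal_gen A S \<Longrightarrow> r \<in> A \<Longrightarrow> s \<in> S \<Longrightarrow> r * s + g \<in> ideal_gen A S"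

lemma ideal_gen_base: "subring_set A \<Longrightarrow> s \<in> S \<Longrightarrow> s \<in> ideal_gen A S"
  using ideal_gen_step[OF ideal_gen_zero, of 1 A s S] by (auto simp: subring_setD)

lemma ideal_gen_mono: "x \<in> ideal_gen A S \<Longrightarrow> S \<subseteq> S' \<Longrightarrow> x \<in> ideal_gen A S'"
  by (induction rule: ideal_gen.induct) (auto intro: ideal_gen.intros)

lemma ideal_gen_add: "x \<in> ideal_gen A S \<Longrightarrow> y \<in> ideal_gen A S \<Longrightarrow> x + y \<in> ideal_gen A S"
  by (induction rule: ideal_gen.induct) (auto intro: ideal_gen.intros simp: add.assoc)

lemma ideal_gen_mult:
  assumes "subring_set A" "x \<in> ideal_gen A S" "r \<in> A"
  shows "r * x \<in> ideal_gen A S"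
  using assms(2)
proof (induction rule: ideal_gen.induct)
  case ideal_gen_zero
  show ?case by (simp add: ideal_gen.ideal_gen_zero)
next
  case (ideal_gen_step g t s)
  have "(r * t) * s + r * g \<in> ideal_gen A S"
    by (intro ideal_gen.intros ideal_gen_step subring_setD(5)[OF assms(1)] assms)
  then show ?case by (simp add: algebra_simps)
qed

lemma ideal_gen_trans:
  assumes "subring_set A" "S \<subseteq> ideal_gen A S'" "x \<in> ideal_gen A S"
  shows "x \<in> ideal_gen A S'"
  using assms(3)
  by (induction rule: ideal_gen.induct)
    (use assms in \<open>auto intro: ideal_gen.intros ideal_gen_add ideal_gen_mult\<close>)

lemma ideal_gen_sum:
  "subring_set A \<Longrightarrow> (\<And>i. i \<in> I \<Longrightarrow> f i \<in> ideal_gen A S) \<Longrightarrow> (\<Sum>i\<in>I. f i) \<in> ideal_gen A S"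
  by (induction I rule: infinite_finite_induct) (auto intro: ideal_gen_add ideal_gen_zero)

lemma ideal_gen_imageD:
  assumes "subring_set A" "x \<in> ideal_gen A (F ` {..<m})"
  shows "\<exists>a. (\<forall>i<m::nat. a i \<in> A) \<and> x = (\<Sum>i<m. a i * F i)"
  using assms(2)
proof (induction rule: ideal_gen.induct)
  case ideal_gen_zero
  show ?case
    by (rule exI[of _ "\<lambda>_. 0"]) (use assms in \<open>auto simp: subring_setD\<close>)
next
  case (ideal_gen_step g r s)
  then obtain a j where a: "\<forall>i<m. a i \<in> A" "g = (\<Sum>i<m. a i * F i)" and j: "j < m" "s = F j"
    by auto
  have "(\<Sum>i<m. (a i + (if i = j then r else 0)) * F i) = (\<Sum>i<m. a i * F i) + (\<Sum>i<m. if i = j then r * F i else 0)"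
    by (subst sum.distrib[symmetric], rule sum.cong) (auto simp: algebra_simps)
  also have "\<dots> = r * s + g"
    using j a by simp
  finally show ?case
    by (intro exI[of _ "\<lambda>i. a i + (if i = j then r else 0)"])
      (use assms a ideal_gen_step in \<open>auto simp: subring_setD\<close>)
qed

text \<open>The ascending chain condition in the form in which it is applied: along any sequence
  some member is a combination of its predecessors. It is this relation that later arguments
  evaluate at points.\<close>

definition noetherian_set :: "'a::comm_ring_1 set \<Rightarrow> bool"
  where "noetherian_set A \<longleftrightarrow> (\<forall>F::nat \<Rightarrow> 'a. (\<forall>i. F i \<in> A) \<longrightarrow> (\<exists>m. F m \<in> ideal_gen A (F ` {..<m})))"

definition polys_over :: "'a::comm_ring_1 set \<Rightarrow> 'a poly set"
  where "polys_over A = {p. \<forall>k. coeff p k \<in> A}"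

lemma subring_polys_over:
  assumes "subring_set A" shows "subring_set (polys_over A)"
proof -
  note A = subring_setD[OF assms]
  have "coeff 1 k \<in> A" for k
    using A(1,2) by (cases k) (simp_all add: coeff_1)
  moreover have "coeff (p * q) k \<in> A" if "p \<in> polys_over A" "q \<in> polys_over A" for p q k
    unfolding coeff_mult using that A(5) by (intro subring_set_sum[OF assms]) (auto simp: polys_over_def)
  ultimately show ?thesis
    using A(1,3,4) unfolding subring_set_def[of "polys_over A"] by (simp add: polys_over_def)
qed

text \<open>Hilbert's argument: among the polynomials not yet generated, always choose one of least
  degree. If the choice never stopped, the leading coefficient of some chosen polynomial would be a
  combination of the earlier ones, and subtracting the matching combination would leave a polynomial
  of smaller degree that is still not generated.\<close>

lemma noetherian_polys_over:
  fixes A :: "'a::comm_ring_1 set"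
  assumes A: "subring_set A" and N: "noetherian_set A"
  shows "noetherian_set (polys_over A)"
  unfolding noetherian_set_def
proof (intro allI impI)
  fix P :: "nat \<Rightarrow> 'a poly"
  assume P: "\<forall>i. P i \<in> polys_over A"
  let ?R = "polys_over A"
  have R: "subring_set ?R" using A by (rule subring_polys_over)
  define J where "J = ideal_gen ?R (range P)"
  define pick where "pick = (\<lambda>S. arg_min degree (\<lambda>p. p \<in> J - ideal_gen ?R S))"
  \<comment> \<open>The recursion carries the list of earlier choices, because each choice depends
    on all of them; \<open>f k\<close> is the choice made after \<open>k\<close> steps.\<close>
  define fs where "fs = rec_nat [] (\<lambda>_ l. l @ [pick (set l)])"
  define f where "f = (\<lambda>k. pick (set (fs k)))"
  have set_fs: "set (fs k) = f ` {..<k}" for k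
    by (induction k) (auto simp: fs_def f_def lessThan_Suc)
  have JR: "p \<in> ?R" if "p \<in> J" for p
    using that unfolding J_def
    by (induction rule: ideal_gen.induct) (use R P in \<open>auto simp: subring_setD\<close>)
  have f_eq: "f k = pick (f ` {..<k})" for k
    unfolding set_fs[symmetric] by (simp only: f_def)
  have f_min: "f k \<in> J - ideal_gen ?R (f ` {..<k}) \<and>
      (\<forall>p. p \<in> J - ideal_gen ?R (f ` {..<k}) \<longrightarrow> degree (f k) \<le> degree p)"
    if "p0 \<in> J - ideal_gen ?R (f ` {..<k})" for p0 k
    using arg_min_nat_lemma[of "\<lambda>p. p \<in> J - ideal_gen ?R (f ` {..<k})", OF that, of degree]
    unfolding f_eq[of k] pick_def by blast
  have "\<exists>k. J \<subseteq> ideal_gen ?R (f ` {..<k})"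
  proof (rule ccontr)
    assume "\<not> ?thesis"
    then have f: "f k \<in> J - ideal_gen ?R (f ` {..<k})"
      and fmin: "\<And>p. p \<in> J - ideal_gen ?R (f ` {..<k}) \<Longrightarrow> degree (f k) \<le> degree p" for k
      using f_min by blast+
    have mono: "degree (f i) \<le> degree (f k)" if "i < k" for i k
    proof (rule fmin)
      have "f ` {..<i} \<subseteq> f ` {..<k}" using that by auto
      then show "f k \<in> J - ideal_gen ?R (f ` {..<i})"
        using f[of k] ideal_gen_mono by blast
    qed
    have "\<forall>i. lead_coeff (f i) \<in> A"
      using f JR by (auto simp: polys_over_def)
    then obtain m where "lead_coeff (f m) \<in> ideal_gen A ((\<lambda>i. lead_coeff (f i)) ` {..<m})"
      using N unfolding noetherian_set_def by (elim allE[of _ "\<lambda>i. lead_coeff (f i)"]) auto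
    from ideal_gen_imageD[OF A this] obtain u
      where u: "\<forall>i<m. u i \<in> A" "lead_coeff (f m) = (\<Sum>i<m. u i * lead_coeff (f i))" by auto
    \<comment> \<open>The monomials raise every earlier polynomial to the degree of
      \<open>f m\<close>, which is possible because the chosen degrees never decrease
      (\<open>mono\<close>).\<close>
    define q where "q = (\<lambda>i. monom (u i) (degree (f m) - degree (f i)))"
    define h where "h = (\<Sum>i<m. q i * f i)"
    have qR: "q i \<in> ?R" if "i < m" for i
      using that u A by (auto simp: q_def polys_over_def subring_setD)
    have h1: "h \<in> ideal_gen ?R (f ` {..<m})"
      unfolding h_def by (intro ideal_gen_sum[OF R] ideal_gen_mult[OF R] qR ideal_gen_base[OF R]) auto
    have hJ: "h \<in> J"
      unfolding h_def J_def by (intro ideal_gen_sum[OF R] ideal_gen_mult[OF R] qR) (use f J_def in auto)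
    have "- 1 * h \<in> J"
      unfolding J_def by (intro ideal_gen_mult[OF R] hJ[unfolded J_def] subring_setD[OF R])
    then have "f m - h \<in> J"
      using ideal_gen_add[of "f m" ?R "range P" "- 1 * h"] f[of m] unfolding J_def by simp
    moreover have nin: "f m - h \<notin> ideal_gen ?R (f ` {..<m})"
      using ideal_gen_add[OF _ h1, of "f m - h"] f[of m] by auto
    ultimately have le: "degree (f m) \<le> degree (f m - h)" by (intro fmin) auto
    have deg_h: "degree h \<le> degree (f m)"
      unfolding h_def
    proof (rule degree_sum_le)
      fix i assume "i \<in> {..<m}"
      then have "degree (f i) \<le> degree (f m)" using mono by auto
      moreover have "degree (q i * f i) \<le> (degree (f m) - degree (f i)) + degree (f i)"
        unfolding q_def by (rule order_trans[OF degree_mult_le]) (simp add: degree_monom_le)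
      ultimately show "degree (q i * f i) \<le> degree (f m)" by simp
    qed simp
    have "coeff (q i * f i) (degree (f m)) = u i * lead_coeff (f i)" if "i < m" for i
      using mono[OF that] unfolding q_def by (simp add: coeff_monom_mult)
    then have ch: "coeff h (degree (f m)) = lead_coeff (f m)"
      unfolding h_def by (simp add: coeff_sum u(2))
    have "degree (f m - h) \<le> degree (f m)"
      using deg_h by (simp add: degree_diff_le)
    with le have "degree (f m - h) = degree (f m)" by simp
    then have "lead_coeff (f m - h) = 0" using ch by simp
    then have "f m - h = 0" by (simp only: leading_coeff_0_iff)
    then show False using nin by (simp add: ideal_gen_zero)
  qed
  then have kJ: "\<exists>k. J \<subseteq> ideal_gen ?R (f ` {..<k})" .
  \<comment> \<open>The least number of steps is taken because \<open>f k\<close> is known to lie in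
    \<open>J\<close> only as long as something is left to choose.\<close>
  define n where "n = (LEAST k. J \<subseteq> ideal_gen ?R (f ` {..<k}))"
  have n: "J \<subseteq> ideal_gen ?R (f ` {..<n})" unfolding n_def using kJ by (rule LeastI_ex)
  have fJ: "f ` {..<n} \<subseteq> J"
    using not_less_Least[of _ "\<lambda>k. J \<subseteq> ideal_gen ?R (f ` {..<k})"] f_min unfolding n_def by blast
  \<comment> \<open>Each element of \<open>J\<close> involves finitely many members of
    \<open>P\<close>, so the finitely many generators all lie in the ideal of one initial segment of
    \<open>P\<close>; the next member of \<open>P\<close> then yields the relation.\<close>
  have "\<exists>M. p \<in> ideal_gen ?R (P ` {..<M})" if "p \<in> J" for p
    using that unfolding J_def
  proof (induction rule: ideal_gen.induct)
    case ideal_gen_zero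
    then show ?case by (auto intro: ideal_gen.intros)
  next
    case (ideal_gen_step g r s)
    then obtain M j where M: "g \<in> ideal_gen ?R (P ` {..<M})" and j: "s = P j" by auto
    have "g \<in> ideal_gen ?R (P ` {..<max M (Suc j)})"
      by (rule ideal_gen_mono[OF M]) auto
    then show ?case
      using j by (intro exI[of _ "max M (Suc j)"] ideal_gen.intros ideal_gen_step) auto
  qed
  then obtain M where M: "p \<in> ideal_gen ?R (P ` {..<M p})" if "p \<in> J" for p by metis
  define m where "m = Max (insert 0 (M ` f ` {..<n}))"
  have "f ` {..<n} \<subseteq> ideal_gen ?R (P ` {..<m})"
  proof
    fix p assume p: "p \<in> f ` {..<n}"
    then have "M p \<le> m" unfolding m_def by (intro Max_ge) auto
    then show "p \<in> ideal_gen ?R (P ` {..<m})"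
      using p fJ by (intro ideal_gen_mono[OF M]) auto
  qed
  moreover have "P m \<in> J" unfolding J_def by (rule ideal_gen_base[OF R]) auto
  ultimately show "\<exists>m. P m \<in> ideal_gen ?R (P ` {..<m})"
    using n ideal_gen_trans[OF R] by blast
qed

section \<open>Adjoining one element to a Noetherian ring\<close>

definition adjoin :: "'a::comm_ring_1 set \<Rightarrow> 'a \<Rightarrow> 'a set"
  where "adjoin A y = (\<lambda>p. poly p y) ` polys_over A"

lemma subring_adjoin: 
  assumes "subring_set A" shows "subring_set (adjoin A y)"
proof -
  note R = subring_polys_over[OF assms]
  have "0 \<in> adjoin A y" "1 \<in> adjoin A y"
    unfolding adjoin_def using subring_setD(1,2)[OF R] by (force intro: rev_image_eqI)+
  moreover have "- a \<in> adjoin A y" if "a \<in> adjoin A y" for a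
    using that subring_setD(3)[OF R] unfolding adjoin_def by (force intro: rev_image_eqI)
  moreover have "a + b \<in> adjoin A y" if "a \<in> adjoin A y" "b \<in> adjoin A y" for a b
    using that subring_setD(4)[OF R] unfolding adjoin_def by (force intro: rev_image_eqI)
  moreover have "a * b \<in> adjoin A y" if "a \<in> adjoin A y" "b \<in> adjoin A y" for a b
    using that subring_setD(5)[OF R] unfolding adjoin_def by (force intro: rev_image_eqI)
  ultimately show ?thesis by (auto simp: subring_set_def)
qed

text \<open>Evaluation at \<open>y\<close> is a ring homomorphism from the polynomials over
  \<open>A\<close> onto \<open>adjoin A y\<close>, and it carries a relation among preimages to a
  relation among the given elements.\<close>

lemma noetherian_adjoin:
  assumes A: "subring_set A" and N: "noetherian_set A"
  shows "noetherian_set (adjoin A y)"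
  unfolding noetherian_set_def
proof (intro allI impI)
  fix F :: "nat \<Rightarrow> 'a"
  assume "\<forall>i. F i \<in> adjoin A y"
  then have "\<forall>i. \<exists>p. p \<in> polys_over A \<and> F i = poly p y" by (auto simp: adjoin_def)
  then obtain P where P: "\<And>i. P i \<in> polys_over A" "\<And>i. F i = poly (P i) y" by metis
  obtain m where m: "P m \<in> ideal_gen (polys_over A) (P ` {..<m})"
    using noetherian_polys_over[OF A N] P unfolding noetherian_set_def by blast
  have "poly p y \<in> ideal_gen (adjoin A y) (F ` {..<m})"
    if "p \<in> ideal_gen (polys_over A) (P ` {..<m})" for p
    using that
  proof (induction rule: ideal_gen.induct)
    case ideal_gen_zero
    show ?case by (simp add: ideal_gen.ideal_gen_zero)
  next
    case (ideal_gen_step g r s)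
    then have "poly r y \<in> adjoin A y" "poly s y \<in> F ` {..<m}"
      using P(2) by (auto simp: adjoin_def)
    from ideal_gen.ideal_gen_step[OF ideal_gen_step.IH this] show ?case by simp
  qed
  then show "\<exists>m. F m \<in> ideal_gen (adjoin A y) (F ` {..<m})"
    using m P(2) by auto
qed


section \<open>Homogeneous polynomials\<close>

definition mono_fun :: "('n::finite \<Rightarrow> nat) \<Rightarrow> ('n \<Rightarrow> complex) \<Rightarrow> complex"
  where "mono_fun m = (\<lambda>x. \<Prod>i\<in>UNIV. x i ^ m i)"

lemma finite_exponents: "finite {m :: 'n::finite \<Rightarrow> nat. (\<Sum>i\<in>UNIV. m i) = d}"
proof (rule finite_subset)
  show "{m :: 'n \<Rightarrow> nat. (\<Sum>i\<in>UNIV. m i) = d} \<subseteq> PiE UNIV (\<lambda>_. {..d})"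
    by (auto intro: member_le_sum)
  show "finite (PiE (UNIV :: 'n set) (\<lambda>_. {..d}))"
    by (rule finite_PiE) auto
qed

text \<open>Closure properties of forms become those of a span. The spanning set is finite, and on
  this finite dimension the later relations among forms of one degree rest.\<close>

lemma homogeneous_eq_span:
  "homogeneous d F \<longleftrightarrow> F \<in> complex_vector.span (mono_fun ` {m. (\<Sum>i\<in>UNIV. m i) = d})"
proof
  assume "homogeneous d F"
  then obtain c where F: "F = (\<lambda>x. \<Sum>m | (\<Sum>i\<in>UNIV. m i) = d. c m * (\<Prod>i\<in>UNIV. x i ^ m i))"
    by (auto simp: homogeneous_def)
  have "F = (\<Sum>m | (\<Sum>i\<in>UNIV. m i) = d. c m *\<^sub>C mono_fun m)"
    by (simp add: F fun_eq_iff mono_fun_def)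
  then show "F \<in> complex_vector.span (mono_fun ` {m. (\<Sum>i\<in>UNIV. m i) = d})"
    by (simp only:) (intro complex_vector.span_sum complex_vector.span_scale complex_vector.span_base imageI)
next
  assume "F \<in> complex_vector.span (mono_fun ` {m. (\<Sum>i\<in>UNIV. m i) = d})"
  then show "homogeneous d F"
  proof (rule complex_vector.span_induct)
    show "complex_vector.subspace {F :: ('a \<Rightarrow> complex) \<Rightarrow> complex. homogeneous d F}"
    proof (rule complex_vector.subspaceI)
      show "0 \<in> {F :: ('a \<Rightarrow> complex) \<Rightarrow> complex. homogeneous d F}"
        unfolding homogeneous_def mem_Collect_eq by (rule exI[of _ "\<lambda>_. 0"]) (simp add: fun_eq_iff)
    next
      fix F G :: "('a \<Rightarrow> complex) \<Rightarrow> complex"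
      assume "F \<in> {F. homogeneous d F}" "G \<in> {F. homogeneous d F}"
      then obtain c e where "F = (\<lambda>x. \<Sum>m | (\<Sum>i\<in>UNIV. m i) = d. c m * (\<Prod>i\<in>UNIV. x i ^ m i))"
        "G = (\<lambda>x. \<Sum>m | (\<Sum>i\<in>UNIV. m i) = d. e m * (\<Prod>i\<in>UNIV. x i ^ m i))"
        by (auto simp: homogeneous_def)
      then show "F + G \<in> {F. homogeneous d F}"
        unfolding homogeneous_def mem_Collect_eq
        by (intro exI[of _ "\<lambda>m. c m + e m"]) (simp add: fun_eq_iff distrib_right sum.distrib)
    next
      fix a and F :: "('a \<Rightarrow> complex) \<Rightarrow> complex"
      assume "F \<in> {F. homogeneous d F}"
      then obtain c where "F = (\<lambda>x. \<Sum>m | (\<Sum>i\<in>UNIV. m i) = d. c m * (\<Prod>i\<in>UNIV. x i ^ m i))"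
        by (auto simp: homogeneous_def)
      then show "a *\<^sub>C F \<in> {F. homogeneous d F}"
        unfolding homogeneous_def mem_Collect_eq
        by (intro exI[of _ "\<lambda>m. a * c m"]) (simp add: fun_eq_iff sum_distrib_left mult.assoc)
    qed
  next
    fix F :: "('a \<Rightarrow> complex) \<Rightarrow> complex"
    assume "F \<in> mono_fun ` {m. (\<Sum>i\<in>UNIV. m i) = d}"
    then obtain m where m: "(\<Sum>i\<in>UNIV. m i) = d" "F = mono_fun m" by auto
    have "(\<Sum>k | (\<Sum>i\<in>UNIV. k i) = d. (if k = m then 1 else 0) * (\<Prod>i\<in>UNIV. x i ^ k i)) = mono_fun m x" for x
      by (simp add: finite_exponents m(1) mono_fun_def if_distrib[of "\<lambda>c. c * _"] cong: if_cong)
    then show "homogeneous d F"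
      unfolding homogeneous_def m(2) by (intro exI[of _ "\<lambda>k. if k = m then 1 else 0"]) (simp add: fun_eq_iff)
  qed
qed

lemma homogeneous_zero: "homogeneous d 0"
  and homogeneous_add: "homogeneous d F \<Longrightarrow> homogeneous d G \<Longrightarrow> homogeneous d (F + G)"
  and homogeneous_diff: "homogeneous d F \<Longrightarrow> homogeneous d G \<Longrightarrow> homogeneous d (F - G)"
  and homogeneous_uminus: "homogeneous d F \<Longrightarrow> homogeneous d (- F)"
  and homogeneous_scale: "homogeneous d F \<Longrightarrow> homogeneous d (c *\<^sub>C F)"
  and homogeneous_sum: "(\<And>i. i \<in> I \<Longrightarrow> homogeneous d (f i)) \<Longrightarrow> homogeneous d (\<Sum>i\<in>I. f i)"
  by (auto simp: homogeneous_eq_span intro: complex_vector.span_zero complex_vector.span_add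
    complex_vector.span_diff complex_vector.span_neg complex_vector.span_scale complex_vector.span_sum)

lemma homogeneous_mono_fun: "homogeneous (\<Sum>i\<in>UNIV. m i) (mono_fun m)"
  by (auto simp: homogeneous_eq_span intro: complex_vector.span_base)

lemma homogeneous_induct [consumes 1, case_names zero add scale mono]:
  assumes "homogeneous d F"
    and "P 0" "\<And>F G. P F \<Longrightarrow> P G \<Longrightarrow> P (F + G)" "\<And>c F. P F \<Longrightarrow> P (c *\<^sub>C F)"
    and "\<And>m. (\<Sum>i\<in>UNIV. m i) = d \<Longrightarrow> P (mono_fun m)"
  shows "P F"
  using assms(1)[unfolded homogeneous_eq_span]
  by (rule complex_vector.span_induct) (use assms in \<open>auto intro!: complex_vector.subspaceI\<close>)

lemma mono_fun_add: "mono_fun (\<lambda>i. m i + k i) = mono_fun m * mono_fun k"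
  by (simp add: mono_fun_def fun_eq_iff power_add prod.distrib)

lemma scaleC_mult_fun:
  fixes F G :: "'a \<Rightarrow> complex"
  shows "(c *\<^sub>C F) * G = c *\<^sub>C (F * G)" "F * (c *\<^sub>C G) = c *\<^sub>C (F * G)"
  by (simp_all add: fun_eq_iff)

lemma homogeneous_mult:
  assumes "homogeneous d F" "homogeneous e G"
  shows "homogeneous (d + e) (F * G)"
  using assms(1)
proof (induction rule: homogeneous_induct)
  case (mono m)
  show ?case
    using assms(2)
  proof (induction rule: homogeneous_induct)
    case (mono k)
    have "homogeneous (\<Sum>i\<in>UNIV. m i + k i) (mono_fun m * mono_fun k)"
      unfolding mono_fun_add[symmetric] by (rule homogeneous_mono_fun)
    then show ?case
      by (simp only: sum.distrib mono \<open>(\<Sum>i\<in>UNIV. m i) = d\<close>)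
  qed (simp_all only: mult_zero_right homogeneous_zero homogeneous_add homogeneous_scale distrib_left scaleC_mult_fun)
qed (simp_all only: mult_zero_left homogeneous_zero homogeneous_add homogeneous_scale distrib_right scaleC_mult_fun)

lemma homogeneous_const: "homogeneous 0 (\<lambda>_ :: 'n::finite \<Rightarrow> complex. c)"
proof -
  have "(\<lambda>_. c) = c *\<^sub>C mono_fun (\<lambda>_::'n. 0)"
    by (simp add: mono_fun_def fun_eq_iff)
  then show ?thesis
    using homogeneous_scale[OF homogeneous_mono_fun[of "\<lambda>_::'n. 0"]] by simp
qed

lemma homogeneous_one: "homogeneous 0 1"
  using homogeneous_const[of 1] by (simp add: one_fun_def)

lemma homogeneous_coord: "homogeneous 1 (\<lambda>x. x i)"
proof -
  have "(\<lambda>x. x i) = mono_fun (\<lambda>j. if j = i then 1 else 0)"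
    by (simp add: mono_fun_def fun_eq_iff if_distrib[of "\<lambda>k. _ ^ k"] cong: if_cong)
  then show ?thesis
    using homogeneous_mono_fun[of "\<lambda>j. if j = i then 1 else 0"] by simp
qed

lemma homogeneous_power: "homogeneous d F \<Longrightarrow> homogeneous (k * d) (F ^ k)"
  by (induction k) (use homogeneous_one homogeneous_mult in auto)

lemma homogeneous_cong_degree: "homogeneous d F \<Longrightarrow> d = e \<Longrightarrow> homogeneous e F"
  by simp

text \<open>Splitting one coordinate off every monomial allows inductions on the degree whose steps
  involve only the coordinate functions.\<close>

lemma homogeneous_SucE:
  fixes F :: "('n::finite \<Rightarrow> complex) \<Rightarrow> complex"
  assumes "homogeneous (Suc d) F"
  obtains G where "\<forall>i. homogeneous d (G i)" "F = (\<Sum>i\<in>UNIV. (\<lambda>x. x i) * G i)"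
proof -
  have "\<exists>G. (\<forall>i. homogeneous d (G i)) \<and> F = (\<Sum>i\<in>UNIV. (\<lambda>x. x i) * G i)"
    using assms
  proof (induction rule: homogeneous_induct)
    case zero
    show ?case
      by (rule exI[of _ "\<lambda>_. 0"]) (simp only: mult_zero_right sum.neutral_const homogeneous_zero simp_thms)
  next
    case (add F F')
    then obtain G G' where "\<forall>i. homogeneous d (G i)" "F = (\<Sum>i\<in>UNIV. (\<lambda>x. x i) * G i)"
      "\<forall>i. homogeneous d (G' i)" "F' = (\<Sum>i\<in>UNIV. (\<lambda>x. x i) * G' i)" by blast
    then show ?case
      by (intro exI[of _ "\<lambda>i. G i + G' i"]) (simp only: homogeneous_add distrib_left sum.distrib simp_thms)
  next
    case (scale c F)
    then obtain G where "\<forall>i. homogeneous d (G i)" "F = (\<Sum>i\<in>UNIV. (\<lambda>x. x i) * G i)" by blast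
    then show ?case
      by (intro exI[of _ "\<lambda>i. c *\<^sub>C G i"])
        (simp only: homogeneous_scale scaleC_mult_fun complex_vector.scale_sum_right simp_thms)
  next
    case (mono m)
    then have "(\<Sum>i\<in>UNIV. m i) \<noteq> 0" by simp
    then obtain j where j: "m j \<noteq> 0" by auto
    define k where "k = m(j := m j - 1)"
    have m: "m = (\<lambda>i. (if i = j then 1 else 0) + k i)" using j by (auto simp: k_def)
    then have "(\<Sum>i\<in>UNIV. m i) = Suc (\<Sum>i\<in>UNIV. k i)" by (simp add: sum.distrib)
    with mono have k: "(\<Sum>i\<in>UNIV. k i) = d" by simp
    have "mono_fun (\<lambda>i. if i = j then 1 else 0) = (\<lambda>x. x j)"
      by (simp add: mono_fun_def fun_eq_iff if_distrib[of "\<lambda>k. _ ^ k"] cong: if_cong)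
    then have "mono_fun m = (\<lambda>x. x j) * mono_fun k"
      by (subst m) (simp add: mono_fun_add)
    also have "\<dots> = (\<Sum>i\<in>UNIV. (\<lambda>x. x i) * (if i = j then mono_fun k else 0))"
      by (simp add: if_distrib[of "\<lambda>k. _ * k"] cong: if_cong)
    finally show ?case
      by (intro exI[of _ "\<lambda>i. if i = j then mono_fun k else 0"])
        (use homogeneous_mono_fun[of k] homogeneous_zero k in auto)
  qed
  then show ?thesis using that by blast
qed

lemma homogeneous_0E:
  assumes "homogeneous 0 F" obtains c where "F = (\<lambda>_. c)"
proof -
  have "\<exists>c. F = (\<lambda>_. c)"
    using assms
  proof (induction rule: homogeneous_induct)
    case (mono m)
    then show ?case by (simp add: mono_fun_def fun_eq_iff)
  qed (force simp: fun_eq_iff)+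
  then show ?thesis using that by blast
qed

lemma homogeneous_scaling: "homogeneous d F \<Longrightarrow> F (c *\<^sub>C x) = c ^ d * F x"
proof (induction rule: homogeneous_induct)
  case (mono m)
  then show ?case
    by (simp add: mono_fun_def power_mult_distrib prod.distrib power_sum[symmetric])
qed (simp_all add: distrib_left)

text \<open>Scaling by 2 multiplies the value both by \<open>2 ^ d\<close> and by
  \<open>2 ^ e\<close>. The nonzero value excludes the zero function, which is a form of every
  degree.\<close>

lemma homogeneous_degree_unique:
  assumes "homogeneous d F" "homogeneous e F" "F x \<noteq> 0"
  shows "d = e"
proof -
  have "(2::complex) ^ d = 2 ^ e"
    using homogeneous_scaling[OF assms(1), of 2 x] homogeneous_scaling[OF assms(2), of 2 x] assms(3)
    by simp
  then have "(2::nat) ^ d = 2 ^ e"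
    by (metis of_nat_eq_iff of_nat_numeral of_nat_power)
  then show ?thesis by simp
qed

text \<open>The relations supplied by the Hilbert basis theorem may have inhomogeneous coefficients;
  they live in this ring.\<close>

definition poly_funs :: "(('n::finite \<Rightarrow> complex) \<Rightarrow> complex) set"
  where "poly_funs = complex_vector.span (\<Union>d. {F. homogeneous d F})"

lemma poly_funsI: "homogeneous d F \<Longrightarrow> F \<in> poly_funs"
  unfolding poly_funs_def by (rule complex_vector.span_base) auto

lemma poly_funs_mult:
  assumes "F \<in> poly_funs" "G \<in> poly_funs" shows "F * G \<in> poly_funs"
  using assms(1) unfolding poly_funs_def
proof (rule complex_vector.span_induct)
  show "complex_vector.subspace {F. F * G \<in> complex_vector.span (\<Union>d. {F. homogeneous d F})}"
    by (rule complex_vector.subspaceI)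
      (auto simp: distrib_right scaleC_mult_fun complex_vector.span_zero intro: complex_vector.span_add complex_vector.span_scale)
next
  fix F assume "F \<in> (\<Union>d. {F :: ('a \<Rightarrow> complex) \<Rightarrow> complex. homogeneous d F})"
  then obtain d where d: "homogeneous d F" by auto
  show "F * G \<in> complex_vector.span (\<Union>d. {F. homogeneous d F})"
    using assms(2)[unfolded poly_funs_def]
  proof (rule complex_vector.span_induct)
    show "complex_vector.subspace {G. F * G \<in> complex_vector.span (\<Union>d. {F. homogeneous d F})}"
      by (rule complex_vector.subspaceI)
        (auto simp: distrib_left scaleC_mult_fun complex_vector.span_zero intro: complex_vector.span_add complex_vector.span_scale)
  qed (use homogeneous_mult[OF d] in \<open>blast intro: complex_vector.span_base\<close>)
qed

lemma subring_poly_funs: "subring_set poly_funs"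
  using poly_funsI[OF homogeneous_one] poly_funs_mult
  by (auto simp: subring_set_def poly_funs_def complex_vector.span_zero complex_vector.span_neg
    complex_vector.span_add)

lemma poly_funs_decompose:
  assumes "Q \<in> poly_funs"
  obtains K q where "\<forall>k. homogeneous k (q k)" "\<forall>x. Q x = (\<Sum>k\<le>K. q k x)"
proof -
  have "\<exists>K q. (\<forall>k. homogeneous k (q k)) \<and> (\<forall>k>K. q k = 0) \<and> Q = (\<Sum>k\<le>K. q k)"
    using assms unfolding poly_funs_def
  proof (induction rule: complex_vector.span_induct_alt)
    case base
    show ?case
      by (rule exI[of _ 0], rule exI[of _ "\<lambda>_. 0"])
        (simp only: homogeneous_zero simp_thms sum.neutral_const)
  next
    case (step c F G)
    then obtain d K q where d: "homogeneous d F" and q: "\<forall>k. homogeneous k (q k)" "\<forall>k>K. q k = 0"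
      "G = (\<Sum>k\<le>K. q k)" by blast
    define L where "L = max K d"
    have "G = (\<Sum>k\<le>L. q k)"
      unfolding q(3) by (rule sum.mono_neutral_left) (use q(2) in \<open>auto simp: L_def\<close>)
    moreover have "(\<Sum>k\<le>L. if k = d then c *\<^sub>C F else 0) = c *\<^sub>C F"
      by (subst sum.delta) (simp_all add: L_def)
    ultimately have "c *\<^sub>C F + G = (\<Sum>k\<le>L. q k + (if k = d then c *\<^sub>C F else 0))"
      by (simp only: sum.distrib add.commute)
    moreover have "homogeneous k (q k + (if k = d then c *\<^sub>C F else 0))" for k
      using q(1) d by (cases "k = d") (simp_all only: homogeneous_add homogeneous_scale homogeneous_zero if_True if_False simp_thms)
    moreover have "q k + (if k = d then c *\<^sub>C F else 0) = 0" if "k > L" for k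
      using that q(2) by (simp add: L_def)
    ultimately show ?case
      by (intro exI[of _ L] exI[of _ "\<lambda>k. q k + (if k = d then c *\<^sub>C F else 0)"]) blast
  qed
  then show ?thesis using that by (metis sum_fun_apply)
qed

text \<open>Variables are adjoined one at a time, starting from the constants. These form a field: a
  second constant is a multiple of the first unless the first is zero.\<close>

lemma noetherian_variables:
  fixes S :: "'n::finite set"
  shows "\<exists>A. subring_set A \<and> noetherian_set A \<and> (\<forall>c. (\<lambda>_. c) \<in> A) \<and> (\<forall>i\<in>S. (\<lambda>x. x i) \<in> A) \<and>
    A \<subseteq> (poly_funs :: (('n \<Rightarrow> complex) \<Rightarrow> complex) set)"
proof (induction S rule: finite_induct[OF finite])
  case 1
  let ?A = "range (\<lambda>c _. c) :: (('n \<Rightarrow> complex) \<Rightarrow> complex) set"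
  have "noetherian_set ?A"
    unfolding noetherian_set_def
  proof (intro allI impI)
    fix F :: "nat \<Rightarrow> ('n \<Rightarrow> complex) \<Rightarrow> complex"
    assume "\<forall>i. F i \<in> ?A"
    then have "\<forall>i. \<exists>c. F i = (\<lambda>_. c)" by auto
    then obtain c where c: "\<And>i. F i = (\<lambda>_. c i)" by metis
    show "\<exists>m. F m \<in> ideal_gen ?A (F ` {..<m})"
    proof (cases "c 0 = 0")
      case True
      then have "F 0 = 0" by (simp add: c fun_eq_iff)
      then show ?thesis by (intro exI[of _ 0]) (simp add: ideal_gen_zero)
    next
      case False
      have "(\<lambda>_. c 1 / c 0) * F 0 + 0 \<in> ideal_gen ?A (F ` {..<1})"
        by (intro ideal_gen.intros) auto
      also have "(\<lambda>_. c 1 / c 0) * F 0 + 0 = F 1" using False by (simp add: c fun_eq_iff)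
      finally show ?thesis by blast
    qed
  qed
  moreover have "subring_set ?A"
    by (auto simp: subring_set_def zero_fun_def one_fun_def plus_fun_def times_fun_def fun_Compl_def)
  ultimately show ?case
    by (intro exI[of _ ?A]) (auto intro: poly_funsI homogeneous_const)
next
  case (2 i S)
  then obtain A where A: "subring_set A" "noetherian_set A" "\<forall>c. (\<lambda>_. c) \<in> A"
    "\<forall>i\<in>S. (\<lambda>x. x i) \<in> A" "A \<subseteq> (poly_funs :: (('n \<Rightarrow> complex) \<Rightarrow> complex) set)" by auto
  define y where "y = (\<lambda>x :: 'n \<Rightarrow> complex. x i)"
  have sub: "A \<subseteq> adjoin A y"
  proof
    fix a assume "a \<in> A"
    then have "[:a:] \<in> polys_over A"
      using subring_setD(1)[OF A(1)] by (auto simp: polys_over_def coeff_pCons split: nat.split)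
    then show "a \<in> adjoin A y" unfolding adjoin_def by (rule rev_image_eqI) simp
  qed
  have "[:0, 1:] \<in> polys_over A"
    using subring_setD(1,2)[OF A(1)] by (auto simp: polys_over_def coeff_pCons split: nat.split)
  then have y: "y \<in> adjoin A y" unfolding adjoin_def by (rule rev_image_eqI) simp
  have "y \<in> poly_funs" unfolding y_def by (rule poly_funsI[OF homogeneous_coord])
  then have "poly p y \<in> poly_funs" if "p \<in> polys_over A" for p
    unfolding poly_altdef using that A(5) subring_poly_funs
    by (intro subring_set_sum subring_setD(5) subring_set_power) (auto simp: polys_over_def)
  then have "adjoin A y \<subseteq> poly_funs" by (auto simp: adjoin_def)
  then show ?case
    using subring_adjoin[OF A(1)] noetherian_adjoin[OF A(1,2)] A(3,4) sub y
    by (intro exI[of _ "adjoin A y"]) (auto simp: y_def)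
qed

text \<open>The coefficients are left inhomogeneous: the relation is either evaluated at a point or
  combined with \<open>vanishes_mult_poly\<close>, which allows polynomial cofactors.\<close>

theorem hilbert_basis:
  fixes F :: "nat \<Rightarrow> ('n::finite \<Rightarrow> complex) \<Rightarrow> complex"
  assumes "\<And>i. homogeneous (d i) (F i)"
  obtains m B where "\<forall>i<m. B i \<in> poly_funs" "F m = (\<Sum>i<m. B i * F i)"
proof -
  obtain A where A: "subring_set A" "noetherian_set A" "\<forall>c. (\<lambda>_. c) \<in> A"
    "\<forall>i. (\<lambda>x. x i) \<in> A" "A \<subseteq> (poly_funs :: (('n \<Rightarrow> complex) \<Rightarrow> complex) set)"
    using noetherian_variables[of "UNIV :: 'n set"] by auto
  have "G \<in> A" if "homogeneous e G" for e G
    using that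
  proof (induction e arbitrary: G)
    case 0
    then show ?case using A(3) by (auto elim: homogeneous_0E)
  next
    case (Suc e)
    obtain H where "\<forall>i. homogeneous e (H i)" "G = (\<Sum>i\<in>UNIV. (\<lambda>x. x i) * H i)"
      by (rule homogeneous_SucE[OF Suc.prems])
    then show ?case
      by (simp only:) (intro subring_set_sum[OF A(1)] subring_setD(5)[OF A(1)] A(4)[rule_format] Suc.IH[rule_format], blast)
  qed
  then have "\<forall>i. F i \<in> A" using assms by blast
  then obtain m where "F m \<in> ideal_gen A (F ` {..<m})"
    using A(2) unfolding noetherian_set_def by blast
  from ideal_gen_imageD[OF A(1) this] show ?thesis using that A(5) by blast
qed

section \<open>Points and closed sets\<close>

lemma Rep_proj_range: "\<exists>v. v \<noteq> 0 \<and> Rep_proj p = range (\<lambda>c. c *\<^sub>C v)"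
  using Rep_proj[of p] by blast

lemma coordsE:
  assumes "v \<in> coords p" "w \<in> coords p"
  obtains c where "c \<noteq> 0" "w = c *\<^sub>C v"
proof -
  obtain u where u: "u \<noteq> 0" "Rep_proj p = range (\<lambda>c. c *\<^sub>C u)" using Rep_proj_range by blast
  then obtain a b where a: "v = a *\<^sub>C u" "v \<noteq> 0" and b: "w = b *\<^sub>C u" "w \<noteq> 0"
    using assms by (auto simp only: coords_def)
  then have "a \<noteq> 0" "b \<noteq> 0" by (auto simp only: complex_vector.scale_zero_left)
  then show ?thesis
    using that[of "b / a"] by (simp add: a(1) b(1) scaleC_scaleC)
qed

lemma coords_nonzero: "v \<in> coords p \<Longrightarrow> v \<noteq> 0"
  by (simp add: coords_def)

lemma coords_scale:
  assumes "v \<in> coords p" "c \<noteq> 0" shows "c *\<^sub>C v \<in> coords p"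
proof -
  obtain u where u: "u \<noteq> 0" "Rep_proj p = range (\<lambda>c. c *\<^sub>C u)" using Rep_proj_range by blast
  then obtain a where "v = a *\<^sub>C u" "v \<noteq> 0" using assms by (auto simp only: coords_def)
  then show ?thesis
    using assms by (simp add: coords_def u(2) scaleC_scaleC)
qed

text \<open>An arbitrary choice of a vector on each line, without algebraic dependence on the point.
  Evaluating forms at it trivializes all twisting sheaves at once, as sheaves of plain
  functions.\<close>

definition rep :: "'n::finite proj \<Rightarrow> 'n \<Rightarrow> complex"
  where "rep p = (SOME v. v \<in> coords p)"

lemma rep_in_coords: "rep p \<in> coords p"
proof -
  obtain u where u: "u \<noteq> 0" "Rep_proj p = range (\<lambda>c. c *\<^sub>C u)" using Rep_proj_range by blast
  have "1 *\<^sub>C u \<in> range (\<lambda>c. c *\<^sub>C u)" by (rule rangeI)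
  then have "u \<in> coords p"
    unfolding coords_def u(2) using u(1) by (simp only: scaleC_one) blast
  then show ?thesis unfolding rep_def by (rule someI[where P = "\<lambda>v. v \<in> coords p"])
qed

lemma rep_nonzero: "rep p \<noteq> 0"
  using coords_nonzero rep_in_coords by blast

lemma point_of_vector:
  fixes v :: "'n::finite \<Rightarrow> complex"
  assumes "v \<noteq> 0" obtains p where "v \<in> coords p"
proof
  have "range (\<lambda>c. c *\<^sub>C v) \<in> {range (\<lambda>c. c *\<^sub>C v) | v :: 'n \<Rightarrow> complex. v \<noteq> 0}"
    using assms by blast
  from Abs_proj_inverse[OF this] have "Rep_proj (Abs_proj (range (\<lambda>c. c *\<^sub>C v))) = range (\<lambda>c. c *\<^sub>C v)" .
  moreover have "v \<in> range (\<lambda>c. c *\<^sub>C v)" using scaleC_one[of v] by (metis rangeI)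
  ultimately show "v \<in> coords (Abs_proj (range (\<lambda>c. c *\<^sub>C v)))"
    using assms by (simp only: coords_def) simp
qed

lemma rep_scale_inj:
  assumes "rep q = c *\<^sub>C rep p" shows "p = q"
proof -
  obtain u where u: "u \<noteq> 0" "Rep_proj p = range (\<lambda>c. c *\<^sub>C u)" using Rep_proj_range by blast
  obtain w where w: "w \<noteq> 0" "Rep_proj q = range (\<lambda>c. c *\<^sub>C w)" using Rep_proj_range by blast
  obtain a where a: "rep p = a *\<^sub>C u" using rep_in_coords[of p] u by (auto simp only: coords_def)
  obtain b where b: "rep q = b *\<^sub>C w" using rep_in_coords[of q] w by (auto simp only: coords_def)
  have b0: "b \<noteq> 0" using b rep_nonzero[of q] by (auto simp only: complex_vector.scale_zero_left)
  have ca: "c * a \<noteq> 0"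
    using assms a rep_nonzero[of q] by (auto simp only: scaleC_scaleC complex_vector.scale_zero_left)
  have "b *\<^sub>C w = (c * a) *\<^sub>C u" using assms a b by (simp add: scaleC_scaleC)
  then have "(1 / b) *\<^sub>C b *\<^sub>C w = (1 / b) *\<^sub>C (c * a) *\<^sub>C u" by simp
  then have wu: "w = ((c * a) / b) *\<^sub>C u" using b0 by (simp add: scaleC_scaleC scaleC_one)
  have nz: "(c * a) / b \<noteq> 0" using ca b0 by simp
  have "range (\<lambda>c. c *\<^sub>C w) = range (\<lambda>c. c *\<^sub>C u)"
  proof
    show "range (\<lambda>c. c *\<^sub>C w) \<subseteq> range (\<lambda>c. c *\<^sub>C u)"
      unfolding wu by (auto simp only: scaleC_scaleC)
    show "range (\<lambda>c. c *\<^sub>C u) \<subseteq> range (\<lambda>c. c *\<^sub>C w)"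
    proof
      fix x assume "x \<in> range (\<lambda>c. c *\<^sub>C u)"
      then obtain t where t: "x = t *\<^sub>C u" by blast
      have "x = (t / ((c * a) / b)) *\<^sub>C w"
        unfolding wu t scaleC_scaleC using nz by (metis nonzero_eq_divide_eq)
      then show "x \<in> range (\<lambda>c. c *\<^sub>C w)" by blast
    qed
  qed
  then show ?thesis using u w by (simp only: Rep_proj_inject[symmetric])
qed

lemma homogeneous_coords:
  assumes "homogeneous d F" "v \<in> coords p"
  obtains c where "c \<noteq> 0" "v = c *\<^sub>C rep p" "F v = c ^ d * F (rep p)"
  using coordsE[OF rep_in_coords assms(2)] homogeneous_scaling[OF assms(1)] by metis

lemma homogeneous_zero_iff:
  "homogeneous d F \<Longrightarrow> v \<in> coords p \<Longrightarrow> F v = 0 \<longleftrightarrow> F (rep p) = 0"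
  by (erule (1) homogeneous_coords) simp

lemma zariski_closed_iff:
  "zariski_closed Z \<longleftrightarrow> (\<exists>S. (\<forall>F\<in>S. \<exists>d. homogeneous d F) \<and> Z = {p. \<forall>F\<in>S. F (rep p) = 0})"
proof -
  have "{p. \<forall>F\<in>S. \<forall>v\<in>coords p. F v = 0} = {p. \<forall>F\<in>S. F (rep p) = 0}"
    if "\<forall>F\<in>S. \<exists>d. homogeneous d F" for S :: "(('a \<Rightarrow> complex) \<Rightarrow> complex) set"
    using that homogeneous_zero_iff rep_in_coords by blast
  then show ?thesis unfolding zariski_closed_def by (metis (no_types, lifting))
qed

lemma closed_zeros: "homogeneous d F \<Longrightarrow> zariski_closed {p. F (rep p) = 0}"
  unfolding zariski_closed_iff by (rule exI[of _ "{F}"]) auto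

lemma closed_empty: "zariski_closed {}"
  using closed_zeros[OF homogeneous_one] by simp

lemma closed_Inter: "(\<And>Z. Z \<in> \<Z> \<Longrightarrow> zariski_closed Z) \<Longrightarrow> zariski_closed (\<Inter>\<Z>)"
proof -
  assume "\<And>Z. Z \<in> \<Z> \<Longrightarrow> zariski_closed Z"
  then have "\<forall>Z\<in>\<Z>. \<exists>S. (\<forall>F\<in>S. \<exists>d. homogeneous d F) \<and> Z = {p. \<forall>F\<in>S. F (rep p) = 0}"
    unfolding zariski_closed_iff by blast
  from bchoice[OF this] obtain S where
    S: "\<forall>Z\<in>\<Z>. (\<forall>F\<in>S Z. \<exists>d. homogeneous d F) \<and> Z = {p. \<forall>F\<in>S Z. F (rep p) = 0}"
    by blast
  have "(\<Inter>\<Z>) = {p. \<forall>F\<in>(\<Union>Z\<in>\<Z>. S Z). F (rep p) = 0}" (is "_ = ?R")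
  proof (rule equalityI; rule subsetI)
    fix p assume "p \<in> \<Inter>\<Z>"
    then show "p \<in> ?R" using S by blast
  next
    fix p assume "p \<in> ?R"
    then have "p \<in> Z" if "Z \<in> \<Z>" for Z using S that by blast
    then show "p \<in> \<Inter>\<Z>" by blast
  qed
  moreover have "\<forall>F\<in>(\<Union>Z\<in>\<Z>. S Z). \<exists>d. homogeneous d F" using S by blast
  ultimately show ?thesis unfolding zariski_closed_iff by (intro exI[of _ "\<Union>Z\<in>\<Z>. S Z"]) (rule conjI)
qed

lemma closed_Int: "zariski_closed A \<Longrightarrow> zariski_closed B \<Longrightarrow> zariski_closed (A \<inter> B)"
  using closed_Inter[of "{A, B}"] by auto

lemma closed_Un:
  assumes "zariski_closed A" "zariski_closed B" shows "zariski_closed (A \<union> B)"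
proof -
  obtain S T where S: "\<forall>F\<in>S. \<exists>d. homogeneous d F" "A = {p. \<forall>F\<in>S. F (rep p) = 0}"
    and T: "\<forall>F\<in>T. \<exists>d. homogeneous d F" "B = {p. \<forall>F\<in>T. F (rep p) = 0}"
    using assms unfolding zariski_closed_iff by blast
  have "A \<union> B = {p. \<forall>H\<in>{F * G |F G. F \<in> S \<and> G \<in> T}. H (rep p) = 0}"
  proof (rule equalityI; rule subsetI)
    fix p assume p: "p \<in> {p. \<forall>H\<in>{F * G |F G. F \<in> S \<and> G \<in> T}. H (rep p) = 0}"
    have "F (rep p) * G (rep p) = 0" if "F \<in> S" "G \<in> T" for F G
    proof -
      have "(F * G) (rep p) = 0" using p that by blast
      then show ?thesis by simp
    qed
    then show "p \<in> A \<union> B" unfolding S T by (simp only: mult_eq_0_iff) blast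
  qed (auto simp: S T)
  moreover have "\<forall>H\<in>{F * G |F G. F \<in> S \<and> G \<in> T}. \<exists>d. homogeneous d H"
    using S T homogeneous_mult by blast
  ultimately show ?thesis unfolding zariski_closed_iff by blast
qed

text \<open>With one of two coordinate vectors fixed, their 2 by 2 minors are linear forms in the
  other; their common zero set is a single point.\<close>

lemma homogeneous_minor: "homogeneous 1 (\<lambda>x. a * x i - b * x j)"
proof -
  have "(\<lambda>x :: 'a \<Rightarrow> complex. a * x i - b * x j) = a *\<^sub>C (\<lambda>x. x i) - b *\<^sub>C (\<lambda>x. x j)"
    by (simp add: fun_eq_iff)
  then show ?thesis
    by (simp only: homogeneous_diff homogeneous_scale homogeneous_coord)
qed

lemma proj_eqI:
  assumes "\<And>i j. rep p j * rep q i = rep p i * rep q j" shows "p = q"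
proof -
  obtain j where j: "rep p j \<noteq> 0" using rep_nonzero[of p] by (auto simp: fun_eq_iff)
  have "rep q = (rep q j / rep p j) *\<^sub>C rep p"
    using assms[of j] j by (auto simp: fun_eq_iff field_simps)
  then show ?thesis by (rule rep_scale_inj)
qed

lemma closed_point: "zariski_closed {p}"
proof -
  have "{p} = \<Inter>(range (\<lambda>(i, j). {q. rep p j * rep q i - rep p i * rep q j = 0}))"
    using proj_eqI[of p] by auto
  also have "zariski_closed \<dots>"
  proof (rule closed_Inter)
    fix Z assume "Z \<in> range (\<lambda>(i, j). {q. rep p j * rep q i - rep p i * rep q j = 0})"
    then obtain i j where "Z = {q. rep p j * rep q i - rep p i * rep q j = 0}" by auto
    then show "zariski_closed Z" by (simp only: closed_zeros[OF homogeneous_minor])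
  qed
  finally show ?thesis .
qed

lemma closed_finite: "finite Z \<Longrightarrow> zariski_closed Z"
  by (induction Z rule: finite_induct) (auto intro: closed_empty closed_Un[OF closed_point, simplified])

lemma separating_linear_form:
  assumes "p \<noteq> q" obtains F where "homogeneous 1 F" "F (rep p) = 0" "F (rep q) \<noteq> 0"
proof -
  obtain i j where "rep p j * rep q i - rep p i * rep q j \<noteq> 0" using proj_eqI[of p q] assms by auto
  then show ?thesis
    using that[OF homogeneous_minor[of "rep p j" i "rep p i" j]] by (simp add: mult.commute)
qed

text \<open>Along an infinite descending chain, choose forms that vanish on the next set but not at
  some point of the present one. A relation expressing one of them by its predecessors, evaluated at
  its own point, is contradictory, since all predecessors vanish there.\<close>

lemma wf_closed: "wf {(A, B :: 'n::finite proj set). zariski_closed A \<and> zariski_closed B \<and> A \<subset> B}"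
  unfolding wf_iff_no_infinite_down_chain
proof
  assume "\<exists>Z. \<forall>i. (Z (Suc i), Z i) \<in> {(A, B :: 'n proj set). zariski_closed A \<and> zariski_closed B \<and> A \<subset> B}"
  then obtain Z :: "nat \<Rightarrow> 'n proj set" where Z: "\<And>i. zariski_closed (Z i)" "\<And>i. Z (Suc i) \<subset> Z i" by blast
  have "\<exists>F d z. homogeneous d F \<and> (\<forall>p\<in>Z (Suc i). F (rep p) = 0) \<and> z \<in> Z i \<and> F (rep z) \<noteq> 0" for i
  proof -
    obtain S where S: "\<forall>F\<in>S. \<exists>d. homogeneous d F" "Z (Suc i) = {p. \<forall>F\<in>S. F (rep p) = 0}"
      using Z(1)[of "Suc i"] unfolding zariski_closed_iff by blast
    obtain z where z: "z \<in> Z i" "z \<notin> Z (Suc i)" using Z(2)[of i] by blast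
    then obtain F where F: "F \<in> S" "F (rep z) \<noteq> 0" using S by blast
    then obtain d where d: "homogeneous d F" using S by blast
    have "\<forall>p\<in>Z (Suc i). F (rep p) = 0" using F(1) unfolding S(2) by blast
    then show ?thesis
      by (intro exI[of _ F] exI[of _ d] exI[of _ z] conjI d z(1) F(2))
  qed
  then obtain F d z where F: "\<And>i. homogeneous (d i) (F i)" "\<And>i p. p \<in> Z (Suc i) \<Longrightarrow> F i (rep p) = 0"
    "\<And>i. z i \<in> Z i" "\<And>i. F i (rep (z i)) \<noteq> 0" by metis
  have mono: "Z (i + k) \<subseteq> Z i" for i k
    by (induction k) (use Z(2) in \<open>auto dest!: psubset_imp_subset\<close>)
  obtain m B where "\<forall>i<m. B i \<in> poly_funs" and B: "F m = (\<Sum>i<m. B i * F i)"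
    by (rule hilbert_basis[of d F, OF F(1)])
  from B have "F m (rep (z m)) = (\<Sum>i<m. B i (rep (z m)) * F i (rep (z m)))" by simp
  also have "\<dots> = 0"
  proof (rule sum.neutral, safe)
    fix i assume "i < m"
    then have "z m \<in> Z (Suc i)" using mono[of "Suc i" "m - Suc i"] F(3)[of m] by auto
    then show "B i (rep (z m)) * F i (rep (z m)) = 0" using F(2) by simp
  qed
  finally show False using F(4) by blast
qed

section \<open>Relatively open sets\<close>

lemma open_in_self: "zariski_open_in C C"
  unfolding zariski_open_in_def using closed_empty by blast

lemma open_in_subset: "zariski_open_in C U \<Longrightarrow> U \<subseteq> C"
  unfolding zariski_open_in_def by blast

lemma open_in_Int:
  assumes "zariski_open_in C U" "zariski_open_in C W" shows "zariski_open_in C (U \<inter> W)"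
proof -
  obtain Y Z where "zariski_closed Y" "U = C - Y" "zariski_closed Z" "W = C - Z"
    using assms unfolding zariski_open_in_def by blast
  then show ?thesis
    unfolding zariski_open_in_def using closed_Un by (intro exI[of _ "Y \<union> Z"]) auto
qed

lemma open_in_INT:
  "finite I \<Longrightarrow> zariski_open_in C U \<Longrightarrow> (\<And>i. i \<in> I \<Longrightarrow> zariski_open_in C (W i)) \<Longrightarrow>
    zariski_open_in C (U \<inter> (\<Inter>i\<in>I. W i))"
proof (induction I rule: finite_induct)
  case (insert i I)
  then have "zariski_open_in C ((U \<inter> (\<Inter>i\<in>I. W i)) \<inter> W i)"
    by (intro open_in_Int[of C "U \<inter> (\<Inter>i\<in>I. W i)"]) auto
  moreover have "(U \<inter> (\<Inter>i\<in>I. W i)) \<inter> W i = U \<inter> (\<Inter>i\<in>insert i I. W i)" by blast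
  ultimately show ?case by metis
qed simp

lemma open_in_nonzero: "homogeneous d F \<Longrightarrow> zariski_open_in C {q \<in> C. F (rep q) \<noteq> 0}"
  unfolding zariski_open_in_def by (rule exI[of _ "{p. F (rep p) = 0}"]) (auto intro: closed_zeros)

lemma open_in_cofinite: "finite P \<Longrightarrow> zariski_open_in C (C - P)"
  unfolding zariski_open_in_def using closed_finite by blast

section \<open>Forms on a curve\<close>

locale curve =
  fixes C :: "'n::finite proj set"
  assumes curve: "smooth_irreducible_projective_curve C"
begin

lemma irreducible: "irreducible_closed C"
  and dimension: "has_krull_dim C 1"
  and smooth: "p \<in> C \<Longrightarrow> \<exists>x. generates_max_ideal C p 1 x"
  using curve by (auto simp: smooth_irreducible_projective_variety_def)

abbreviation opn :: "'n proj set \<Rightarrow> bool"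
  where "opn \<equiv> zariski_open_in C"

lemma open_meet:
  assumes "opn U" "opn W" "U \<noteq> {}" "W \<noteq> {}"
  shows "U \<inter> W \<noteq> {}"
proof
  obtain Y Z where YZ: "zariski_closed Y" "U = C - Y" "zariski_closed Z" "W = C - Z"
    using assms unfolding zariski_open_in_def by blast
  assume "U \<inter> W = {}"
  then have "C \<subseteq> Y \<union> Z" using YZ by blast
  then have "C \<subseteq> Y \<or> C \<subseteq> Z" using irreducible YZ unfolding irreducible_closed_def by blast
  then show False using YZ assms by blast
qed

text \<open>Noetherian induction: an infinite irreducible closed subset would fit strictly between
  one of its points and the curve, against dimension 1, while a reducible one is a union of two
  smaller closed sets.\<close>

lemma closed_proper_finite:
  assumes "zariski_closed Z" "Z \<subseteq> C" "Z \<noteq> C" shows "finite Z"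
  using assms
proof (induction Z rule: wf_induct_rule[OF wf_closed])
  case (1 Z)
  show ?case
  proof (rule ccontr)
    assume inf: "infinite Z"
    then obtain p where p: "p \<in> Z" by (metis ex_in_conv finite.emptyI)
    show False
    proof (cases "irreducible_closed Z")
      case True
      have "irreducible_closed {p}" unfolding irreducible_closed_def using closed_point by blast
      moreover have "{p} \<subset> Z" using p inf by auto
      ultimately have "has_irreducible_chain C 2"
        unfolding has_irreducible_chain_def
        using True irreducible 1 p
        by (intro exI[of _ "\<lambda>i. if i = 0 then {p} else if i = 1 then Z else C"])
          (auto simp: less_2_cases_iff)
      then show False using dimension by (simp add: has_krull_dim_def numeral_2_eq_2)
    next
      case False
      then obtain A B where AB: "zariski_closed A" "zariski_closed B" "Z \<subseteq> A \<union> B" "\<not> Z \<subseteq> A" "\<not> Z \<subseteq> B"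
        unfolding irreducible_closed_def using 1 p by blast
      have "finite (Z \<inter> A)" "finite (Z \<inter> B)"
        using 1 AB closed_Int by (blast intro: 1)+
      then show False using inf AB(3) by (metis Int_Un_distrib Int_absorb2 finite_UnI)
    qed
  qed
qed

lemma open_cofinite:
  assumes "opn U" "U \<noteq> {}" shows "finite (C - U)"
proof -
  obtain Z where Z: "zariski_closed Z" "U = C - Z" using assms unfolding zariski_open_in_def by blast
  have "zariski_closed (C \<inter> Z)" using irreducible Z closed_Int unfolding irreducible_closed_def by blast
  then have "finite (C \<inter> Z)" using Z assms by (intro closed_proper_finite) auto
  moreover have "C - U = C \<inter> Z" using Z by blast
  ultimately show ?thesis by simp
qed

text \<open>Finite sets are closed, so a finite irreducible set is a single point, and a point
  contains no strict chain.\<close>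

lemma infinite_curve: "infinite C"
proof
  assume fin: "finite C"
  obtain Z where Z: "\<forall>i\<le>1. irreducible_closed (Z i) \<and> Z i \<subseteq> C" "\<forall>i<1. Z i \<subset> Z (Suc i)"
    using dimension unfolding has_krull_dim_def has_irreducible_chain_def by blast
  then have Z0: "Z 0 \<noteq> {}" "Z 0 \<subset> Z 1" "Z 1 \<subseteq> C" by (auto simp: irreducible_closed_def)
  then obtain p where p: "p \<in> Z 0" by blast
  then have "C \<noteq> {p}" "p \<in> C" using Z0 by auto
  moreover have "C \<subseteq> {p} \<union> (C - {p})" by blast
  then have "C \<subseteq> {p} \<or> C \<subseteq> C - {p}"
    using irreducible closed_finite[of "C - {p}"] closed_point[of p] fin
    unfolding irreducible_closed_def by blast
  ultimately show False by blast
qed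

lemma open_infinite: "opn U \<Longrightarrow> U \<noteq> {} \<Longrightarrow> infinite U"
  using open_cofinite infinite_curve by (metis Diff_infinite_finite)

lemma open_minus_finite:
  assumes "opn U" "finite P" shows "opn (U - P)"
proof -
  have "U - P = U \<inter> (C - P)" using open_in_subset[OF assms(1)] by blast
  then show ?thesis using open_in_Int[OF assms(1) open_in_cofinite[OF assms(2)]] by simp
qed

definition vanishes :: "(('n \<Rightarrow> complex) \<Rightarrow> complex) \<Rightarrow> bool"
  where "vanishes F \<longleftrightarrow> (\<forall>q\<in>C. F (rep q) = 0)"

lemma vanishes_on_open:
  assumes "homogeneous d F" "opn U" "U \<noteq> {}" "\<And>q. q \<in> U \<Longrightarrow> F (rep q) = 0"
  shows "vanishes F"
proof (rule ccontr)
  assume "\<not> vanishes F"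
  then have "{q \<in> C. F (rep q) \<noteq> 0} \<noteq> {}" by (auto simp: vanishes_def)
  then show False
    using open_meet[OF assms(2) open_in_nonzero[OF assms(1)] assms(3)] assms(4) by blast
qed

lemma vanishes_mult:
  assumes "homogeneous d F" "homogeneous e G" "\<And>q. q \<in> C \<Longrightarrow> F (rep q) * G (rep q) = 0"
  shows "vanishes F \<or> vanishes G"
  using vanishes_on_open[OF assms(2) open_in_nonzero[OF assms(1)]] assms(3)
  by (auto simp: vanishes_def)

lemma vanishes_mult_iff:
  "homogeneous d F \<Longrightarrow> homogeneous e G \<Longrightarrow> vanishes (F * G) \<longleftrightarrow> vanishes F \<or> vanishes G"
  using vanishes_mult[of d F e G] by (auto simp: vanishes_def)

lemma vanishes_power: "homogeneous d F \<Longrightarrow> vanishes (F ^ k) \<Longrightarrow> vanishes F"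
  by (auto simp: vanishes_def)

lemma finite_zeros:
  assumes "homogeneous d F" "\<not> vanishes F" shows "finite {q \<in> C. F (rep q) = 0}"
proof -
  have "{q \<in> C. F (rep q) \<noteq> 0} \<noteq> {}" using assms by (auto simp: vanishes_def)
  from open_cofinite[OF open_in_nonzero[OF assms(1)] this] show ?thesis
    by (rule rev_finite_subset) auto
qed

text \<open>A polynomial need not be homogeneous; its homogeneous components are recovered by
  scaling the coordinates.\<close>

lemma vanishes_mult_poly:
  assumes F: "homogeneous d F" and Q: "Q \<in> poly_funs"
    and FQ: "\<And>q v. q \<in> C \<Longrightarrow> v \<in> coords q \<Longrightarrow> F v * Q v = 0"
    and p: "p \<in> C" "Q (rep p) \<noteq> 0"
  shows "vanishes F"
proof -
  obtain K Qs where "\<forall>k. homogeneous k (Qs k)" "\<forall>x. Q x = (\<Sum>k\<le>K. Qs k x)"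
    by (rule poly_funs_decompose[OF Q])
  then have Qs: "\<And>k. homogeneous k (Qs k)" "\<And>x. Q x = (\<Sum>k\<le>K. Qs k x)" by blast+
  have comp: "F (rep q) * Qs k (rep q) = 0" if "q \<in> C" "k \<le> K" for q k
  proof -
    have z: "(\<Sum>k\<le>K. (F (rep q) * Qs k (rep q)) * c ^ (d + k)) = 0" if "c \<noteq> 0" for c
    proof -
      have "(\<Sum>k\<le>K. (F (rep q) * Qs k (rep q)) * c ^ (d + k)) = F (c *\<^sub>C rep q) * Q (c *\<^sub>C rep q)"
        by (simp add: Qs(2) homogeneous_scaling[OF F] homogeneous_scaling[OF Qs(1)]
          sum_distrib_left power_add algebra_simps)
      then show ?thesis using FQ[OF \<open>q \<in> C\<close> coords_scale[OF rep_in_coords that]] by simp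
    qed
    have c: "(\<Sum>k\<le>K. (F (rep q) * Qs k (rep q)) * c ^ (d + k)) =
        c ^ d * (\<Sum>k\<le>K. (F (rep q) * Qs k (rep q)) * c ^ k)" for c
      by (simp add: power_add sum_distrib_left algebra_simps)
    have eq: "(\<Sum>k\<le>K. (F (rep q) * Qs k (rep q)) * c ^ k) = 0" if "c \<noteq> 0" for c
      using z[OF that] that unfolding c by simp
    show ?thesis
    proof (rule ccontr)
      assume "F (rep q) * Qs k (rep q) \<noteq> 0"
      from polyfun_roots_finite[of "\<lambda>k. F (rep q) * Qs k (rep q)", OF this \<open>k \<le> K\<close>]
      have "finite (UNIV - {0 :: complex})" by (rule rev_finite_subset) (use eq in auto)
      then show False using infinite_UNIV_char_0 by (metis finite.emptyI finite_Diff2 finite_insert)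
    qed
  qed
  have "\<exists>k\<le>K. Qs k (rep p) \<noteq> 0"
    using p(2) unfolding Qs(2) by (auto intro: ccontr sum.neutral)
  then obtain k where k: "k \<le> K" "Qs k (rep p) \<noteq> 0" by blast
  then have "vanishes F \<or> vanishes (Qs k)"
    using comp by (intro vanishes_mult[OF F Qs(1)[of k]]) auto
  then show ?thesis using k p by (auto simp: vanishes_def)
qed

end

section \<open>Orders of vanishing\<close>

lemma form_nonzero_at: obtains h where "homogeneous 1 h" "h (rep p) \<noteq> 0"
proof -
  obtain i where "rep p i \<noteq> 0" using rep_nonzero[of p] by (auto simp: fun_eq_iff)
  then show ?thesis using that[OF homogeneous_coord[of i]] by simp
qed

lemma regular_onE:
  assumes "regular_on C U f" "p \<in> U"
  obtains W d F G where "zariski_open_in C W" "p \<in> W" "W \<subseteq> U" "homogeneous d F" "homogeneous d G"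
    "\<forall>q\<in>W. G (rep q) \<noteq> 0 \<and> f q = F (rep q) / G (rep q)"
proof -
  obtain W d F G where "zariski_open_in C W" "p \<in> W" "W \<subseteq> U" "homogeneous d F" "homogeneous d G"
    and *: "\<forall>q\<in>W. \<forall>v\<in>coords q. G v \<noteq> 0 \<and> f q = F v / G v"
    using assms unfolding regular_on_def by meson
  moreover have "\<forall>q\<in>W. G (rep q) \<noteq> 0 \<and> f q = F (rep q) / G (rep q)"
    using * rep_in_coords by blast
  ultimately show ?thesis using that by metis
qed

lemma regular_onI:
  assumes "\<And>p. p \<in> U \<Longrightarrow> \<exists>W d F G. zariski_open_in C W \<and> p \<in> W \<and> W \<subseteq> U \<and> homogeneous d F \<and>
    homogeneous d G \<and> (\<forall>q\<in>W. G (rep q) \<noteq> 0 \<and> f q = F (rep q) / G (rep q))"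
  shows "regular_on C U f"
  unfolding regular_on_def
proof
  fix p assume "p \<in> U"
  from assms[OF this] obtain W d F G where W: "zariski_open_in C W" "p \<in> W" "W \<subseteq> U"
    and F: "homogeneous d F" and G: "homogeneous d G"
    and *: "\<forall>q\<in>W. G (rep q) \<noteq> 0 \<and> f q = F (rep q) / G (rep q)" by (elim exE conjE)
  have all: "\<forall>q\<in>W. \<forall>v\<in>coords q. G v \<noteq> 0 \<and> f q = F v / G v"
  proof (intro ballI)
    fix q v assume "q \<in> W" "v \<in> coords q"
    obtain c where c: "c \<noteq> 0" "v = c *\<^sub>C rep q" using coordsE[OF rep_in_coords \<open>v \<in> coords q\<close>] by metis
    show "G v \<noteq> 0 \<and> f q = F v / G v"
      using * \<open>q \<in> W\<close> c(1) unfolding c(2) homogeneous_scaling[OF F] homogeneous_scaling[OF G] by simp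
  qed
  show "\<exists>W d F G. zariski_open_in C W \<and> p \<in> W \<and> W \<subseteq> U \<and> homogeneous d F \<and> homogeneous d G \<and>
      (\<forall>q\<in>W. \<forall>v\<in>coords q. G v \<noteq> 0 \<and> f q = F v / G v)"
    by (rule exI[of _ W], rule exI[of _ d], rule exI[of _ F], rule exI[of _ G])
      (intro conjI W F G all)
qed

lemma regular_on_quotient:
  assumes "zariski_open_in C U" "homogeneous d F" "homogeneous d G"
    "\<And>q. q \<in> U \<Longrightarrow> G (rep q) \<noteq> 0" "\<And>q. q \<in> U \<Longrightarrow> f q = F (rep q) / G (rep q)"
  shows "regular_on C U f"
  by (rule regular_onI, rule exI[of _ U], rule exI[of _ d], rule exI[of _ F], rule exI[of _ G])
    (use assms in auto)

lemma regular_at_quotient: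
  assumes "zariski_open_in C U" "p \<in> U" "homogeneous d F" "homogeneous d G"
    "\<And>q. q \<in> U \<Longrightarrow> G (rep q) \<noteq> 0" "\<And>q. q \<in> U \<Longrightarrow> f q = F (rep q) / G (rep q)"
  shows "regular_at C p f"
  unfolding regular_at_def using regular_on_quotient[OF assms(1,3-6)] assms(1,2) by auto

lemma regular_atE:
  assumes "regular_at C p f"
  obtains W d F G where "zariski_open_in C W" "p \<in> W" "homogeneous d F" "homogeneous d G"
    "\<forall>q\<in>W. G (rep q) \<noteq> 0 \<and> f q = F (rep q) / G (rep q)"
proof -
  obtain W where "zariski_open_in C W" "p \<in> W" "regular_on C W f"
    using assms unfolding regular_at_def by blast
  then show ?thesis using regular_onE[of C W f p] that by metis
qed

context curve
begin

lemma equal_on_open: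
  assumes "homogeneous d F" "homogeneous d G" "opn U" "U \<noteq> {}"
    "\<And>q. q \<in> U \<Longrightarrow> F (rep q) = G (rep q)" "q \<in> C"
  shows "F (rep q) = G (rep q)"
  using vanishes_on_open[OF homogeneous_diff[OF assms(1,2)] assms(3,4)] assms(5,6)
  by (simp add: vanishes_def)

lemma equal_on_coords:
  assumes "homogeneous d F" "homogeneous d G" "F (rep q) = G (rep q)" "v \<in> coords q"
  shows "F v = G v"
proof -
  obtain c where "v = c *\<^sub>C rep q" using coordsE[OF rep_in_coords assms(4)] by metis
  then show ?thesis by (simp add: homogeneous_scaling[OF assms(1)] homogeneous_scaling[OF assms(2)] assms(3))
qed

text \<open>A form \<open>T\<close> is the numerator of a local parameter at \<open>p\<close>.\<close>

definition uniformizer :: "'n proj \<Rightarrow> nat \<Rightarrow> (('n \<Rightarrow> complex) \<Rightarrow> complex) \<Rightarrow> bool"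
  where "uniformizer p t T \<longleftrightarrow> homogeneous t T \<and> T (rep p) = 0 \<and>
    (\<forall>d F. homogeneous d F \<and> F (rep p) = 0 \<longrightarrow>
      (\<exists>e G a A. homogeneous e G \<and> homogeneous a A \<and> d + e = a + t \<and> G (rep p) \<noteq> 0 \<and>
        (\<forall>q\<in>C. F (rep q) * G (rep q) = A (rep q) * T (rep q))))"

lemma uniformizerE:
  assumes "uniformizer p t T" "homogeneous d F" "F (rep p) = 0"
  obtains e G a A where "homogeneous e G" "homogeneous a A" "d + e = a + t" "G (rep p) \<noteq> 0"
    "\<forall>q\<in>C. F (rep q) * G (rep q) = A (rep q) * T (rep q)"
proof -
  have "\<exists>e G a A. homogeneous e G \<and> homogeneous a A \<and> d + e = a + t \<and> G (rep p) \<noteq> 0 \<and>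
        (\<forall>q\<in>C. F (rep q) * G (rep q) = A (rep q) * T (rep q))"
    using assms(1)[unfolded uniformizer_def, THEN conjunct2, THEN conjunct2, rule_format, of d F]
      assms(2,3) by simp
  then show ?thesis using that by (elim exE conjE)
qed

text \<open>Elements of the local ring are quotients of forms of equal degree. Dividing
  \<open>F\<close> by a power of a linear form that is nonzero at \<open>p\<close> gives such an
  element; clearing denominators in its expression as a multiple of \<open>x\<close> gives an
  identity near \<open>p\<close>, which extends to \<open>C\<close> by irreducibility.\<close>

lemma generator_uniformizer:
  assumes p: "p \<in> C" and x: "generates_max_ideal C p 1 (\<lambda>_. x)"
  obtains W t T X where "opn W" "p \<in> W" "uniformizer p t T" "homogeneous t X"
    "\<forall>q\<in>W. X (rep q) \<noteq> 0 \<and> x q = T (rep q) / X (rep q)"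
proof -
  have "regular_at C p x" and xp: "x p = 0" using x by (auto simp: generates_max_ideal_def)
  then obtain W t T X where W: "opn W" "p \<in> W" and T: "homogeneous t T" and X: "homogeneous t X"
    and xT: "\<forall>q\<in>W. X (rep q) \<noteq> 0 \<and> x q = T (rep q) / X (rep q)" by (elim regular_atE)
  obtain h where h: "homogeneous 1 h" "h (rep p) \<noteq> 0" by (rule form_nonzero_at)
  have "\<exists>e G a A. homogeneous e G \<and> homogeneous a A \<and> d + e = a + t \<and> G (rep p) \<noteq> 0 \<and>
        (\<forall>q\<in>C. F (rep q) * G (rep q) = A (rep q) * T (rep q))"
    if F: "homogeneous d F" and Fp: "F (rep p) = 0" for d F
  proof -
    define g where "g = (\<lambda>q. F (rep q) / (h ^ d) (rep q))"
    have hd: "homogeneous d (h ^ d)" using homogeneous_power[OF h(1), of d] by simp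
    have "regular_at C p g"
      by (rule regular_at_quotient[OF open_in_nonzero[OF h(1)] _ F hd]) (use p h in \<open>auto simp: g_def\<close>)
    moreover have "g p = 0" by (simp add: g_def Fp)
    ultimately obtain a W' where a: "regular_at C p a" and W': "opn W'" "p \<in> W'"
      and ga: "\<forall>q\<in>W'. g q = a q * x q"
      using x unfolding generates_max_ideal_def by fastforce
    obtain W'' e A B where W'': "opn W''" "p \<in> W''" and A: "homogeneous e A" and B: "homogeneous e B"
      and aA: "\<forall>q\<in>W''. B (rep q) \<noteq> 0 \<and> a q = A (rep q) / B (rep q)" using a by (elim regular_atE)
    define U where "U = W \<inter> W' \<inter> W'' \<inter> {q \<in> C. h (rep q) \<noteq> 0}"
    have U: "opn U" "p \<in> U"
      unfolding U_def using W W' W'' p h by (auto intro!: open_in_Int open_in_nonzero)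
    have L: "homogeneous (d + (e + t)) (F * (B * X))" by (intro homogeneous_mult F B X)
    have "homogeneous ((e + d) + t) ((A * h ^ d) * T)" by (intro homogeneous_mult A hd T)
    then have R: "homogeneous (d + (e + t)) ((A * h ^ d) * T)" by (simp only: ac_simps)
    have "(F * (B * X)) (rep q) = ((A * h ^ d) * T) (rep q)" if "q \<in> U" for q
    proof -
      have "F (rep q) / h (rep q) ^ d = (A (rep q) / B (rep q)) * (T (rep q) / X (rep q))"
        using ga aA xT that unfolding U_def g_def by auto
      moreover have "h (rep q) \<noteq> 0" "B (rep q) \<noteq> 0" "X (rep q) \<noteq> 0"
        using that aA xT by (auto simp: U_def)
      ultimately show ?thesis by (simp add: field_simps)
    qed
    from equal_on_open[OF L R U(1) _ this] U(2)
    have "\<forall>q\<in>C. F (rep q) * (B * X) (rep q) = (A * h ^ d) (rep q) * T (rep q)" by auto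
    moreover have "(B * X) (rep p) \<noteq> 0" using aA xT W W'' by simp
    moreover have "homogeneous (e + t) (B * X)" "homogeneous (e + d) (A * h ^ d)"
      by (intro homogeneous_mult B X A hd)+
    moreover have "d + (e + t) = (e + d) + t" by simp
    ultimately show ?thesis by (intro exI conjI)
  qed
  moreover have "T (rep p) = 0" using xT xp W by auto
  ultimately have "uniformizer p t T" using T by (simp add: uniformizer_def)
  then show ?thesis using that W X xT by metis
qed

lemma uniformizer_exists:
  assumes p: "p \<in> C" shows "\<exists>t T. uniformizer p t T"
proof -
  obtain x where x: "generates_max_ideal C p 1 x" using smooth[OF p] by blast
  then have "generates_max_ideal C p 1 (\<lambda>_. x 0)" by (simp add: generates_max_ideal_def)
  then obtain W t T X where "opn W" "p \<in> W" "uniformizer p t T" "homogeneous t X"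
    "\<forall>q\<in>W. X (rep q) \<noteq> 0 \<and> x 0 q = T (rep q) / X (rep q)" by (rule generator_uniformizer[OF p])
  then show ?thesis by blast
qed

text \<open>Otherwise every form that is zero at \<open>p\<close> would vanish on all of
  \<open>C\<close>, although linear forms separate \<open>p\<close> from the other points.\<close>

lemma uniformizer_not_vanishes:
  assumes "p \<in> C" "uniformizer p t T" shows "\<not> vanishes T"
proof
  assume T: "vanishes T"
  have "infinite (C - {p})" using infinite_curve by simp
  then have "C - {p} \<noteq> {}" by (metis finite.emptyI)
  then obtain q where q: "q \<in> C" "q \<noteq> p" by blast
  then obtain F where F: "homogeneous 1 F" "F (rep p) = 0" "F (rep q) \<noteq> 0"
    using separating_linear_form[of p q] by blast
  obtain e G a A where G: "homogeneous e G" "homogeneous a A" "1 + e = a + t" "G (rep p) \<noteq> 0"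
    "\<forall>q\<in>C. F (rep q) * G (rep q) = A (rep q) * T (rep q)"
    by (rule uniformizerE[OF assms(2) F(1,2)])
  then have "vanishes F \<or> vanishes G"
    using T by (intro vanishes_mult[OF F(1) G(1)]) (auto simp: vanishes_def)
  then show False using q F G(4) assms(1) by (auto simp: vanishes_def)
qed

text \<open>Divisibility by the \<open>k\<close>-th power of the local parameter with denominators
  cleared: \<open>G\<close> is a unit at \<open>p\<close>, and the degrees of both sides balance.
  The degree \<open>d\<close> of \<open>F\<close> is an argument because the zero function has no
  definite one.\<close>

definition vanishing_ge :: "'n proj \<Rightarrow> nat \<Rightarrow> (('n \<Rightarrow> complex) \<Rightarrow> complex) \<Rightarrow> nat \<Rightarrow> nat \<Rightarrow> (('n \<Rightarrow> complex) \<Rightarrow> complex) \<Rightarrow> bool"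
  where "vanishing_ge p t T k d F \<longleftrightarrow> (\<exists>e G a A. homogeneous e G \<and> homogeneous a A \<and> d + e = a + k * t \<and>
    G (rep p) \<noteq> 0 \<and> (\<forall>q\<in>C. F (rep q) * G (rep q) = A (rep q) * T (rep q) ^ k))"

definition vanishing_eq :: "'n proj \<Rightarrow> nat \<Rightarrow> (('n \<Rightarrow> complex) \<Rightarrow> complex) \<Rightarrow> nat \<Rightarrow> nat \<Rightarrow> (('n \<Rightarrow> complex) \<Rightarrow> complex) \<Rightarrow> bool"
  where "vanishing_eq p t T k d F \<longleftrightarrow> (\<exists>e G a A. homogeneous e G \<and> homogeneous a A \<and> d + e = a + k * t \<and>
    G (rep p) \<noteq> 0 \<and> A (rep p) \<noteq> 0 \<and> (\<forall>q\<in>C. F (rep q) * G (rep q) = A (rep q) * T (rep q) ^ k))"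

lemma vanishing_geI:
  "homogeneous e G \<Longrightarrow> homogeneous a A \<Longrightarrow> d + e = a + k * t \<Longrightarrow> G (rep p) \<noteq> 0 \<Longrightarrow>
    (\<And>q. q \<in> C \<Longrightarrow> F (rep q) * G (rep q) = A (rep q) * T (rep q) ^ k) \<Longrightarrow> vanishing_ge p t T k d F"
  unfolding vanishing_ge_def by (intro exI conjI ballI)

lemma vanishing_eqI:
  "homogeneous e G \<Longrightarrow> homogeneous a A \<Longrightarrow> d + e = a + k * t \<Longrightarrow> G (rep p) \<noteq> 0 \<Longrightarrow> A (rep p) \<noteq> 0 \<Longrightarrow>
    (\<And>q. q \<in> C \<Longrightarrow> F (rep q) * G (rep q) = A (rep q) * T (rep q) ^ k) \<Longrightarrow> vanishing_eq p t T k d F"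
  unfolding vanishing_eq_def by (intro exI conjI ballI)

lemma vanishing_geE:
  assumes "vanishing_ge p t T k d F"
  obtains e G a A where "homogeneous e G" "homogeneous a A" "d + e = a + k * t" "G (rep p) \<noteq> 0"
    "\<forall>q\<in>C. F (rep q) * G (rep q) = A (rep q) * T (rep q) ^ k"
  using assms unfolding vanishing_ge_def by (elim exE conjE)

lemma vanishing_eqE:
  assumes "vanishing_eq p t T k d F"
  obtains e G a A where "homogeneous e G" "homogeneous a A" "d + e = a + k * t" "G (rep p) \<noteq> 0"
    "A (rep p) \<noteq> 0" "\<forall>q\<in>C. F (rep q) * G (rep q) = A (rep q) * T (rep q) ^ k"
  using assms unfolding vanishing_eq_def by (elim exE conjE)

lemma vanishing_eq_imp_ge: "vanishing_eq p t T k d F \<Longrightarrow> vanishing_ge p t T k d F"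
  by (erule vanishing_eqE) (rule vanishing_geI, assumption+, blast)

lemma vanishing_ge_0: "homogeneous d F \<Longrightarrow> vanishing_ge p t T 0 d F"
  by (rule vanishing_geI[OF homogeneous_one]) auto

lemma vanishing_eq_0: "homogeneous d F \<Longrightarrow> F (rep p) \<noteq> 0 \<Longrightarrow> vanishing_eq p t T 0 d F"
  by (rule vanishing_eqI[OF homogeneous_one]) auto

lemma vanishing_ge_Suc_D:
  assumes T: "homogeneous t T" and "vanishing_ge p t T (Suc k) d F" shows "vanishing_ge p t T k d F"
proof -
  obtain e G a A where G: "homogeneous e G" "homogeneous a A" "d + e = a + Suc k * t" "G (rep p) \<noteq> 0"
    "\<forall>q\<in>C. F (rep q) * G (rep q) = A (rep q) * T (rep q) ^ Suc k" using assms(2) by (rule vanishing_geE)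
  show ?thesis
    by (rule vanishing_geI[OF G(1) homogeneous_mult[OF G(2) T] _ G(4)]) (use G(3,5) in auto)
qed

lemma vanishing_ge_mono:
  "homogeneous t T \<Longrightarrow> vanishing_ge p t T k d F \<Longrightarrow> j \<le> k \<Longrightarrow> vanishing_ge p t T j d F"
  by (induction k) (auto simp: le_Suc_eq dest: vanishing_ge_Suc_D)

lemma vanishing_ge_cases:
  assumes U: "uniformizer p t T" and "vanishing_ge p t T k d F"
  shows "vanishing_eq p t T k d F \<or> vanishing_ge p t T (Suc k) d F"
proof -
  obtain e G a A where G: "homogeneous e G" "homogeneous a A" "d + e = a + k * t" "G (rep p) \<noteq> 0"
    "\<forall>q\<in>C. F (rep q) * G (rep q) = A (rep q) * T (rep q) ^ k" using assms(2) by (rule vanishing_geE)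
  show ?thesis
  proof (cases "A (rep p) = 0")
    case False
    show ?thesis by (rule disjI1, rule vanishing_eqI[OF G(1-4) False]) (use G(5) in blast)
  next
    case True
    obtain e' G' a' A' where G': "homogeneous e' G'" "homogeneous a' A'" "a + e' = a' + t" "G' (rep p) \<noteq> 0"
      "\<forall>q\<in>C. A (rep q) * G' (rep q) = A' (rep q) * T (rep q)"
      by (rule uniformizerE[OF U G(2) True])
    have "vanishing_ge p t T (Suc k) d F"
    proof (rule vanishing_geI[OF homogeneous_mult[OF G(1) G'(1)] G'(2)])
      show "d + (e + e') = a' + Suc k * t" using G(3) G'(3) by simp
      show "(G * G') (rep p) \<noteq> 0" using G(4) G'(4) by simp
      fix q assume q: "q \<in> C"
      have "F (rep q) * (G * G') (rep q) = (F (rep q) * G (rep q)) * G' (rep q)" by simp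
      also have "\<dots> = (A (rep q) * G' (rep q)) * T (rep q) ^ k" using G(5) q by simp
      also have "\<dots> = A' (rep q) * T (rep q) ^ Suc k" using G'(5) q by simp
      finally show "F (rep q) * (G * G') (rep q) = A' (rep q) * T (rep q) ^ Suc k" .
    qed
    then show ?thesis ..
  qed
qed

text \<open>Powers of \<open>T\<close> cancel because \<open>C\<close> is irreducible. A higher
  order would make the product of \<open>A\<close> and \<open>G'\<close>, both nonzero at
  \<open>p\<close>, agree on \<open>C\<close> with a multiple of a positive power of
  \<open>T\<close>, which is zero at \<open>p\<close>.\<close>

lemma vanishing_eq_ge_le:
  assumes p: "p \<in> C" and U: "uniformizer p t T"
    and eq: "vanishing_eq p t T k d F" and ge: "vanishing_ge p t T j d F"
  shows "j \<le> k"
proof (rule ccontr)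
  assume "\<not> j \<le> k"
  then obtain i where i: "j = k + i" "i > 0" by (metis less_imp_add_positive not_le)
  have T: "homogeneous t T" "T (rep p) = 0" using U by (auto simp: uniformizer_def)
  obtain e G a A where G: "homogeneous e G" "homogeneous a A" "d + e = a + k * t" "G (rep p) \<noteq> 0"
    "A (rep p) \<noteq> 0" "\<forall>q\<in>C. F (rep q) * G (rep q) = A (rep q) * T (rep q) ^ k" using eq by (rule vanishing_eqE)
  obtain e' G' a' A' where G': "homogeneous e' G'" "homogeneous a' A'" "d + e' = a' + j * t" "G' (rep p) \<noteq> 0"
    "\<forall>q\<in>C. F (rep q) * G' (rep q) = A' (rep q) * T (rep q) ^ j" using ge by (rule vanishing_geE)
  define H where "H = A * G' - A' * G * T ^ i"
  have deg: "a + e' = a' + e + i * t"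
  proof -
    have "a + e' + (d + e) = a' + e + i * t + (d + e)"
      using G(3) G'(3) i(1) by (simp add: algebra_simps)
    then show ?thesis by simp
  qed
  have "homogeneous (a + e') (A' * G * T ^ i)"
    unfolding deg by (intro homogeneous_mult homogeneous_power G G' T)
  then have H: "homogeneous (a + e') H"
    unfolding H_def by (intro homogeneous_diff homogeneous_mult[OF G(2) G'(1)])
  have "(T ^ k) (rep q) * H (rep q) = 0" if q: "q \<in> C" for q
  proof -
    have "(F (rep q) * G (rep q)) * G' (rep q) = (F (rep q) * G' (rep q)) * G (rep q)" by simp
    then have "(A (rep q) * T (rep q) ^ k) * G' (rep q) = (A' (rep q) * T (rep q) ^ j) * G (rep q)"
      by (simp only: G(6)[rule_format, OF q] G'(5)[rule_format, OF q])
    then show ?thesis unfolding H_def i(1) by (simp add: power_add algebra_simps)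
  qed
  then have "vanishes (T ^ k) \<or> vanishes H" by (intro vanishes_mult[OF homogeneous_power[OF T(1)] H])
  then have "vanishes H" using uniformizer_not_vanishes[OF p U] vanishes_power[OF T(1)] by blast
  then have "H (rep p) = 0" using p by (simp add: vanishes_def)
  then show False using G G' T i by (simp add: H_def power_0_left)
qed

text \<open>If \<open>F\<close> vanished to every order \<open>k\<close>, say \<open>F G\<^sub>k = A\<^sub>k T\<^sup>k\<close>, then a relation \<open>A\<^sub>m = \<Sum>i<m. B\<^sub>i A\<^sub>i\<close>
  would give \<open>F (G\<^sub>m - \<Sum>i<m. B\<^sub>i G\<^sub>i T\<^bsup>m-i\<^esup>) = 0\<close>, whose second factor is nonzero at \<open>p\<close>.\<close>

lemma vanishing_eq_exists:
  assumes p: "p \<in> C" and U: "uniformizer p t T" and F: "homogeneous d F" "\<not> vanishes F"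
  shows "\<exists>k. vanishing_eq p t T k d F"
proof (rule ccontr)
  assume "\<not> ?thesis"
  then have neq: "\<not> vanishing_eq p t T k d F" for k by blast
  have T: "homogeneous t T" "T (rep p) = 0" using U by (auto simp: uniformizer_def)
  have "vanishing_ge p t T k d F" for k
    by (induction k) (use vanishing_ge_0[OF F(1)] vanishing_ge_cases[OF U] neq in blast)+
  then have "\<forall>k. \<exists>e G a A. homogeneous e G \<and> homogeneous a A \<and> d + e = a + k * t \<and>
    G (rep p) \<noteq> 0 \<and> (\<forall>q\<in>C. F (rep q) * G (rep q) = A (rep q) * T (rep q) ^ k)"
    unfolding vanishing_ge_def by blast
  then obtain e G a A where G: "\<And>k. homogeneous (e k) (G k)" and A: "\<And>k. homogeneous (a k) (A k)"
    and deg: "\<And>k. d + e k = a k + k * t" and Gp: "\<And>k. G k (rep p) \<noteq> 0"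
    and eq: "\<And>k q. q \<in> C \<Longrightarrow> F (rep q) * G k (rep q) = A k (rep q) * T (rep q) ^ k"
    unfolding choice_iff by blast
  obtain m B where B: "\<forall>i<m. B i \<in> poly_funs" "A m = (\<Sum>i<m. B i * A i)"
    by (rule hilbert_basis[of a A, OF A])
  define Q where "Q = G m - (\<Sum>i<m. B i * (G i * T ^ (m - i)))"
  have "Q \<in> poly_funs"
    unfolding Q_def using B(1)
    by (intro subring_setD(6)[OF subring_poly_funs] subring_set_sum[OF subring_poly_funs]
        subring_setD(5)[OF subring_poly_funs] poly_funsI[OF G] poly_funsI[OF homogeneous_power[OF T(1)]]) auto
  moreover have "F v * Q v = 0" if q: "q \<in> C" and v: "v \<in> coords q" for q v
  proof -
    have "homogeneous (d + e k) (A k * T ^ k)" for k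
      unfolding deg by (intro homogeneous_mult homogeneous_power A T)
    from equal_on_coords[OF homogeneous_mult[OF F(1) G] this _ v] eq[OF q]
    have ev: "F v * G k v = A k v * T v ^ k" for k by simp
    have "F v * Q v = F v * G m v - (\<Sum>i<m. B i v * (F v * G i v * T v ^ (m - i)))"
      unfolding Q_def by (simp add: right_diff_distrib sum_distrib_left algebra_simps)
    also have "(\<Sum>i<m. B i v * (F v * G i v * T v ^ (m - i))) = (\<Sum>i<m. B i v * A i v) * T v ^ m"
      unfolding sum_distrib_right ev
      by (rule sum.cong) (auto simp: mult.assoc power_add[symmetric])
    also have "(\<Sum>i<m. B i v * A i v) = A m v" by (simp add: B(2))
    finally show ?thesis using ev[of m] by simp
  qed
  moreover have "Q (rep p) \<noteq> 0"
  proof -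
    have "(\<Sum>i<m. B i (rep p) * (G i (rep p) * T (rep p) ^ (m - i))) = 0"
      by (rule sum.neutral) (use T(2) in auto)
    then show ?thesis using Gp[of m] by (simp add: Q_def)
  qed
  ultimately have "vanishes F" using p by (intro vanishes_mult_poly[OF F(1)])
  then show False using F by simp
qed

lemma vanishing_eq_mult:
  assumes T: "homogeneous t T" and F: "vanishing_eq p t T k d F" and G: "vanishing_eq p t T j e G"
  shows "vanishing_eq p t T (k + j) (d + e) (F * G)"
proof -
  obtain e1 G1 a1 A1 where 1: "homogeneous e1 G1" "homogeneous a1 A1" "d + e1 = a1 + k * t" "G1 (rep p) \<noteq> 0"
    "A1 (rep p) \<noteq> 0" "\<forall>q\<in>C. F (rep q) * G1 (rep q) = A1 (rep q) * T (rep q) ^ k" using F by (rule vanishing_eqE)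
  obtain e2 G2 a2 A2 where 2: "homogeneous e2 G2" "homogeneous a2 A2" "e + e2 = a2 + j * t" "G2 (rep p) \<noteq> 0"
    "A2 (rep p) \<noteq> 0" "\<forall>q\<in>C. G (rep q) * G2 (rep q) = A2 (rep q) * T (rep q) ^ j" using G by (rule vanishing_eqE)
  show ?thesis
  proof (rule vanishing_eqI[OF homogeneous_mult[OF 1(1) 2(1)] homogeneous_mult[OF 1(2) 2(2)]])
    show "d + e + (e1 + e2) = a1 + a2 + (k + j) * t" using 1(3) 2(3) by (simp add: algebra_simps)
    fix q assume q: "q \<in> C"
    have "(F * G) (rep q) * (G1 * G2) (rep q) = (F (rep q) * G1 (rep q)) * (G (rep q) * G2 (rep q))"
      by simp
    then show "(F * G) (rep q) * (G1 * G2) (rep q) = (A1 * A2) (rep q) * T (rep q) ^ (k + j)"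
      using 1(6) 2(6) q by (simp add: power_add)
  qed (use 1 2 in auto)
qed

lemma vanishing_ge_add:
  assumes F: "vanishing_ge p t T k d F" and G: "vanishing_ge p t T k d G"
  shows "vanishing_ge p t T k d (F + c *\<^sub>C G)"
proof -
  obtain e1 G1 a1 A1 where 1: "homogeneous e1 G1" "homogeneous a1 A1" "d + e1 = a1 + k * t" "G1 (rep p) \<noteq> 0"
    "\<forall>q\<in>C. F (rep q) * G1 (rep q) = A1 (rep q) * T (rep q) ^ k" using F by (rule vanishing_geE)
  obtain e2 G2 a2 A2 where 2: "homogeneous e2 G2" "homogeneous a2 A2" "d + e2 = a2 + k * t" "G2 (rep p) \<noteq> 0"
    "\<forall>q\<in>C. G (rep q) * G2 (rep q) = A2 (rep q) * T (rep q) ^ k" using G by (rule vanishing_geE)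
  have A21: "homogeneous (a1 + e2) (A2 * G1)"
    by (rule homogeneous_cong_degree[OF homogeneous_mult[OF 2(2) 1(1)]]) (use 1(3) 2(3) in linarith)
  then have A: "homogeneous (a1 + e2) (A1 * G2 + c *\<^sub>C (A2 * G1))"
    by (intro homogeneous_add homogeneous_scale A21 homogeneous_mult[OF 1(2) 2(1)])
  show ?thesis
  proof (rule vanishing_geI[OF homogeneous_mult[OF 1(1) 2(1)] A])
    show "d + (e1 + e2) = a1 + e2 + k * t" using 1(3) by simp
    fix q assume q: "q \<in> C"
    have "(F + c *\<^sub>C G) (rep q) * (G1 * G2) (rep q) =
        (F (rep q) * G1 (rep q)) * G2 (rep q) + c * ((G (rep q) * G2 (rep q)) * G1 (rep q))"
      by (simp add: algebra_simps)
    also have "\<dots> = (A1 * G2 + c *\<^sub>C (A2 * G1)) (rep q) * T (rep q) ^ k"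
      using 1(5) 2(5) q by (simp add: algebra_simps)
    finally show "(F + c *\<^sub>C G) (rep q) * (G1 * G2) (rep q) = (A1 * G2 + c *\<^sub>C (A2 * G1)) (rep q) * T (rep q) ^ k" .
  qed (use 1 2 in auto)
qed

text \<open>The residue field is the field of complex numbers: the leading coefficients of
  \<open>F\<close> and \<open>G\<close> at \<open>p\<close> are numbers, and \<open>c\<close> is
  chosen so that they cancel.\<close>

lemma vanishing_ge_codim:
  assumes U: "uniformizer p t T" and F: "vanishing_ge p t T k d F" and G: "vanishing_eq p t T k d G"
  shows "\<exists>c. vanishing_ge p t T (Suc k) d (F + c *\<^sub>C G)"
proof -
  obtain e1 G1 a1 A1 where 1: "homogeneous e1 G1" "homogeneous a1 A1" "d + e1 = a1 + k * t" "G1 (rep p) \<noteq> 0"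
    "\<forall>q\<in>C. F (rep q) * G1 (rep q) = A1 (rep q) * T (rep q) ^ k" using F by (rule vanishing_geE)
  obtain e2 G2 a2 A2 where 2: "homogeneous e2 G2" "homogeneous a2 A2" "d + e2 = a2 + k * t" "G2 (rep p) \<noteq> 0"
    "A2 (rep p) \<noteq> 0" "\<forall>q\<in>C. G (rep q) * G2 (rep q) = A2 (rep q) * T (rep q) ^ k" using G by (rule vanishing_eqE)
  define c where "c = - (A1 (rep p) * G2 (rep p)) / (A2 (rep p) * G1 (rep p))"
  have A21: "homogeneous (a1 + e2) (A2 * G1)"
    by (rule homogeneous_cong_degree[OF homogeneous_mult[OF 2(2) 1(1)]]) (use 1(3) 2(3) in linarith)
  then have A: "homogeneous (a1 + e2) (A1 * G2 + c *\<^sub>C (A2 * G1))"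
    by (intro homogeneous_add homogeneous_scale A21 homogeneous_mult[OF 1(2) 2(1)])
  have Ap: "(A1 * G2 + c *\<^sub>C (A2 * G1)) (rep p) = 0"
    using 1 2 by (simp add: c_def)
  obtain e G3 a A3 where 3: "homogeneous e G3" "homogeneous a A3" "a1 + e2 + e = a + t" "G3 (rep p) \<noteq> 0"
    "\<forall>q\<in>C. (A1 * G2 + c *\<^sub>C (A2 * G1)) (rep q) * G3 (rep q) = A3 (rep q) * T (rep q)"
    by (rule uniformizerE[OF U A Ap])
  have "vanishing_ge p t T (Suc k) d (F + c *\<^sub>C G)"
  proof (rule vanishing_geI[OF homogeneous_mult[OF homogeneous_mult[OF 1(1) 2(1)] 3(1)] 3(2)])
    show "d + (e1 + e2 + e) = a + Suc k * t" using 1(3) 3(3) by simp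
    fix q assume q: "q \<in> C"
    have "(F + c *\<^sub>C G) (rep q) * (G1 * G2 * G3) (rep q) =
        ((F (rep q) * G1 (rep q)) * G2 (rep q) + c * ((G (rep q) * G2 (rep q)) * G1 (rep q))) * G3 (rep q)"
      by (simp add: algebra_simps)
    also have "\<dots> = ((A1 * G2 + c *\<^sub>C (A2 * G1)) (rep q) * G3 (rep q)) * T (rep q) ^ k"
      using 1(5) 2(6) q by (simp add: algebra_simps)
    also have "\<dots> = A3 (rep q) * T (rep q) ^ Suc k" using 3(5) q by simp
    finally show "(F + c *\<^sub>C G) (rep q) * (G1 * G2 * G3) (rep q) = A3 (rep q) * T (rep q) ^ Suc k" .
  qed (use 1 2 3 in auto)
  then show ?thesis ..
qed

text \<open>Quantifying over every uniformizer keeps it out of the notation;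
  \<open>vanishing_eq_change\<close> shows that the choice does not matter.\<close>

definition order_at :: "'n proj \<Rightarrow> (('n \<Rightarrow> complex) \<Rightarrow> complex) \<Rightarrow> nat"
  where "order_at p F = (THE k. \<forall>d t T. homogeneous d F \<and> uniformizer p t T \<longrightarrow> vanishing_eq p t T k d F)"

lemma vanishing_eq_not_vanishes:
  assumes p: "p \<in> C" and U: "uniformizer p t T" and "vanishing_eq p t T k d F"
  shows "\<not> vanishes F"
proof
  assume F: "vanishes F"
  have T: "homogeneous t T" using U by (auto simp: uniformizer_def)
  obtain e G a A where G: "homogeneous e G" "homogeneous a A" "d + e = a + k * t" "G (rep p) \<noteq> 0"
    "A (rep p) \<noteq> 0" "\<forall>q\<in>C. F (rep q) * G (rep q) = A (rep q) * T (rep q) ^ k" using assms(3) by (rule vanishing_eqE)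
  have "vanishes A \<or> vanishes (T ^ k)"
    by (rule vanishes_mult[OF G(2) homogeneous_power[OF T]]) (use F G(6) in \<open>auto simp: vanishes_def\<close>)
  then show False
    using G(5) p vanishes_power[OF T] uniformizer_not_vanishes[OF p U] by (auto simp: vanishes_def)
qed

text \<open>Each parameter is a multiple of the other. The two factors have product 1 on
  \<open>C\<close>, so both are units at \<open>p\<close>.\<close>

lemma uniformizer_change:
  assumes p: "p \<in> C" and U: "uniformizer p t T" and U': "uniformizer p t' T'"
  shows "vanishing_eq p t' T' 1 t T"
proof -
  have T: "homogeneous t T" "T (rep p) = 0" and T': "homogeneous t' T'" "T' (rep p) = 0"
    using U U' by (auto simp: uniformizer_def)
  obtain e G a A where G: "homogeneous e G" "homogeneous a A" "t + e = a + t'" "G (rep p) \<noteq> 0"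
    "\<forall>q\<in>C. T (rep q) * G (rep q) = A (rep q) * T' (rep q)" by (rule uniformizerE[OF U' T])
  obtain e' G' a' A' where G': "homogeneous e' G'" "homogeneous a' A'" "t' + e' = a' + t" "G' (rep p) \<noteq> 0"
    "\<forall>q\<in>C. T' (rep q) * G' (rep q) = A' (rep q) * T (rep q)" by (rule uniformizerE[OF U T'])
  have "homogeneous (e' + e) (A' * A)"
    by (rule homogeneous_cong_degree[OF homogeneous_mult[OF G'(2) G(2)]]) (use G(3) G'(3) in linarith)
  then have H: "homogeneous (e' + e) (G' * G - A' * A)"
    by (intro homogeneous_diff homogeneous_mult[OF G'(1) G(1)])
  have "T' (rep q) * (G' * G - A' * A) (rep q) = 0" if q: "q \<in> C" for q
  proof -
    have "T' (rep q) * G' (rep q) * G (rep q) = A' (rep q) * (T (rep q) * G (rep q))"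
      using G'(5) q by simp
    also have "\<dots> = A' (rep q) * A (rep q) * T' (rep q)" using G(5) q by simp
    finally show ?thesis by (simp add: algebra_simps)
  qed
  then have "vanishes (G' * G - A' * A)"
    using vanishes_mult[OF T'(1) H] uniformizer_not_vanishes[OF p U'] by blast
  then have "G' (rep p) * G (rep p) = A' (rep p) * A (rep p)" using p by (simp add: vanishes_def)
  then have "A (rep p) \<noteq> 0" using G(4) G'(4) by auto
  then show ?thesis
    by (intro vanishing_eqI[OF G(1,2) _ G(4)]) (use G in auto)
qed

lemma vanishing_eq_power:
  assumes T: "homogeneous t T" and "vanishing_eq p t T k d F"
  shows "vanishing_eq p t T (j * k) (j * d) (F ^ j)"
proof (induction j)
  case 0
  have "vanishing_eq p t T 0 0 1" by (rule vanishing_eq_0[OF homogeneous_one]) simp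
  then show ?case by (simp only: mult_0 power_0)
next
  case (Suc j)
  then show ?case using vanishing_eq_mult[OF T assms(2) Suc.IH] by (simp only: mult_Suc power_Suc)
qed

lemma vanishing_eq_change:
  assumes p: "p \<in> C" and U: "uniformizer p t T" and U': "uniformizer p t' T'"
    and F: "vanishing_eq p t T k d F"
  shows "vanishing_eq p t' T' k d F"
proof -
  have T: "homogeneous t T" and T': "homogeneous t' T'" using U U' by (auto simp: uniformizer_def)
  obtain e G a A where G: "homogeneous e G" "homogeneous a A" "d + e = a + k * t" "G (rep p) \<noteq> 0"
    "A (rep p) \<noteq> 0" "\<forall>q\<in>C. F (rep q) * G (rep q) = A (rep q) * T (rep q) ^ k" using F by (rule vanishing_eqE)
  obtain e' G' a' A' where G': "homogeneous e' G'" "homogeneous a' A'" "k * t + e' = a' + (k * 1) * t'" "G' (rep p) \<noteq> 0"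
    "A' (rep p) \<noteq> 0" "\<forall>q\<in>C. (T ^ k) (rep q) * G' (rep q) = A' (rep q) * T' (rep q) ^ (k * 1)"
    using vanishing_eq_power[OF T' uniformizer_change[OF p U U'], of k] by (rule vanishing_eqE)
  show ?thesis
  proof (rule vanishing_eqI[OF homogeneous_mult[OF G(1) G'(1)] homogeneous_mult[OF G(2) G'(2)]])
    show "d + (e + e') = a + a' + k * t'" using G(3) G'(3) by simp
    fix q assume q: "q \<in> C"
    have "F (rep q) * (G * G') (rep q) = (F (rep q) * G (rep q)) * G' (rep q)" by simp
    also have "\<dots> = A (rep q) * ((T ^ k) (rep q) * G' (rep q))" using G(6) q by simp
    also have "\<dots> = (A * A') (rep q) * T' (rep q) ^ k" using G'(6) q by simp
    finally show "F (rep q) * (G * G') (rep q) = (A * A') (rep q) * T' (rep q) ^ k" .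
  qed (use G G' in auto)
qed

lemma order_at_eqI:
  assumes p: "p \<in> C" and U: "uniformizer p t T" and F: "homogeneous d F" "vanishing_eq p t T k d F"
  shows "order_at p F = k"
  unfolding order_at_def
proof (rule the_equality)
  have nz: "\<not> vanishes F" using vanishing_eq_not_vanishes[OF p U F(2)] .
  then obtain q where "F (rep q) \<noteq> 0" by (auto simp: vanishes_def)
  then have d: "d' = d" if "homogeneous d' F" for d' using homogeneous_degree_unique that F(1) by blast
  show "\<forall>d t T. homogeneous d F \<and> uniformizer p t T \<longrightarrow> vanishing_eq p t T k d F"
    using d vanishing_eq_change[OF p U _ F(2)] by blast
  fix j assume "\<forall>d t T. homogeneous d F \<and> uniformizer p t T \<longrightarrow> vanishing_eq p t T j d F"
  then have "vanishing_eq p t T j d F" using F U by blast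
  then show "j = k"
    using vanishing_eq_ge_le[OF p U] vanishing_eq_imp_ge F(2) by (metis order_antisym)
qed

lemma order_atD:
  assumes p: "p \<in> C" and U: "uniformizer p t T" and F: "homogeneous d F" "\<not> vanishes F"
  shows "vanishing_eq p t T (order_at p F) d F"
  using vanishing_eq_exists[OF p U F] order_at_eqI[OF p U F(1)] by auto

lemma order_at_ge_iff:
  assumes p: "p \<in> C" and U: "uniformizer p t T" and F: "homogeneous d F" "\<not> vanishes F"
  shows "vanishing_ge p t T k d F \<longleftrightarrow> k \<le> order_at p F"
  using vanishing_eq_ge_le[OF p U order_atD[OF p U F]] vanishing_ge_mono[OF _ vanishing_eq_imp_ge[OF order_atD[OF p U F]]]
    U by (auto simp: uniformizer_def)

lemma order_at_mult:
  assumes p: "p \<in> C" and F: "homogeneous d F" "\<not> vanishes F" and G: "homogeneous e G" "\<not> vanishes G"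
  shows "order_at p (F * G) = order_at p F + order_at p G"
proof -
  obtain t T where U: "uniformizer p t T" using uniformizer_exists[OF p] by blast
  then have T: "homogeneous t T" by (auto simp: uniformizer_def)
  show ?thesis
    by (rule order_at_eqI[OF p U homogeneous_mult[OF F(1) G(1)] vanishing_eq_mult[OF T order_atD[OF p U F] order_atD[OF p U G]]])
qed

lemma order_at_power:
  assumes p: "p \<in> C" and F: "homogeneous d F" "\<not> vanishes F"
  shows "order_at p (F ^ k) = k * order_at p F"
proof -
  obtain t T where U: "uniformizer p t T" using uniformizer_exists[OF p] by blast
  then have T: "homogeneous t T" by (auto simp: uniformizer_def)
  show ?thesis
    by (rule order_at_eqI[OF p U homogeneous_power[OF F(1)] vanishing_eq_power[OF T order_atD[OF p U F]]])
qed

lemma order_at_eq_0_iff: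
  assumes p: "p \<in> C" and F: "homogeneous d F" "\<not> vanishes F"
  shows "order_at p F = 0 \<longleftrightarrow> F (rep p) \<noteq> 0"
proof -
  obtain t T where U: "uniformizer p t T" using uniformizer_exists[OF p] by blast
  show ?thesis
  proof
    assume "F (rep p) \<noteq> 0"
    then show "order_at p F = 0" using order_at_eqI[OF p U F(1) vanishing_eq_0[OF F(1)]] by blast
  next
    assume 0: "order_at p F = 0"
    obtain e G a A where "homogeneous e G" "homogeneous a A" "d + e = a + 0 * t" "G (rep p) \<noteq> 0"
      "A (rep p) \<noteq> 0" "\<forall>q\<in>C. F (rep q) * G (rep q) = A (rep q) * T (rep q) ^ 0"
      using order_atD[OF p U F] unfolding 0 by (rule vanishing_eqE)
    then show "F (rep p) \<noteq> 0" using p by auto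
  qed
qed

lemma order_at_uniformizer:
  "p \<in> C \<Longrightarrow> uniformizer p t T \<Longrightarrow> order_at p T = 1"
  using order_at_eqI[OF _ _ _ uniformizer_change] by (auto simp: uniformizer_def)

lemma vanishing_eq_cong:
  "(\<And>q. q \<in> C \<Longrightarrow> F (rep q) = F' (rep q)) \<Longrightarrow> vanishing_eq p t T k d F \<longleftrightarrow> vanishing_eq p t T k d F'"
  unfolding vanishing_eq_def by simp

lemma order_at_cong:
  assumes p: "p \<in> C" and F: "homogeneous d F" "\<not> vanishes F" "homogeneous d F'"
    and eq: "\<And>q. q \<in> C \<Longrightarrow> F (rep q) = F' (rep q)"
  shows "order_at p F = order_at p F'"
proof -
  obtain t T where U: "uniformizer p t T" using uniformizer_exists[OF p] by blast
  show ?thesis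
    using order_at_eqI[OF p U F(3), of "order_at p F"] order_atD[OF p U F(1,2)] vanishing_eq_cong[of F F' p t T "order_at p F" d] eq
    by simp
qed

text \<open>The hypothesis is the equality of \<open>F / G\<close> and \<open>F' / G'\<close>
  written without division; the conclusion makes the order of a rational function independent of its
  representation.\<close>

lemma order_at_cross:
  assumes p: "p \<in> C" and F: "homogeneous d F" "\<not> vanishes F" and G: "homogeneous d G" "\<not> vanishes G"
    and F': "homogeneous e F'" "\<not> vanishes F'" and G': "homogeneous e G'" "\<not> vanishes G'"
    and eq: "\<And>q. q \<in> C \<Longrightarrow> F (rep q) * G' (rep q) = F' (rep q) * G (rep q)"
  shows "order_at p F + order_at p G' = order_at p F' + order_at p G"
proof -
  have "order_at p (F * G') = order_at p (F' * G)"
  proof (rule order_at_cong[OF p homogeneous_mult[OF F(1) G'(1)]])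
    show "\<not> vanishes (F * G')" using vanishes_mult_iff[OF F(1) G'(1)] F G' by blast
    show "homogeneous (d + e) (F' * G)" using homogeneous_mult[OF F'(1) G(1)] by (simp only: add.commute)
  qed (use eq in auto)
  then show ?thesis
    by (simp add: order_at_mult[OF p F G'] order_at_mult[OF p F' G])
qed

lemma order_at_eq_0_outside:
  assumes "homogeneous d F" "\<not> vanishes F" shows "finite {p \<in> C. order_at p F \<noteq> 0}"
proof -
  have "{p \<in> C. order_at p F \<noteq> 0} = {q \<in> C. F (rep q) = 0}"
  proof (intro Collect_cong conj_cong refl)
    fix p assume "p \<in> C"
    from order_at_eq_0_iff[OF this assms] show "(order_at p F \<noteq> 0) = (F (rep p) = 0)" by argo
  qed
  then show ?thesis using finite_zeros[OF assms] by simp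
qed

section \<open>The degree of the divisor of a form\<close>

definition form_degree :: "(('n \<Rightarrow> complex) \<Rightarrow> complex) \<Rightarrow> nat"
  where "form_degree F = (\<Sum>p | p \<in> C \<and> order_at p F \<noteq> 0. order_at p F)"

lemma form_degree_eq:
  assumes "finite P" "{p \<in> C. order_at p F \<noteq> 0} \<subseteq> P" "P \<subseteq> C"
  shows "form_degree F = (\<Sum>p\<in>P. order_at p F)"
  unfolding form_degree_def by (rule sum.mono_neutral_left) (use assms in auto)

lemma form_degree_mult:
  assumes F: "homogeneous d F" "\<not> vanishes F" and G: "homogeneous e G" "\<not> vanishes G"
  shows "form_degree (F * G) = form_degree F + form_degree G"
proof -
  let ?P = "{p \<in> C. order_at p F \<noteq> 0} \<union> {p \<in> C. order_at p G \<noteq> 0}"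
  have fin: "finite ?P" using order_at_eq_0_outside F G by blast
  have "form_degree (F * G) = (\<Sum>p\<in>?P. order_at p (F * G))"
    by (rule form_degree_eq[OF fin]) (auto simp: order_at_mult[OF _ F G])
  also have "\<dots> = (\<Sum>p\<in>?P. order_at p F + order_at p G)"
    by (rule sum.cong) (auto simp: order_at_mult[OF _ F G])
  also have "\<dots> = (\<Sum>p\<in>?P. order_at p F) + (\<Sum>p\<in>?P. order_at p G)" by (rule sum.distrib)
  also have "\<dots> = form_degree F + form_degree G"
    using form_degree_eq[OF fin, of F] form_degree_eq[OF fin, of G] by auto
  finally show ?thesis .
qed

lemma form_degree_power:
  assumes F: "homogeneous d F" "\<not> vanishes F" shows "form_degree (F ^ k) = k * form_degree F"
proof -
  let ?P = "{p \<in> C. order_at p F \<noteq> 0}"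
  have fin: "finite ?P" using order_at_eq_0_outside F by blast
  have "form_degree (F ^ k) = (\<Sum>p\<in>?P. order_at p (F ^ k))"
    by (rule form_degree_eq[OF fin]) (auto simp: order_at_power[OF _ F])
  also have "\<dots> = (\<Sum>p\<in>?P. k * order_at p F)"
    by (rule sum.cong) (auto simp: order_at_power[OF _ F])
  finally show ?thesis using form_degree_eq[OF fin, of F] by (auto simp: sum_distrib_left)
qed

text \<open>Vanishing to order at least \<open>k\<close>; a form vanishing on \<open>C\<close> has infinite order, while
  \<open>order_at\<close> is then meaningless.\<close>

definition order_ge :: "'n proj \<Rightarrow> nat \<Rightarrow> (('n \<Rightarrow> complex) \<Rightarrow> complex) \<Rightarrow> bool"
  where "order_ge p k F \<longleftrightarrow> vanishes F \<or> k \<le> order_at p F"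

lemma order_ge_iff:
  assumes p: "p \<in> C" and U: "uniformizer p t T" and F: "homogeneous d F"
  shows "order_ge p k F \<longleftrightarrow> vanishing_ge p t T k d F"
proof (cases "vanishes F")
  case True
  obtain h where h: "homogeneous 1 h" "h (rep p) \<noteq> 0" by (rule form_nonzero_at)
  \<comment> \<open>The witness is the numerator 0; the power of \<open>h\<close> is a denominator
    that is nonzero at \<open>p\<close> and has the degree required by the balance.\<close>
  have "vanishing_ge p t T k d F"
  proof (rule vanishing_geI)
    show "homogeneous (k * t) (h ^ (k * t))" using homogeneous_power[OF h(1), of "k * t"] by simp
    show "homogeneous d 0" by (rule homogeneous_zero)
  qed (use h True in \<open>auto simp: vanishes_def\<close>)
  then show ?thesis using True by (simp add: order_ge_def)
next
  case False
  then show ?thesis using order_at_ge_iff[OF p U F False] by (simp add: order_ge_def)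
qed

lemma order_ge_add:
  assumes p: "p \<in> C" and F: "homogeneous d F" "order_ge p k F" and G: "homogeneous d G" "order_ge p k G"
  shows "order_ge p k (F + c *\<^sub>C G)"
proof -
  obtain t T where U: "uniformizer p t T" using uniformizer_exists[OF p] by blast
  show ?thesis
    using vanishing_ge_add F(2) G(2)
    unfolding order_ge_iff[OF p U F(1)] order_ge_iff[OF p U G(1)]
      order_ge_iff[OF p U homogeneous_add[OF F(1) homogeneous_scale[OF G(1)]]] by blast
qed

lemma order_ge_codim:
  assumes p: "p \<in> C" and F: "homogeneous d F" "order_ge p k F"
    and G: "homogeneous d G" "\<not> vanishes G" "order_at p G = k"
  shows "\<exists>c. order_ge p (Suc k) (F + c *\<^sub>C G)"
proof -
  obtain t T where U: "uniformizer p t T" using uniformizer_exists[OF p] by blast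
  show ?thesis
    using vanishing_ge_codim[OF U _ order_atD[OF p U G(1,2), unfolded G(3)]] F(2)
    unfolding order_ge_iff[OF p U F(1)]
      order_ge_iff[OF p U homogeneous_add[OF F(1) homogeneous_scale[OF G(1)]]] by blast
qed

lemma order_ge_scale:
  assumes p: "p \<in> C" and F: "homogeneous d F" "order_ge p k F"
  shows "order_ge p k (c *\<^sub>C F)"
proof -
  have "order_ge p k 0" by (simp add: order_ge_def vanishes_def)
  from order_ge_add[OF p homogeneous_zero this F] show ?thesis by (simp only: add_0_left)
qed

lemma order_ge_mult:
  assumes p: "p \<in> C" and F: "homogeneous d F" "order_ge p k F" and G: "homogeneous e G"
  shows "order_ge p k (F * G)"
proof (cases "vanishes F \<or> vanishes G")
  case True
  then show ?thesis using vanishes_mult_iff[OF F(1) G] by (simp add: order_ge_def)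
next
  case False
  then show ?thesis using order_at_mult[OF p F(1) _ G] F(2) by (auto simp: order_ge_def)
qed

lemma order_ge_mult_unit:
  assumes p: "p \<in> C" and F: "homogeneous d F" and G: "homogeneous e G" "G (rep p) \<noteq> 0"
  shows "order_ge p k (F * G) \<longleftrightarrow> order_ge p k F"
proof -
  have nG: "\<not> vanishes G" using p G(2) by (auto simp: vanishes_def)
  have G0: "order_at p G = 0" using order_at_eq_0_iff[OF p G(1) nG] G(2) by simp
  show ?thesis
  proof (cases "vanishes F")
    case True
    then show ?thesis using vanishes_mult_iff[OF F G(1)] by (simp add: order_ge_def)
  next
    case False
    then show ?thesis
      using vanishes_mult_iff[OF F G(1)] nG order_at_mult[OF p F False G(1) nG] G0 by (simp add: order_ge_def)
  qed
qed

lemma order_ge_mono: "order_ge p k F \<Longrightarrow> j \<le> k \<Longrightarrow> order_ge p j F"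
  by (auto simp: order_ge_def)

lemma order_ge_cong:
  assumes p: "p \<in> C" and F: "homogeneous d F" "homogeneous d F'"
    and eq: "\<And>q. q \<in> C \<Longrightarrow> F (rep q) = F' (rep q)" and "order_ge p k F"
  shows "order_ge p k F'"
proof -
  have "vanishes F \<longleftrightarrow> vanishes F'" using eq by (simp add: vanishes_def)
  then show ?thesis
    using order_at_cong[OF p F(1) _ F(2) eq] assms(5) by (cases "vanishes F") (auto simp: order_ge_def)
qed

end

section \<open>The projective Nullstellensatz\<close>

text \<open>An indexed family may repeat a vector, while \<open>independent\<close> concerns sets; a
  repetition gives the relation with coefficients 1 and -1 directly.\<close>

lemma linear_relation:
  fixes H :: "'i \<Rightarrow> 'v::complex_vector"
  assumes "finite I" "finite E" "\<And>i. i \<in> I \<Longrightarrow> H i \<in> complex_vector.span E" "card E < card I"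
  shows "\<exists>c. (\<exists>i\<in>I. c i \<noteq> 0) \<and> (\<Sum>i\<in>I. c i *\<^sub>C H i) = 0"
proof (cases "inj_on H I")
  case True
  have "\<not> complex_vector.independent (H ` I)"
    using complex_vector.independent_span_bound[OF assms(2), of "H ` I"] assms(3,4) card_image[OF True]
    by auto
  then obtain u where u: "\<exists>v\<in>H ` I. u v \<noteq> 0" "(\<Sum>v\<in>H ` I. u v *\<^sub>C v) = 0"
    using complex_vector.dependent_finite[of "H ` I"] assms(1) by auto
  have "(\<Sum>i\<in>I. u (H i) *\<^sub>C H i) = 0"
    using u(2) by (simp add: sum.reindex[OF True] o_def)
  then show ?thesis using u(1) by (intro exI[of _ "\<lambda>i. u (H i)"]) auto
next
  case False
  then obtain i j where ij: "i \<in> I" "j \<in> I" "i \<noteq> j" "H i = H j" by (auto simp: inj_on_def)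
  define c where "c = (\<lambda>k. if k = i then 1 else if k = j then - 1 else (0 :: complex))"
  have "(\<Sum>k\<in>I. c k *\<^sub>C H k) = (\<Sum>k\<in>{i, j}. c k *\<^sub>C H k)"
    by (rule sum.mono_neutral_right) (use assms ij in \<open>auto simp: c_def\<close>)
  also have "\<dots> = 0" using ij by (simp add: c_def scaleC_one)
  finally show ?thesis using ij by (intro exI[of _ c]) (auto simp: c_def)
qed

text \<open>Only the homogeneous elements of an ideal are recorded, so sums are formed within one
  degree. The zero function counts as a form of every degree.\<close>

definition graded_ideal :: "(('n::finite \<Rightarrow> complex) \<Rightarrow> complex) set \<Rightarrow> bool"
  where "graded_ideal I \<longleftrightarrow> 0 \<in> I \<and> (\<forall>F\<in>I. \<exists>d. homogeneous d F) \<and>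
    (\<forall>d. \<forall>F\<in>I. \<forall>G\<in>I. homogeneous d F \<longrightarrow> homogeneous d G \<longrightarrow> F + G \<in> I) \<and>
    (\<forall>F\<in>I. \<forall>e G. homogeneous e G \<longrightarrow> G * F \<in> I)"

lemma graded_idealD:
  assumes "graded_ideal I"
  shows "0 \<in> I" "F \<in> I \<Longrightarrow> \<exists>d. homogeneous d F"
    "homogeneous d F \<Longrightarrow> homogeneous d G \<Longrightarrow> F \<in> I \<Longrightarrow> G \<in> I \<Longrightarrow> F + G \<in> I"
    "F \<in> I \<Longrightarrow> homogeneous e G \<Longrightarrow> G * F \<in> I"
  using assms unfolding graded_ideal_def by blast+

lemma graded_ideal_scale:
  assumes "graded_ideal I" "F \<in> I" shows "c *\<^sub>C F \<in> I"
proof -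
  have "c *\<^sub>C F = (\<lambda>_. c) * F" by (simp add: fun_eq_iff)
  then show ?thesis using graded_idealD(4)[OF assms homogeneous_const] by simp
qed

lemma graded_ideal_diff:
  assumes "graded_ideal I" "homogeneous d F" "homogeneous d G" "F \<in> I" "G \<in> I"
  shows "F - G \<in> I"
proof -
  have "F - G = F + (- 1) *\<^sub>C G" by (simp add: fun_eq_iff)
  then show ?thesis
    using graded_idealD(3)[OF assms(1,2) homogeneous_scale[OF assms(3)] assms(4) graded_ideal_scale[OF assms(1,5)]]
    by (simp only:)
qed

lemma graded_ideal_sum:
  assumes "graded_ideal I" "\<And>j. j \<in> J \<Longrightarrow> homogeneous d (F j)" "\<And>j. j \<in> J \<Longrightarrow> F j \<in> I"
  shows "(\<Sum>j\<in>J. F j) \<in> I"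
proof -
  have "(\<Sum>j\<in>J. F j) \<in> I \<and> homogeneous d (\<Sum>j\<in>J. F j)"
    using assms(2,3)
  proof (induction J rule: infinite_finite_induct)
    case (insert k J)
    then have "(\<Sum>j\<in>J. F j) \<in> I \<and> homogeneous d (\<Sum>j\<in>J. F j)" "homogeneous d (F k)" "F k \<in> I"
      by blast+
    then show ?case
      using graded_idealD(3)[OF assms(1), of d "F k" "\<Sum>j\<in>J. F j"] homogeneous_add[of d "F k" "\<Sum>j\<in>J. F j"]
      unfolding sum.insert[OF insert.hyps(1,2)] by blast
  qed (simp_all only: sum.infinite sum.empty graded_idealD[OF assms(1)] homogeneous_zero simp_thms)
  then show ?thesis ..
qed

text \<open>For an ideal this says that it contains a power of the irrelevant ideal, the case in
  which there is no common zero in projective space.\<close>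

definition contains_degree :: "(('n::finite \<Rightarrow> complex) \<Rightarrow> complex) set \<Rightarrow> nat \<Rightarrow> bool"
  where "contains_degree I N \<longleftrightarrow> (\<forall>F. homogeneous N F \<longrightarrow> F \<in> I)"

lemma contains_degree_monos:
  fixes I :: "(('n::finite \<Rightarrow> complex) \<Rightarrow> complex) set"
  assumes I: "graded_ideal I" and "\<And>m. (\<Sum>i\<in>UNIV. m i) = N \<Longrightarrow> mono_fun m \<in> I"
  shows "contains_degree I N"
  unfolding contains_degree_def
proof (intro allI impI)
  fix F :: "('n \<Rightarrow> complex) \<Rightarrow> complex"
  assume "homogeneous N F"
  then have "F \<in> I \<and> homogeneous N F"
  proof (induction rule: homogeneous_induct)
    case (mono m)
    then show ?case using assms(2) homogeneous_mono_fun by blast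
  qed (use graded_idealD(1,3)[OF I] graded_ideal_scale[OF I] homogeneous_zero homogeneous_add homogeneous_scale in blast)+
  then show "F \<in> I" ..
qed

lemma contains_degree_Suc:
  fixes I :: "(('n::finite \<Rightarrow> complex) \<Rightarrow> complex) set"
  assumes I: "graded_ideal I" and N: "contains_degree I N"
  shows "contains_degree I (Suc N)"
  unfolding contains_degree_def
proof (intro allI impI)
  fix F :: "('n \<Rightarrow> complex) \<Rightarrow> complex"
  assume "homogeneous (Suc N) F"
  then obtain G where G: "\<forall>i. homogeneous N (G i)" "F = (\<Sum>i\<in>UNIV. (\<lambda>x. x i) * G i)"
    by (rule homogeneous_SucE)
  show "F \<in> I"
    unfolding G(2)
  proof (rule graded_ideal_sum[OF I])
    fix i
    show "homogeneous (1 + N) ((\<lambda>x. x i) * G i)"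
      by (intro homogeneous_mult homogeneous_coord G(1)[rule_format])
    show "(\<lambda>x. x i) * G i \<in> I"
      using graded_idealD(4)[OF I _ homogeneous_coord] N G(1) unfolding contains_degree_def by blast
  qed
qed

lemma contains_degree_mono:
  "graded_ideal I \<Longrightarrow> contains_degree I N \<Longrightarrow> N \<le> M \<Longrightarrow> contains_degree I M"
  by (induction M) (auto simp: le_Suc_eq intro: contains_degree_Suc)

definition prime_graded_ideal :: "(('n::finite \<Rightarrow> complex) \<Rightarrow> complex) set \<Rightarrow> bool"
  where "prime_graded_ideal I \<longleftrightarrow> graded_ideal I \<and>
    (\<forall>d e F G. homogeneous d F \<longrightarrow> homogeneous e G \<longrightarrow> F * G \<in> I \<longrightarrow> F \<in> I \<or> G \<in> I)"

text \<open>Over the complex numbers a binary form in \<open>x\<close> and \<open>y\<close> is a product of linear forms, one of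
  which lies in the prime ideal.\<close>

lemma prime_linear_factor:
  assumes P: "prime_graded_ideal I" and x: "homogeneous d x" "x \<notin> I" and y: "homogeneous d y"
    and g: "homogeneous e g" "g \<notin> I"
  shows "\<exists>j\<le>K. c j \<noteq> 0 \<Longrightarrow> (\<Sum>j\<le>K. c j *\<^sub>C (y ^ j * x ^ (K - j))) * g \<in> I \<Longrightarrow> \<exists>l. y - l *\<^sub>C x \<in> I"
proof (induction K arbitrary: c)
  case 0
  have "(\<Sum>j\<le>0. c j *\<^sub>C (y ^ j * x ^ (0 - j))) * g = c 0 *\<^sub>C g" by (simp add: fun_eq_iff)
  then have "c 0 *\<^sub>C g \<in> I" using 0 by (simp only:)
  then have "(1 / c 0) *\<^sub>C (c 0 *\<^sub>C g) \<in> I"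
    using graded_ideal_scale P unfolding prime_graded_ideal_def by blast
  moreover have "c 0 \<noteq> 0" using 0 by simp
  ultimately have "g \<in> I" by (simp add: scaleC_scaleC scaleC_one)
  then show ?case using g by simp
next
  case (Suc K)
  define S where "S = (\<lambda>b. \<Sum>j\<le>K. b j *\<^sub>C (y ^ j * x ^ (K - j)))"
  have S_hom: "homogeneous (K * d) (S b)" for b
    unfolding S_def
  proof (intro homogeneous_sum homogeneous_scale)
    fix j assume "j \<in> {..K}"
    then have "j * d + (K - j) * d = K * d" by (simp add: distrib_right[symmetric])
    then show "homogeneous (K * d) (y ^ j * x ^ (K - j))"
      using homogeneous_mult[OF homogeneous_power[OF y] homogeneous_power[OF x(1)], of j "K - j"] by (simp only:)
  qed
  have prime: "F \<in> I \<or> G \<in> I" if "homogeneous a F" "homogeneous b G" "F * G \<in> I" for a b F G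
    using P that unfolding prime_graded_ideal_def by blast
  show ?case
  proof (cases "c (Suc K) = 0")
    case True
    \<comment> \<open>Without the top term every summand contains the factor \<open>x\<close>, which
      cancels because \<open>x\<close> is not in the prime ideal.\<close>
    have "(\<Sum>j\<le>Suc K. c j *\<^sub>C (y ^ j * x ^ (Suc K - j))) * g = x * (S c * g)"
      unfolding S_def using True
      by (simp add: fun_eq_iff sum_distrib_left sum_distrib_right Suc_diff_le algebra_simps)
    then have "x * (S c * g) \<in> I" using Suc.prems(2) by (simp only:)
    then have "S c * g \<in> I" using prime[OF x(1) homogeneous_mult[OF S_hom g(1)]] x(2) by blast
    moreover have "\<exists>j\<le>K. c j \<noteq> 0" using Suc.prems(1) True by (auto simp: le_Suc_eq)
    ultimately show ?thesis using Suc.IH[of c] unfolding S_def by blast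
  next
    case False
    \<comment> \<open>Setting \<open>x = 1\<close> makes the binary form a polynomial in one
      variable; a root \<open>l\<close> gives the factor \<open>y - l x\<close>, and the quotient
      \<open>q\<close> supplies the coefficients for the induction.\<close>
    define p where "p = (\<Sum>j\<le>Suc K. monom (c j) j)"
    have cp: "coeff p j = (if j \<le> Suc K then c j else 0)" for j
      unfolding p_def by (simp add: coeff_sum)
    have degp: "degree p = Suc K"
      by (rule antisym) (auto intro!: degree_le le_degree simp: cp False)
    then have "\<not> constant (poly p)" by (simp add: constant_degree)
    then obtain l where "poly p l = 0" using fundamental_theorem_of_algebra by blast
    then obtain q where q: "p = [:- l, 1:] * q" by (auto simp: poly_eq_0_iff_dvd)
    have "q \<noteq> 0" using q degp by auto
    then have "degree p = degree [:- l, 1:] + degree q" unfolding q by (intro degree_mult_eq) auto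
    then have degq: "degree q = K" using degp by simp
    define b where "b = coeff q"
    have bK: "b (Suc K) = 0" unfolding b_def using degq by (simp add: coeff_eq_0)
    have cq: "coeff p j = coeff (pCons 0 q) j - l * coeff q j" for j
      unfolding q by simp
    have c0: "c 0 = - l * b 0"
      using cp[of 0] cq[of 0] by (simp add: b_def)
    have cS: "c (Suc j) = b j - l * b (Suc j)" if "j \<le> K" for j
      using cp[of "Suc j"] cq[of "Suc j"] that by (simp add: b_def)
    have id: "(\<Sum>j\<le>Suc K. c j * (Y ^ j * X ^ (Suc K - j))) = (Y - l * X) * (\<Sum>j\<le>K. b j * (Y ^ j * X ^ (K - j)))"
      for X Y :: complex
    proof -
      have "(\<Sum>j\<le>Suc K. c j * (Y ^ j * X ^ (Suc K - j))) =
          c 0 * X ^ Suc K + (\<Sum>j\<le>K. c (Suc j) * (Y ^ Suc j * X ^ (K - j)))"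
        by (subst sum.atMost_Suc_shift) simp
      also have "(\<Sum>j\<le>K. c (Suc j) * (Y ^ Suc j * X ^ (K - j))) =
          (\<Sum>j\<le>K. b j * (Y ^ Suc j * X ^ (K - j))) - l * (\<Sum>j\<le>K. b (Suc j) * (Y ^ Suc j * X ^ (K - j)))"
        by (simp add: cS sum_distrib_left sum_subtractf[symmetric] left_diff_distrib mult.assoc)
      also have "(\<Sum>j\<le>K. b (Suc j) * (Y ^ Suc j * X ^ (K - j))) =
          (\<Sum>j\<le>Suc K. b j * (Y ^ j * X ^ (Suc K - j))) - b 0 * X ^ Suc K"
        by (subst sum.atMost_Suc_shift) simp
      also have "(\<Sum>j\<le>Suc K. b j * (Y ^ j * X ^ (Suc K - j))) = X * (\<Sum>j\<le>K. b j * (Y ^ j * X ^ (K - j)))"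
        by (simp add: bK sum_distrib_left Suc_diff_le algebra_simps)
      also have "(\<Sum>j\<le>K. b j * (Y ^ Suc j * X ^ (K - j))) = Y * (\<Sum>j\<le>K. b j * (Y ^ j * X ^ (K - j)))"
        by (simp add: sum_distrib_left algebra_simps)
      finally show ?thesis by (simp add: c0 algebra_simps)
    qed
    have "(\<Sum>j\<le>Suc K. c j *\<^sub>C (y ^ j * x ^ (Suc K - j))) * g = (y - l *\<^sub>C x) * (S b * g)"
    proof
      fix v
      show "((\<Sum>j\<le>Suc K. c j *\<^sub>C (y ^ j * x ^ (Suc K - j))) * g) v = ((y - l *\<^sub>C x) * (S b * g)) v"
        using id[of "y v" "x v"] unfolding S_def by (simp only: times_fun_apply sum_fun_apply scaleC_fun_apply
          scaleC_complex_eq power_fun_apply minus_apply mult.assoc)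
    qed
    then have "(y - l *\<^sub>C x) * (S b * g) \<in> I" using Suc.prems(2) by (simp only:)
    then have "y - l *\<^sub>C x \<in> I \<or> S b * g \<in> I"
      using prime[OF homogeneous_diff[OF y homogeneous_scale[OF x(1)]] homogeneous_mult[OF S_hom g(1)]] by blast
    moreover have "b K \<noteq> 0" unfolding b_def using degq \<open>q \<noteq> 0\<close> by auto
    ultimately show ?thesis using Suc.IH[of b] unfolding S_def by blast
  qed
qed

text \<open>Zorn's lemma applies because containing all forms of degree \<open>N\<close> amounts to
  containing finitely many monomials; if the union of a chain contained them, so would one of its
  members.\<close>

lemma maximal_graded_ideal:
  fixes I :: "(('n::finite \<Rightarrow> complex) \<Rightarrow> complex) set"
  assumes I: "graded_ideal I" "\<And>N. \<not> contains_degree I N"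
  obtains M where "I \<subseteq> M" "graded_ideal M" "\<forall>N. \<not> contains_degree M N"
    "\<forall>J. graded_ideal J \<longrightarrow> M \<subset> J \<longrightarrow> (\<exists>N. contains_degree J N)"
proof -
  define \<A> where "\<A> = {J. graded_ideal J \<and> I \<subseteq> J \<and> (\<forall>N. \<not> contains_degree J N)}"
  have "\<exists>M\<in>\<A>. \<forall>X\<in>\<A>. M \<subseteq> X \<longrightarrow> X = M"
  proof (rule subset_Zorn_nonempty)
    show "\<A> \<noteq> {}" using I by (auto simp: \<A>_def)
  next
    fix \<C> assume ne: "\<C> \<noteq> {}" and ch: "subset.chain \<A> \<C>"
    then have sub: "\<And>J. J \<in> \<C> \<Longrightarrow> graded_ideal J \<and> I \<subseteq> J \<and> (\<forall>N. \<not> contains_degree J N)"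
      by (auto simp: subset.chain_def \<A>_def)
    have g: "graded_ideal (\<Union>\<C>)"
      unfolding graded_ideal_def
    proof (intro conjI ballI allI impI)
      show "0 \<in> \<Union>\<C>" using ne sub graded_idealD(1) by blast
    next
      fix F assume "F \<in> \<Union>\<C>" then show "\<exists>d. homogeneous d F" using sub graded_idealD(2) by blast
    next
      fix d F G assume FG: "F \<in> \<Union>\<C>" "G \<in> \<Union>\<C>" "homogeneous d F" "homogeneous d G"
      then obtain J1 J2 where J: "J1 \<in> \<C>" "F \<in> J1" "J2 \<in> \<C>" "G \<in> J2" by blast
      then have "J1 \<subseteq> J2 \<or> J2 \<subseteq> J1" using ch by (auto simp: subset.chain_def)
      then obtain J where "J \<in> \<C>" "F \<in> J" "G \<in> J" using J by blast
      then show "F + G \<in> \<Union>\<C>" using graded_idealD(3)[of J d F G] sub FG by blast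
    next
      fix F e G assume "F \<in> \<Union>\<C>" "homogeneous e (G :: ('n \<Rightarrow> complex) \<Rightarrow> complex)"
      then show "G * F \<in> \<Union>\<C>" using graded_idealD(4)[of _ F e G] sub by blast
    qed
    moreover have "\<not> contains_degree (\<Union>\<C>) N" for N
    proof
      assume N: "contains_degree (\<Union>\<C>) N"
      let ?B = "mono_fun ` {m :: 'n \<Rightarrow> nat. (\<Sum>i\<in>UNIV. m i) = N}"
      have "finite ?B" by (intro finite_imageI finite_exponents)
      moreover have "?B \<subseteq> \<Union>\<C>" using N homogeneous_mono_fun unfolding contains_degree_def by blast
      ultimately obtain J where "J \<in> \<C>" "?B \<subseteq> J"
        using finite_subset_Union_chain[of ?B \<C> \<A>] ne ch by blast
      then show False using contains_degree_monos[of J N] sub by blast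
    qed
    moreover have "I \<subseteq> \<Union>\<C>" using ne sub by blast
    ultimately show "\<Union>\<C> \<in> \<A>" by (simp add: \<A>_def)
  qed
  then obtain M where "M \<in> \<A>" "\<forall>X\<in>\<A>. M \<subseteq> X \<longrightarrow> X = M" by blast
  then show ?thesis using that[of M] unfolding \<A>_def by blast
qed

text \<open>The proof takes a maximal graded ideal \<open>M\<close> not containing all forms of any degree. Modulo \<open>M\<close>
  every form of large degree is a multiple of a fixed coordinate \<open>x \<notin> M\<close>, so by finite dimension and
  \<open>prime_linear_factor\<close> every coordinate is congruent to a multiple of \<open>x\<close>: \<open>M\<close> is the ideal of a point.\<close>

theorem projective_nullstellensatz:
  fixes I :: "(('n::finite \<Rightarrow> complex) \<Rightarrow> complex) set"
  assumes I: "graded_ideal I" "\<And>N. \<not> contains_degree I N"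
  obtains p where "\<forall>F\<in>I. F (rep p) = 0"
proof -
  obtain M where M: "I \<subseteq> M" "graded_ideal M" "\<forall>N. \<not> contains_degree M N"
    and max: "\<forall>J. graded_ideal J \<longrightarrow> M \<subset> J \<longrightarrow> (\<exists>N. contains_degree J N)"
    by (rule maximal_graded_ideal[OF I])
  note MD = graded_idealD[OF M(2)]
  \<comment> \<open>The homogeneous elements of the ideal generated by \<open>M\<close> and
    \<open>z\<close> form a graded ideal larger than \<open>M\<close>; by maximality it contains all
    forms of large degree.\<close>
  have split: "\<exists>N\<ge>d. \<forall>n\<ge>N. \<forall>F. homogeneous n F \<longrightarrow>
      (\<exists>G H. G \<in> M \<and> homogeneous n G \<and> homogeneous (n - d) H \<and> F = G + z * H)"
    if z: "homogeneous d z" "z \<notin> M" for d z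
  proof -
    define R where "R = (\<lambda>n F. \<exists>G a H. G \<in> M \<and> homogeneous n G \<and> homogeneous a H \<and> n = d + a \<and> F = G + z * H)"
    have RI: "R n (G + z * H)" if "G \<in> M" "homogeneous n G" "homogeneous a H" "n = d + a" for n G a H
      unfolding R_def using that by blast
    have R_hom: "homogeneous n F" if "R n F" for n F
      using that homogeneous_add homogeneous_mult[OF z(1)] unfolding R_def by blast
    have R_deg: "n' = n" if "R n' F" "homogeneous n F" "F \<noteq> 0" for n n' F
    proof -
      obtain v where "F v \<noteq> 0" using \<open>F \<noteq> 0\<close> by (auto simp: fun_eq_iff)
      then show ?thesis using homogeneous_degree_unique[OF R_hom[OF that(1)] that(2)] by blast
    qed
    define J where "J = M \<union> {F. \<exists>n. R n F}"
    have MR: "R n (F + F')" if M1: "F \<in> M" "homogeneous n F" and R1: "R n F'" for n F F'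
    proof -
      obtain G a H where G: "G \<in> M" "homogeneous n G" "homogeneous a H" "n = d + a" "F' = G + z * H"
        using R1 unfolding R_def by blast
      have "R n ((F + G) + z * H)"
        by (rule RI[OF MD(3)[OF M1(2) G(2) M1(1) G(1)] homogeneous_add[OF M1(2) G(2)] G(3,4)])
      then show ?thesis by (simp only: G(5) add.assoc)
    qed
    have RR: "R n (F + F')" if R1: "R n F" and R2: "R n F'" for n F F'
    proof -
      obtain G a H where G: "G \<in> M" "homogeneous n G" "homogeneous a H" "n = d + a" "F = G + z * H"
        using R1 unfolding R_def by blast
      obtain G' a' H' where G': "G' \<in> M" "homogeneous n G'" "homogeneous a' H'" "n = d + a'" "F' = G' + z * H'"
        using R2 unfolding R_def by blast
      have a: "homogeneous a H'" using G(4) G'(3,4) by simp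
      have "R n ((G + G') + z * (H + H'))"
        by (rule RI[OF MD(3)[OF G(2) G'(2) G(1) G'(1)] homogeneous_add[OF G(2) G'(2)] homogeneous_add[OF G(3) a] G(4)])
      moreover have "(G + G') + z * (H + H') = F + F'" by (simp only: G(5) G'(5) distrib_left ac_simps)
      ultimately show ?thesis by (simp only:)
    qed
    have "graded_ideal J"
      unfolding graded_ideal_def
    proof (intro conjI ballI allI impI)
      show "0 \<in> J" using MD(1) by (simp only: J_def UnI1)
    next
      fix F assume "F \<in> J" then show "\<exists>n. homogeneous n F" using MD(2) R_hom unfolding J_def by blast
    next
      fix n F F' assume F: "F \<in> J" "F' \<in> J" "homogeneous n F" "homogeneous n F'"
      show "F + F' \<in> J"
      proof (cases "F = 0 \<or> F' = 0")
        case True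
        then show ?thesis using F(1,2) by (elim disjE) (simp_all only: add_0_left add_0_right)
      next
        case False
        then have "F \<in> M \<or> R n F" "F' \<in> M \<or> R n F'" using F R_deg unfolding J_def by blast+
        then have "F + F' \<in> M \<or> R n (F + F')"
          using MD(3)[OF F(3,4)] MR[OF _ F(3)] MR[OF _ F(4), of F] RR[of n F F'] add.commute[of F F'] by metis
        then show ?thesis unfolding J_def by blast
      qed
    next
      fix F e E assume F: "F \<in> J" and E: "homogeneous e (E :: ('n \<Rightarrow> complex) \<Rightarrow> complex)"
      show "E * F \<in> J"
      proof (cases "F \<in> M")
        case True
        then show ?thesis using MD(4)[OF _ E] unfolding J_def by blast
      next
        case False
        then obtain n G a H where G: "G \<in> M" "homogeneous n G" "homogeneous a H" "n = d + a" "F = G + z * H"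
          using F unfolding J_def R_def by blast
        have "R (e + n) (E * G + z * (E * H))"
          by (rule RI[OF MD(4)[OF G(1) E] homogeneous_mult[OF E G(2)] homogeneous_mult[OF E G(3)]]) (use G(4) in simp)
        moreover have "E * G + z * (E * H) = E * F" by (simp only: G(5) distrib_left ac_simps)
        ultimately show ?thesis unfolding J_def by (metis (mono_tags, lifting) CollectI UnI2)
      qed
    qed
    moreover have "R d (0 + z * 1)" by (rule RI[OF MD(1) homogeneous_zero homogeneous_one]) simp
    then have "z \<in> J" unfolding J_def by (simp only: add_0_left mult_1_right) blast
    then have "M \<subset> J" using z(2) unfolding J_def by blast
    ultimately obtain N where "contains_degree J N" using max by blast
    then have N: "contains_degree J n" if "N \<le> n" for n
      using contains_degree_mono[OF \<open>graded_ideal J\<close>] that by blast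
    show ?thesis
    proof (intro exI[of _ "max N d"] conjI allI impI)
      fix n F assume n: "max N d \<le> n" and F: "homogeneous n (F :: ('n \<Rightarrow> complex) \<Rightarrow> complex)"
      then have "F \<in> J" using N[of n] unfolding contains_degree_def by simp
      show "\<exists>G H. G \<in> M \<and> homogeneous n G \<and> homogeneous (n - d) H \<and> F = G + z * H"
      proof (cases "F \<in> M")
        case True
        have "F = F + z * 0" by simp
        then show ?thesis using True F homogeneous_zero by blast
      next
        case False
        then have nz: "F \<noteq> 0" using MD(1) by blast
        obtain n' where n': "R n' F" using False \<open>F \<in> J\<close> unfolding J_def by blast
        then have "R n F" using R_deg[OF n' F nz] by simp
        then obtain G a H where G: "G \<in> M" "homogeneous n G" "homogeneous a H" "n = d + a" "F = G + z * H"
          unfolding R_def by blast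
        have "homogeneous (n - d) H" using G(3,4) by simp
        then show ?thesis using G by blast
      qed
    qed simp
  qed
  have prime: "H \<in> M" if z: "homogeneous d z" "z \<notin> M" and H: "homogeneous e H" "z * H \<in> M" for d z e H
  proof (rule ccontr)
    assume HM: "H \<notin> M"
    \<comment> \<open>The colon ideal of \<open>M\<close> by \<open>z\<close>. It contains
      \<open>H\<close> and so is larger than \<open>M\<close>, hence contains all forms of large
      degree. Modulo \<open>M\<close> every form of large degree is \<open>z\<close> times such a
      form, so it would lie in \<open>M\<close>.\<close>
    define J where "J = {F. (\<exists>e. homogeneous e F) \<and> z * F \<in> M}"
    have "graded_ideal J"
      unfolding graded_ideal_def
    proof (intro conjI ballI allI impI)
      show "0 \<in> J" unfolding J_def using homogeneous_zero MD(1) by (simp only: mem_Collect_eq mult_zero_right) blast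
    next
      fix F assume "F \<in> J" then show "\<exists>n. homogeneous n F" unfolding J_def by blast
    next
      fix n F F' assume F: "F \<in> J" "F' \<in> J" "homogeneous n F" "homogeneous n F'"
      have "z * F + z * F' \<in> M"
        by (rule MD(3)[OF homogeneous_mult[OF z(1) F(3)] homogeneous_mult[OF z(1) F(4)]]) (use F in \<open>simp_all only: J_def mem_Collect_eq\<close>)
      then show "F + F' \<in> J" unfolding J_def using homogeneous_add[OF F(3,4)] by (simp only: mem_Collect_eq distrib_left) blast
    next
      fix F e E assume F: "F \<in> J" and E: "homogeneous e (E :: ('n \<Rightarrow> complex) \<Rightarrow> complex)"
      obtain n where n: "homogeneous n F" "z * F \<in> M" using F unfolding J_def by blast
      have "E * (z * F) \<in> M" by (rule MD(4)[OF n(2) E])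
      then show "E * F \<in> J"
        unfolding J_def using homogeneous_mult[OF E n(1)] by (simp only: mem_Collect_eq mult.left_commute[of z E F]) blast
    qed
    moreover have "M \<subseteq> J" unfolding J_def using MD(2) MD(4)[OF _ z(1)] by blast
    moreover have "H \<in> J" unfolding J_def using H by blast
    ultimately obtain N1 where N1: "contains_degree J N1" using max HM by blast
    obtain N2 where N2: "\<forall>n\<ge>N2. \<forall>F. homogeneous n F \<longrightarrow>
        (\<exists>G H. G \<in> M \<and> homogeneous n G \<and> homogeneous (n - d) H \<and> F = G + z * H)"
      using split[OF z] by blast
    define n where "n = N1 + N2 + d"
    have N1': "contains_degree J (n - d)"
      by (rule contains_degree_mono[OF \<open>graded_ideal J\<close> N1]) (simp add: n_def)
    have "contains_degree M n"
      unfolding contains_degree_def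
    proof (intro allI impI)
      fix F assume "homogeneous n (F :: ('n \<Rightarrow> complex) \<Rightarrow> complex)"
      moreover have "n \<ge> N2" by (simp add: n_def)
      ultimately obtain G E where G: "G \<in> M" "homogeneous n G" "homogeneous (n - d) E" "F = G + z * E"
        using N2 by blast
      have "z * E \<in> M" using N1' G(3) unfolding contains_degree_def J_def by blast
      moreover have "homogeneous n (z * E)"
        by (rule homogeneous_cong_degree[OF homogeneous_mult[OF z(1) G(3)]]) (simp add: n_def)
      ultimately show "F \<in> M" unfolding G(4) by (intro MD(3)[OF G(2) _ G(1)])
    qed
    then show False using M(3) by blast
  qed
  have P: "prime_graded_ideal M"
    unfolding prime_graded_ideal_def using M(2) prime by blast
  have one: "1 \<notin> M"
  proof
    assume "1 \<in> M"
    then have "contains_degree M 0"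
      unfolding contains_degree_def using MD(4)[of 1] by (metis mult_1_right)
    then show False using M(3) by blast
  qed
  have "\<exists>k. (\<lambda>x. x k) \<notin> M"
  proof (rule ccontr)
    assume "\<not> ?thesis"
    then have co: "(\<lambda>x. x k) \<in> M" for k by blast
    have "contains_degree M (Suc 0)"
      unfolding contains_degree_def
    proof (intro allI impI)
      fix F assume "homogeneous (Suc 0) (F :: ('n \<Rightarrow> complex) \<Rightarrow> complex)"
      then obtain G where G: "\<forall>i. homogeneous 0 (G i)" "F = (\<Sum>i\<in>UNIV. (\<lambda>x. x i) * G i)"
        by (rule homogeneous_SucE)
      show "F \<in> M"
        unfolding G(2)
      proof (rule graded_ideal_sum[OF M(2)])
        fix i
        show "homogeneous (1 + 0) ((\<lambda>x. x i) * G i)"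
          by (intro homogeneous_mult homogeneous_coord G(1)[rule_format])
        show "(\<lambda>x. x i) * G i \<in> M"
          using MD(4)[OF co G(1)[rule_format], of i i] by (simp only: mult.commute)
      qed
    qed
    then show False using M(3) by blast
  qed
  then obtain k where k: "(\<lambda>x. x k) \<notin> M" by blast
  define x where "x = (\<lambda>v :: 'n \<Rightarrow> complex. v k)"
  have x: "homogeneous 1 x" "x \<notin> M" unfolding x_def using homogeneous_coord k by blast+
  have xn: "homogeneous n (x ^ n)" for n using homogeneous_power[OF x(1), of n] by (simp only: mult_1_right)
  have xnM: "x ^ n \<notin> M" for n
  proof (induction n)
    case 0
    then show ?case using one by (simp only: power_0) simp
  next
    case (Suc n)
    then show ?case using prime[OF x xn, of n] by (simp only: power_Suc) blast
  qed
  obtain N where N: "\<forall>n\<ge>N. \<forall>F. homogeneous n F \<longrightarrow>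
        (\<exists>G H. G \<in> M \<and> homogeneous n G \<and> homogeneous (n - 1) H \<and> F = G + x * H)"
    using split[OF x] by blast
  \<comment> \<open>Dividing by \<open>x\<close> repeatedly brings the cofactor down to the fixed
    degree \<open>N\<close>, so all cofactors lie in one finite-dimensional space.\<close>
  have red: "\<exists>H. homogeneous N H \<and> F - x ^ j * H \<in> M" if "homogeneous (N + j) F" for j F
    using that
  proof (induction j arbitrary: F)
    case 0
    have "F - x ^ 0 * F = 0" by simp
    then show ?case using 0 MD(1) by (intro exI[of _ F]) (simp only: add_0_right simp_thms)
  next
    case (Suc j)
    obtain G H where G: "G \<in> M" "homogeneous (N + Suc j) G" "homogeneous (N + Suc j - 1) H" "F = G + x * H"
      using N[rule_format, OF _ Suc.prems] by auto
    have H: "homogeneous (N + j) H" using G(3) by simp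
    obtain H' where H': "homogeneous N H'" "H - x ^ j * H' \<in> M" using Suc.IH[OF H] by blast
    have "homogeneous (N + j) (x ^ j * H')"
      by (rule homogeneous_cong_degree[OF homogeneous_mult[OF xn H'(1)]]) simp
    then have hom: "homogeneous (N + Suc j) (x * (H - x ^ j * H'))"
      by (intro homogeneous_cong_degree[OF homogeneous_mult[OF x(1) homogeneous_diff[OF H]]]) simp_all
    have "G + x * (H - x ^ j * H') \<in> M"
      by (rule MD(3)[OF G(2) hom G(1) MD(4)[OF H'(2) x(1)]])
    moreover have "G + x * (H - x ^ j * H') = F - x ^ Suc j * H'"
      by (simp only: G(4) power_Suc right_diff_distrib add_diff_eq mult.assoc)
    ultimately show ?case using H'(1) by (intro exI[of _ H']) (simp only: simp_thms)
  qed
  have "\<exists>l. (\<lambda>v. v i) - l *\<^sub>C x \<in> M" for i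
  proof -
    define y where "y = (\<lambda>v :: 'n \<Rightarrow> complex. v i)"
    have y: "homogeneous 1 y" unfolding y_def by (rule homogeneous_coord)
    have yn: "homogeneous n (y ^ n)" for n using homogeneous_power[OF y, of n] by (simp only: mult_1_right)
    have hom: "homogeneous (N + j) (y ^ j * x ^ N)" for j
      by (rule homogeneous_cong_degree[OF homogeneous_mult[OF yn xn]]) simp
    have "\<forall>j. \<exists>H. homogeneous N H \<and> y ^ j * x ^ N - x ^ j * H \<in> M" using red[OF hom] by blast
    from choice[OF this] obtain H where H: "\<And>j. homogeneous N (H j)" "\<And>j. y ^ j * x ^ N - x ^ j * H j \<in> M"
      by blast
    define B where "B = mono_fun ` {m :: 'n \<Rightarrow> nat. (\<Sum>i\<in>UNIV. m i) = N}"
    have fin: "finite B" unfolding B_def by (intro finite_imageI finite_exponents)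
    have "H j \<in> complex_vector.span B" for j
      unfolding B_def using H(1) homogeneous_eq_span by blast
    from linear_relation[of "{..card B}" B H, OF _ fin this] obtain c
      where c: "\<exists>j\<le>card B. c j \<noteq> 0" "(\<Sum>j\<le>card B. c j *\<^sub>C H j) = 0" by auto
    let ?K = "card B"
    have sum0: "(\<Sum>j\<le>?K. c j * H j v) = 0" for v
      using fun_cong[OF c(2), of v] by simp
    \<comment> \<open>The relation among the cofactors \<open>H j\<close> cancels their
      contribution. What remains in \<open>M\<close> is a nontrivial binary form in \<open>y\<close>
      and \<open>x\<close>, times a power of \<open>x\<close>.\<close>
    have "(\<Sum>j\<le>?K. c j *\<^sub>C (y ^ j * x ^ (?K - j))) * x ^ N =
        (\<Sum>j\<le>?K. c j *\<^sub>C (x ^ (?K - j) * (y ^ j * x ^ N - x ^ j * H j)))"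
    proof
      fix v
      have "(\<Sum>j\<le>?K. c j * (x v ^ (?K - j) * (y v ^ j * x v ^ N - x v ^ j * H j v))) =
          (\<Sum>j\<le>?K. c j * (y v ^ j * x v ^ (?K - j)) * x v ^ N - x v ^ ?K * (c j * H j v))"
      proof (rule sum.cong[OF refl])
        fix j assume "j \<in> {..?K}"
        then have "x v ^ ?K = x v ^ (?K - j) * x v ^ j" by (simp add: power_add[symmetric])
        then show "c j * (x v ^ (?K - j) * (y v ^ j * x v ^ N - x v ^ j * H j v)) =
          c j * (y v ^ j * x v ^ (?K - j)) * x v ^ N - x v ^ ?K * (c j * H j v)"
          by (simp add: algebra_simps)
      qed
      also have "\<dots> = (\<Sum>j\<le>?K. c j * (y v ^ j * x v ^ (?K - j))) * x v ^ N - x v ^ ?K * (\<Sum>j\<le>?K. c j * H j v)"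
        by (simp only: sum_subtractf sum_distrib_left sum_distrib_right)
      finally show "((\<Sum>j\<le>?K. c j *\<^sub>C (y ^ j * x ^ (?K - j))) * x ^ N) v =
        (\<Sum>j\<le>?K. c j *\<^sub>C (x ^ (?K - j) * (y ^ j * x ^ N - x ^ j * H j))) v"
        by (simp add: sum0)
    qed
    also have "\<dots> \<in> M"
    proof (rule graded_ideal_sum[OF M(2), where d = "?K + N"])
      fix j assume "j \<in> {..?K}"
      then have "?K - j + (N + j) = ?K + N" by simp
      moreover have "homogeneous (N + j) (x ^ j * H j)"
        by (rule homogeneous_cong_degree[OF homogeneous_mult[OF xn H(1)]]) simp
      ultimately show "homogeneous (?K + N) (c j *\<^sub>C (x ^ (?K - j) * (y ^ j * x ^ N - x ^ j * H j)))"
        using homogeneous_mult[OF xn homogeneous_diff[OF hom], of j "x ^ j * H j" "?K - j"]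
        by (intro homogeneous_scale) (simp only:)
      show "c j *\<^sub>C (x ^ (?K - j) * (y ^ j * x ^ N - x ^ j * H j)) \<in> M"
        by (intro graded_ideal_scale[OF M(2)] MD(4)[OF H(2) xn])
    qed
    finally show ?thesis
      using prime_linear_factor[OF P x y xn xnM, of ?K c] c(1) unfolding y_def by blast
  qed
  then obtain l where l: "\<And>i. (\<lambda>v. v i) - l i *\<^sub>C x \<in> M" by metis
  \<comment> \<open>Modulo \<open>M\<close> the coordinates are multiples of \<open>x\<close> with
    factors \<open>l\<close>, so every form is congruent to its value at \<open>l\<close> times a
    power of \<open>x\<close>.\<close>
  have eval: "F - F l *\<^sub>C x ^ d \<in> M" if "homogeneous d F" for d F
    using that
  proof (induction d arbitrary: F)
    case 0
    then obtain c where "F = (\<lambda>_. c)" by (rule homogeneous_0E)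
    then have "F - F l *\<^sub>C x ^ 0 = 0" by (simp add: fun_eq_iff)
    then show ?case using MD(1) by (simp only:)
  next
    case (Suc d)
    obtain G where G: "\<forall>i. homogeneous d (G i)" "F = (\<Sum>i\<in>UNIV. (\<lambda>x. x i) * G i)"
      by (rule homogeneous_SucE[OF Suc.prems])
    have eq: "F - F l *\<^sub>C x ^ Suc d = (\<Sum>i\<in>UNIV. (\<lambda>v. v i) * (G i - G i l *\<^sub>C x ^ d) +
        (G i l *\<^sub>C x ^ d) * ((\<lambda>v. v i) - l i *\<^sub>C x))"
    proof
      fix v
      show "(F - F l *\<^sub>C x ^ Suc d) v = (\<Sum>i\<in>UNIV. (\<lambda>v. v i) * (G i - G i l *\<^sub>C x ^ d) +
        (G i l *\<^sub>C x ^ d) * ((\<lambda>v. v i) - l i *\<^sub>C x)) v"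
        by (simp add: G(2) sum_distrib_right sum_distrib_left sum_subtractf sum.distrib algebra_simps)
    qed
    have h1: "homogeneous (Suc d) ((\<lambda>v. v i) * (G i - G i l *\<^sub>C x ^ d))" for i
      by (rule homogeneous_cong_degree[OF homogeneous_mult[OF homogeneous_coord
            homogeneous_diff[OF G(1)[rule_format] homogeneous_scale[OF xn]]]]) simp
    have h2: "homogeneous (Suc d) ((G i l *\<^sub>C x ^ d) * ((\<lambda>v. v i) - l i *\<^sub>C x))" for i
      by (rule homogeneous_cong_degree[OF homogeneous_mult[OF homogeneous_scale[OF xn]
            homogeneous_diff[OF homogeneous_coord homogeneous_scale[OF x(1)]]]]) simp
    show ?case
      unfolding eq
      by (rule graded_ideal_sum[OF M(2)], rule homogeneous_add[OF h1 h2],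
          rule MD(3)[OF h1 h2 MD(4)[OF Suc.IH homogeneous_coord] MD(4)[OF l homogeneous_scale[OF xn]]])
        (use G(1) in blast)
  qed
  have Fl: "F l = 0" if F: "F \<in> M" for F
  proof (rule ccontr)
    assume nz: "F l \<noteq> 0"
    obtain d where d: "homogeneous d F" using MD(2)[OF F] by blast
    have "F - (F - F l *\<^sub>C x ^ d) \<in> M"
      by (rule graded_ideal_diff[OF M(2) d homogeneous_diff[OF d homogeneous_scale[OF xn]] F eval[OF d]])
    then have "(1 / F l) *\<^sub>C (F l *\<^sub>C x ^ d) \<in> M"
      using graded_ideal_scale[OF M(2)] by (simp only: diff_diff_eq2 add_diff_cancel_left')
    then have "x ^ d \<in> M" using nz by (simp add: scaleC_scaleC scaleC_one)
    then show False using xnM by blast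
  qed
  have "l \<noteq> 0"
  proof
    assume "l = 0"
    then have "(\<lambda>v. v k) - l k *\<^sub>C x = x" by (simp add: x_def)
    then show False using l[of k] x(2) by (simp only:)
  qed
  then obtain p where p: "l \<in> coords p" by (rule point_of_vector)
  have "\<forall>F\<in>I. F (rep p) = 0"
  proof
    fix F assume "F \<in> I"
    then have "F \<in> M" using M(1) by blast
    moreover obtain d where "homogeneous d F" using MD(2) \<open>F \<in> M\<close> by blast
    ultimately show "F (rep p) = 0" using Fl homogeneous_zero_iff[OF _ p] by blast
  qed
  then show ?thesis using that by blast
qed

section \<open>The degree of a form on a curve\<close>

context curve
begin

text \<open>Irreducibility of \<open>C\<close> makes its ideal prime, so that
  \<open>prime_linear_factor\<close> applies to identities holding on the curve.\<close>

lemma curve_ideal: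
  "prime_graded_ideal {F. (\<exists>d. homogeneous d F) \<and> vanishes F}" (is "prime_graded_ideal ?I")
proof -
  have "graded_ideal ?I"
    unfolding graded_ideal_def
  proof (intro conjI ballI allI impI)
    show "0 \<in> ?I" using homogeneous_zero by (auto simp: vanishes_def)
  next
    fix d F G assume "F \<in> ?I" "G \<in> ?I" "homogeneous d F" "homogeneous d G"
    then show "F + G \<in> ?I" using homogeneous_add[of d F G] by (simp add: vanishes_def) blast
  next
    fix F e G assume "F \<in> ?I" and G: "homogeneous e (G :: ('n \<Rightarrow> complex) \<Rightarrow> complex)"
    then obtain d where "homogeneous d F" "vanishes F" by blast
    then have "homogeneous (e + d) (G * F)" "vanishes (G * F)"
      using homogeneous_mult[OF G] by (auto simp: vanishes_def)
    then show "G * F \<in> ?I" by blast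
  qed blast
  moreover have "F \<in> ?I \<or> G \<in> ?I" if "homogeneous d F" "homogeneous e G" "F * G \<in> ?I" for d e F G
    using that vanishes_mult_iff[of d F e G] by blast
  ultimately show ?thesis unfolding prime_graded_ideal_def by blast
qed

text \<open>If \<open>A\<close> vanishes everywhere at least to the order of \<open>B\<close>, the denominators of \<open>A / B\<close> have no
  common zero on \<open>C\<close>, so \<open>A / B\<close> maps the forms of some degree \<open>N\<close> to forms of degree \<open>N\<close>.\<close>

lemma regular_quotient_forms:
  assumes A: "homogeneous d A" and B: "homogeneous d B" "\<not> vanishes B"
    and ord: "\<And>p. p \<in> C \<Longrightarrow> order_ge p (order_at p B) A"
  obtains N where "\<And>F. homogeneous N F \<Longrightarrow> \<exists>H. homogeneous N H \<and> (\<forall>q\<in>C. A (rep q) * F (rep q) = B (rep q) * H (rep q))"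
proof -
  define I where "I = {F. \<exists>e H. homogeneous e F \<and> homogeneous e H \<and> (\<forall>q\<in>C. A (rep q) * F (rep q) = B (rep q) * H (rep q))}"
  have II: "F \<in> I" if "homogeneous e F" "homogeneous e H" "\<forall>q\<in>C. A (rep q) * F (rep q) = B (rep q) * H (rep q)" for e F H
    unfolding I_def using that by blast
  have degree_eq: "e = e'" if "homogeneous e F" "homogeneous e' F" "F \<noteq> 0" for e e' F
  proof -
    obtain v where "F v \<noteq> 0" using \<open>F \<noteq> 0\<close> by (auto simp: fun_eq_iff)
    then show ?thesis using homogeneous_degree_unique that by blast
  qed
  have IE: "\<exists>H. homogeneous e H \<and> (\<forall>q\<in>C. A (rep q) * F (rep q) = B (rep q) * H (rep q))"
    if F: "F \<in> I" "homogeneous e F" for e F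
  proof (cases "F = 0")
    case True
    then show ?thesis using homogeneous_zero[of e] by (intro exI[of _ 0]) simp
  next
    case False
    obtain e' H where e': "homogeneous e' F" "homogeneous e' H"
      "\<forall>q\<in>C. A (rep q) * F (rep q) = B (rep q) * H (rep q)" using F(1) unfolding I_def by blast
    then show ?thesis using degree_eq[OF F(2) e'(1) False] by blast
  qed
  have gI: "graded_ideal I"
    unfolding graded_ideal_def
  proof (intro conjI ballI allI impI)
    show "0 \<in> I" by (rule II[OF homogeneous_zero homogeneous_zero]) simp
  next
    fix F assume "F \<in> I" then show "\<exists>d. homogeneous d F" unfolding I_def by blast
  next
    fix e F G assume FG: "F \<in> I" "G \<in> I" "homogeneous e F" "homogeneous e G"
    obtain H where H: "homogeneous e H" "\<forall>q\<in>C. A (rep q) * F (rep q) = B (rep q) * H (rep q)"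
      using IE[OF FG(1,3)] by blast
    obtain K where K: "homogeneous e K" "\<forall>q\<in>C. A (rep q) * G (rep q) = B (rep q) * K (rep q)"
      using IE[OF FG(2,4)] by blast
    show "F + G \<in> I"
      by (rule II[OF homogeneous_add[OF FG(3,4)] homogeneous_add[OF H(1) K(1)]])
        (use H K in \<open>simp add: distrib_left\<close>)
  next
    fix F e G assume F: "F \<in> I" and G: "homogeneous e (G :: ('n \<Rightarrow> complex) \<Rightarrow> complex)"
    obtain e' H where e': "homogeneous e' F" "homogeneous e' H"
      "\<forall>q\<in>C. A (rep q) * F (rep q) = B (rep q) * H (rep q)" using F unfolding I_def by blast
    show "G * F \<in> I"
    proof (rule II[OF homogeneous_mult[OF G e'(1)] homogeneous_mult[OF G e'(2)]], intro ballI)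
      fix q assume "q \<in> C"
      then show "A (rep q) * (G * F) (rep q) = B (rep q) * (G * H) (rep q)"
        using e'(3) by (simp add: mult.left_commute[of _ "G (rep q)"])
    qed
  qed
  have "\<exists>N. contains_degree I N"
  proof (rule ccontr)
    assume "\<not> ?thesis"
    then have "\<And>N. \<not> contains_degree I N" by blast
    then obtain p where p: "\<forall>F\<in>I. F (rep p) = 0" by (rule projective_nullstellensatz[OF gI])
    have "zariski_closed C" using irreducible by (simp add: irreducible_closed_def)
    then obtain S where S: "\<forall>F\<in>S. \<exists>d. homogeneous d F" "C = {p. \<forall>F\<in>S. F (rep p) = 0}"
      unfolding zariski_closed_iff by (elim exE conjE)
    \<comment> \<open>An equation of \<open>C\<close> lies in \<open>I\<close> with numerator 0, so
      the common zero \<open>p\<close> of \<open>I\<close> satisfies all equations of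
      \<open>C\<close>.\<close>
    have Fp: "F (rep p) = 0" if "F \<in> S" for F
    proof -
      obtain e where e: "homogeneous e F" using S(1) \<open>F \<in> S\<close> by blast
      have "F (rep q) = 0" if "q \<in> C" for q
        using that[unfolded S(2), THEN CollectD] \<open>F \<in> S\<close> by (rule bspec)
      then have "F \<in> I" by (intro II[OF e homogeneous_zero[of e]]) simp
      then show ?thesis by (rule bspec[OF p])
    qed
    have pC: "p \<in> C" unfolding S(2) by (intro CollectI ballI Fp)
    obtain t T where U: "uniformizer p t T" using uniformizer_exists[OF pC] by blast
    define k where "k = order_at p B"
    obtain e2 G2 a2 A2 where 2: "homogeneous e2 G2" "homogeneous a2 A2" "d + e2 = a2 + k * t" "G2 (rep p) \<noteq> 0"
      "A2 (rep p) \<noteq> 0" "\<forall>q\<in>C. B (rep q) * G2 (rep q) = A2 (rep q) * T (rep q) ^ k"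
      using order_atD[OF pC U B] unfolding k_def[symmetric] by (rule vanishing_eqE)
    have "vanishing_ge p t T k d A"
      using ord[OF pC] order_ge_iff[OF pC U A] by (simp add: k_def)
    then obtain e1 G1 a1 A1 where 1: "homogeneous e1 G1" "homogeneous a1 A1" "d + e1 = a1 + k * t" "G1 (rep p) \<noteq> 0"
      "\<forall>q\<in>C. A (rep q) * G1 (rep q) = A1 (rep q) * T (rep q) ^ k" by (rule vanishing_geE)
    have "homogeneous (e1 + a2) (G2 * A1)"
      by (rule homogeneous_cong_degree[OF homogeneous_mult[OF 2(1) 1(2)]]) (use 1(3) 2(3) in linarith)
    \<comment> \<open>After cancelling the power of \<open>T\<close>, the quotient
      \<open>A / B\<close> is \<open>(A1 G2) / (G1 A2)\<close>, with a denominator that is nonzero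
      at \<open>p\<close>.\<close>
    then have "G1 * A2 \<in> I"
    proof (rule II[OF homogeneous_mult[OF 1(1) 2(2)]], intro ballI)
      fix q assume q: "q \<in> C"
      have "A (rep q) * (G1 * A2) (rep q) = (A (rep q) * G1 (rep q)) * A2 (rep q)" by simp
      also have "\<dots> = (A2 (rep q) * T (rep q) ^ k) * A1 (rep q)" using 1(5) q by simp
      also have "\<dots> = (B (rep q) * G2 (rep q)) * A1 (rep q)" using 2(6) q by simp
      finally show "A (rep q) * (G1 * A2) (rep q) = B (rep q) * (G2 * A1) (rep q)" by simp
    qed
    then have "(G1 * A2) (rep p) = 0" by (rule bspec[OF p])
    then show False using 1(4) 2(5) by simp
  qed
  then obtain N where "contains_degree I N" by blast
  then show ?thesis using that[of N] IE unfolding contains_degree_def by blast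
qed

text \<open>A function without poles on a projective curve is constant. Multiplication by
  \<open>A / B\<close> preserves the forms of some degree \<open>N\<close> on \<open>C\<close>, a
  finite-dimensional space, so the iterates of one form \<open>g\<close> satisfy a linear relation.
  It becomes a binary form in \<open>A\<close> and \<open>B\<close>, times \<open>g\<close>, that
  vanishes on \<open>C\<close>, and one of its linear factors must vanish.\<close>

lemma proportional_of_order:
  assumes A: "homogeneous d A" and B: "homogeneous d B" "\<not> vanishes B"
    and ord: "\<And>p. p \<in> C \<Longrightarrow> order_ge p (order_at p B) A"
  shows "\<exists>c. vanishes (A - c *\<^sub>C B)"
proof -
  obtain N where N: "\<And>F. homogeneous N F \<Longrightarrow>
      \<exists>H. homogeneous N H \<and> (\<forall>q\<in>C. A (rep q) * F (rep q) = B (rep q) * H (rep q))"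
    using regular_quotient_forms[OF A B ord] by metis
  obtain p where p: "p \<in> C" using infinite_curve by (metis ex_in_conv finite.emptyI)
  obtain h where h: "homogeneous 1 h" "h (rep p) \<noteq> 0" by (rule form_nonzero_at)
  define g where "g = h ^ N"
  have g: "homogeneous N g" "\<not> vanishes g"
    using homogeneous_power[OF h(1), of N] h(2) p by (auto simp: g_def vanishes_def)
  \<comment> \<open>\<open>H j\<close> stands for \<open>(A / B) ^ j * g\<close>.\<close>
  have "\<exists>H. \<forall>j. homogeneous N (H j) \<and> (\<forall>q\<in>C. A (rep q) ^ j * g (rep q) = B (rep q) ^ j * H j (rep q))"
  proof (rule choice, rule allI)
    fix j
    show "\<exists>H. homogeneous N H \<and> (\<forall>q\<in>C. A (rep q) ^ j * g (rep q) = B (rep q) ^ j * H (rep q))"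
    proof (induction j)
      case 0
      then show ?case using g by (intro exI[of _ g]) simp
    next
      case (Suc j)
      then obtain H where H: "homogeneous N H" "\<forall>q\<in>C. A (rep q) ^ j * g (rep q) = B (rep q) ^ j * H (rep q)" by blast
      obtain K where K: "homogeneous N K" "\<forall>q\<in>C. A (rep q) * H (rep q) = B (rep q) * K (rep q)"
        using N[OF H(1)] by blast
      have "A (rep q) ^ Suc j * g (rep q) = B (rep q) ^ Suc j * K (rep q)" if "q \<in> C" for q
      proof -
        have "A (rep q) ^ Suc j * g (rep q) = A (rep q) * (A (rep q) ^ j * g (rep q))" by simp
        also have "\<dots> = B (rep q) ^ j * (A (rep q) * H (rep q))" using H(2) that by simp
        finally show ?thesis using K(2) that by simp
      qed
      then show ?case using K(1) by blast
    qed
  qed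
  then obtain H where H: "\<And>j. homogeneous N (H j)"
    "\<And>j q. q \<in> C \<Longrightarrow> A (rep q) ^ j * g (rep q) = B (rep q) ^ j * H j (rep q)" by blast
  define E where "E = mono_fun ` {m :: 'n \<Rightarrow> nat. (\<Sum>i\<in>UNIV. m i) = N}"
  have fin: "finite E" unfolding E_def by (intro finite_imageI finite_exponents)
  have "H j \<in> complex_vector.span E" for j
    unfolding E_def using H(1) homogeneous_eq_span by blast
  from linear_relation[of "{..card E}" E H, OF _ fin this] obtain c
    where c: "\<exists>j\<le>card E. c j \<noteq> 0" "(\<Sum>j\<le>card E. c j *\<^sub>C H j) = 0" by auto
  let ?K = "card E"
  let ?I = "{F. (\<exists>d. homogeneous d F) \<and> vanishes F}"
  define S where "S = (\<Sum>j\<le>?K. c j *\<^sub>C (A ^ j * B ^ (?K - j))) * g"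
  have "homogeneous (?K * d) (\<Sum>j\<le>?K. c j *\<^sub>C (A ^ j * B ^ (?K - j)))"
  proof (intro homogeneous_sum homogeneous_scale)
    fix j assume "j \<in> {..?K}"
    then have "j * d + (?K - j) * d = ?K * d" by (simp add: distrib_right[symmetric])
    then show "homogeneous (?K * d) (A ^ j * B ^ (?K - j))"
      using homogeneous_mult[OF homogeneous_power[OF A] homogeneous_power[OF B(1)], of j "?K - j"] by (simp only:)
  qed
  then have "homogeneous (?K * d + N) S" unfolding S_def using g(1) by (rule homogeneous_mult)
  moreover have "vanishes S"
    unfolding vanishes_def
  proof
    fix q assume q: "q \<in> C"
    have "S (rep q) = (\<Sum>j\<le>?K. c j * (A (rep q) ^ j * B (rep q) ^ (?K - j)) * g (rep q))"
      by (simp add: S_def sum_distrib_right)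
    also have "\<dots> = (\<Sum>j\<le>?K. B (rep q) ^ ?K * (c j * H j (rep q)))"
    proof (rule sum.cong[OF refl])
      fix j assume "j \<in> {..?K}"
      then have e: "B (rep q) ^ ?K = B (rep q) ^ (?K - j) * B (rep q) ^ j" by (simp add: power_add[symmetric])
      have "c j * (A (rep q) ^ j * B (rep q) ^ (?K - j)) * g (rep q) =
          c j * B (rep q) ^ (?K - j) * (A (rep q) ^ j * g (rep q))" by simp
      also have "\<dots> = c j * B (rep q) ^ (?K - j) * (B (rep q) ^ j * H j (rep q))" using H(2)[OF q] by simp
      finally show "c j * (A (rep q) ^ j * B (rep q) ^ (?K - j)) * g (rep q) = B (rep q) ^ ?K * (c j * H j (rep q))"
        unfolding e by simp
    qed
    also have "\<dots> = B (rep q) ^ ?K * (\<Sum>j\<le>?K. c j *\<^sub>C H j) (rep q)"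
      by (simp add: sum_distrib_left)
    finally show "S (rep q) = 0" using c(2) by simp
  qed
  ultimately have "S \<in> ?I" by blast
  then have "\<exists>l. A - l *\<^sub>C B \<in> ?I"
    unfolding S_def
    by (intro prime_linear_factor[OF curve_ideal B(1) _ A g(1) _ c(1)]) (use B g in blast)+
  then show ?thesis by blast
qed

text \<open>Extension by 0 outside \<open>C\<close> matches the normalization of global sections and
  makes equality of functions the same as equality on \<open>C\<close>.\<close>

definition restrict_form :: "(('n \<Rightarrow> complex) \<Rightarrow> complex) \<Rightarrow> 'n proj \<Rightarrow> complex"
  where "restrict_form F = (\<lambda>q. if q \<in> C then F (rep q) else 0)"

lemma restrict_form_linear:
  "restrict_form (F + G) = restrict_form F + restrict_form G"
  "restrict_form (c *\<^sub>C F) = c *\<^sub>C restrict_form F"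
  "restrict_form (F - G) = restrict_form F - restrict_form G"
  by (auto simp: restrict_form_def fun_eq_iff)

lemma restrict_form_eq_0_iff: "restrict_form F = 0 \<longleftrightarrow> vanishes F"
  by (auto simp: restrict_form_def vanishes_def fun_eq_iff)

text \<open>Each point of the divisor of \<open>B\<close> imposes at most one linear condition.\<close>

lemma forms_dimension_bound_aux:
  assumes B: "homogeneous d B" "\<not> vanishes B" and P: "finite P" "P \<subseteq> C" "{p \<in> C. order_at p B \<noteq> 0} \<subseteq> P"
  shows "(\<And>p. p \<in> C \<Longrightarrow> D p \<le> order_at p B) \<Longrightarrow>
    \<exists>E. finite E \<and> card E \<le> (\<Sum>p\<in>P. order_at p B - D p) + 1 \<and>
      restrict_form ` {F. homogeneous d F \<and> (\<forall>p\<in>C. order_ge p (D p) F)} \<subseteq> complex_vector.span E"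
proof (induction "\<Sum>p\<in>P. order_at p B - D p" arbitrary: D)
  case 0
  then have eq: "order_at p B \<le> D p" if "p \<in> C" for p
    using P that by (cases "p \<in> P") (auto simp: subset_iff)
  have "restrict_form F \<in> complex_vector.span {restrict_form B}"
    if F: "homogeneous d F" "\<forall>p\<in>C. order_ge p (D p) F" for F
  proof -
    have "order_ge p (order_at p B) F" if "p \<in> C" for p
      using F(2) eq[OF that] that order_ge_mono by blast
    from proportional_of_order[OF F(1) B this] obtain c where "vanishes (F - c *\<^sub>C B)" by blast
    then have "restrict_form F = c *\<^sub>C restrict_form B"
      by (simp only: restrict_form_eq_0_iff[symmetric] restrict_form_linear) simp
    then show ?thesis by (auto intro: complex_vector.span_scale complex_vector.span_base)
  qed
  then have "restrict_form ` {F. homogeneous d F \<and> (\<forall>p\<in>C. order_ge p (D p) F)} \<subseteq> complex_vector.span {restrict_form B}"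
    by blast
  moreover have "finite {restrict_form B}" "card {restrict_form B} \<le> (\<Sum>p\<in>P. order_at p B - D p) + 1" by auto
  ultimately show ?case by blast
next
  case (Suc n)
  have "\<exists>p\<in>P. order_at p B - D p \<noteq> 0"
  proof (rule ccontr)
    assume "\<not> ?thesis"
    then have "(\<Sum>p\<in>P. order_at p B - D p) = 0" by simp
    then show False using Suc.hyps(2) by simp
  qed
  then obtain p where p: "p \<in> P" "D p < order_at p B" by auto
  then have pC: "p \<in> C" using P(2) by blast
  define D' where "D' = D(p := Suc (D p))"
  have le: "\<And>q. q \<in> C \<Longrightarrow> D' q \<le> order_at q B" using Suc.prems p by (simp add: D'_def)
  have s: "(\<Sum>q\<in>P. order_at q B - D q) = Suc (\<Sum>q\<in>P. order_at q B - D' q)"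
  proof -
    have "(\<Sum>q\<in>P - {p}. order_at q B - D q) = (\<Sum>q\<in>P - {p}. order_at q B - D' q)"
      by (rule sum.cong) (auto simp: D'_def)
    moreover have "order_at p B - D p = Suc (order_at p B - D' p)" using p by (simp add: D'_def)
    ultimately show ?thesis
      by (simp add: sum.remove[OF P(1) p(1), of "\<lambda>q. order_at q B - D q"] sum.remove[OF P(1) p(1), of "\<lambda>q. order_at q B - D' q"])
  qed
  then have "n = (\<Sum>q\<in>P. order_at q B - D' q)" using Suc.hyps(2) by simp
  from Suc.hyps(1)[OF this le] obtain E where E: "finite E" "card E \<le> (\<Sum>q\<in>P. order_at q B - D' q) + 1"
    "restrict_form ` {F. homogeneous d F \<and> (\<forall>p\<in>C. order_ge p (D' p) F)} \<subseteq> complex_vector.span E" by blast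
  show ?case
  proof (cases "\<forall>F. homogeneous d F \<and> (\<forall>p\<in>C. order_ge p (D p) F) \<longrightarrow> order_ge p (D' p) F")
    case True
    then have "{F. homogeneous d F \<and> (\<forall>p\<in>C. order_ge p (D p) F)} \<subseteq> {F. homogeneous d F \<and> (\<forall>p\<in>C. order_ge p (D' p) F)}"
      by (auto simp: D'_def)
    then have "restrict_form ` {F. homogeneous d F \<and> (\<forall>p\<in>C. order_ge p (D p) F)} \<subseteq> complex_vector.span E"
      using E(3) by blast
    moreover have "card E \<le> (\<Sum>q\<in>P. order_at q B - D q) + 1" using E(2) s by simp
    ultimately show ?thesis using E(1) by blast
  next
    case False
    then obtain G where G: "homogeneous d G" "\<And>q. q \<in> C \<Longrightarrow> order_ge q (D q) G" "\<not> order_ge p (Suc (D p)) G"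
      by (auto simp: D'_def)
    then have Gp: "\<not> vanishes G" "order_at p G = D p" using pC by (auto simp: order_ge_def dest!: G(2))
    have "restrict_form F \<in> complex_vector.span (insert (restrict_form G) E)"
      if F: "homogeneous d F" "\<forall>q\<in>C. order_ge q (D q) F" for F
    proof -
      obtain c where c: "order_ge p (Suc (D p)) (F + c *\<^sub>C G)"
        using order_ge_codim[OF pC F(1) _ G(1) Gp] F(2) pC by blast
      have hom: "homogeneous d (F + c *\<^sub>C G)" by (intro homogeneous_add homogeneous_scale F G)
      have "order_ge q (D' q) (F + c *\<^sub>C G)" if "q \<in> C" for q
        using c order_ge_add[OF that F(1) _ G(1) G(2)[OF that]] F(2) that by (auto simp: D'_def)
      then have "restrict_form (F + c *\<^sub>C G) \<in> complex_vector.span E" using E(3) hom by blast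
      then have "restrict_form (F + c *\<^sub>C G) \<in> complex_vector.span (insert (restrict_form G) E)"
        using complex_vector.span_mono[of E "insert (restrict_form G) E"] by blast
      moreover have "c *\<^sub>C restrict_form G \<in> complex_vector.span (insert (restrict_form G) E)"
        by (intro complex_vector.span_scale complex_vector.span_base) simp
      ultimately have "restrict_form (F + c *\<^sub>C G) - c *\<^sub>C restrict_form G \<in> complex_vector.span (insert (restrict_form G) E)"
        by (rule complex_vector.span_diff)
      then show ?thesis by (simp only: restrict_form_linear add_diff_cancel_right')
    qed
    then have "restrict_form ` {F. homogeneous d F \<and> (\<forall>p\<in>C. order_ge p (D p) F)} \<subseteq>
        complex_vector.span (insert (restrict_form G) E)" by blast
    moreover have "card (insert (restrict_form G) E) \<le> (\<Sum>q\<in>P. order_at q B - D q) + 1"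
      using E(1,2) s by (simp add: card_insert_if)
    moreover have "finite (insert (restrict_form G) E)" using E(1) by simp
    ultimately show ?thesis by blast
  qed
qed

lemma forms_dimension_bound:
  assumes B: "homogeneous d B" "\<not> vanishes B"
  obtains E where "finite E" "card E \<le> form_degree B + 1"
    "\<forall>F. homogeneous d F \<longrightarrow> restrict_form F \<in> complex_vector.span E"
proof -
  have "finite {p \<in> C. order_at p B \<noteq> 0}" by (rule order_at_eq_0_outside[OF B])
  from forms_dimension_bound_aux[OF B this, of "\<lambda>_. 0"] obtain E
    where E: "finite E" "card E \<le> (\<Sum>p | p \<in> C \<and> order_at p B \<noteq> 0. order_at p B - 0) + 1"
      "restrict_form ` {F. homogeneous d F \<and> (\<forall>p\<in>C. order_ge p 0 F)} \<subseteq> complex_vector.span E" by auto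
  have "order_ge p 0 F" for p F by (simp add: order_ge_def)
  then have "\<forall>F. homogeneous d F \<longrightarrow> restrict_form F \<in> complex_vector.span E" using E(3) by blast
  moreover have "card E \<le> form_degree B + 1" using E(2) by (simp add: form_degree_def)
  ultimately show ?thesis using that E(1) by blast
qed

text \<open>Points are added one by one. In the pencil \<open>h + t g\<close>, with \<open>g\<close>
  nonzero at the new point, each point excludes at most one value of \<open>t\<close>.\<close>

lemma linear_form_avoiding:
  assumes "finite P" obtains h where "homogeneous 1 h" "\<forall>p\<in>P. h (rep p) \<noteq> 0"
proof -
  have "\<exists>h. homogeneous 1 h \<and> (\<forall>p\<in>P. h (rep p) \<noteq> 0)"
    using assms
  proof (induction P rule: finite_induct)
    case empty
    then show ?case using homogeneous_coord by blast
  next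
    case (insert p P)
    then obtain h where h: "homogeneous 1 h" "\<forall>p\<in>P. h (rep p) \<noteq> 0" by blast
    obtain g where g: "homogeneous 1 g" "g (rep p) \<noteq> 0" by (rule form_nonzero_at)
    have "finite ((\<lambda>q. - h (rep q) / g (rep q)) ` insert p P)" using insert by simp
    then obtain t where t: "t \<notin> (\<lambda>q. - h (rep q) / g (rep q)) ` insert p P"
      using ex_new_if_finite infinite_UNIV_char_0 by blast
    have "(h + t *\<^sub>C g) (rep q) \<noteq> 0" if "q \<in> insert p P" for q
    proof
      assume 0: "(h + t *\<^sub>C g) (rep q) = 0"
      then have "g (rep q) \<noteq> 0" using h(2) g(2) that by auto
      then have "t = - h (rep q) / g (rep q)"
        using 0 by (simp add: field_simps) (metis add.commute add_eq_0_iff)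
      then show False using t that by blast
    qed
    moreover have "homogeneous 1 (h + t *\<^sub>C g)" by (intro homogeneous_add homogeneous_scale h g)
    ultimately show ?case by blast
  qed
  then show ?thesis using that by blast
qed

text \<open>A product of powers of linear forms, each zero at one point of \<open>P\<close> but not
  at \<open>p\<close>.\<close>

lemma separating_form:
  assumes "finite P" "P \<subseteq> C" "p \<in> C" "p \<notin> P"
  shows "\<exists>e Z. homogeneous e Z \<and> Z (rep p) \<noteq> 0 \<and> (\<forall>q\<in>P. order_ge q (D q) Z)"
  using assms
proof (induction P rule: finite_induct)
  case empty
  show ?case by (rule exI[of _ 0], rule exI[of _ 1]) (simp add: homogeneous_one[unfolded one_fun_def] one_fun_def)
next
  case (insert q P)
  then obtain e Z where Z: "homogeneous e Z" "Z (rep p) \<noteq> 0" "\<forall>q\<in>P. order_ge q (D q) Z" by auto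
  obtain l where l: "homogeneous 1 l" "l (rep q) = 0" "l (rep p) \<noteq> 0"
    using separating_linear_form[of q p] insert.prems by blast
  have nl: "\<not> vanishes l" using l insert.prems by (auto simp: vanishes_def)
  have lD: "homogeneous (D q) (l ^ D q)" using homogeneous_power[OF l(1), of "D q"] by simp
  have "order_at q l \<noteq> 0" using order_at_eq_0_iff[of q 1 l] l nl insert.prems by simp
  then have "D q \<le> D q * order_at q l" by simp
  then have "order_ge q (D q) (l ^ D q)"
    using order_at_power[of q 1 l "D q"] l nl insert.prems by (simp add: order_ge_def)
  then have "order_ge q (D q) (l ^ D q * Z)" using order_ge_mult[OF _ lD _ Z(1)] insert.prems by simp
  moreover have "order_ge q' (D q') (Z * l ^ D q)" if "q' \<in> P" for q'
    using order_ge_mult[OF _ Z(1) _ lD] Z(3) that insert.prems by blast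
  ultimately have "\<forall>q'\<in>insert q P. order_ge q' (D q') (Z * l ^ D q)" by (simp add: mult.commute)
  moreover have "(Z * l ^ D q) (rep p) \<noteq> 0" using Z(2) l(3) by simp
  ultimately show ?case using homogeneous_mult[OF Z(1) lD] by blast
qed

text \<open>The conditions imposed by a divisor are independent on forms of some high degree. To
  raise the multiplicity at \<open>p\<close> from \<open>k\<close> to \<open>Suc k\<close>, a form
  \<open>T ^ k * Z\<close> of order exactly \<open>k\<close> at \<open>p\<close> is added, with
  \<open>Z\<close> vanishing sufficiently at the other points. Powers of \<open>h\<close>, which is
  nonzero on the divisor, bring old and new forms to a common degree without changing
  orders.\<close>

lemma independent_jets:
  assumes P: "finite P" "P \<subseteq> C"
  shows "n = (\<Sum>p\<in>P. D p) \<Longrightarrow> \<exists>e u. (\<forall>i<n. homogeneous e (u i)) \<and>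
    (\<forall>c. (\<forall>p\<in>P. order_ge p (D p) (\<Sum>i<n. c i *\<^sub>C u i)) \<longrightarrow> (\<forall>i<n. c i = 0))"
proof (induction n arbitrary: D)
  case 0
  then show ?case by simp
next
  case (Suc n)
  have "\<exists>p\<in>P. D p \<noteq> 0"
  proof (rule ccontr)
    assume "\<not> ?thesis"
    then have "(\<Sum>p\<in>P. D p) = 0" by simp
    then show False using Suc.prems by simp
  qed
  then obtain p k where p: "p \<in> P" "D p = Suc k" by (metis not0_implies_Suc)
  then have pC: "p \<in> C" using P(2) by blast
  define D' where "D' = D(p := k)"
  have "(\<Sum>q\<in>P - {p}. D q) = (\<Sum>q\<in>P - {p}. D' q)" by (rule sum.cong) (auto simp: D'_def)
  then have "(\<Sum>q\<in>P. D q) = Suc (\<Sum>q\<in>P. D' q)"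
    unfolding sum.remove[OF P(1) p(1), of D] sum.remove[OF P(1) p(1), of D'] p(2) by (simp add: D'_def)
  then have "n = (\<Sum>p\<in>P. D' p)" using Suc.prems by simp
  from Suc.IH[OF this] obtain e u where u: "\<forall>i<n. homogeneous e (u i)"
    "\<forall>c. (\<forall>p\<in>P. order_ge p (D' p) (\<Sum>i<n. c i *\<^sub>C u i)) \<longrightarrow> (\<forall>i<n. c i = 0)" by blast
  obtain h where h: "homogeneous 1 h" "\<forall>p\<in>P. h (rep p) \<noteq> 0" by (rule linear_form_avoiding[OF P(1)])
  have hk: "homogeneous m (h ^ m)" for m using homogeneous_power[OF h(1), of m] by simp
  obtain t T where U: "uniformizer p t T" using uniformizer_exists[OF pC] by blast
  then have T: "homogeneous t T" by (auto simp: uniformizer_def)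
  note nT = uniformizer_not_vanishes[OF pC U]
  obtain e' Z where Z: "homogeneous e' Z" "Z (rep p) \<noteq> 0" "\<forall>q\<in>P - {p}. order_ge q (D' q) Z"
    using separating_form[of "P - {p}" p D'] P pC by auto
  have nZ: "\<not> vanishes Z" using Z(2) pC by (auto simp: vanishes_def)
  define a where "a = k * t + e'"
  define w where "w = T ^ k * Z"
  have w: "homogeneous a w" unfolding a_def w_def by (intro homogeneous_mult homogeneous_power T Z)
  have Tk: "\<not> vanishes (T ^ k)" using vanishes_power[OF T] nT by blast
  have wn: "\<not> vanishes w"
    unfolding w_def using vanishes_mult_iff[OF homogeneous_power[OF T] Z(1)] Tk nZ by blast
  have "order_at p w = order_at p (T ^ k) + order_at p Z"
    unfolding w_def by (rule order_at_mult[OF pC homogeneous_power[OF T] Tk Z(1) nZ])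
  also have "order_at p Z = 0" using order_at_eq_0_iff[OF pC Z(1) nZ] Z(2) by simp
  also have "order_at p (T ^ k) = k" using order_at_power[OF pC T nT, of k] order_at_uniformizer[OF pC U] by simp
  finally have wp: "order_at p w = k" by simp
  have wD: "order_ge q (D' q) w" if "q \<in> P" for q
  proof (cases "q = p")
    case True
    then show ?thesis using wp by (simp add: order_ge_def D'_def)
  next
    case False
    then have "order_ge q (D' q) (Z * T ^ k)"
      using order_ge_mult[OF _ Z(1) _ homogeneous_power[OF T]] Z(3) that P(2) by blast
    then show ?thesis by (simp add: w_def mult.commute)
  qed
  define v where "v = (\<lambda>i. if i < n then u i * h ^ a else w * h ^ e)"
  have vh: "homogeneous (e + a) (v i)" for i
    using homogeneous_mult[OF _ hk, of e "u i" a] homogeneous_mult[OF w hk, of e] u(1)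
    by (auto simp: v_def add.commute)
  have "\<forall>i<Suc n. c i = 0" if c: "\<forall>p\<in>P. order_ge p (D p) (\<Sum>i<Suc n. c i *\<^sub>C v i)" for c
  proof -
    define S where "S = (\<Sum>i<n. c i *\<^sub>C u i)"
    have S: "homogeneous e S" unfolding S_def using u(1) by (intro homogeneous_sum homogeneous_scale) auto
    have "(\<Sum>i<n. c i *\<^sub>C v i) = S * h ^ a"
      unfolding S_def sum_distrib_right scaleC_mult_fun by (rule sum.cong) (auto simp: v_def)
    then have sum: "(\<Sum>i<Suc n. c i *\<^sub>C v i) = S * h ^ a + c n *\<^sub>C (w * h ^ e)"
      by (simp only: sum.lessThan_Suc) (simp add: v_def)
    have Sh: "homogeneous (e + a) (S * h ^ a)" and wh: "homogeneous (e + a) (w * h ^ e)"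
      using homogeneous_mult[OF S hk, of a] homogeneous_mult[OF w hk, of e] by (simp_all add: add.commute)
    \<comment> \<open>The new form meets the smaller divisor \<open>D'\<close>, so its term may be
      subtracted; the induction hypothesis then removes all old coefficients.\<close>
    have "order_ge q (D' q) S" if q: "q \<in> P" for q
    proof -
      have qC: "q \<in> C" using q P(2) by blast
      have "order_ge q (D q) (S * h ^ a + c n *\<^sub>C (w * h ^ e))"
        using c q unfolding sum by (rule bspec)
      moreover have "D' q \<le> D q" by (simp add: D'_def p)
      ultimately have 1: "order_ge q (D' q) (S * h ^ a + c n *\<^sub>C (w * h ^ e))" by (rule order_ge_mono)
      have 2: "order_ge q (D' q) (w * h ^ e)" by (rule order_ge_mult[OF qC w wD[OF q] hk])
      have "order_ge q (D' q) ((S * h ^ a + c n *\<^sub>C (w * h ^ e)) + (- c n) *\<^sub>C (w * h ^ e))"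
        by (rule order_ge_add[OF qC homogeneous_add[OF Sh homogeneous_scale[OF wh]] 1 wh 2])
      also have "(S * h ^ a + c n *\<^sub>C (w * h ^ e)) + (- c n) *\<^sub>C (w * h ^ e) = S * h ^ a"
        by (simp add: fun_eq_iff)
      finally have 3: "order_ge q (D' q) (S * h ^ a)" .
      have ha: "(h ^ a) (rep q) \<noteq> 0" using h(2) q by simp
      from 3 show ?thesis unfolding order_ge_mult_unit[OF qC S hk[of a] ha] .
    qed
    then have c0: "\<forall>i<n. c i = 0" using u(2) unfolding S_def by blast
    \<comment> \<open>Only the new term is left, and its order at \<open>p\<close> is
      \<open>k\<close>, too small for the required \<open>Suc k\<close>.\<close>
    have "c n = 0"
    proof (rule ccontr)
      assume cn: "c n \<noteq> 0"
      have "S = 0" unfolding S_def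
      proof (rule sum.neutral, rule ballI)
        fix i assume "i \<in> {..<n}"
        then have "c i = 0" using c0 by blast
        then show "c i *\<^sub>C u i = 0" by (simp only: complex_vector.scale_zero_left)
      qed
      then have "S * h ^ a + c n *\<^sub>C (w * h ^ e) = c n *\<^sub>C (w * h ^ e)"
        by (simp only: mult_zero_left add_0_left)
      moreover have "order_ge p (D p) (S * h ^ a + c n *\<^sub>C (w * h ^ e))"
        using c p(1) unfolding sum by (rule bspec)
      ultimately have "order_ge p (Suc k) (c n *\<^sub>C (w * h ^ e))" by (simp only: p(2))
      from order_ge_scale[OF pC homogeneous_scale[OF wh] this, of "1 / c n"]
      have 4: "order_ge p (Suc k) (w * h ^ e)" using cn by (simp only: scaleC_scaleC) (simp only: scaleC_one nonzero_divide_eq_eq divide_self_if times_divide_eq_left mult_1_left if_False)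
      have he: "(h ^ e) (rep p) \<noteq> 0" using h(2) p(1) by simp
      from 4 have "order_ge p (Suc k) w" unfolding order_ge_mult_unit[OF pC w hk[of e] he] .
      then show False using wn wp by (simp add: order_ge_def)
    qed
    then show ?thesis using c0 by (simp add: less_Suc_eq)
  qed
  then show ?case using vh by blast
qed

lemma form_degree_le:
  assumes F: "homogeneous d F" "\<not> vanishes F" and G: "homogeneous d G" "\<not> vanishes G"
    and disj: "\<And>p. p \<in> C \<Longrightarrow> F (rep p) = 0 \<Longrightarrow> G (rep p) \<noteq> 0"
  shows "form_degree F \<le> form_degree G"
proof -
  define P where "P = {p \<in> C. order_at p F \<noteq> 0}"
  have P: "finite P" "P \<subseteq> C" unfolding P_def using order_at_eq_0_outside[OF F] by auto
  define n where "n = form_degree F"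
  have "n = (\<Sum>p\<in>P. order_at p F)" unfolding n_def form_degree_def P_def ..
  from independent_jets[OF P this] obtain e u where u: "\<forall>i<n. homogeneous e (u i)"
    "\<forall>c. (\<forall>p\<in>P. order_ge p (order_at p F) (\<Sum>i<n. c i *\<^sub>C u i)) \<longrightarrow> (\<forall>i<n. c i = 0)" by blast
  obtain p where p: "p \<in> C" using infinite_curve by (metis ex_in_conv finite.emptyI)
  obtain h where h: "homogeneous 1 h" "h (rep p) \<noteq> 0" by (rule form_nonzero_at)
  have nh: "\<not> vanishes h" using h(2) p by (auto simp: vanishes_def)
  have he: "homogeneous e (h ^ e)" "\<not> vanishes (h ^ e)"
    using homogeneous_power[OF h(1), of e] vanishes_power[OF h(1)] nh by auto
  \<comment> \<open>The right side bounds the dimension of the forms of degree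
    \<open>e + k * d\<close> on \<open>C\<close>: it is one more than the degree of the comparison
    form \<open>h ^ e * G ^ k\<close>.\<close>
  have "n * (k + 1) \<le> k * form_degree G + (e * form_degree h + 1)" for k
  proof (rule ccontr)
    assume contr: "\<not> ?thesis"
    have Gk: "homogeneous (k * d) (G ^ k)" "\<not> vanishes (G ^ k)"
      using homogeneous_power[OF G(1)] vanishes_power[OF G(1)] G(2) by blast+
    define B where "B = h ^ e * G ^ k"
    have B: "homogeneous (e + k * d) B" "\<not> vanishes B"
      unfolding B_def using homogeneous_mult[OF he(1) Gk(1)] vanishes_mult_iff[OF he(1) Gk(1)] he Gk by blast+
    have degB: "form_degree B = e * form_degree h + k * form_degree G"
      unfolding B_def form_degree_mult[OF he Gk] form_degree_power[OF h(1) nh] form_degree_power[OF G] ..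
    obtain E where E: "finite E" "card E \<le> form_degree B + 1"
      "\<forall>F. homogeneous (e + k * d) F \<longrightarrow> restrict_form F \<in> complex_vector.span E"
      by (rule forms_dimension_bound[OF B])
    define w where "w = (\<lambda>(i, j). u i * (F ^ j * G ^ (k - j)))"
    have FG: "homogeneous (k * d) (F ^ j * G ^ (k - j))" if "j \<le> k" for j
      by (rule homogeneous_cong_degree[OF homogeneous_mult[OF homogeneous_power[OF F(1)] homogeneous_power[OF G(1)]]])
        (use that in \<open>simp add: distrib_right[symmetric]\<close>)
    have w: "homogeneous (e + k * d) (w x)" if "x \<in> {..<n} \<times> {..k}" for x
      using that u(1) homogeneous_mult[OF _ FG] by (auto simp: w_def)
    have "card E < card ({..<n} \<times> {..k})" using E(2) contr degB by (simp add: card_cartesian_product)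
    from linear_relation[of "{..<n} \<times> {..k}" E "\<lambda>x. restrict_form (w x)", OF _ E(1) E(3)[rule_format, OF w] this]
    obtain c where c: "\<exists>x\<in>{..<n} \<times> {..k}. c x \<noteq> 0" "(\<Sum>x\<in>{..<n} \<times> {..k}. c x *\<^sub>C restrict_form (w x)) = 0"
      by auto
    define S where "S = (\<lambda>j. \<Sum>i<n. c (i, j) *\<^sub>C u i)"
    have S: "homogeneous e (S j)" for j
      unfolding S_def using u(1) by (intro homogeneous_sum homogeneous_scale) auto
    have rel: "(\<Sum>j\<le>k. S j (rep q) * (F (rep q) ^ j * G (rep q) ^ (k - j))) = 0" if "q \<in> C" for q
    proof -
      have "0 = (\<Sum>x\<in>{..<n} \<times> {..k}. c x *\<^sub>C restrict_form (w x)) q" using c(2) by simp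
      also have "\<dots> = (\<Sum>i<n. \<Sum>j\<le>k. c (i, j) * (u i (rep q) * (F (rep q) ^ j * G (rep q) ^ (k - j))))"
        using that by (simp add: sum.cartesian_product' restrict_form_def w_def)
      also have "\<dots> = (\<Sum>j\<le>k. \<Sum>i<n. c (i, j) * (u i (rep q) * (F (rep q) ^ j * G (rep q) ^ (k - j))))"
        by (rule sum.swap)
      finally show ?thesis by (simp add: S_def sum_distrib_right mult.assoc)
    qed
    \<comment> \<open>Induction from the lowest power of \<open>F\<close> upwards: once the lower
      terms are gone, \<open>F ^ j\<close> cancels, and \<open>S j * G ^ (k - j)\<close> is a
      multiple of \<open>F\<close> on \<open>C\<close>. As \<open>G\<close> is nonzero at the zeros
      of \<open>F\<close>, already \<open>S j\<close> vanishes along the divisor of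
      \<open>F\<close>, and independence of the \<open>u i\<close> applies.\<close>
    have "\<forall>i<n. c (i, j) = 0" if "j \<le> k" for j
      using that
    proof (induction j rule: less_induct)
      case (less j)
      have S0: "S j' (rep q) = 0" if "j' < j" for j' q
        using less.IH[OF that] less.prems that by (simp add: S_def)
      define R where "R = (\<Sum>i<k - j. S (Suc (j + i)) * (F ^ i * G ^ (k - j - Suc i)))"
      have Rh: "homogeneous (e + (k - j - 1) * d) R"
        unfolding R_def
      proof (intro homogeneous_sum)
        fix i assume "i \<in> {..<k - j}"
        then have "i + (k - j - Suc i) = k - j - 1" by auto
        then have "i * d + (k - j - Suc i) * d = (k - j - 1) * d" by (metis distrib_right)
        then have "homogeneous ((k - j - 1) * d) (F ^ i * G ^ (k - j - Suc i))"
          using homogeneous_mult[OF homogeneous_power[OF F(1)] homogeneous_power[OF G(1)], of i "k - j - Suc i"] by (simp only:)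
        then show "homogeneous (e + (k - j - 1) * d) (S (Suc (j + i)) * (F ^ i * G ^ (k - j - Suc i)))"
          by (intro homogeneous_mult S)
      qed
      have SG: "homogeneous (e + (k - j) * d) (S j * G ^ (k - j))" by (intro homogeneous_mult S homogeneous_power G)
      have key: "F (rep q) ^ j * (S j (rep q) * G (rep q) ^ (k - j) + F (rep q) * R (rep q)) = 0" if q: "q \<in> C" for q
      proof -
        have "(\<Sum>j\<le>k. S j (rep q) * (F (rep q) ^ j * G (rep q) ^ (k - j))) =
            (\<Sum>i\<le>k - j. S (j + i) (rep q) * (F (rep q) ^ (j + i) * G (rep q) ^ (k - (j + i))))"
        proof (rule sum.mono_neutral_cong_left[symmetric, of "{..k}" "{j..k}", THEN trans])
          show "(\<Sum>i = j..k. S i (rep q) * (F (rep q) ^ i * G (rep q) ^ (k - i))) =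
            (\<Sum>i\<le>k - j. S (j + i) (rep q) * (F (rep q) ^ (j + i) * G (rep q) ^ (k - (j + i))))"
            by (rule sum.reindex_bij_witness[of _ "\<lambda>i. j + i" "\<lambda>i. i - j"]) (use less.prems in auto)
        qed (use S0 in auto)
        also have "\<dots> = (\<Sum>i\<le>k - j. F (rep q) ^ j * (S (j + i) (rep q) * (F (rep q) ^ i * G (rep q) ^ (k - j - i))))"
          by (rule sum.cong) (auto simp: power_add)
        also have "\<dots> = F (rep q) ^ j * (\<Sum>i\<le>k - j. S (j + i) (rep q) * (F (rep q) ^ i * G (rep q) ^ (k - j - i)))"
          by (simp only: sum_distrib_left)
        also have "(\<Sum>i\<le>k - j. S (j + i) (rep q) * (F (rep q) ^ i * G (rep q) ^ (k - j - i))) =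
            S j (rep q) * G (rep q) ^ (k - j) + F (rep q) * R (rep q)"
          by (simp add: sum.atMost_shift R_def sum_distrib_left algebra_simps)
        finally show ?thesis using rel[OF q] by simp
      qed
      have ge: "order_ge p (order_at p F) (S j)" if p: "p \<in> P" for p
      proof -
        have pC: "p \<in> C" using p P by blast
        have Fp: "F (rep p) = 0" using p order_at_eq_0_iff[OF pC F] by (auto simp: P_def)
        have Gp: "(G ^ (k - j)) (rep p) \<noteq> 0" using disj[OF pC Fp] by simp
        have ge0: "order_ge p (order_at p F) (S j * G ^ (k - j))"
        proof (cases "k = j")
          case True
          then have "R = 0" by (simp add: R_def)
          then have "vanishes (F ^ j) \<or> vanishes (S j * G ^ (k - j))"
            using key by (intro vanishes_mult[OF homogeneous_power[OF F(1)] SG]) simp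
          then show ?thesis using vanishes_power[OF F(1)] F(2) by (auto simp: order_ge_def)
        next
          case False
          then have deg: "e + (k - j) * d = d + (e + (k - j - 1) * d)"
            using less.prems by (metis add.left_commute add_diff_inverse_nat diff_is_0_eq le_antisym less_one mult_1 distrib_right)
          have FR: "homogeneous (e + (k - j) * d) (F * R)" unfolding deg by (intro homogeneous_mult F Rh)
          have "vanishes (F ^ j) \<or> vanishes (S j * G ^ (k - j) + F * R)"
            using key by (intro vanishes_mult[OF homogeneous_power[OF F(1)] homogeneous_add[OF SG FR]]) simp
          then have v: "vanishes (S j * G ^ (k - j) + F * R)" using vanishes_power[OF F(1)] F(2) by blast
          have "order_ge p (order_at p F) F" by (simp add: order_ge_def)
          from order_ge_scale[OF pC FR order_ge_mult[OF pC F(1) this Rh], of "- 1"]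
          show ?thesis
          proof (rule order_ge_cong[OF pC homogeneous_scale[OF FR] SG, rotated])
            fix q assume "q \<in> C"
            then show "((- 1) *\<^sub>C (F * R)) (rep q) = (S j * G ^ (k - j)) (rep q)"
              using v by (simp add: vanishes_def) (metis add.commute add_eq_0_iff)
          qed
        qed
        then show ?thesis
          using order_ge_mult_unit[OF pC S homogeneous_power[OF G(1)] Gp] by blast
      qed
      have "\<forall>p\<in>P. order_ge p (order_at p F) (\<Sum>i<n. c (i, j) *\<^sub>C u i)"
        using ge unfolding S_def by (rule ballI)
      with u(2)[THEN spec, of "\<lambda>i. c (i, j)"] show ?case by (rule mp)
    qed
    then show False using c(1) by auto
  qed
  \<comment> \<open>With this value for \<open>k\<close> the bound becomes
    \<open>n * (k + 1) \<le> k * (form_degree G + 1)\<close>, which rules out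
    \<open>n > form_degree G\<close>.\<close>
  from this[of "e * form_degree h + 1"]
  have "n * (e * form_degree h + 2) \<le> (e * form_degree h + 1) * (form_degree G + 1)" by (simp add: algebra_simps)
  show ?thesis
  proof (rule ccontr)
    assume "\<not> form_degree F \<le> form_degree G"
    then have "form_degree G + 1 \<le> n" by (simp add: n_def)
    then have "(form_degree G + 1) * (e * form_degree h + 2) \<le> n * (e * form_degree h + 2)" by (rule mult_le_mono1)
    then show False using \<open>n * (e * form_degree h + 2) \<le> _\<close> by (simp add: algebra_simps)
  qed
qed

section \<open>Independence of the form: the degree of the curve\<close>

definition hyperplane_degree :: nat
  where "hyperplane_degree = form_degree (SOME h. homogeneous 1 h \<and> \<not> vanishes h)"

lemma form_degree_eq_disjoint:
  assumes F: "homogeneous d F" "\<not> vanishes F" and G: "homogeneous d G" "\<not> vanishes G"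
    and disj: "\<And>p. p \<in> C \<Longrightarrow> F (rep p) = 0 \<Longrightarrow> G (rep p) \<noteq> 0"
  shows "form_degree F = form_degree G"
  using form_degree_le[OF F G disj] form_degree_le[OF G F] disj by (metis order_antisym)

text \<open>Disjoint zeros are arranged by an auxiliary linear form that avoids finitely many given
  points. Hence all linear forms have the same degree, and \<open>F\<close> can be compared with the
  \<open>d\<close>-th power of a suitable one.\<close>

theorem form_degree_homogeneous:
  assumes F: "homogeneous d F" "\<not> vanishes F"
  shows "form_degree F = d * hyperplane_degree"
proof -
  obtain p where p: "p \<in> C" using infinite_curve by (metis ex_in_conv finite.emptyI)
  have lin: "form_degree h = form_degree h'"
    if h: "homogeneous 1 h" "\<not> vanishes h" "homogeneous 1 h'" "\<not> vanishes h'" for h h'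
  proof -
    have "finite ({q \<in> C. h (rep q) = 0} \<union> {q \<in> C. h' (rep q) = 0} \<union> {p})"
      using finite_zeros h by auto
    then obtain g where g: "homogeneous 1 g" "\<forall>q\<in>{q \<in> C. h (rep q) = 0} \<union> {q \<in> C. h' (rep q) = 0} \<union> {p}. g (rep q) \<noteq> 0"
      by (rule linear_form_avoiding)
    then have "\<not> vanishes g" using p by (auto simp: vanishes_def)
    then show ?thesis
      using form_degree_eq_disjoint[OF h(1,2) g(1)] form_degree_eq_disjoint[OF h(3,4) g(1)] g(2) by auto
  qed
  have "finite ({q \<in> C. F (rep q) = 0} \<union> {p})" using finite_zeros[OF F] by simp
  then obtain h where h: "homogeneous 1 h" "\<forall>q\<in>{q \<in> C. F (rep q) = 0} \<union> {p}. h (rep q) \<noteq> 0"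
    by (rule linear_form_avoiding)
  then have nh: "\<not> vanishes h" using p by (auto simp: vanishes_def)
  have hd: "homogeneous d (h ^ d)" "\<not> vanishes (h ^ d)"
    using homogeneous_power[OF h(1), of d] vanishes_power[OF h(1)] nh by auto
  have "form_degree F = form_degree (h ^ d)"
    by (rule form_degree_eq_disjoint[OF F hd]) (use h(2) in auto)
  also have "\<dots> = d * form_degree h" by (rule form_degree_power[OF h(1) nh])
  also have "form_degree h = hyperplane_degree"
    unfolding hyperplane_degree_def
    using someI[of "\<lambda>h. homogeneous 1 h \<and> \<not> vanishes h" h] h(1) nh by (intro lin) auto
  finally show ?thesis .
qed

lemma hyperplane_degree_pos: "hyperplane_degree > 0"
proof -
  obtain p where p: "p \<in> C" using infinite_curve by (metis ex_in_conv finite.emptyI)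
  have "infinite (C - {p})" using infinite_curve by simp
  then obtain q where q: "q \<in> C" "q \<noteq> p" by (metis Diff_iff ex_in_conv finite.emptyI singletonI)
  obtain l where l: "homogeneous 1 l" "l (rep p) = 0" "l (rep q) \<noteq> 0"
    using separating_linear_form[of p q] q by metis
  have nl: "\<not> vanishes l" using l q by (auto simp: vanishes_def)
  have "order_at p l \<noteq> 0" using order_at_eq_0_iff[OF p l(1) nl] l(2) by simp
  then have "form_degree l \<noteq> 0"
    unfolding form_degree_def using p order_at_eq_0_outside[OF l(1) nl] by auto
  then show ?thesis using form_degree_homogeneous[OF l(1) nl] by simp
qed

lemma linear_form_has_zero:
  assumes "homogeneous 1 h" "\<not> vanishes h" shows "\<exists>p\<in>C. h (rep p) = 0"
proof (rule ccontr)
  assume "\<not> ?thesis"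
  then have "form_degree h = 0"
    unfolding form_degree_def using order_at_eq_0_iff[OF _ assms] by (intro sum.neutral) auto
  then show False using form_degree_homogeneous[OF assms] hyperplane_degree_pos by simp
qed

end

section \<open>Regular functions\<close>

lemma regular_on_mono:
  assumes "regular_on C U f" "zariski_open_in C W" "W \<subseteq> U" shows "regular_on C W f"
proof (rule regular_onI)
  fix p assume p: "p \<in> W"
  then have "p \<in> U" using assms(3) by blast
  with assms(1) obtain W' d F G where W': "zariski_open_in C W'" "p \<in> W'" "W' \<subseteq> U" "homogeneous d F" "homogeneous d G"
    "\<forall>q\<in>W'. G (rep q) \<noteq> 0 \<and> f q = F (rep q) / G (rep q)" by (rule regular_onE)
  show "\<exists>W' d F G. zariski_open_in C W' \<and> p \<in> W' \<and> W' \<subseteq> W \<and> homogeneous d F \<and>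
    homogeneous d G \<and> (\<forall>q\<in>W'. G (rep q) \<noteq> 0 \<and> f q = F (rep q) / G (rep q))"
    by (rule exI[of _ "W' \<inter> W"], rule exI[of _ d], rule exI[of _ F], rule exI[of _ G])
      (use W' p open_in_Int[OF W'(1) assms(2)] in auto)
qed

lemma regular_on_cong:
  assumes "\<And>q. q \<in> U \<Longrightarrow> f q = g q" shows "regular_on C U f \<longleftrightarrow> regular_on C U g"
proof -
  have "regular_on C U g" if f: "regular_on C U f" and eq: "\<And>q. q \<in> U \<Longrightarrow> f q = g q" for f g
  proof (rule regular_onI)
    fix p assume "p \<in> U"
    with f obtain W' d F G where W': "zariski_open_in C W'" "p \<in> W'" "W' \<subseteq> U" "homogeneous d F" "homogeneous d G"
      "\<forall>q\<in>W'. G (rep q) \<noteq> 0 \<and> f q = F (rep q) / G (rep q)" by (rule regular_onE)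
    have "\<forall>q\<in>W'. G (rep q) \<noteq> 0 \<and> g q = F (rep q) / G (rep q)"
      using W'(3,6) eq by (metis subsetD)
    then show "\<exists>W' d F G. zariski_open_in C W' \<and> p \<in> W' \<and> W' \<subseteq> U \<and> homogeneous d F \<and>
      homogeneous d G \<and> (\<forall>q\<in>W'. G (rep q) \<noteq> 0 \<and> g q = F (rep q) / G (rep q))"
      by (intro exI[of _ W'] exI[of _ d] exI[of _ F] exI[of _ G] conjI W'(1-5))
  qed
  from this[of f g] this[of g f] show ?thesis using assms by auto
qed

lemma regular_on_local:
  assumes "\<And>p. p \<in> U \<Longrightarrow> \<exists>W. zariski_open_in C W \<and> p \<in> W \<and> W \<subseteq> U \<and> regular_on C W f"
  shows "regular_on C U f"
proof (rule regular_onI)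
  fix p assume "p \<in> U"
  then obtain W where W: "zariski_open_in C W" "p \<in> W" "W \<subseteq> U" "regular_on C W f" using assms by blast
  obtain W' d F G where W': "zariski_open_in C W'" "p \<in> W'" "W' \<subseteq> W" "homogeneous d F" "homogeneous d G"
    "\<forall>q\<in>W'. G (rep q) \<noteq> 0 \<and> f q = F (rep q) / G (rep q)" using W(4,2) by (rule regular_onE)
  then show "\<exists>W d F G. zariski_open_in C W \<and> p \<in> W \<and> W \<subseteq> U \<and> homogeneous d F \<and>
    homogeneous d G \<and> (\<forall>q\<in>W. G (rep q) \<noteq> 0 \<and> f q = F (rep q) / G (rep q))"
    using W(3) by (intro exI[of _ W'] exI[of _ d] exI[of _ F] exI[of _ G]) auto
qed

lemma regular_on_const: "zariski_open_in C U \<Longrightarrow> regular_on C U (\<lambda>_. c)"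
  by (rule regular_on_quotient[OF _ homogeneous_const[of c] homogeneous_const[of 1]]) auto

lemma regular_on_add:
  assumes "regular_on C U f" "regular_on C U g" shows "regular_on C U (\<lambda>q. f q + g q)"
proof (rule regular_onI)
  fix p assume p: "p \<in> U"
  obtain W d F G where 1: "zariski_open_in C W" "p \<in> W" "W \<subseteq> U" "homogeneous d F" "homogeneous d G"
    "\<forall>q\<in>W. G (rep q) \<noteq> 0 \<and> f q = F (rep q) / G (rep q)" using assms(1) p by (rule regular_onE)
  obtain W' d' F' G' where 2: "zariski_open_in C W'" "p \<in> W'" "W' \<subseteq> U" "homogeneous d' F'" "homogeneous d' G'"
    "\<forall>q\<in>W'. G' (rep q) \<noteq> 0 \<and> g q = F' (rep q) / G' (rep q)" using assms(2) p by (rule regular_onE)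
  have "homogeneous (d + d') (F' * G)"
    by (rule homogeneous_cong_degree[OF homogeneous_mult[OF 2(4) 1(5)]]) simp
  then have h: "homogeneous (d + d') (F * G' + F' * G)"
    by (intro homogeneous_add homogeneous_mult[OF 1(4) 2(5)])
  have h': "homogeneous (d + d') (G * G')" by (rule homogeneous_mult[OF 1(5) 2(5)])
  have eq: "\<forall>q\<in>W \<inter> W'. (G * G') (rep q) \<noteq> 0 \<and> f q + g q = (F * G' + F' * G) (rep q) / (G * G') (rep q)"
    using 1(6) 2(6) by (auto simp: field_simps)
  show "\<exists>W d F G. zariski_open_in C W \<and> p \<in> W \<and> W \<subseteq> U \<and> homogeneous d F \<and>
    homogeneous d G \<and> (\<forall>q\<in>W. G (rep q) \<noteq> 0 \<and> f q + g q = F (rep q) / G (rep q))"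
    by (rule exI[of _ "W \<inter> W'"], rule exI[of _ "d + d'"], rule exI[of _ "F * G' + F' * G"], rule exI[of _ "G * G'"])
      (intro conjI open_in_Int 1(1,2) 2(1,2) IntI le_infI1[OF 1(3)] h h' eq)
qed

lemma regular_on_mult:
  assumes "regular_on C U f" "regular_on C U g" shows "regular_on C U (\<lambda>q. f q * g q)"
proof (rule regular_onI)
  fix p assume p: "p \<in> U"
  obtain W d F G where 1: "zariski_open_in C W" "p \<in> W" "W \<subseteq> U" "homogeneous d F" "homogeneous d G"
    "\<forall>q\<in>W. G (rep q) \<noteq> 0 \<and> f q = F (rep q) / G (rep q)" using assms(1) p by (rule regular_onE)
  obtain W' d' F' G' where 2: "zariski_open_in C W'" "p \<in> W'" "W' \<subseteq> U" "homogeneous d' F'" "homogeneous d' G'"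
    "\<forall>q\<in>W'. G' (rep q) \<noteq> 0 \<and> g q = F' (rep q) / G' (rep q)" using assms(2) p by (rule regular_onE)
  have h: "homogeneous (d + d') (F * F')" "homogeneous (d + d') (G * G')"
    by (intro homogeneous_mult[OF 1(4) 2(4)] homogeneous_mult[OF 1(5) 2(5)])+
  have eq: "\<forall>q\<in>W \<inter> W'. (G * G') (rep q) \<noteq> 0 \<and> f q * g q = (F * F') (rep q) / (G * G') (rep q)"
    using 1(6) 2(6) by auto
  show "\<exists>W d F G. zariski_open_in C W \<and> p \<in> W \<and> W \<subseteq> U \<and> homogeneous d F \<and>
    homogeneous d G \<and> (\<forall>q\<in>W. G (rep q) \<noteq> 0 \<and> f q * g q = F (rep q) / G (rep q))"
    by (rule exI[of _ "W \<inter> W'"], rule exI[of _ "d + d'"], rule exI[of _ "F * F'"], rule exI[of _ "G * G'"])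
      (intro conjI open_in_Int 1(1,2) 2(1,2) IntI le_infI1[OF 1(3)] h eq)
qed

lemma regular_on_sum:
  "zariski_open_in C U \<Longrightarrow> (\<And>i. i \<in> I \<Longrightarrow> regular_on C U (f i)) \<Longrightarrow> regular_on C U (\<lambda>q. \<Sum>i\<in>I. f i q)"
  by (induction I rule: infinite_finite_induct) (auto intro: regular_on_const regular_on_add)

lemma regular_on_prod:
  "zariski_open_in C U \<Longrightarrow> (\<And>i. i \<in> I \<Longrightarrow> regular_on C U (f i)) \<Longrightarrow> regular_on C U (\<lambda>q. \<Prod>i\<in>I. f i q)"
  by (induction I rule: infinite_finite_induct) (auto intro: regular_on_const regular_on_mult)

lemma regular_on_diff:
  assumes "zariski_open_in C U" "regular_on C U f" "regular_on C U g"
  shows "regular_on C U (\<lambda>q. f q - g q)"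
  using regular_on_add[OF assms(2) regular_on_mult[OF regular_on_const[OF assms(1), of "- 1"] assms(3)]] by simp

lemma regular_on_power:
  "zariski_open_in C U \<Longrightarrow> regular_on C U f \<Longrightarrow> regular_on C U (\<lambda>q. f q ^ n)"
  by (induction n) (auto intro: regular_on_const regular_on_mult)

lemma regular_on_det:
  assumes U: "zariski_open_in C U" and a: "\<And>i j. i < r \<Longrightarrow> j < r \<Longrightarrow> regular_on C U (a i j)"
  shows "regular_on C U (\<lambda>q. det (mat r r (\<lambda>(i, j). a i j q)))"
proof -
  have "regular_on C U (\<lambda>q. \<Sum>\<sigma> | \<sigma> permutes {0..<r}. signof \<sigma> * (\<Prod>i = 0..<r. a i (\<sigma> i) q))"
  proof (intro regular_on_sum[OF U] regular_on_mult regular_on_const[OF U] regular_on_prod[OF U])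
    fix \<sigma> i assume "\<sigma> \<in> {\<sigma>. \<sigma> permutes {0..<r}}" "i \<in> {0..<r}"
    then show "regular_on C U (a i (\<sigma> i))" using permutes_in_image[of \<sigma> "{0..<r}" i] by (intro a) auto
  qed
  moreover have "det (mat r r (\<lambda>(i, j). a i j q)) =
      (\<Sum>\<sigma> | \<sigma> permutes {0..<r}. signof \<sigma> * (\<Prod>i = 0..<r. a i (\<sigma> i) q))" for q
    unfolding det_def'[OF mat_carrier]
  proof (rule sum.cong[OF refl])
    fix \<sigma> assume "\<sigma> \<in> {\<sigma>. \<sigma> permutes {0..<r}}"
    then have "mat r r (\<lambda>(i, j). a i j q) $$ (i, \<sigma> i) = a i (\<sigma> i) q" if "i \<in> {0..<r}" for i
      using permutes_in_image[of \<sigma> "{0..<r}" i] that by auto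
    then have "(\<Prod>i = 0..<r. mat r r (\<lambda>(i, j). a i j q) $$ (i, \<sigma> i)) = (\<Prod>i = 0..<r. a i (\<sigma> i) q)"
      by (intro prod.cong refl)
    then show "signof \<sigma> * (\<Prod>i = 0..<r. mat r r (\<lambda>(i, j). a i j q) $$ (i, \<sigma> i)) =
        signof \<sigma> * (\<Prod>i = 0..<r. a i (\<sigma> i) q)"
      by (simp only:)
  qed
  ultimately show ?thesis by simp
qed

section \<open>Orders of rational functions\<close>

context curve
begin

text \<open>Near \<open>p\<close> the function is a quotient of forms. The numerator vanishes on a
  nonempty open set, hence on all of \<open>C\<close>.\<close>

lemma regular_zero:
  assumes f: "regular_on C U f" and W: "opn W" "W \<noteq> {}" "W \<subseteq> U" "\<And>q. q \<in> W \<Longrightarrow> f q = 0" and p: "p \<in> U"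
  shows "f p = 0"
proof -
  obtain W' d F G where 1: "opn W'" "p \<in> W'" "W' \<subseteq> U" "homogeneous d F" "homogeneous d G"
    "\<forall>q\<in>W'. G (rep q) \<noteq> 0 \<and> f q = F (rep q) / G (rep q)" using f p by (rule regular_onE)
  have "W' \<inter> W \<noteq> {}" using open_meet 1 W by blast
  moreover have "F (rep q) = 0" if "q \<in> W' \<inter> W" for q using 1(6) W(4) that by force
  ultimately have "vanishes F" by (intro vanishes_on_open[OF 1(4) open_in_Int[OF 1(1) W(1)]])
  then show ?thesis using 1 open_in_subset[OF 1(1)] by (auto simp: vanishes_def)
qed

text \<open>\<open>f\<close> agrees on a nonempty open set with a quotient of forms of equal degree, and \<open>k\<close> is the
  difference of their orders at \<open>p\<close>.\<close>

definition rational_order :: "'n proj \<Rightarrow> ('n proj \<Rightarrow> complex) \<Rightarrow> int \<Rightarrow> bool"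
  where "rational_order p f k \<longleftrightarrow> (\<exists>U d F G. opn U \<and> U \<noteq> {} \<and> homogeneous d F \<and> homogeneous d G \<and>
    \<not> vanishes F \<and> \<not> vanishes G \<and> (\<forall>q\<in>U. f q * G (rep q) = F (rep q)) \<and>
    k = int (order_at p F) - int (order_at p G))"

lemma rational_orderI:
  assumes "opn U" "U \<noteq> {}" "homogeneous d F" "homogeneous d G" "\<not> vanishes F" "\<not> vanishes G"
    "\<And>q. q \<in> U \<Longrightarrow> f q * G (rep q) = F (rep q)" "k = int (order_at p F) - int (order_at p G)"
  shows "rational_order p f k"
  unfolding rational_order_def using assms by (intro exI[of _ U] exI[of _ d] exI[of _ F] exI[of _ G]) auto

lemma rational_orderE:
  assumes "rational_order p f k"
  obtains U d F G where "opn U" "U \<noteq> {}" "homogeneous d F" "homogeneous d G" "\<not> vanishes F" "\<not> vanishes G"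
    "\<forall>q\<in>U. f q * G (rep q) = F (rep q)" "k = int (order_at p F) - int (order_at p G)"
  using assms unfolding rational_order_def by (elim exE conjE)

lemma rational_order_unique:
  assumes p: "p \<in> C" and f: "rational_order p f k" and g: "rational_order p g l"
    and W: "opn W" "W \<noteq> {}" "\<And>q. q \<in> W \<Longrightarrow> f q = g q"
  shows "k = l"
proof -
  obtain U d F G where 1: "opn U" "U \<noteq> {}" "homogeneous d F" "homogeneous d G" "\<not> vanishes F" "\<not> vanishes G"
    "\<forall>q\<in>U. f q * G (rep q) = F (rep q)" "k = int (order_at p F) - int (order_at p G)"
    using f by (rule rational_orderE)
  obtain U' d' F' G' where 2: "opn U'" "U' \<noteq> {}" "homogeneous d' F'" "homogeneous d' G'" "\<not> vanishes F'" "\<not> vanishes G'"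
    "\<forall>q\<in>U'. g q * G' (rep q) = F' (rep q)" "l = int (order_at p F') - int (order_at p G')"
    using g by (rule rational_orderE)
  have o: "opn (U \<inter> U' \<inter> W)" using 1 2 W open_in_Int by blast
  have "U \<inter> U' \<noteq> {}" using open_meet 1 2 by blast
  then have ne: "U \<inter> U' \<inter> W \<noteq> {}" using open_meet[OF open_in_Int[OF 1(1) 2(1)] W(1)] W(2) by blast
  have h: "homogeneous (d + d') (F * G')" "homogeneous (d + d') (G * F')"
    by (intro homogeneous_mult 1 2)+
  have eq: "(F * G') (rep q) = (G * F') (rep q)" if q: "q \<in> U \<inter> U' \<inter> W" for q
  proof -
    have "f q * G (rep q) = F (rep q)" "g q * G' (rep q) = F' (rep q)" "f q = g q" using 1(7) 2(7) W(3) q by auto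
    then show ?thesis by (metis times_fun_apply mult.commute mult.left_commute)
  qed
  have "F (rep q) * G' (rep q) = F' (rep q) * G (rep q)" if "q \<in> C" for q
    using equal_on_open[OF h o ne eq that] by (simp add: mult.commute)
  from order_at_cross[OF p 1(3,5) 1(4,6) 2(3,5) 2(4,6) this] show ?thesis using 1(8) 2(8) by simp
qed

lemma rational_order_mult:
  assumes p: "p \<in> C" and f: "rational_order p f k" and g: "rational_order p g l"
  shows "rational_order p (\<lambda>q. f q * g q) (k + l)"
proof -
  obtain U d F G where 1: "opn U" "U \<noteq> {}" "homogeneous d F" "homogeneous d G" "\<not> vanishes F" "\<not> vanishes G"
    "\<forall>q\<in>U. f q * G (rep q) = F (rep q)" "k = int (order_at p F) - int (order_at p G)"
    using f by (rule rational_orderE)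
  obtain U' d' F' G' where 2: "opn U'" "U' \<noteq> {}" "homogeneous d' F'" "homogeneous d' G'" "\<not> vanishes F'" "\<not> vanishes G'"
    "\<forall>q\<in>U'. g q * G' (rep q) = F' (rep q)" "l = int (order_at p F') - int (order_at p G')"
    using g by (rule rational_orderE)
  show ?thesis
  proof (rule rational_orderI[OF open_in_Int[OF 1(1) 2(1)] open_meet[OF 1(1) 2(1) 1(2) 2(2)]
        homogeneous_mult[OF 1(3) 2(3)] homogeneous_mult[OF 1(4) 2(4)]])
    show "\<not> vanishes (F * F')" "\<not> vanishes (G * G')"
      using vanishes_mult_iff[OF 1(3) 2(3)] vanishes_mult_iff[OF 1(4) 2(4)] 1 2 by blast+
    fix q assume q: "q \<in> U \<inter> U'"
    have "f q * G (rep q) = F (rep q)" "g q * G' (rep q) = F' (rep q)" using 1(7) 2(7) q by blast+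
    then have "F (rep q) * F' (rep q) = (f q * G (rep q)) * (g q * G' (rep q))" by (simp only:)
    then show "f q * g q * (G * G') (rep q) = (F * F') (rep q)" by (simp only: times_fun_apply mult_ac)
  next
    show "k + l = int (order_at p (F * F')) - int (order_at p (G * G'))"
      using order_at_mult[OF p 1(3,5) 2(3,5)] order_at_mult[OF p 1(4,6) 2(4,6)] 1(8) 2(8) by simp
  qed
qed

text \<open>Any two local quotients agree where their domains meet, and nonempty open sets always
  meet. So one pair of forms represents \<open>f\<close> on all of \<open>U\<close> once the
  division is cleared, even at zeros of \<open>G\<close>.\<close>

lemma regular_representation:
  assumes f: "regular_on C U f" "opn U" and r: "r \<in> U" "f r \<noteq> 0"
  obtains d F G where "homogeneous d F" "homogeneous d G" "\<not> vanishes F" "\<not> vanishes G" "G (rep r) \<noteq> 0"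
    "F (rep r) \<noteq> 0" "\<forall>q\<in>U. f q * G (rep q) = F (rep q)"
proof -
  obtain W d F G where 1: "opn W" "r \<in> W" "W \<subseteq> U" "homogeneous d F" "homogeneous d G"
    "\<forall>q\<in>W. G (rep q) \<noteq> 0 \<and> f q = F (rep q) / G (rep q)" using f(1) r(1) by (rule regular_onE)
  have "f q * G (rep q) = F (rep q)" if q: "q \<in> U" for q
  proof -
    obtain W' d' F' G' where 2: "opn W'" "q \<in> W'" "W' \<subseteq> U" "homogeneous d' F'" "homogeneous d' G'"
      "\<forall>q\<in>W'. G' (rep q) \<noteq> 0 \<and> f q = F' (rep q) / G' (rep q)" using f(1) q by (rule regular_onE)
    have ne: "W \<inter> W' \<noteq> {}" using open_meet 1 2 by blast
    have h: "homogeneous (d + d') (F * G')" "homogeneous (d + d') (G * F')"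
      by (intro homogeneous_mult 1 2)+
    have e: "(F * G') (rep x) = (G * F') (rep x)" if "x \<in> W \<inter> W'" for x
    proof -
      have "F (rep x) / G (rep x) = F' (rep x) / G' (rep x)" "G (rep x) \<noteq> 0" "G' (rep x) \<noteq> 0"
        using 1(6) 2(6) that by (metis Int_iff)+
      then show ?thesis by (simp add: field_simps)
    qed
    have qC: "q \<in> C" using open_in_subset[OF f(2)] q by blast
    have "(F * G') (rep q) = (G * F') (rep q)"
      using equal_on_open[OF h open_in_Int[OF 1(1) 2(1)] ne e qC] .
    then have FG: "F' (rep q) * G (rep q) = F (rep q) * G' (rep q)" by (simp add: mult.commute)
    have G': "G' (rep q) \<noteq> 0" "f q = F' (rep q) / G' (rep q)" using 2 by blast+
    then have "f q * G (rep q) = (F' (rep q) * G (rep q)) / G' (rep q)" by simp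
    then show ?thesis unfolding FG using G'(1) by simp
  qed
  moreover have "G (rep r) \<noteq> 0" "F (rep r) \<noteq> 0" using 1 r(2) by auto
  moreover have "r \<in> C" using open_in_subset[OF f(2)] r(1) by blast
  ultimately show ?thesis using that[of d F G] 1(4,5) unfolding vanishes_def by blast
qed

lemma rational_order_exists:
  assumes "regular_on C U f" "opn U" "r \<in> U" "f r \<noteq> 0"
  obtains k where "rational_order p f k"
proof -
  obtain d F G where "homogeneous d F" "homogeneous d G" "\<not> vanishes F" "\<not> vanishes G" "G (rep r) \<noteq> 0"
    "F (rep r) \<noteq> 0" "\<forall>q\<in>U. f q * G (rep q) = F (rep q)" using assms by (rule regular_representation)
  then show ?thesis using that rational_orderI[of U d F G f _ p] assms(2,3) by blast
qed

lemma rational_order_unit: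
  assumes "regular_on C U f" "opn U" "p \<in> U" "f p \<noteq> 0"
  shows "rational_order p f 0"
proof -
  obtain d F G where 1: "homogeneous d F" "homogeneous d G" "\<not> vanishes F" "\<not> vanishes G" "G (rep p) \<noteq> 0"
    "F (rep p) \<noteq> 0" "\<forall>q\<in>U. f q * G (rep q) = F (rep q)" using assms by (rule regular_representation)
  have "p \<in> C" using open_in_subset[OF assms(2)] assms(3) by blast
  then have "order_at p F = 0" "order_at p G = 0"
    using order_at_eq_0_iff[OF _ 1(1,3)] order_at_eq_0_iff[OF _ 1(2,4)] 1(5,6) by auto
  then show ?thesis using rational_orderI[of U d F G f 0 p] 1 assms(2,3) by auto
qed

lemma order_at_unit_mult:
  assumes p: "p \<in> C" and F: "homogeneous d F" "\<not> vanishes F" and G: "homogeneous e G" "G (rep p) \<noteq> 0"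
  shows "order_at p (F * G) = order_at p F" "\<not> vanishes (F * G)"
proof -
  have nG: "\<not> vanishes G" using p G by (auto simp: vanishes_def)
  then have "order_at p G = 0" using order_at_eq_0_iff[OF p G(1)] G(2) by blast
  then show "order_at p (F * G) = order_at p F" using order_at_mult[OF p F G(1) nG] by simp
  show "\<not> vanishes (F * G)" using vanishes_mult_iff[OF F(1) G(1)] F nG by blast
qed

text \<open>Together with the converse, this replaces the local description of an order by a
  difference of orders of forms, which is visibly multiplicative and involves no local
  parameter.\<close>

lemma has_order_at_imp_rational_order:
  assumes p: "p \<in> C" and "has_order_at C p f k" shows "rational_order p f k"
proof -
  obtain x u W where x: "generates_max_ideal C p 1 (\<lambda>_. x)" and u: "regular_at C p u" "u p \<noteq> 0"
    and W: "opn W" "p \<in> W" "\<forall>q\<in>W - {p}. x q \<noteq> 0 \<and> f q = u q * x q powi k"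
    using assms(2) unfolding has_order_at_def by (elim exE conjE)
  obtain W1 t T X where T: "opn W1" "p \<in> W1" "uniformizer p t T" "homogeneous t X"
    "\<forall>q\<in>W1. X (rep q) \<noteq> 0 \<and> x q = T (rep q) / X (rep q)" by (rule generator_uniformizer[OF p x])
  have hT: "homogeneous t T" using T(3) by (simp add: uniformizer_def)
  note nT = uniformizer_not_vanishes[OF p T(3)]
  obtain W2 e A B where A: "opn W2" "p \<in> W2" "homogeneous e A" "homogeneous e B"
    "\<forall>q\<in>W2. B (rep q) \<noteq> 0 \<and> u q = A (rep q) / B (rep q)" using u(1) by (rule regular_atE)
  have Ap: "A (rep p) \<noteq> 0" "B (rep p) \<noteq> 0" using A u(2) by auto
  have Xp: "X (rep p) \<noteq> 0" using T by blast
  \<comment> \<open>\<open>has_order_at\<close> says nothing about the value at \<open>p\<close>, so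
    \<open>p\<close> is removed; the set stays nonempty because nonempty open sets are
    infinite.\<close>
  define V where "V = (W \<inter> W1 \<inter> W2) - {p}"
  have V: "opn V" unfolding V_def by (intro open_minus_finite open_in_Int W T A) simp
  have "infinite (W \<inter> W1 \<inter> W2)"
    by (rule open_infinite) (use W T A in \<open>auto intro!: open_in_Int\<close>)
  then have Vne: "V \<noteq> {}" unfolding V_def by (metis finite.emptyI finite.insertI infinite_remove)
  define n where "n = nat \<bar>k\<bar>"
  have Tn: "homogeneous (n * t) (T ^ n)" "homogeneous (n * t) (X ^ n)" by (intro homogeneous_power hT T)+
  have nTn: "\<not> vanishes (T ^ n)" using vanishes_power[OF hT] nT by blast
  have oT: "order_at p (T ^ n) = n" using order_at_power[OF p hT nT] order_at_uniformizer[OF p T(3)] by simp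
  have nX: "\<not> vanishes (X ^ n)" "order_at p (X ^ n) = 0"
    using order_at_eq_0_iff[OF p Tn(2)] Xp p by (auto simp: vanishes_def)
  have nA: "\<not> vanishes A" "\<not> vanishes B" using Ap p by (auto simp: vanishes_def)
  have 1: "homogeneous (n * t + e) (T ^ n * A)" "homogeneous (n * t + e) (X ^ n * B)"
    "homogeneous (n * t + e) (X ^ n * A)" "homogeneous (n * t + e) (T ^ n * B)"
    by (intro homogeneous_mult Tn A)+
  note um = order_at_unit_mult[OF p Tn(1) nTn A(3) Ap(1)] order_at_unit_mult[OF p Tn(1) nTn A(4) Ap(2)]
    order_at_unit_mult[OF p Tn(2) nX(1) A(3) Ap(1)] order_at_unit_mult[OF p Tn(2) nX(1) A(4) Ap(2)]
  have fq: "f q = A (rep q) / B (rep q) * (T (rep q) / X (rep q)) powi k" "T (rep q) \<noteq> 0" "X (rep q) \<noteq> 0"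
    "B (rep q) \<noteq> 0" if "q \<in> V" for q
    using W(3) T(5) A(5) that unfolding V_def by auto
  show ?thesis
  proof (cases "k \<ge> 0")
    case True
    then have k: "k = int n" by (simp add: n_def)
    show ?thesis
    proof (rule rational_orderI[OF V Vne 1(1,2)])
      fix q assume "q \<in> V"
      from fq[OF this] show "f q * (X ^ n * B) (rep q) = (T ^ n * A) (rep q)"
        by (simp add: k power_divide)
    qed (use um oT nX k in auto)
  next
    case False
    then have k: "k = - int n" by (simp add: n_def)
    show ?thesis
    proof (rule rational_orderI[OF V Vne 1(3,4)])
      fix q assume "q \<in> V"
      from fq[OF this] show "f q * (T ^ n * B) (rep q) = (X ^ n * A) (rep q)"
        by (simp add: k power_int_minus power_divide)
    qed (use um oT nX k in auto)
  qed
qed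

lemma rational_order_imp_has_order_at:
  assumes p: "p \<in> C" and "rational_order p f k" shows "has_order_at C p f k"
proof -
  obtain U d F G where 1: "opn U" "U \<noteq> {}" "homogeneous d F" "homogeneous d G" "\<not> vanishes F" "\<not> vanishes G"
    "\<forall>q\<in>U. f q * G (rep q) = F (rep q)" "k = int (order_at p F) - int (order_at p G)"
    using assms(2) by (rule rational_orderE)
  obtain x0 where x0: "generates_max_ideal C p 1 x0" using smooth[OF p] by blast
  define x where "x = x0 0"
  have x: "generates_max_ideal C p 1 (\<lambda>_. x)" using x0 unfolding x_def by (simp add: generates_max_ideal_def)
  obtain W t T X where T: "opn W" "p \<in> W" "uniformizer p t T" "homogeneous t X"
    "\<forall>q\<in>W. X (rep q) \<noteq> 0 \<and> x q = T (rep q) / X (rep q)" by (rule generator_uniformizer[OF p x])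
  have hT: "homogeneous t T" using T(3) by (simp add: uniformizer_def)
  note nT = uniformizer_not_vanishes[OF p T(3)]
  define m where "m = order_at p F"
  define n where "n = order_at p G"
  obtain e1 G1 a1 A1 where F1: "homogeneous e1 G1" "homogeneous a1 A1" "d + e1 = a1 + m * t" "G1 (rep p) \<noteq> 0"
    "A1 (rep p) \<noteq> 0" "\<forall>q\<in>C. F (rep q) * G1 (rep q) = A1 (rep q) * T (rep q) ^ m"
    using order_atD[OF p T(3) 1(3,5)] unfolding m_def[symmetric] by (rule vanishing_eqE)
  obtain e2 G2 a2 A2 where F2: "homogeneous e2 G2" "homogeneous a2 A2" "d + e2 = a2 + n * t" "G2 (rep p) \<noteq> 0"
    "A2 (rep p) \<noteq> 0" "\<forall>q\<in>C. G (rep q) * G2 (rep q) = A2 (rep q) * T (rep q) ^ n"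
    using order_atD[OF p T(3) 1(4,6)] unfolding n_def[symmetric] by (rule vanishing_eqE)
  define N where "N = A1 * G2 * X ^ m"
  define D where "D = A2 * G1 * X ^ n"
  have deg: "a2 + e1 + n * t = a1 + e2 + m * t" using F1(3) F2(3) by linarith
  have N: "homogeneous (a1 + e2 + m * t) N" unfolding N_def by (intro homogeneous_mult homogeneous_power F1 F2 T)
  have "homogeneous (a2 + e1 + n * t) D" unfolding D_def by (intro homogeneous_mult homogeneous_power F1 F2 T)
  then have D: "homogeneous (a1 + e2 + m * t) D" by (simp only: deg)
  have Xp: "X (rep p) \<noteq> 0" using T by blast
  have NDp: "N (rep p) \<noteq> 0" "D (rep p) \<noteq> 0" using F1 F2 Xp by (auto simp: N_def D_def)
  define u where "u = (\<lambda>q. N (rep q) / D (rep q))"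
  have "regular_at C p u"
    by (rule regular_at_quotient[OF open_in_nonzero[OF D] _ N D]) (use p NDp in \<open>auto simp: u_def\<close>)
  moreover have "u p \<noteq> 0" using NDp by (simp add: u_def)
  moreover define Q where "Q = (C - U) \<union> {q \<in> C. T (rep q) = 0} \<union> {q \<in> C. G (rep q) = 0}"
  have "finite Q" unfolding Q_def using open_cofinite[OF 1(1,2)] finite_zeros[OF hT nT] finite_zeros[OF 1(4,6)] by blast
  \<comment> \<open>Zeros of \<open>T\<close> and \<open>G\<close> and points outside
    \<open>U\<close> are removed, but never \<open>p\<close>: a neighbourhood of \<open>p\<close> is
    required, with the formula on the rest of it.\<close>
  define V where "V = (W \<inter> {q \<in> C. D (rep q) \<noteq> 0} \<inter> {q \<in> C. G1 (rep q) \<noteq> 0} \<inter> {q \<in> C. G2 (rep q) \<noteq> 0}) - (Q - {p})"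
  have "opn V"
    unfolding V_def using \<open>finite Q\<close>
    by (intro open_minus_finite open_in_Int T open_in_nonzero[OF D] open_in_nonzero[OF F1(1)] open_in_nonzero[OF F2(1)]) auto
  moreover have "p \<in> V" unfolding V_def using p T(2) NDp F1(4) F2(4) by auto
  moreover have "\<forall>q\<in>V - {p}. x q \<noteq> 0 \<and> f q = u q * x q powi k"
  proof
    fix q assume q: "q \<in> V - {p}"
    then have qW: "q \<in> W" "q \<in> C" "D (rep q) \<noteq> 0" "G1 (rep q) \<noteq> 0" "G2 (rep q) \<noteq> 0" "q \<in> U"
      "T (rep q) \<noteq> 0" "G (rep q) \<noteq> 0" by (auto simp: V_def Q_def)
    have X: "X (rep q) \<noteq> 0" and xq: "x q = T (rep q) / X (rep q)" using T(5) qW by blast+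
    have A2: "A2 (rep q) \<noteq> 0" using qW(3) by (auto simp: D_def)
    have Feq: "F (rep q) = A1 (rep q) * T (rep q) ^ m / G1 (rep q)"
      using F1(6) qW by (simp add: field_simps)
    have Geq: "G (rep q) = A2 (rep q) * T (rep q) ^ n / G2 (rep q)"
      using F2(6) qW by (simp add: field_simps)
    have x0: "x q \<noteq> 0" using xq X qW by simp
    have pw: "x q powi k = x q ^ m / x q ^ n"
      unfolding 1(8) m_def[symmetric] n_def[symmetric] using x0 by (simp add: power_int_diff)
    have "f q = F (rep q) / G (rep q)" using 1(7) qW by (simp add: field_simps)
    also have "\<dots> = u q * (x q ^ m / x q ^ n)"
      unfolding u_def N_def D_def Feq Geq xq using X qW A2 by (simp add: field_simps power_divide)
    finally show "x q \<noteq> 0 \<and> f q = u q * x q powi k" using x0 pw by simp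
  qed
  ultimately show ?thesis
    unfolding has_order_at_def using x
    by (intro exI[of _ x] exI[of _ u] exI[of _ V]) simp
qed

section \<open>Frames, rank and degree\<close>

lemma module_sheafD:
  assumes "module_sheaf C E" "opn U"
  shows "s \<in> E U \<Longrightarrow> (\<And>q. q \<in> U \<Longrightarrow> s q = t q) \<Longrightarrow> t \<in> E U"
    "s \<in> E U \<Longrightarrow> opn W \<Longrightarrow> W \<subseteq> U \<Longrightarrow> s \<in> E W"
  using assms unfolding module_sheaf_def by blast+

lemma frameD:
  assumes "frame C r E U e"
  shows "opn U" "i < r \<Longrightarrow> e i \<in> E U"
    "opn W \<Longrightarrow> W \<subseteq> U \<Longrightarrow> s \<in> E W \<Longrightarrow>
      \<exists>a. (\<forall>i<r. regular_on C W (a i)) \<and> (\<forall>q\<in>W. s q = (\<Sum>i<r. a i q *\<^sub>C e i q))"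
    "opn W \<Longrightarrow> W \<subseteq> U \<Longrightarrow> \<forall>i<r. regular_on C W (a i) \<Longrightarrow> \<forall>q\<in>W. (\<Sum>i<r. a i q *\<^sub>C e i q) = 0 \<Longrightarrow>
      i < r \<Longrightarrow> q \<in> W \<Longrightarrow> a i q = 0"
  using assms unfolding frame_def by blast+

lemma transition_exists:
  assumes E: "module_sheaf C E" and e: "frame C r E U e" and e': "frame C r' E U' e'"
  shows "\<exists>a. (\<forall>i<r'. \<forall>j<r. regular_on C (U \<inter> U') (a i j)) \<and>
    (\<forall>i<r'. \<forall>q\<in>U \<inter> U'. e' i q = (\<Sum>j<r. a i j q *\<^sub>C e j q))"
proof -
  have o: "opn (U \<inter> U')" using frameD(1)[OF e] frameD(1)[OF e'] open_in_Int by blast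
  have "\<exists>a. (\<forall>j<r. regular_on C (U \<inter> U') (a j)) \<and> (\<forall>q\<in>U \<inter> U'. e' i q = (\<Sum>j<r. a j q *\<^sub>C e j q))"
    if "i < r'" for i
  proof (rule frameD(3)[OF e o])
    show "e' i \<in> E (U \<inter> U')"
      by (rule module_sheafD(2)[OF E frameD(1)[OF e'] frameD(2)[OF e' that] o]) blast
  qed blast
  then have "\<forall>i. \<exists>a. i < r' \<longrightarrow> (\<forall>j<r. regular_on C (U \<inter> U') (a j)) \<and> (\<forall>q\<in>U \<inter> U'. e' i q = (\<Sum>j<r. a j q *\<^sub>C e j q))"
    by blast
  from choice[OF this] show ?thesis by blast
qed

lemma double_sum_scaleC:
  "(\<Sum>j<m. b j *\<^sub>C (\<Sum>k<r. a j k *\<^sub>C x k)) = (\<Sum>k<r. (\<Sum>j<m. b j * a j k) *\<^sub>C x k)"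
  for x :: "nat \<Rightarrow> 'v::complex_vector"
  by (simp add: complex_vector.scale_sum_right complex_vector.scale_sum_left scaleC_scaleC) (rule sum.swap)

lemma frame_coefficients_unique:
  assumes e: "frame C r E U e" and W: "opn W" "W \<subseteq> U"
    and a: "\<And>i. i < r \<Longrightarrow> regular_on C W (a i)" and b: "\<And>i. i < r \<Longrightarrow> regular_on C W (b i)"
    and eq: "\<And>q. q \<in> W \<Longrightarrow> (\<Sum>i<r. a i q *\<^sub>C e i q) = (\<Sum>i<r. b i q *\<^sub>C e i q)" and "i < r" "q \<in> W"
  shows "a i q = b i q"
proof -
  have "a i q - b i q = 0"
  proof (rule frameD(4)[OF e W _ _ \<open>i < r\<close> \<open>q \<in> W\<close>])
    show "\<forall>i<r. regular_on C W (\<lambda>q. a i q - b i q)" using regular_on_diff[OF W(1)] a b by blast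
    show "\<forall>q\<in>W. (\<Sum>i<r. (a i q - b i q) *\<^sub>C e i q) = 0"
      using eq by (simp add: complex_vector.scale_left_diff_distrib sum_subtractf)
  qed
  then show ?thesis by simp
qed

text \<open>Expressing \<open>e\<close> through \<open>e'\<close> and back through \<open>e\<close>
  must give the identity, because coefficients in a frame are unique.\<close>

lemma transition_inverse:
  assumes e: "frame C r E U e" and W: "opn W" "W \<subseteq> U"
    and a: "\<forall>i<r'. \<forall>j<r. regular_on C W (a i j)" "\<forall>i<r'. \<forall>q\<in>W. e' i q = (\<Sum>j<r. a i j q *\<^sub>C e j q)"
    and b: "\<forall>i<r. \<forall>j<r'. regular_on C W (b i j)" "\<forall>i<r. \<forall>q\<in>W. e i q = (\<Sum>j<r'. b i j q *\<^sub>C e' j q)"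
    and ik: "i < r" "k < r" and q: "q \<in> W"
  shows "(\<Sum>j<r'. b i j q * a j k q) = (if i = k then 1 else 0)"
proof -
  define c where "c = (\<lambda>k q. \<Sum>j<r'. b i j q * a j k q)"
  define d where "d = (\<lambda>k (q :: 'n proj). if i = k then 1 else (0 :: complex))"
  have c: "regular_on C W (c k)" if "k < r" for k
    unfolding c_def using a(1) b(1) that ik by (intro regular_on_sum[OF W(1)] regular_on_mult) auto
  have d: "regular_on C W (d k)" for k
    unfolding d_def by (rule regular_on_const[OF W(1)])
  have eq: "(\<Sum>k<r. c k q *\<^sub>C e k q) = (\<Sum>k<r. d k q *\<^sub>C e k q)" if q: "q \<in> W" for q
  proof -
    have "(\<Sum>k<r. c k q *\<^sub>C e k q) = (\<Sum>j<r'. b i j q *\<^sub>C (\<Sum>k<r. a j k q *\<^sub>C e k q))"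
      by (simp only: double_sum_scaleC c_def)
    also have "\<dots> = (\<Sum>j<r'. b i j q *\<^sub>C e' j q)"
      by (rule sum.cong) (simp_all add: a(2) q del: scaleC_fun_apply)
    also have "\<dots> = e i q" using b(2) ik q by simp
    also have "\<dots> = (\<Sum>k<r. (if i = k then e k q else 0))" using ik(1) by simp
    also have "\<dots> = (\<Sum>k<r. d k q *\<^sub>C e k q)"
      by (rule sum.cong) (auto simp: d_def scaleC_one)
    finally show ?thesis .
  qed
  have "c k q = d k q" by (rule frame_coefficients_unique[OF e W c d eq ik(2) q])
  then show ?thesis by (simp add: c_def d_def)
qed

text \<open>Both products of the two transition matrices are identity matrices; comparing traces shows
  that the matrices are square.\<close>

lemma frame_rank_unique:
  assumes E: "module_sheaf C E" and e: "frame C r E U e" and e': "frame C r' E U' e'" and q: "q \<in> U \<inter> U'"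
  shows "r = r'"
proof -
  obtain a where a: "\<forall>i<r'. \<forall>j<r. regular_on C (U \<inter> U') (a i j)"
    "\<forall>i<r'. \<forall>q\<in>U \<inter> U'. e' i q = (\<Sum>j<r. a i j q *\<^sub>C e j q)" using transition_exists[OF E e e'] by blast
  obtain b where b: "\<forall>i<r. \<forall>j<r'. regular_on C (U \<inter> U') (b i j)"
    "\<forall>i<r. \<forall>q\<in>U \<inter> U'. e i q = (\<Sum>j<r'. b i j q *\<^sub>C e' j q)"
    using transition_exists[OF E e' e] by (auto simp: Int_commute)
  have o: "opn (U \<inter> U')" using frameD(1)[OF e] frameD(1)[OF e'] open_in_Int by blast
  have "of_nat r = (\<Sum>i<r. \<Sum>j<r'. b i j q * a j i q)"
    using transition_inverse[OF e o _ a b _ _ q] by simp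
  also have "\<dots> = (\<Sum>j<r'. \<Sum>i<r. a j i q * b i j q)"
    by (subst sum.swap) (simp add: mult.commute)
  also have "\<dots> = of_nat r'"
    using transition_inverse[OF e' o _ b a _ _ q] by simp
  finally show ?thesis by (simp only: of_nat_eq_iff)
qed

lemma bundle_rank_eq:
  assumes "vector_bundle_of_rank C r E" shows "bundle_rank C E = r"
  unfolding bundle_rank_def
proof (rule the_equality[of "\<lambda>r. vector_bundle_of_rank C r E", OF assms])
  fix r' assume r': "vector_bundle_of_rank C r' E"
  obtain p where p: "p \<in> C" using infinite_curve by (metis ex_in_conv finite.emptyI)
  obtain U e where e: "p \<in> U" "frame C r E U e" using assms p unfolding vector_bundle_of_rank_def by blast
  obtain U' e' where e': "p \<in> U'" "frame C r' E U' e'" using r' p unfolding vector_bundle_of_rank_def by blast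
  show "r' = r" using frame_rank_unique[OF _ e'(2) e(2), of p] e(1) e'(1) assms
    unfolding vector_bundle_of_rank_def by blast
qed

section \<open>Determinants of transition matrices and the degree of a bundle\<close>

abbreviation transition_det :: "nat \<Rightarrow> (nat \<Rightarrow> nat \<Rightarrow> 'n proj \<Rightarrow> complex) \<Rightarrow> 'n proj \<Rightarrow> complex"
  where "transition_det r a \<equiv> (\<lambda>q. det (mat r r (\<lambda>(i, j). a i j q)))"

lemma transition_det_mult:
  assumes "\<And>i k. i < r \<Longrightarrow> k < r \<Longrightarrow> (\<Sum>j<r. b i j q * a j k q) = c i k q"
  shows "transition_det r c q = transition_det r b q * transition_det r a q"
proof -
  have "mat r r (\<lambda>(i, j). b i j q) * mat r r (\<lambda>(i, j). a i j q) = mat r r (\<lambda>(i, j). c i j q)"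
    by (rule eq_matI) (auto simp: scalar_prod_def assms[symmetric] lessThan_atLeast0)
  then show ?thesis using det_mult[of "mat r r (\<lambda>(i, j). b i j q)" r "mat r r (\<lambda>(i, j). a i j q)"] by simp
qed

lemma transition_det_one:
  assumes "\<And>i k. i < r \<Longrightarrow> k < r \<Longrightarrow> a i k q = (if i = k then 1 else 0)"
  shows "transition_det r a q = 1"
proof -
  have "mat r r (\<lambda>(i, j). a i j q) = 1\<^sub>m r" by (rule eq_matI) (auto simp: assms)
  then show ?thesis by simp
qed

lemma transition_restrict:
  assumes "\<forall>i<m. \<forall>j<r. regular_on C V (a i j)" "opn W" "W \<subseteq> V"
  shows "\<forall>i<m. \<forall>j<r. regular_on C W (a i j)"
proof (intro allI impI)
  fix i j assume "i < m" "j < r"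
  then have "regular_on C V (a i j)" using assms(1) by simp
  then show "regular_on C W (a i j)" using assms(2,3) by (rule regular_on_mono)
qed

text \<open>The transition in the opposite direction is an inverse matrix, so the two determinants
  have product 1.\<close>

lemma transition_det_nonzero:
  assumes E: "module_sheaf C E" and e: "frame C r E U e" and t: "frame C r E U0 t"
    and W: "opn W" "W \<subseteq> U \<inter> U0"
    and a: "\<forall>i<r. \<forall>j<r. regular_on C W (a i j)" "\<forall>i<r. \<forall>q\<in>W. t i q = (\<Sum>j<r. a i j q *\<^sub>C e j q)"
    and q: "q \<in> W"
  shows "transition_det r a q \<noteq> 0"
proof -
  obtain b where b: "\<forall>i<r. \<forall>j<r. regular_on C (U0 \<inter> U) (b i j)"
    "\<forall>i<r. \<forall>q\<in>U0 \<inter> U. e i q = (\<Sum>j<r. b i j q *\<^sub>C t j q)" using transition_exists[OF E t e] by blast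
  have WV: "W \<subseteq> U0 \<inter> U" using W(2) by blast
  note bW1 = transition_restrict[OF b(1) W(1) WV]
  have bW2: "\<forall>i<r. \<forall>q\<in>W. e i q = (\<Sum>j<r. b i j q *\<^sub>C t j q)"
    by (intro allI impI ballI b(2)[rule_format] subsetD[OF WV])
  have WU: "W \<subseteq> U" using W(2) by blast
  have "transition_det r (\<lambda>i k q. if i = k then 1 else 0) q = transition_det r b q * transition_det r a q"
    by (rule transition_det_mult) (rule transition_inverse[OF e W(1) WU a bW1 bW2 _ _ q])
  moreover have "transition_det r (\<lambda>i k q. if i = k then 1 else 0) q = 1" by (rule transition_det_one) simp
  ultimately show ?thesis by auto
qed

text \<open>Expanding \<open>t\<close> through \<open>t'\<close>, then \<open>e'\<close>, then
  \<open>e\<close> gives the matrix identity \<open>a = c a' g\<close>, where \<open>g\<close> is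
  the transition between the two local frames at \<open>p\<close>. Its determinant is a unit at
  \<open>p\<close> and contributes order 0.\<close>

lemma frame_order_chain:
  assumes E: "module_sheaf C E" and p: "p \<in> C" and U: "p \<in> U" "frame C r E U e" "p \<in> U'" "frame C r E U' e'"
    and t: "frame C r E U0 t" and t': "frame C r E U0' t'"
    and W: "opn W" "W \<noteq> {}" "W \<subseteq> U \<inter> U' \<inter> U0 \<inter> U0'"
    and a: "\<forall>i<r. \<forall>j<r. regular_on C W (a i j)" "\<forall>i<r. \<forall>q\<in>W. t i q = (\<Sum>j<r. a i j q *\<^sub>C e j q)"
    and a': "\<forall>i<r. \<forall>j<r. regular_on C W (a' i j)" "\<forall>i<r. \<forall>q\<in>W. t' i q = (\<Sum>j<r. a' i j q *\<^sub>C e' j q)"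
    and c: "\<forall>i<r. \<forall>j<r. regular_on C W (c i j)" "\<forall>i<r. \<forall>q\<in>W. t i q = (\<Sum>j<r. c i j q *\<^sub>C t' j q)"
    and k: "rational_order p (transition_det r a) k" "rational_order p (transition_det r a') k'"
      "rational_order p (transition_det r c) l"
  shows "k = l + k'"
proof -
  obtain g where g: "\<forall>i<r. \<forall>j<r. regular_on C (U \<inter> U') (g i j)"
    "\<forall>i<r. \<forall>q\<in>U \<inter> U'. e' i q = (\<Sum>j<r. g i j q *\<^sub>C e j q)" using transition_exists[OF E U(2,4)] by blast
  have o: "opn (U \<inter> U')" using frameD(1)[OF U(2)] frameD(1)[OF U(4)] open_in_Int by blast
  have gp: "transition_det r g p \<noteq> 0"
    by (rule transition_det_nonzero[OF E U(2,4) o _ g]) (use U in auto)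
  have "regular_on C (U \<inter> U') (transition_det r g)" using g(1) by (intro regular_on_det[OF o]) auto
  from rational_order_unit[OF this o _ gp] have g0: "rational_order p (transition_det r g) 0" using U by blast
  have "W \<subseteq> U \<inter> U'" using W(3) by blast
  note gW = transition_restrict[OF g(1) W(1) this]
  have WU: "W \<subseteq> U" using W(3) by blast
  define h where "h = (\<lambda>i m q. \<Sum>l<r. (\<Sum>j<r. c i j q * a' j l q) * g l m q)"
  have h_reg: "regular_on C W (h i m)" if "i < r" "m < r" for i m
    unfolding h_def using c(1) a'(1) gW that by (intro regular_on_sum[OF W(1)] regular_on_mult) auto
  have h_eq: "(\<Sum>m<r. a i m q *\<^sub>C e m q) = (\<Sum>m<r. h i m q *\<^sub>C e m q)" if i: "i < r" and q: "q \<in> W" for i q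
  proof -
    have qU: "q \<in> U \<inter> U'" using q W(3) by blast
    have "(\<Sum>m<r. h i m q *\<^sub>C e m q) = (\<Sum>l<r. (\<Sum>j<r. c i j q * a' j l q) *\<^sub>C (\<Sum>m<r. g l m q *\<^sub>C e m q))"
      by (simp only: double_sum_scaleC h_def)
    also have "\<dots> = (\<Sum>l<r. (\<Sum>j<r. c i j q * a' j l q) *\<^sub>C e' l q)"
      by (rule sum.cong) (simp_all only: g(2)[rule_format, OF _ qU] lessThan_iff)
    also have "\<dots> = (\<Sum>j<r. c i j q *\<^sub>C (\<Sum>l<r. a' j l q *\<^sub>C e' l q))" by (simp only: double_sum_scaleC)
    also have "\<dots> = (\<Sum>j<r. c i j q *\<^sub>C t' j q)"
      by (rule sum.cong) (simp_all only: a'(2)[rule_format, OF _ q] lessThan_iff)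
    also have "\<dots> = t i q" using c(2) i q by (simp only:)
    also have "\<dots> = (\<Sum>m<r. a i m q *\<^sub>C e m q)" using a(2) i q by (simp only:)
    finally show ?thesis ..
  qed
  have a_reg: "regular_on C W (a i m)" if "i < r" "m < r" for i m using a(1) that by blast
  have eq: "a i m q = h i m q" if i: "i < r" "m < r" and q: "q \<in> W" for i m q
    by (rule frame_coefficients_unique[OF U(2) W(1) WU a_reg[OF i(1)] h_reg[OF i(1)] h_eq[OF i(1)] i(2) q])
  have "transition_det r a q = (transition_det r c q * transition_det r a' q) * transition_det r g q" if q: "q \<in> W" for q
  proof -
    have "transition_det r a q = transition_det r (\<lambda>i l q. \<Sum>j<r. c i j q * a' j l q) q * transition_det r g q"
      by (rule transition_det_mult) (simp only: eq[OF _ _ q] h_def)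
    also have "transition_det r (\<lambda>i l q. \<Sum>j<r. c i j q * a' j l q) q = transition_det r c q * transition_det r a' q"
      by (rule transition_det_mult) simp
    finally show ?thesis .
  qed
  from rational_order_unique[OF p k(1) rational_order_mult[OF p rational_order_mult[OF p k(3,2)] g0] W(1,2) this]
  show ?thesis by simp
qed

lemma has_frame_order_atE:
  assumes "has_frame_order_at C r E U0 t p k" and p: "p \<in> C"
  obtains U e a where "p \<in> U" "frame C r E U e" "\<forall>i<r. \<forall>j<r. regular_on C (U \<inter> U0) (a i j)"
    "\<forall>i<r. \<forall>q\<in>U \<inter> U0. t i q = (\<Sum>j<r. a i j q *\<^sub>C e j q)" "rational_order p (transition_det r a) k"
proof -
  obtain U e a where "p \<in> U" "frame C r E U e" "\<forall>i<r. \<forall>j<r. regular_on C (U \<inter> U0) (a i j)"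
    "\<forall>i<r. \<forall>q\<in>U \<inter> U0. t i q = (\<Sum>j<r. a i j q *\<^sub>C e j q)" "has_order_at C p (transition_det r a) k"
    using assms(1) unfolding has_frame_order_at_def by (elim exE conjE)
  then show ?thesis using that has_order_at_imp_rational_order[OF p] by blast
qed

lemma has_frame_order_atI:
  assumes "p \<in> C" "p \<in> U" "frame C r E U e" "\<forall>i<r. \<forall>j<r. regular_on C (U \<inter> U0) (a i j)"
    "\<forall>i<r. \<forall>q\<in>U \<inter> U0. t i q = (\<Sum>j<r. a i j q *\<^sub>C e j q)" "rational_order p (transition_det r a) k"
  shows "has_frame_order_at C r E U0 t p k"
  unfolding has_frame_order_at_def
  using rational_order_imp_has_order_at[OF assms(1,6)] assms(2-5)
  by (intro exI[of _ U] exI[of _ e] exI[of _ a] conjI)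

lemma has_frame_order_at_compare:
  assumes E: "module_sheaf C E" and p: "p \<in> C" and t: "frame C r E U0 t" "U0 \<noteq> {}" and t': "frame C r E U0' t'" "U0' \<noteq> {}"
    and k: "has_frame_order_at C r E U0 t p k" "has_frame_order_at C r E U0' t' p k'"
    and c: "\<forall>i<r. \<forall>j<r. regular_on C (U0' \<inter> U0) (c i j)" "\<forall>i<r. \<forall>q\<in>U0' \<inter> U0. t i q = (\<Sum>j<r. c i j q *\<^sub>C t' j q)"
    and l: "rational_order p (transition_det r c) l"
  shows "k = l + k'"
proof -
  obtain U e a where 1: "p \<in> U" "frame C r E U e" "\<forall>i<r. \<forall>j<r. regular_on C (U \<inter> U0) (a i j)"
    "\<forall>i<r. \<forall>q\<in>U \<inter> U0. t i q = (\<Sum>j<r. a i j q *\<^sub>C e j q)" "rational_order p (transition_det r a) k"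
    using k(1) p by (rule has_frame_order_atE)
  obtain U' e' a' where 2: "p \<in> U'" "frame C r E U' e'" "\<forall>i<r. \<forall>j<r. regular_on C (U' \<inter> U0') (a' i j)"
    "\<forall>i<r. \<forall>q\<in>U' \<inter> U0'. t' i q = (\<Sum>j<r. a' i j q *\<^sub>C e' j q)" "rational_order p (transition_det r a') k'"
    using k(2) p by (rule has_frame_order_atE)
  note o = frameD(1)[OF 1(2)] frameD(1)[OF 2(2)] frameD(1)[OF t(1)] frameD(1)[OF t'(1)]
  define W where "W = (U \<inter> U') \<inter> (U0 \<inter> U0')"
  have W: "opn W" unfolding W_def by (intro open_in_Int o)
  have "U \<inter> U' \<noteq> {}" "U0 \<inter> U0' \<noteq> {}" using 1(1) 2(1) open_meet[OF o(3,4)] t t' by blast+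
  then have Wne: "W \<noteq> {}" unfolding W_def using open_meet[OF open_in_Int[OF o(1,2)] open_in_Int[OF o(3,4)]] by blast
  have sub: "W \<subseteq> U \<inter> U' \<inter> U0 \<inter> U0'" "W \<subseteq> U \<inter> U0" "W \<subseteq> U' \<inter> U0'" "W \<subseteq> U0' \<inter> U0" unfolding W_def by blast+
  have eqs: "\<forall>i<r. \<forall>q\<in>W. t i q = (\<Sum>j<r. a i j q *\<^sub>C e j q)"
    "\<forall>i<r. \<forall>q\<in>W. t' i q = (\<Sum>j<r. a' i j q *\<^sub>C e' j q)" "\<forall>i<r. \<forall>q\<in>W. t i q = (\<Sum>j<r. c i j q *\<^sub>C t' j q)"
    by (intro allI impI ballI 1(4)[rule_format] subsetD[OF sub(2)], assumption+)
      (intro allI impI ballI 2(4)[rule_format] subsetD[OF sub(3)], assumption+,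
        intro allI impI ballI c(2)[rule_format] subsetD[OF sub(4)], assumption+)
  show ?thesis
    by (rule frame_order_chain[OF E p 1(1,2) 2(1,2) t(1) t'(1) W Wne sub(1)
          transition_restrict[OF 1(3) W sub(2)] eqs(1) transition_restrict[OF 2(3) W sub(3)] eqs(2)
          transition_restrict[OF c(1) W sub(4)] eqs(3) 1(5) 2(5) l])
qed

lemma has_frame_order_at_exists:
  assumes E: "vector_bundle_of_rank C r E" and p: "p \<in> C" and t: "frame C r E U0 t" "U0 \<noteq> {}"
  shows "\<exists>k. has_frame_order_at C r E U0 t p k"
proof -
  have ms: "module_sheaf C E" using E unfolding vector_bundle_of_rank_def by blast
  obtain U e where e: "p \<in> U" "frame C r E U e" using E p unfolding vector_bundle_of_rank_def by blast
  obtain a where a: "\<forall>i<r. \<forall>j<r. regular_on C (U \<inter> U0) (a i j)"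
    "\<forall>i<r. \<forall>q\<in>U \<inter> U0. t i q = (\<Sum>j<r. a i j q *\<^sub>C e j q)" using transition_exists[OF ms e(2) t(1)] by blast
  have o: "opn (U \<inter> U0)" using frameD(1)[OF e(2)] frameD(1)[OF t(1)] open_in_Int by blast
  obtain q where q: "q \<in> U \<inter> U0" using open_meet[OF frameD(1)[OF e(2)] frameD(1)[OF t(1)]] e t by blast
  have "regular_on C (U \<inter> U0) (transition_det r a)" using a(1) by (intro regular_on_det[OF o]) auto
  moreover have "transition_det r a q \<noteq> 0"
    by (rule transition_det_nonzero[OF ms e(2) t(1) o _ a q]) blast
  ultimately obtain k where "rational_order p (transition_det r a) k" using o q by (elim rational_order_exists)
  from has_frame_order_atI[OF p e a this] show ?thesis by blast
qed

lemma frame_self_transition: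
  assumes t: "frame C r E U0 t"
  shows "\<forall>i<r. \<forall>j<r. regular_on C (U0 \<inter> U0) (\<lambda>q. if i = j then 1 else (0 :: complex))"
    "\<forall>i<r. \<forall>q\<in>U0 \<inter> U0. t i q = (\<Sum>j<r. (if i = j then 1 else 0) *\<^sub>C t j q)"
  using regular_on_const[OF frameD(1)[OF t]]
  by (auto simp: if_distrib[of "\<lambda>c. c *\<^sub>C _"] scaleC_one cong: if_cong)

lemma identity_rational_order:
  assumes "p \<in> C" shows "rational_order p (transition_det r (\<lambda>i j q. if i = j then 1 else 0)) 0"
proof (rule rational_order_unit[OF _ open_in_self assms])
  have one: "transition_det r (\<lambda>i j q. if i = j then 1 else 0) q = 1" for q by (rule transition_det_one) simp
  show "regular_on C C (transition_det r (\<lambda>i j q. if i = j then 1 else 0))"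
    unfolding one by (rule regular_on_const[OF open_in_self])
  show "transition_det r (\<lambda>i j q. if i = j then 1 else 0) p \<noteq> 0" unfolding one by simp
qed

lemma frame_order_at_eq:
  assumes E: "module_sheaf C E" and p: "p \<in> C" and t: "frame C r E U0 t" "U0 \<noteq> {}"
    and k: "has_frame_order_at C r E U0 t p k"
  shows "frame_order_at C r E U0 t p = k"
  unfolding frame_order_at_def
proof (rule the_equality[of "has_frame_order_at C r E U0 t p", OF k])
  fix l assume "has_frame_order_at C r E U0 t p l"
  then show "l = k"
    using has_frame_order_at_compare[OF E p t t _ k frame_self_transition[OF t(1)] identity_rational_order[OF p]] by simp
qed

lemma frame_order_at_inside:
  assumes E: "module_sheaf C E" and t: "frame C r E U0 t" and p: "p \<in> U0"
  shows "frame_order_at C r E U0 t p = 0"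
proof -
  have pC: "p \<in> C" using open_in_subset[OF frameD(1)[OF t]] p by blast
  have "has_frame_order_at C r E U0 t p 0"
    by (rule has_frame_order_atI[OF pC p t frame_self_transition[OF t] identity_rational_order[OF pC]])
  from frame_order_at_eq[OF E pC t _ this] show ?thesis using p by blast
qed

text \<open>Any single frame computes the degree: two rational sections of the determinant differ by
  a quotient of forms of equal degree, whose divisor has degree 0 by
  \<open>form_degree_homogeneous\<close>. This also shows that the definite description is well
  defined.\<close>

theorem bundle_degree_eq:
  assumes E: "vector_bundle_of_rank C r E" and t: "frame C r E U0 t" "U0 \<noteq> {}"
    and k: "\<And>p. p \<in> C \<Longrightarrow> has_frame_order_at C r E U0 t p (k p)"
    and P: "finite P" "P \<subseteq> C" "\<And>p. p \<in> C - P \<Longrightarrow> k p = 0"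
  shows "bundle_degree C E = (\<Sum>p\<in>P. k p)"
proof -
  have ms: "module_sheaf C E" using E unfolding vector_bundle_of_rank_def by blast
  have deg: "(\<Sum>p | p \<in> C \<and> frame_order_at C r E V s p \<noteq> 0. frame_order_at C r E V s p) = (\<Sum>p\<in>P. k p)"
    if s: "V \<noteq> {}" "frame C r E V s" for V s
  proof -
    obtain c where c: "\<forall>i<r. \<forall>j<r. regular_on C (V \<inter> U0) (c i j)"
      "\<forall>i<r. \<forall>q\<in>V \<inter> U0. t i q = (\<Sum>j<r. c i j q *\<^sub>C s j q)" using transition_exists[OF ms s(2) t(1)] by blast
    have o: "opn (V \<inter> U0)" using frameD(1)[OF s(2)] frameD(1)[OF t(1)] open_in_Int by blast
    obtain q where q: "q \<in> V \<inter> U0" using open_meet[OF frameD(1)[OF s(2)] frameD(1)[OF t(1)]] s t by blast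
    have reg: "regular_on C (V \<inter> U0) (transition_det r c)" using c(1) by (intro regular_on_det[OF o]) auto
    have nz: "transition_det r c q \<noteq> 0"
      by (rule transition_det_nonzero[OF ms s(2) t(1) o _ c q]) blast
    obtain d F G where 1: "homogeneous d F" "homogeneous d G" "\<not> vanishes F" "\<not> vanishes G" "G (rep q) \<noteq> 0"
      "F (rep q) \<noteq> 0" "\<forall>q\<in>V \<inter> U0. transition_det r c q * G (rep q) = F (rep q)"
      using reg o q nz by (rule regular_representation)
    have l: "rational_order p (transition_det r c) (int (order_at p F) - int (order_at p G))" for p
      using 1 o q by (intro rational_orderI[of "V \<inter> U0" d F G]) auto
    have rel: "k p = (int (order_at p F) - int (order_at p G)) + frame_order_at C r E V s p" if p: "p \<in> C" for p
    proof -
      obtain k' where k': "has_frame_order_at C r E V s p k'" using has_frame_order_at_exists[OF E p s(2,1)] by blast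
      show ?thesis
        using has_frame_order_at_compare[OF ms p t s(2,1) k[OF p] k' c l] frame_order_at_eq[OF ms p s(2,1) k'] by simp
    qed
    \<comment> \<open>Outside this finite set every order in the comparison is 0, so all sums can be
      taken over \<open>Q\<close>.\<close>
    define Q where "Q = P \<union> (C - V) \<union> {p \<in> C. order_at p F \<noteq> 0} \<union> {p \<in> C. order_at p G \<noteq> 0}"
    have Q: "finite Q" "Q \<subseteq> C"
      unfolding Q_def using P open_cofinite[OF frameD(1)[OF s(2)] s(1)] order_at_eq_0_outside[OF 1(1,3)]
        order_at_eq_0_outside[OF 1(2,4)] by auto
    have sub: "{p \<in> C. order_at p F \<noteq> 0} \<subseteq> Q" "{p \<in> C. order_at p G \<noteq> 0} \<subseteq> Q"
      unfolding Q_def by blast+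
    have degF: "(\<Sum>p\<in>Q. int (order_at p F)) = int (form_degree F)" "(\<Sum>p\<in>Q. int (order_at p G)) = int (form_degree G)"
      by (simp_all only: form_degree_eq[OF Q(1) sub(1) Q(2)] form_degree_eq[OF Q(1) sub(2) Q(2)] of_nat_sum)
    have "(\<Sum>p\<in>P. k p) = (\<Sum>p\<in>Q. k p)"
      by (rule sum.mono_neutral_left) (use Q P in \<open>auto simp: Q_def\<close>)
    also have "\<dots> = (\<Sum>p\<in>Q. (int (order_at p F) - int (order_at p G)) + frame_order_at C r E V s p)"
      by (rule sum.cong) (use rel Q in auto)
    also have "\<dots> = (int (form_degree F) - int (form_degree G)) + (\<Sum>p\<in>Q. frame_order_at C r E V s p)"
      by (simp only: sum.distrib sum_subtractf degF)
    also have "\<dots> = (\<Sum>p\<in>Q. frame_order_at C r E V s p)"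
      by (simp add: form_degree_homogeneous[OF 1(1,3)] form_degree_homogeneous[OF 1(2,4)])
    also have "\<dots> = (\<Sum>p | p \<in> C \<and> frame_order_at C r E V s p \<noteq> 0. frame_order_at C r E V s p)"
      by (rule sum.mono_neutral_right) (use Q frame_order_at_inside[OF ms s(2)] in \<open>auto simp: Q_def\<close>)
    finally show ?thesis by simp
  qed
  show ?thesis
    unfolding bundle_degree_def bundle_rank_eq[OF E]
  proof (rule the_equality)
    show "\<exists>U\<^sub>0 t. U\<^sub>0 \<noteq> {} \<and> frame C r E U\<^sub>0 t \<and>
      (\<Sum>p\<in>P. k p) = (\<Sum>p | p \<in> C \<and> frame_order_at C r E U\<^sub>0 t p \<noteq> 0. frame_order_at C r E U\<^sub>0 t p)"
      using t deg[OF t(2,1)] by (intro exI[of _ U0] exI[of _ t]) simp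
  next
    fix d assume "\<exists>U\<^sub>0 t. U\<^sub>0 \<noteq> {} \<and> frame C r E U\<^sub>0 t \<and>
      d = (\<Sum>p | p \<in> C \<and> frame_order_at C r E U\<^sub>0 t p \<noteq> 0. frame_order_at C r E U\<^sub>0 t p)"
    then obtain V s where "V \<noteq> {}" "frame C r E V s"
      "d = (\<Sum>p | p \<in> C \<and> frame_order_at C r E V s p \<noteq> 0. frame_order_at C r E V s p)" by (elim exE conjE)
    then show "d = (\<Sum>p\<in>P. k p)" using deg by simp
  qed
qed

end

section \<open>Line bundles generated by forms\<close>

context curve
begin

text \<open>Coefficients have to be found only near each point. Uniqueness on overlaps makes the
  local families agree, so at \<open>q\<close> the value of the family chosen for \<open>q\<close>
  defines global coefficients.\<close>

lemma frameI:
  assumes U: "opn U" and e: "\<And>i. i < r \<Longrightarrow> e i \<in> E U"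
    and ex: "\<And>W s p. opn W \<Longrightarrow> W \<subseteq> U \<Longrightarrow> s \<in> E W \<Longrightarrow> p \<in> W \<Longrightarrow>
      \<exists>W' a. opn W' \<and> p \<in> W' \<and> W' \<subseteq> W \<and> (\<forall>i<r. regular_on C W' (a i)) \<and>
        (\<forall>q\<in>W'. s q = (\<Sum>i<r. a i q *\<^sub>C e i q))"
    and un: "\<And>W a i q. opn W \<Longrightarrow> W \<subseteq> U \<Longrightarrow> \<forall>i<r. regular_on C W (a i) \<Longrightarrow>
      \<forall>q\<in>W. (\<Sum>i<r. a i q *\<^sub>C e i q) = 0 \<Longrightarrow> i < r \<Longrightarrow> q \<in> W \<Longrightarrow> a i q = 0"
  shows "frame C r E U e"
  unfolding frame_def
proof (intro conjI allI impI ballI)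
  show "opn U" by (rule U)
  show "\<And>i. i < r \<Longrightarrow> e i \<in> E U" by (rule e)
next
  fix W a i q
  assume "opn W \<and> W \<subseteq> U" "(\<forall>i<r. regular_on C W (a i)) \<and> (\<forall>q\<in>W. (\<Sum>i<r. a i q *\<^sub>C e i q) = 0)" "i < r" "q \<in> W"
  then show "a i q = 0" by (elim conjE) (rule un)
next
  fix W s assume W: "opn W \<and> W \<subseteq> U" and s: "s \<in> E W"
  have "\<forall>p. \<exists>Wa. p \<in> W \<longrightarrow> opn (fst Wa) \<and> p \<in> fst Wa \<and> fst Wa \<subseteq> W \<and> (\<forall>i<r. regular_on C (fst Wa) (snd Wa i)) \<and>
        (\<forall>q\<in>fst Wa. s q = (\<Sum>i<r. snd Wa i q *\<^sub>C e i q))"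
  proof
    fix p
    show "\<exists>Wa. p \<in> W \<longrightarrow> opn (fst Wa) \<and> p \<in> fst Wa \<and> fst Wa \<subseteq> W \<and> (\<forall>i<r. regular_on C (fst Wa) (snd Wa i)) \<and>
        (\<forall>q\<in>fst Wa. s q = (\<Sum>i<r. snd Wa i q *\<^sub>C e i q))"
    proof (cases "p \<in> W")
      case True
      from ex[OF conjunct1[OF W] conjunct2[OF W] s True] obtain W' a where
        "opn W' \<and> p \<in> W' \<and> W' \<subseteq> W \<and> (\<forall>i<r. regular_on C W' (a i)) \<and> (\<forall>q\<in>W'. s q = (\<Sum>i<r. a i q *\<^sub>C e i q))"
        by (elim exE)
      then show ?thesis by (intro exI[of _ "(W', a)"]) simp
    qed simp
  qed
  from choice[OF this] obtain Wa where Wa: "\<forall>p. p \<in> W \<longrightarrow> opn (fst (Wa p)) \<and> p \<in> fst (Wa p) \<and> fst (Wa p) \<subseteq> W \<and>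
        (\<forall>i<r. regular_on C (fst (Wa p)) (snd (Wa p) i)) \<and>
        (\<forall>q\<in>fst (Wa p). s q = (\<Sum>i<r. snd (Wa p) i q *\<^sub>C e i q))" by (elim exE)
  define N where "N = (\<lambda>p. fst (Wa p))"
  define b where "b = (\<lambda>p. snd (Wa p))"
  have N: "opn (N p)" "p \<in> N p" "N p \<subseteq> W" "\<And>i. i < r \<Longrightarrow> regular_on C (N p) (b p i)"
    "\<And>q. q \<in> N p \<Longrightarrow> s q = (\<Sum>i<r. b p i q *\<^sub>C e i q)" if "p \<in> W" for p
    using Wa that unfolding N_def b_def by simp_all
  define a where "a = (\<lambda>i q. b q i q)"
  have ab: "a i q = b p i q" if p: "p \<in> W" and i: "i < r" and q: "q \<in> N p" for p i q
  proof -
    have qW: "q \<in> W" using N(3)[OF p] q by blast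
    define Y where "Y = N p \<inter> N q"
    have Y: "opn Y" "Y \<subseteq> N p" "Y \<subseteq> N q" "q \<in> Y" unfolding Y_def using open_in_Int N p qW q by blast+
    have OU: "Y \<subseteq> U" using Y(2) N(3)[OF p] W by blast
    define d where "d = (\<lambda>i x. b q i x - b p i x)"
    have "d i q = 0"
    proof (rule un[of Y d, OF Y(1) OU _ _ i Y(4)])
      show "\<forall>i<r. regular_on C Y (d i)" unfolding d_def
        using regular_on_diff[OF Y(1) regular_on_mono[OF N(4)[OF qW] Y(1,3)] regular_on_mono[OF N(4)[OF p] Y(1,2)]] by blast
      show "\<forall>x\<in>Y. (\<Sum>i<r. d i x *\<^sub>C e i x) = 0"
        unfolding d_def
      proof
        fix x assume "x \<in> Y"
        then have "s x = (\<Sum>i<r. b q i x *\<^sub>C e i x)" "s x = (\<Sum>i<r. b p i x *\<^sub>C e i x)"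
          using N(5)[OF qW, of x] N(5)[OF p, of x] Y(2,3) by blast+
        then show "(\<Sum>i<r. (b q i x - b p i x) *\<^sub>C e i x) = 0"
          by (simp add: complex_vector.scale_left_diff_distrib sum_subtractf)
      qed
    qed
    then show ?thesis by (simp add: a_def d_def)
  qed
  show "\<exists>a. (\<forall>i<r. regular_on C W (a i)) \<and> (\<forall>q\<in>W. s q = (\<Sum>i<r. a i q *\<^sub>C e i q))"
  proof (intro exI[of _ a] conjI allI impI ballI)
    fix i assume i: "i < r"
    show "regular_on C W (a i)"
    proof (rule regular_on_local)
      fix p assume p: "p \<in> W"
      have "regular_on C (N p) (a i)"
        using N(4)[OF p i] regular_on_cong[of "N p" "a i" "b p i" C] ab[OF p i] by blast
      then show "\<exists>V. opn V \<and> p \<in> V \<and> V \<subseteq> W \<and> regular_on C V (a i)" using N[OF p] by blast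
    qed
  next
    fix q assume q: "q \<in> W"
    show "s q = (\<Sum>i<r. a i q *\<^sub>C e i q)" unfolding a_def by (rule N(5)[OF q N(2)[OF q]])
  qed
qed

text \<open>The common power of the local parameter cancels, which leaves a quotient of forms whose
  denominator is nonzero at \<open>p\<close>.\<close>

lemma quotient_regular:
  assumes p: "p \<in> C" and F: "homogeneous d F" and G: "homogeneous d G" "\<not> vanishes G"
    and ge: "order_ge p (order_at p G) F"
  obtains W c where "opn W" "p \<in> W" "regular_on C W c" "\<forall>q\<in>W. F (rep q) = c q * G (rep q)"
proof -
  obtain t T where U: "uniformizer p t T" using uniformizer_exists[OF p] by blast
  define k where "k = order_at p G"
  obtain e2 G2 a2 A2 where 2: "homogeneous e2 G2" "homogeneous a2 A2" "d + e2 = a2 + k * t" "G2 (rep p) \<noteq> 0"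
    "A2 (rep p) \<noteq> 0" "\<forall>q\<in>C. G (rep q) * G2 (rep q) = A2 (rep q) * T (rep q) ^ k"
    using order_atD[OF p U G] unfolding k_def[symmetric] by (rule vanishing_eqE)
  have "vanishing_ge p t T k d F" using ge order_ge_iff[OF p U F] by (simp add: k_def)
  then obtain e1 G1 a1 A1 where 1: "homogeneous e1 G1" "homogeneous a1 A1" "d + e1 = a1 + k * t" "G1 (rep p) \<noteq> 0"
    "\<forall>q\<in>C. F (rep q) * G1 (rep q) = A1 (rep q) * T (rep q) ^ k" by (rule vanishing_geE)
  have N: "homogeneous (e1 + a2) (A1 * G2)"
    by (rule homogeneous_cong_degree[OF homogeneous_mult[OF 1(2) 2(1)]]) (use 1(3) 2(3) in linarith)
  have D: "homogeneous (e1 + a2) (G1 * A2)" by (rule homogeneous_mult[OF 1(1) 2(2)])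
  define W where "W = {q \<in> C. (G1 * A2) (rep q) \<noteq> 0}"
  define c where "c = (\<lambda>q. (A1 * G2) (rep q) / (G1 * A2) (rep q))"
  have W: "opn W" unfolding W_def by (rule open_in_nonzero[OF D])
  have "regular_on C W c" by (rule regular_on_quotient[OF W N D]) (auto simp: W_def c_def)
  moreover have "p \<in> W" using p 1(4) 2(5) by (simp add: W_def)
  moreover have "F (rep q) = c q * G (rep q)" if q: "q \<in> W" for q
  proof -
    have qC: "q \<in> C" and nz: "G1 (rep q) \<noteq> 0" "A2 (rep q) \<noteq> 0" using q by (auto simp: W_def)
    have "F (rep q) * (G1 (rep q) * A2 (rep q)) = (F (rep q) * G1 (rep q)) * A2 (rep q)" by simp
    also have "\<dots> = A1 (rep q) * (A2 (rep q) * T (rep q) ^ k)" using 1(5) qC by simp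
    also have "\<dots> = A1 (rep q) * (G (rep q) * G2 (rep q))" using 2(6) qC by simp
    finally show ?thesis using nz by (simp add: c_def field_simps)
  qed
  ultimately show ?thesis using that W by blast
qed

section \<open>The sheaf generated by a space of sections\<close>

lemma generated_subsheafI:
  assumes "\<And>p. p \<in> U \<Longrightarrow> \<exists>W B a. opn W \<and> p \<in> W \<and> W \<subseteq> U \<and> finite B \<and> B \<subseteq> V \<and>
    (\<forall>v\<in>B. regular_on C W (a v)) \<and> (\<forall>q\<in>W. s q = (\<Sum>v\<in>B. a v q * v q))"
  shows "s \<in> generated_subsheaf C V U"
  unfolding generated_subsheaf_def using assms by blast

lemma generated_subsheafE:
  assumes "s \<in> generated_subsheaf C V U" "p \<in> U"
  obtains W B a where "opn W" "p \<in> W" "W \<subseteq> U" "finite B" "B \<subseteq> V"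
    "\<forall>v\<in>B. regular_on C W (a v)" "\<forall>q\<in>W. s q = (\<Sum>v\<in>B. a v q * v q)"
proof -
  have "\<exists>W B a. opn W \<and> p \<in> W \<and> W \<subseteq> U \<and> finite B \<and> B \<subseteq> V \<and>
    (\<forall>v\<in>B. regular_on C W (a v)) \<and> (\<forall>q\<in>W. s q = (\<Sum>v\<in>B. a v q * v q))"
    using assms unfolding generated_subsheaf_def by blast
  then show ?thesis using that by (elim exE conjE)
qed

lemma generated_subsheaf_multiple:
  assumes U: "opn U" and v: "v \<in> V" and c: "regular_on C U c" and s: "\<And>q. q \<in> U \<Longrightarrow> s q = c q * v q"
  shows "s \<in> generated_subsheaf C V U"
proof (rule generated_subsheafI)
  fix p assume p: "p \<in> U"
  show "\<exists>W B a. opn W \<and> p \<in> W \<and> W \<subseteq> U \<and> finite B \<and> B \<subseteq> V \<and>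
    (\<forall>v\<in>B. regular_on C W (a v)) \<and> (\<forall>q\<in>W. s q = (\<Sum>v\<in>B. a v q * v q))"
    by (rule exI[of _ U], rule exI[of _ "{v}"], rule exI[of _ "\<lambda>_. c"]) (use U p v c s in auto)
qed

lemma generated_subsheaf_base: "opn U \<Longrightarrow> v \<in> V \<Longrightarrow> v \<in> generated_subsheaf C V U"
  by (rule generated_subsheaf_multiple[OF _ _ regular_on_const[of C U 1]]) auto

lemma module_sheaf_generated: "module_sheaf C (generated_subsheaf C V)"
  unfolding module_sheaf_def
proof (intro allI impI conjI ballI)
  fix U s t assume "opn U" and st: "s \<in> generated_subsheaf C V U \<and> (\<forall>q\<in>U. s q = t q)"
  show "t \<in> generated_subsheaf C V U"
  proof (rule generated_subsheafI)
    fix p assume "p \<in> U"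
    with st[THEN conjunct1] obtain W B a where W: "opn W" "p \<in> W" "W \<subseteq> U" "finite B" "B \<subseteq> V"
      "\<forall>v\<in>B. regular_on C W (a v)" "\<forall>q\<in>W. s q = (\<Sum>v\<in>B. a v q * v q)" by (rule generated_subsheafE)
    have "\<forall>q\<in>W. t q = (\<Sum>v\<in>B. a v q * v q)" using W(3,7) st by (metis subsetD)
    then show "\<exists>W B a. opn W \<and> p \<in> W \<and> W \<subseteq> U \<and> finite B \<and> B \<subseteq> V \<and>
      (\<forall>v\<in>B. regular_on C W (a v)) \<and> (\<forall>q\<in>W. t q = (\<Sum>v\<in>B. a v q * v q))"
      using W(1-6) by (intro exI[of _ W] exI[of _ B] exI[of _ a] conjI)
  qed
next
  fix U s Y assume "opn U" and Y: "s \<in> generated_subsheaf C V U \<and> opn Y \<and> Y \<subseteq> U"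
  show "s \<in> generated_subsheaf C V Y"
  proof (rule generated_subsheafI)
    fix p assume p: "p \<in> Y"
    then have "p \<in> U" using Y by blast
    with Y[THEN conjunct1] obtain W B a where W: "opn W" "p \<in> W" "W \<subseteq> U" "finite B" "B \<subseteq> V"
      "\<forall>v\<in>B. regular_on C W (a v)" "\<forall>q\<in>W. s q = (\<Sum>v\<in>B. a v q * v q)" by (rule generated_subsheafE)
    have o: "opn (W \<inter> Y)" using open_in_Int W(1) Y by blast
    have "\<forall>v\<in>B. regular_on C (W \<inter> Y) (a v)" using W(6) regular_on_mono[OF _ o] by (metis Int_lower1)
    then show "\<exists>W B a. opn W \<and> p \<in> W \<and> W \<subseteq> Y \<and> finite B \<and> B \<subseteq> V \<and>
      (\<forall>v\<in>B. regular_on C W (a v)) \<and> (\<forall>q\<in>W. s q = (\<Sum>v\<in>B. a v q * v q))"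
      using W o p by (intro exI[of _ "W \<inter> Y"] exI[of _ B] exI[of _ a]) auto
  qed
next
  fix U s assume "opn U" and loc: "\<forall>p\<in>U. \<exists>W. opn W \<and> p \<in> W \<and> W \<subseteq> U \<and> s \<in> generated_subsheaf C V W"
  show "s \<in> generated_subsheaf C V U"
  proof (rule generated_subsheafI)
    fix p assume "p \<in> U"
    then obtain Y where Y: "p \<in> Y" "Y \<subseteq> U" "s \<in> generated_subsheaf C V Y" using loc by blast
    from Y(3,1) obtain W B a where W: "opn W" "p \<in> W" "W \<subseteq> Y" "finite B" "B \<subseteq> V"
      "\<forall>v\<in>B. regular_on C W (a v)" "\<forall>q\<in>W. s q = (\<Sum>v\<in>B. a v q * v q)" by (rule generated_subsheafE)
    have "W \<subseteq> U" using W(3) Y(2) by blast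
    then show "\<exists>W B a. opn W \<and> p \<in> W \<and> W \<subseteq> U \<and> finite B \<and> B \<subseteq> V \<and>
      (\<forall>v\<in>B. regular_on C W (a v)) \<and> (\<forall>q\<in>W. s q = (\<Sum>v\<in>B. a v q * v q))"
      using W by (intro exI[of _ W] exI[of _ B] exI[of _ a] conjI)
  qed
next
  fix U assume U: "opn U"
  show "(\<lambda>q. 0) \<in> generated_subsheaf C V U"
  proof (rule generated_subsheafI)
    fix p assume "p \<in> U"
    then show "\<exists>W B a. opn W \<and> p \<in> W \<and> W \<subseteq> U \<and> finite B \<and> B \<subseteq> V \<and>
      (\<forall>v\<in>B. regular_on C W (a v)) \<and> (\<forall>q\<in>W. 0 = (\<Sum>v\<in>B. a v q * v q))"
      using U by (intro exI[of _ U] exI[of _ "{}"]) auto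
  qed
next
  fix U s t assume U: "opn U" and s: "s \<in> generated_subsheaf C V U" and t: "t \<in> generated_subsheaf C V U"
  show "(\<lambda>q. s q + t q) \<in> generated_subsheaf C V U"
  proof (rule generated_subsheafI)
    fix p assume p: "p \<in> U"
    from s p obtain W B a where W: "opn W" "p \<in> W" "W \<subseteq> U" "finite B" "B \<subseteq> V"
      "\<forall>v\<in>B. regular_on C W (a v)" "\<forall>q\<in>W. s q = (\<Sum>v\<in>B. a v q * v q)" by (rule generated_subsheafE)
    from t p obtain W' B' a' where W': "opn W'" "p \<in> W'" "W' \<subseteq> U" "finite B'" "B' \<subseteq> V"
      "\<forall>v\<in>B'. regular_on C W' (a' v)" "\<forall>q\<in>W'. t q = (\<Sum>v\<in>B'. a' v q * v q)" by (rule generated_subsheafE)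
    have o: "opn (W \<inter> W')" using open_in_Int W(1) W'(1) by blast
    define c where "c = (\<lambda>v q. (if v \<in> B then a v q else 0) + (if v \<in> B' then a' v q else 0))"
    have "regular_on C (W \<inter> W') (\<lambda>q. if v \<in> B then a v q else 0)" for v
      using W(6) regular_on_mono[OF _ o, of W "a v"] regular_on_const[OF o, of 0] by (cases "v \<in> B") simp_all
    moreover have "regular_on C (W \<inter> W') (\<lambda>q. if v \<in> B' then a' v q else 0)" for v
      using W'(6) regular_on_mono[OF _ o, of W' "a' v"] regular_on_const[OF o, of 0] by (cases "v \<in> B'") simp_all
    ultimately have "regular_on C (W \<inter> W') (c v)" for v
      unfolding c_def by (intro regular_on_add)
    moreover have "s q + t q = (\<Sum>v\<in>B \<union> B'. c v q * v q)" if q: "q \<in> W \<inter> W'" for q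
    proof -
      have "(\<Sum>v\<in>B. a v q * v q) = (\<Sum>v\<in>B \<union> B'. (if v \<in> B then a v q else 0) * v q)"
        using W(4) W'(4) by (intro sum.mono_neutral_cong_left) auto
      moreover have "(\<Sum>v\<in>B'. a' v q * v q) = (\<Sum>v\<in>B \<union> B'. (if v \<in> B' then a' v q else 0) * v q)"
        using W(4) W'(4) by (intro sum.mono_neutral_cong_left) auto
      moreover have "s q = (\<Sum>v\<in>B. a v q * v q)" "t q = (\<Sum>v\<in>B'. a' v q * v q)" using W(7) W'(7) q by blast+
      ultimately show ?thesis by (simp only: c_def distrib_right sum.distrib)
    qed
    ultimately show "\<exists>W B a. opn W \<and> p \<in> W \<and> W \<subseteq> U \<and> finite B \<and> B \<subseteq> V \<and>
      (\<forall>v\<in>B. regular_on C W (a v)) \<and> (\<forall>q\<in>W. s q + t q = (\<Sum>v\<in>B. a v q * v q))"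
      using W W' o by (intro exI[of _ "W \<inter> W'"] exI[of _ "B \<union> B'"] exI[of _ c]) auto
  qed
next
  fix U b s assume U: "opn U" and s: "s \<in> generated_subsheaf C V U" and b: "regular_on C U b"
  show "(\<lambda>q. b q *\<^sub>C s q) \<in> generated_subsheaf C V U"
  proof (rule generated_subsheafI)
    fix p assume p: "p \<in> U"
    from s p obtain W B a where W: "opn W" "p \<in> W" "W \<subseteq> U" "finite B" "B \<subseteq> V"
      "\<forall>v\<in>B. regular_on C W (a v)" "\<forall>q\<in>W. s q = (\<Sum>v\<in>B. a v q * v q)" by (rule generated_subsheafE)
    have "\<forall>v\<in>B. regular_on C W (\<lambda>q. b q * a v q)"
      using W(6) regular_on_mult[OF regular_on_mono[OF b W(1,3)]] by blast
    moreover have "\<forall>q\<in>W. b q *\<^sub>C s q = (\<Sum>v\<in>B. (b q * a v q) * v q)"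
      using W(7) by (simp add: sum_distrib_left mult.assoc)
    ultimately show "\<exists>W B a. opn W \<and> p \<in> W \<and> W \<subseteq> U \<and> finite B \<and> B \<subseteq> V \<and>
      (\<forall>v\<in>B. regular_on C W (a v)) \<and> (\<forall>q\<in>W. b q *\<^sub>C s q = (\<Sum>v\<in>B. a v q * v q))"
      using W(1-5) by (intro exI[of _ W] exI[of _ B] exI[of _ "\<lambda>v q. b q * a v q"] conjI)
  qed
qed

text \<open>A space of sections of the twisting sheaf \<open>\<O>(N)\<close>, which is trivialized non-algebraically by
  the chosen coordinates \<open>rep\<close> of the points.\<close>

definition form_system :: "nat \<Rightarrow> ('n proj \<Rightarrow> complex) set \<Rightarrow> bool"
  where "form_system N V \<longleftrightarrow> (\<exists>v\<in>V. v \<noteq> 0) \<and> (\<forall>v\<in>V. \<exists>F. homogeneous N F \<and> v = restrict_form F)"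

text \<open>The multiplicity at \<open>p\<close> of the fixed divisor of the system. The sheaf
  generated by \<open>V\<close> is the twisting sheaf of degree \<open>N\<close> with this divisor
  subtracted.\<close>

definition base_order :: "nat \<Rightarrow> ('n proj \<Rightarrow> complex) set \<Rightarrow> 'n proj \<Rightarrow> nat"
  where "base_order N V p = (LEAST k. \<exists>F. homogeneous N F \<and> \<not> vanishes F \<and> restrict_form F \<in> V \<and> order_at p F = k)"

lemma base_order_le:
  "homogeneous N F \<Longrightarrow> \<not> vanishes F \<Longrightarrow> restrict_form F \<in> V \<Longrightarrow> base_order N V p \<le> order_at p F"
  unfolding base_order_def by (rule Least_le) blast

lemma form_system_nonzero:
  assumes "form_system N V"
  obtains F where "homogeneous N F" "\<not> vanishes F" "restrict_form F \<in> V"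
proof -
  obtain v F where "v \<in> V" "v \<noteq> 0" "homogeneous N F" "v = restrict_form F"
    using assms unfolding form_system_def by blast
  then show ?thesis using that restrict_form_eq_0_iff by metis
qed

lemma base_order_attained:
  assumes "form_system N V"
  obtains F where "homogeneous N F" "\<not> vanishes F" "restrict_form F \<in> V" "order_at p F = base_order N V p"
proof -
  obtain F0 where "homogeneous N F0" "\<not> vanishes F0" "restrict_form F0 \<in> V"
    by (rule form_system_nonzero[OF assms])
  then have "\<exists>k F. homogeneous N F \<and> \<not> vanishes F \<and> restrict_form F \<in> V \<and> order_at p F = k" by blast
  from LeastI_ex[OF this] show ?thesis using that unfolding base_order_def[symmetric] by blast
qed

text \<open>A member whose order is minimal at every point of \<open>U\<close> divides all others
  locally, hence generates the sheaf there. Coefficients are unique because \<open>G\<close> is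
  nonzero on a nonempty open set and regular functions obey the identity principle.\<close>

lemma generated_frame:
  assumes V: "form_system N V" and G: "homogeneous N G" "\<not> vanishes G" "restrict_form G \<in> V"
    and U: "opn U" and min: "\<And>p F. p \<in> U \<Longrightarrow> homogeneous N F \<Longrightarrow> restrict_form F \<in> V \<Longrightarrow> order_ge p (order_at p G) F"
  shows "frame C 1 (generated_subsheaf C V) U (\<lambda>_. restrict_form G)"
proof (rule frameI[OF U])
  show "restrict_form G \<in> generated_subsheaf C V U" by (rule generated_subsheaf_base[OF U G(3)])
next
  fix W s p assume W: "opn W" "W \<subseteq> U" and s: "s \<in> generated_subsheaf C V W" and p: "p \<in> W"
  obtain Y B a where Y: "opn Y" "p \<in> Y" "Y \<subseteq> W" "finite B" "B \<subseteq> V"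
    "\<forall>v\<in>B. regular_on C Y (a v)" "\<forall>q\<in>Y. s q = (\<Sum>v\<in>B. a v q * v q)" using s p by (rule generated_subsheafE)
  have pC: "p \<in> C" and pU: "p \<in> U" using open_in_subset[OF W(1)] p W(2) by blast+
  have "\<forall>v. \<exists>Wc. v \<in> B \<longrightarrow> opn (fst Wc) \<and> p \<in> fst Wc \<and> regular_on C (fst Wc) (snd Wc) \<and>
      (\<forall>q\<in>fst Wc. v q = snd Wc q * restrict_form G q)"
  proof
    fix v
    show "\<exists>Wc. v \<in> B \<longrightarrow> opn (fst Wc) \<and> p \<in> fst Wc \<and> regular_on C (fst Wc) (snd Wc) \<and>
      (\<forall>q\<in>fst Wc. v q = snd Wc q * restrict_form G q)"
    proof (cases "v \<in> B")
      case True
      then have vV: "v \<in> V" using Y(5) by blast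
      then obtain F where F: "homogeneous N F" "v = restrict_form F" using V unfolding form_system_def by blast
      have "restrict_form F \<in> V" using vV F(2) by simp
      from min[OF pU F(1) this] obtain W' c where W': "opn W'" "p \<in> W'" "regular_on C W' c"
        "\<forall>q\<in>W'. F (rep q) = c q * G (rep q)" by (rule quotient_regular[OF pC F(1) G(1,2)])
      have "\<forall>q\<in>W'. v q = c q * restrict_form G q"
        using W'(4) open_in_subset[OF W'(1)] by (auto simp: F(2) restrict_form_def)
      then show ?thesis using W' by (intro exI[of _ "(W', c)"]) simp
    qed simp
  qed
  from choice[OF this] obtain Wc where Wc: "\<forall>v. v \<in> B \<longrightarrow> opn (fst (Wc v)) \<and> p \<in> fst (Wc v) \<and>
      regular_on C (fst (Wc v)) (snd (Wc v)) \<and> (\<forall>q\<in>fst (Wc v). v q = snd (Wc v) q * restrict_form G q)"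
    by (elim exE)
  define Y' where "Y' = Y \<inter> (\<Inter>v\<in>B. fst (Wc v))"
  have Y': "opn Y'" unfolding Y'_def by (rule open_in_INT[OF Y(4,1)]) (use Wc in blast)
  have sub: "Y' \<subseteq> Y" "\<And>v. v \<in> B \<Longrightarrow> Y' \<subseteq> fst (Wc v)" unfolding Y'_def by blast+
  have pO': "p \<in> Y'" unfolding Y'_def using Y(2) Wc by blast
  have "regular_on C Y' (\<lambda>q. \<Sum>v\<in>B. a v q * snd (Wc v) q)"
    using Y(6) Wc regular_on_mono[OF _ Y' sub(1)] regular_on_mono[OF _ Y' sub(2)]
    by (intro regular_on_sum[OF Y'] regular_on_mult) blast+
  moreover have "\<forall>q\<in>Y'. s q = (\<Sum>i<1::nat. (\<Sum>v\<in>B. a v q * snd (Wc v) q) *\<^sub>C restrict_form G q)"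
  proof
    fix q assume q: "q \<in> Y'"
    have "s q = (\<Sum>v\<in>B. a v q * v q)" using Y(7) sub(1) q by blast
    also have "\<dots> = (\<Sum>v\<in>B. (a v q * snd (Wc v) q) * restrict_form G q)"
    proof (rule sum.cong[OF refl])
      fix v assume v: "v \<in> B"
      then have "v q = snd (Wc v) q * restrict_form G q" using Wc sub(2)[OF v] q by blast
      then show "a v q * v q = (a v q * snd (Wc v) q) * restrict_form G q" by (simp add: mult.assoc)
    qed
    finally show "s q = (\<Sum>i<1::nat. (\<Sum>v\<in>B. a v q * snd (Wc v) q) *\<^sub>C restrict_form G q)"
      by (simp add: sum_distrib_right)
  qed
  ultimately show "\<exists>W' a. opn W' \<and> p \<in> W' \<and> W' \<subseteq> W \<and> (\<forall>i<1::nat. regular_on C W' (a i)) \<and>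
        (\<forall>q\<in>W'. s q = (\<Sum>i<1. a i q *\<^sub>C restrict_form G q))"
    using Y' pO' sub(1) Y(3) by (intro exI[of _ Y'] exI[of _ "\<lambda>_ q. \<Sum>v\<in>B. a v q * snd (Wc v) q"]) auto
next
  fix W and a :: "nat \<Rightarrow> 'n proj \<Rightarrow> complex" and i q
  assume W: "opn W" "W \<subseteq> U" and a: "\<forall>i<1. regular_on C W (a i)"
    "\<forall>q\<in>W. (\<Sum>i<1. a i q *\<^sub>C restrict_form G q) = 0" and i: "i < (1::nat)" and q: "q \<in> W"
  define Z where "Z = W \<inter> {q \<in> C. G (rep q) \<noteq> 0}"
  have ne: "{q \<in> C. G (rep q) \<noteq> 0} \<noteq> {}" using G(2) by (auto simp: vanishes_def)
  have Z: "opn Z" "Z \<noteq> {}" "Z \<subseteq> W"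
    unfolding Z_def using open_in_Int[OF W(1) open_in_nonzero[OF G(1)]] open_meet[OF W(1) open_in_nonzero[OF G(1)] _ ne] q
    by blast+
  have "a 0 x = 0" if "x \<in> Z" for x
    using a(2) that by (auto simp: Z_def restrict_form_def)
  moreover have "regular_on C W (a 0)" using a(1) by simp
  ultimately have "a 0 q = 0" using Z q by (intro regular_zero[of W "a 0" Z q])
  then show "a i q = 0" using i by simp
qed

text \<open>At \<open>p\<close> the order of \<open>G\<close> is minimal by choice; at the other
  points of the open set \<open>G\<close> is nonzero, so its order 0 is minimal too.\<close>

lemma minimal_frame:
  assumes V: "form_system N V" and p: "p \<in> C" and G: "homogeneous N G" "\<not> vanishes G" "restrict_form G \<in> V"
    "order_at p G = base_order N V p"
  shows "frame C 1 (generated_subsheaf C V) (C - ({q \<in> C. G (rep q) = 0} - {p})) (\<lambda>_. restrict_form G)"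
proof (rule generated_frame[OF V G(1-3)])
  show "opn (C - ({q \<in> C. G (rep q) = 0} - {p}))"
    using finite_zeros[OF G(1,2)] by (intro open_in_cofinite) simp
  fix q F assume q: "q \<in> C - ({q \<in> C. G (rep q) = 0} - {p})" and F: "homogeneous N F" "restrict_form F \<in> V"
  show "order_ge q (order_at q G) F"
  proof (cases "q = p")
    case True
    then show ?thesis using base_order_le[OF F(1) _ F(2), of p] G(4) by (auto simp: order_ge_def)
  next
    case False
    then have "order_at q G = 0" using q order_at_eq_0_iff[OF _ G(1,2), of q] by blast
    then show ?thesis by (simp add: order_ge_def)
  qed
qed

lemma generated_line_bundle:
  assumes V: "form_system N V" shows "vector_bundle_of_rank C 1 (generated_subsheaf C V)"
  unfolding vector_bundle_of_rank_def
proof (intro conjI ballI)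
  show "module_sheaf C (generated_subsheaf C V)" by (rule module_sheaf_generated)
  fix p assume p: "p \<in> C"
  obtain G where G: "homogeneous N G" "\<not> vanishes G" "restrict_form G \<in> V" "order_at p G = base_order N V p"
    by (rule base_order_attained[OF V])
  show "\<exists>U e. p \<in> U \<and> frame C 1 (generated_subsheaf C V) U e"
    by (rule exI[of _ "C - ({q \<in> C. G (rep q) = 0} - {p})"], rule exI[of _ "\<lambda>_. restrict_form G"])
      (use minimal_frame[OF V p G] p in simp)
qed

lemma transition_det_diagonal:
  "transition_det r (\<lambda>i j q. if i = j then c i q else 0) q = (\<Prod>i<r. c i q)"
proof -
  let ?A = "mat r r (\<lambda>(i, j). if i = j then c i q else 0)"
  have "det ?A = prod_list (diag_mat ?A)"
    by (rule det_upper_triangular[of _ r]) auto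
  also have "\<dots> = (\<Prod>i = 0..<r. c i q)" unfolding prod_list_diag_prod by simp
  finally show ?thesis by (simp add: lessThan_atLeast0)
qed

text \<open>The member \<open>F\<close> is a rational section. In the local frame given by a
  \<open>G\<close> of minimal order, its coefficient is \<open>F / G\<close>, whose order is the
  order of \<open>F\<close> minus the base order. Away from the zeros of \<open>F\<close> the base
  order is 0.\<close>

theorem generated_degree:
  assumes V: "form_system N V" and F: "homogeneous N F" "\<not> vanishes F" "restrict_form F \<in> V"
  shows "bundle_degree C (generated_subsheaf C V) =
    int (N * hyperplane_degree) - int (\<Sum>p | p \<in> C \<and> order_at p F \<noteq> 0. base_order N V p)"
proof -
  let ?P = "{p \<in> C. order_at p F \<noteq> 0}"
  define U0 where "U0 = {q \<in> C. F (rep q) \<noteq> 0}"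
  define k where "k = (\<lambda>p. int (order_at p F) - int (base_order N V p))"
  have U0: "opn U0" "U0 \<noteq> {}" unfolding U0_def using open_in_nonzero[OF F(1)] F(2) by (auto simp: vanishes_def)
  have t: "frame C 1 (generated_subsheaf C V) U0 (\<lambda>_. restrict_form F)"
  proof (rule generated_frame[OF V F U0(1)])
    fix p G assume "p \<in> U0"
    then have "order_at p F = 0" using order_at_eq_0_iff[OF _ F(1,2), of p] by (simp add: U0_def)
    then show "order_ge p (order_at p F) G" by (simp add: order_ge_def)
  qed
  have "has_frame_order_at C 1 (generated_subsheaf C V) U0 (\<lambda>_. restrict_form F) p (k p)" if p: "p \<in> C" for p
  proof -
    obtain G where G: "homogeneous N G" "\<not> vanishes G" "restrict_form G \<in> V" "order_at p G = base_order N V p"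
      by (rule base_order_attained[OF V])
    define U where "U = C - ({q \<in> C. G (rep q) = 0} - {p})"
    have U: "frame C 1 (generated_subsheaf C V) U (\<lambda>_. restrict_form G)" "p \<in> U"
      using minimal_frame[OF V p G] p by (simp_all add: U_def)
    note o = open_in_Int[OF frameD(1)[OF U(1)] U0(1)]
    have Gq: "G (rep q) \<noteq> 0" "q \<in> C" if q: "q \<in> U \<inter> U0" for q
    proof -
      show qC: "q \<in> C" using q by (simp add: U0_def)
      show "G (rep q) \<noteq> 0"
      proof (cases "q = p")
        case True
        have "order_at p F = 0" using order_at_eq_0_iff[OF p F(1,2)] q True by (simp add: U0_def)
        then have "order_at p G = 0" using base_order_le[OF F, of p] G(4) by simp
        then show ?thesis using order_at_eq_0_iff[OF p G(1,2)] True by simp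
      qed (use q qC in \<open>auto simp: U_def\<close>)
    qed
    define a where "a = (\<lambda>(i::nat) (j::nat) q. if i = j then F (rep q) / G (rep q) else 0)"
    have reg: "regular_on C (U \<inter> U0) (\<lambda>q. F (rep q) / G (rep q))"
      by (rule regular_on_quotient[OF o F(1) G(1)]) (use Gq in auto)
    have "\<forall>i<1. \<forall>j<1. regular_on C (U \<inter> U0) (a i j)" using reg by (simp add: a_def)
    moreover have "\<forall>i<1. \<forall>q\<in>U \<inter> U0. restrict_form F q = (\<Sum>j<1. a i j q *\<^sub>C restrict_form G q)"
      using Gq by (auto simp: a_def restrict_form_def)
    moreover have "rational_order p (transition_det 1 a) (k p)"
    proof (rule rational_orderI[OF open_in_nonzero[OF G(1)] _ F(1) G(1) F(2) G(2)])
      show "{q \<in> C. G (rep q) \<noteq> 0} \<noteq> {}" using G(2) by (auto simp: vanishes_def)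
      show "k p = int (order_at p F) - int (order_at p G)" by (simp add: k_def G(4))
      fix q assume "q \<in> {q \<in> C. G (rep q) \<noteq> 0}"
      then have Gnz: "G (rep q) \<noteq> 0" by simp
      have "transition_det 1 a q = F (rep q) / G (rep q)"
        using transition_det_diagonal[of 1 "\<lambda>_ q. F (rep q) / G (rep q)" q] unfolding a_def by simp
      then show "transition_det 1 a q * G (rep q) = F (rep q)" using Gnz by simp
    qed
    ultimately show ?thesis by (rule has_frame_order_atI[OF p U(2,1)])
  qed
  note ord = this
  have "k p = 0" if p: "p \<in> C - ?P" for p
    using base_order_le[OF F, of p] p by (simp add: k_def)
  then have "bundle_degree C (generated_subsheaf C V) = (\<Sum>p\<in>?P. k p)"
    by (intro bundle_degree_eq[OF generated_line_bundle[OF V] t U0(2) ord order_at_eq_0_outside[OF F(1,2)]]) auto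
  also have "\<dots> = int (form_degree F) - int (\<Sum>p\<in>?P. base_order N V p)"
    by (simp add: k_def sum_subtractf form_degree_def)
  finally show ?thesis using form_degree_homogeneous[OF F(1,2)] by simp
qed

end

section \<open>A plane quintic composed with a pencil\<close>

text \<open>The quintic \<open>(X\<^sup>4Y, Y\<^sup>5 - X\<^sup>5, -XY\<^sup>4)\<close> is the cross product of the syzygies
  \<open>(X\<^sup>2, XY, Y\<^sup>2)\<close> and \<open>(Y\<^sup>3, 0, X\<^sup>3)\<close>, so its dual span bundle on the projective line is
  \<open>\<O>(-2) \<oplus> \<O>(-3)\<close>; it is an immersion, and no three points have the same image.\<close>

definition quintic :: "complex \<Rightarrow> complex \<Rightarrow> complex \<Rightarrow> complex \<Rightarrow> complex \<Rightarrow> complex"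
  where "quintic a b c X Y = a * (X ^ 4 * Y) + b * (Y ^ 5 - X ^ 5) - c * (X * Y ^ 4)"

locale pencil = curve C for C :: "'n::finite proj set" +
  fixes x y :: "('n \<Rightarrow> complex) \<Rightarrow> complex"
  assumes x: "homogeneous 1 x" "\<not> vanishes x"
    and y: "homogeneous 1 y" "\<not> vanishes y"
    and no_base_point: "p \<in> C \<Longrightarrow> x (rep p) \<noteq> 0 \<or> y (rep p) \<noteq> 0"
begin

text \<open>The map to the projective line is onto because the linear form \<open>b x - a y\<close>
  has a zero on \<open>C\<close>. Identities that hold on the curve thereby become identities
  between binary forms.\<close>

lemma pencil_surjective:
  assumes "(a, b) \<noteq> (0, 0)"
  obtains p t where "p \<in> C" "t \<noteq> 0" "x (rep p) = t * a" "y (rep p) = t * b"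
proof -
  define h where "h = b *\<^sub>C x - a *\<^sub>C y"
  have h: "homogeneous 1 h" unfolding h_def by (intro homogeneous_diff homogeneous_scale x y)
  \<comment> \<open>At a zero of \<open>x\<close> only the term with \<open>y\<close> is left, and
    at a zero of \<open>y\<close> only the term with \<open>x\<close>; vanishing at both would make
    \<open>a\<close> and \<open>b\<close> zero.\<close>
  have nh: "\<not> vanishes h"
  proof
    assume v: "vanishes h"
    obtain p where p: "p \<in> C" "x (rep p) = 0" using linear_form_has_zero[OF x] by blast
    obtain q where q: "q \<in> C" "y (rep q) = 0" using linear_form_has_zero[OF y] by blast
    have "b * x (rep p) - a * y (rep p) = 0" "b * x (rep q) - a * y (rep q) = 0"
      using v p q by (auto simp: vanishes_def h_def)
    then show False using p q no_base_point[OF p(1)] no_base_point[OF q(1)] assms by auto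
  qed
  obtain p where p: "p \<in> C" "h (rep p) = 0" using linear_form_has_zero[OF h nh] by blast
  then have eq: "b * x (rep p) = a * y (rep p)" by (simp add: h_def)
  show ?thesis
  proof (cases "a = 0")
    case True
    then have "b \<noteq> 0" using assms by simp
    then have "x (rep p) = 0" using eq True by simp
    then show ?thesis using that[of p "y (rep p) / b"] p(1) no_base_point[OF p(1)] True \<open>b \<noteq> 0\<close> by simp
  next
    case False
    then have "y (rep p) = x (rep p) / a * b" using eq by (simp add: field_simps)
    then show ?thesis using that[of p "x (rep p) / a"] p(1) no_base_point[OF p(1)] False by auto
  qed
qed

definition quintic_form :: "complex \<Rightarrow> complex \<Rightarrow> complex \<Rightarrow> ('n \<Rightarrow> complex) \<Rightarrow> complex"
  where "quintic_form a b c = (\<lambda>v. quintic a b c (x v) (y v))"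

lemma quintic_form_eq:
  "quintic_form a b c = a *\<^sub>C (x ^ 4 * y) + b *\<^sub>C (y ^ 5 - x ^ 5) - c *\<^sub>C (x * y ^ 4)"
  by (simp add: quintic_form_def quintic_def fun_eq_iff)

lemma homogeneous_quintic_form: "homogeneous 5 (quintic_form a b c)"
proof -
  have "homogeneous 5 (x ^ 4 * y)"
    by (rule homogeneous_cong_degree[OF homogeneous_mult[OF homogeneous_power[OF x(1)] y(1)]]) simp
  moreover have "homogeneous 5 (x * y ^ 4)"
    by (rule homogeneous_cong_degree[OF homogeneous_mult[OF x(1) homogeneous_power[OF y(1)]]]) simp
  moreover have "homogeneous 5 (x ^ 5)" "homogeneous 5 (y ^ 5)"
    using homogeneous_power[OF x(1), of 5] homogeneous_power[OF y(1), of 5] by (simp_all only: mult_1_right)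
  ultimately show ?thesis
    unfolding quintic_form_eq by (intro homogeneous_diff homogeneous_add homogeneous_scale)
qed

definition quintic_section :: "complex \<Rightarrow> complex \<Rightarrow> complex \<Rightarrow> 'n proj \<Rightarrow> complex"
  where "quintic_section a b c = restrict_form (quintic_form a b c)"

lemma quintic_section_apply:
  "quintic_section a b c q = (if q \<in> C then quintic a b c (x (rep q)) (y (rep q)) else 0)"
  by (simp add: quintic_section_def restrict_form_def quintic_form_def)

lemma quintic_section_linear:
  "quintic_section (a + a') (b + b') (c + c') = quintic_section a b c + quintic_section a' b' c'"
  "quintic_section (t * a) (t * b) (t * c) = t *\<^sub>C quintic_section a b c"
  by (auto simp: fun_eq_iff quintic_section_apply quintic_def algebra_simps)

lemma quintic_section_zero: "quintic_section 0 0 0 = 0"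
  by (simp add: fun_eq_iff quintic_section_apply quintic_def)

lemma quintic_homogeneous: "quintic a b c (t * X) (t * Y) = t ^ 5 * quintic a b c X Y"
  by (simp add: quintic_def power_mult_distrib eval_nat_numeral algebra_simps)

text \<open>By surjectivity the binary form itself vanishes everywhere; the parameters (1, 0), (1,
  1) and (1, -1) already determine its three coefficients.\<close>

lemma quintic_section_eq_0_iff: "quintic_section a b c = 0 \<longleftrightarrow> a = 0 \<and> b = 0 \<and> c = 0"
proof
  assume 0: "quintic_section a b c = 0"
  have z: "quintic a b c X Y = 0" if XY: "(X, Y) \<noteq> (0, 0)" for X Y
  proof -
    obtain p t where p: "p \<in> C" "t \<noteq> 0" "x (rep p) = t * X" "y (rep p) = t * Y"
      by (rule pencil_surjective[OF XY])
    have "quintic_section a b c p = 0" using 0 by simp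
    then show ?thesis using p by (simp add: quintic_section_apply quintic_homogeneous)
  qed
  from z[of 1 0] have b: "b = 0" by (simp add: quintic_def)
  from z[of 1 1] z[of 1 "-1"] have "a - c = 0" "- a - c = 0" by (simp_all add: quintic_def b)
  then show "a = 0 \<and> b = 0 \<and> c = 0" using b by (simp add: algebra_simps)
qed (simp add: quintic_section_zero)

lemma quintic_section_inject:
  "quintic_section a b c = quintic_section a' b' c' \<longleftrightarrow> a = a' \<and> b = b' \<and> c = c'"
proof
  assume eq: "quintic_section a b c = quintic_section a' b' c'"
  have "quintic_section (a + - 1 * a') (b + - 1 * b') (c + - 1 * c') = 0"
    unfolding quintic_section_linear eq by (simp add: fun_eq_iff)
  then show "a = a' \<and> b = b' \<and> c = c'" unfolding quintic_section_eq_0_iff by simp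
qed simp

section \<open>The net of quintic sections\<close>

definition V :: "('n proj \<Rightarrow> complex) set"
  where "V = {quintic_section a b c | a b c. True}"

lemma V_I: "quintic_section a b c \<in> V"
  unfolding V_def by blast

lemma V_E:
  assumes "v \<in> V" obtains a b c where "v = quintic_section a b c"
  using assms unfolding V_def by blast

definition V_basis :: "('n proj \<Rightarrow> complex) set"
  where "V_basis = {quintic_section 1 0 0, quintic_section 0 1 0, quintic_section 0 0 1}"

lemma V_basis_distinct:
  "quintic_section 1 0 0 \<noteq> quintic_section 0 1 0" "quintic_section 1 0 0 \<noteq> quintic_section 0 0 1"
  "quintic_section 0 1 0 \<noteq> quintic_section 0 0 1"
  unfolding quintic_section_inject by simp_all

lemma quintic_section_basis:
  "quintic_section a b c = a *\<^sub>C quintic_section 1 0 0 + b *\<^sub>C quintic_section 0 1 0 + c *\<^sub>C quintic_section 0 0 1"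
  unfolding quintic_section_linear[symmetric] by simp

lemma card_V_basis: "finite V_basis" "card V_basis = 3"
  using V_basis_distinct by (auto simp: V_basis_def)

lemma sum_V_basis:
  fixes f :: "('n proj \<Rightarrow> complex) \<Rightarrow> 'b::comm_monoid_add"
  shows "(\<Sum>v\<in>V_basis. f v) = f (quintic_section 1 0 0) + f (quintic_section 0 1 0) + f (quintic_section 0 0 1)"
  using V_basis_distinct by (simp add: V_basis_def add.assoc)

lemma subspace_V: "complex_vector.subspace V"
proof (rule complex_vector.subspaceI)
  show "0 \<in> V" using V_I[of 0 0 0] by (simp only: quintic_section_zero)
  show "v + w \<in> V" if "v \<in> V" "w \<in> V" for v w
    using that by (elim V_E) (simp only: quintic_section_linear(1)[symmetric] V_I)
  show "t *\<^sub>C v \<in> V" if "v \<in> V" for t v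
    using that by (elim V_E) (simp only: quintic_section_linear(2)[symmetric] V_I)
qed

lemma span_V_basis: "complex_vector.span V_basis = V"
proof
  show "complex_vector.span V_basis \<subseteq> V"
    by (rule complex_vector.span_minimal[OF _ subspace_V]) (auto simp: V_basis_def V_I)
  show "V \<subseteq> complex_vector.span V_basis"
  proof
    fix v assume "v \<in> V"
    then obtain a b c where v: "v = quintic_section a b c" by (rule V_E)
    show "v \<in> complex_vector.span V_basis"
      unfolding v by (subst quintic_section_basis)
        (intro complex_vector.span_add complex_vector.span_scale complex_vector.span_base, simp_all add: V_basis_def)
  qed
qed

lemma independent_V_basis: "complex_vector.independent V_basis"
proof
  assume "complex_vector.dependent V_basis"
  then obtain u where u: "\<exists>v\<in>V_basis. u v \<noteq> 0" "(\<Sum>v\<in>V_basis. u v *\<^sub>C v) = 0"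
    using complex_vector.dependent_finite[OF card_V_basis(1)] by blast
  have "quintic_section (u (quintic_section 1 0 0)) (u (quintic_section 0 1 0)) (u (quintic_section 0 0 1)) = 0"
    using u(2) by (subst quintic_section_basis) (simp only: sum_V_basis)
  then show False using u(1) unfolding quintic_section_eq_0_iff by (auto simp: V_basis_def)
qed

lemma dim_V: "complex_vector.dim V = 3"
  using complex_vector.dim_span_eq_card_independent[OF independent_V_basis] card_V_basis(2)
  by (simp only: span_V_basis)

lemma form_system_subspace:
  assumes "V' \<subseteq> V" "v \<in> V'" "v \<noteq> 0" shows "form_system 5 V'"
  unfolding form_system_def
proof (intro conjI ballI)
  show "\<exists>v\<in>V'. v \<noteq> 0" using assms by blast
  fix w assume "w \<in> V'"
  then have "w \<in> V" using assms by blast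
  then obtain a b c where "w = quintic_section a b c" by (rule V_E)
  then show "\<exists>F. homogeneous 5 F \<and> w = restrict_form F"
    using homogeneous_quintic_form unfolding quintic_section_def by blast
qed

lemma form_system_V: "form_system 5 V"
  using form_system_subspace[OF subset_refl V_I[of 1 0 0]] quintic_section_eq_0_iff[of 1 0 0] by simp

lemma not_vanishes_quintic: "\<not> vanishes (quintic_form a b c) \<longleftrightarrow> (a, b, c) \<noteq> (0, 0, 0)"
  unfolding restrict_form_eq_0_iff[symmetric] quintic_section_def[symmetric] quintic_section_eq_0_iff by simp

lemma V_no_base_point:
  assumes "p \<in> C"
  shows "\<exists>a b c. quintic_form a b c (rep p) \<noteq> 0"
proof (rule ccontr)
  assume "\<not> ?thesis"
  then have z: "quintic a b c (x (rep p)) (y (rep p)) = 0" for a b c by (auto simp: quintic_form_def)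
  from z[of 1 0 0] z[of 0 1 0] no_base_point[OF assms] show False
    by (auto simp: quintic_def)
qed

lemma base_order_V:
  assumes "p \<in> C" shows "base_order 5 V p = 0"
proof -
  obtain a b c where nz: "quintic_form a b c (rep p) \<noteq> 0" using V_no_base_point[OF assms] by blast
  then have nv: "\<not> vanishes (quintic_form a b c)" using assms by (auto simp: vanishes_def)
  have "order_at p (quintic_form a b c) = 0"
    using order_at_eq_0_iff[OF assms homogeneous_quintic_form nv] nz by blast
  then show ?thesis
    using base_order_le[OF homogeneous_quintic_form nv, of V p] V_I[of a b c] by (simp add: quintic_section_def)
qed

lemma degree_V: "bundle_degree C (generated_subsheaf C V) = int (5 * hyperplane_degree)"
proof -
  have nv: "\<not> vanishes (quintic_form 1 0 0)" by (simp add: not_vanishes_quintic)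
  have "bundle_degree C (generated_subsheaf C V) = int (5 * hyperplane_degree) -
      int (\<Sum>p | p \<in> C \<and> order_at p (quintic_form 1 0 0) \<noteq> 0. base_order 5 V p)"
    by (rule generated_degree[OF form_system_V homogeneous_quintic_form nv]) (use V_I in \<open>simp add: quintic_section_def[symmetric]\<close>)
  also have "(\<Sum>p | p \<in> C \<and> order_at p (quintic_form 1 0 0) \<noteq> 0. base_order 5 V p) = 0"
    by (rule sum.neutral) (use base_order_V in blast)
  finally show ?thesis by simp
qed

section \<open>Linear stability\<close>

text \<open>Division by \<open>Y - t X\<close>: the remainder is \<open>X ^ 5\<close> times the
  value at (1, t), which is zero by hypothesis.\<close>

lemma quintic_factor:
  "quintic a b c X Y = (Y - t * X) * (a * X ^ 4 + b * (Y ^ 4 + t * Y ^ 3 * X + t\<^sup>2 * Y\<^sup>2 * X\<^sup>2 + t ^ 3 * Y * X ^ 3 + t ^ 4 * X ^ 4)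
      - c * (X * (Y ^ 3 + t * Y\<^sup>2 * X + t\<^sup>2 * Y * X\<^sup>2 + t ^ 3 * X ^ 3)))"
  if "quintic a b c 1 t = 0"
proof -
  have "quintic a b c X Y = (Y - t * X) * (a * X ^ 4 + b * (Y ^ 4 + t * Y ^ 3 * X + t\<^sup>2 * Y\<^sup>2 * X\<^sup>2 + t ^ 3 * Y * X ^ 3 + t ^ 4 * X ^ 4)
      - c * (X * (Y ^ 3 + t * Y\<^sup>2 * X + t\<^sup>2 * Y * X\<^sup>2 + t ^ 3 * X ^ 3))) + X ^ 5 * quintic a b c 1 t"
    by (simp add: quintic_def eval_nat_numeral algebra_simps)
  then show ?thesis using that by simp
qed

text \<open>The linear conditions say that the derivatives of \<open>quintic a b c 1\<close> and
  \<open>quintic a' b' c' 1\<close> vanish at \<open>t\<close>.\<close>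

lemma quintic_simple_zero:
  assumes "quintic a b c 1 t = 0" "quintic a' b' c' 1 t = 0"
    and "a + 5 * t ^ 4 * b - 4 * t ^ 3 * c = 0" "a' + 5 * t ^ 4 * b' - 4 * t ^ 3 * c' = 0"
  shows "b * c' - c * b' = 0 \<and> c * a' - a * c' = 0 \<and> a * b' - b * a' = 0"
proof (cases "t = 0")
  case True
  then show ?thesis using assms by (simp add: quintic_def)
next
  case False
  have a: "a = 4 * t ^ 3 * c - 5 * t ^ 4 * b" "a' = 4 * t ^ 3 * c' - 5 * t ^ 4 * b'"
    using assms(3,4) by (simp_all add: algebra_simps)
  have "3 * t ^ 4 * c = (4 * t ^ 5 + 1) * b" "3 * t ^ 4 * c' = (4 * t ^ 5 + 1) * b'"
    using assms(1,2) unfolding a by (simp_all add: quintic_def eval_nat_numeral algebra_simps)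
  then have c: "c = (4 * t ^ 5 + 1) / (3 * t ^ 4) * b" "c' = (4 * t ^ 5 + 1) / (3 * t ^ 4) * b'"
    using False by (simp_all add: field_simps)
  show ?thesis unfolding a unfolding c by (simp add: algebra_simps)
qed

text \<open>Two members of the net are two lines in the plane, meeting at the point (l, m, n) given
  by their cross product, and the common zeros are the parameters mapped to it; \<open>eqs\<close>
  expresses this proportionality. Both syzygies then vanish on (l, m, n). The one of degree 2 gives
  \<open>l X^2 + m X Y + n Y^2 = 0\<close>, which has at most two solutions up to scaling, and this
  is why the curve has no triple point.\<close>

lemma quintic_base_points:
  fixes a b c a' b' c' :: complex
  assumes "(b * c' - c * b', c * a' - a * c', a * b' - b * a') \<noteq> (0, 0, 0)"
  shows "(\<forall>X Y. quintic a b c X Y = 0 \<longrightarrow> quintic a' b' c' X Y = 0 \<longrightarrow> X = 0 \<or> Y = 0) \<or>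
    (\<exists>t u. \<forall>X Y. quintic a b c X Y = 0 \<longrightarrow> quintic a' b' c' X Y = 0 \<longrightarrow> (X, Y) \<noteq> (0, 0) \<longrightarrow>
      X \<noteq> 0 \<and> (Y = t * X \<or> Y = u * X))"
proof -
  define l m n where "l = b * c' - c * b'" and "m = c * a' - a * c'" and "n = a * b' - b * a'"
  have eqs: "n * (X ^ 4 * Y) + l * (X * Y ^ 4) = 0" "l * (Y ^ 5 - X ^ 5) - m * (X ^ 4 * Y) = 0"
    "m * (X * Y ^ 4) + n * (Y ^ 5 - X ^ 5) = 0"
    if q: "quintic a b c X Y = 0" "quintic a' b' c' X Y = 0" for X Y
  proof -
    have "n * (X ^ 4 * Y) + l * (X * Y ^ 4) = b' * quintic a b c X Y - b * quintic a' b' c' X Y"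
      "l * (Y ^ 5 - X ^ 5) - m * (X ^ 4 * Y) = c' * quintic a b c X Y - c * quintic a' b' c' X Y"
      "m * (X * Y ^ 4) + n * (Y ^ 5 - X ^ 5) = a * quintic a' b' c' X Y - a' * quintic a b c X Y"
      by (simp_all add: quintic_def l_def m_def n_def algebra_simps)
    then show "n * (X ^ 4 * Y) + l * (X * Y ^ 4) = 0" "l * (Y ^ 5 - X ^ 5) - m * (X ^ 4 * Y) = 0"
      "m * (X * Y ^ 4) + n * (Y ^ 5 - X ^ 5) = 0" using q by simp_all
  qed
  show ?thesis
  proof (cases "l = 0 \<and> n = 0")
    case True
    \<comment> \<open>Here the point is (0, 1, 0), a double point reached from the two parameters
      (1, 0) and (0, 1).\<close>
    then have "m \<noteq> 0" using assms by (auto simp: l_def m_def n_def)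
    then have "X = 0 \<or> Y = 0" if "quintic a b c X Y = 0" "quintic a' b' c' X Y = 0" for X Y
      using eqs(2)[OF that] True by auto
    then show ?thesis by blast
  next
    case False
    have XY: "X \<noteq> 0 \<and> Y \<noteq> 0" if q: "quintic a b c X Y = 0" "quintic a' b' c' X Y = 0" "(X, Y) \<noteq> (0, 0)" for X Y
      using eqs[OF q(1,2)] q(3) False by auto
    \<comment> \<open>The syzygy \<open>(Y^3, 0, X^3)\<close> evaluated at (l, m, n).\<close>
    have cub: "n * X ^ 3 + l * Y ^ 3 = 0"
      if q: "quintic a b c X Y = 0" "quintic a' b' c' X Y = 0" "(X, Y) \<noteq> (0, 0)" for X Y
    proof -
      have "X * Y * (n * X ^ 3 + l * Y ^ 3) = 0"
        using eqs(1)[OF q(1,2)] by (simp add: eval_nat_numeral algebra_simps)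
      then show ?thesis using XY[OF q] by simp
    qed
    show ?thesis
    proof (cases "l = 0 \<or> n = 0")
      case True
      have False if q: "quintic a b c X Y = 0" "quintic a' b' c' X Y = 0" "(X, Y) \<noteq> (0, 0)" for X Y
      proof -
        have "X ^ 3 \<noteq> 0" "Y ^ 3 \<noteq> 0" using XY[OF q] by simp_all
        from True show False
        proof
          assume l: "l = 0"
          then have "n * X ^ 3 = 0" using cub[OF q] by simp
          then show False using l False \<open>X ^ 3 \<noteq> 0\<close> unfolding mult_eq_0_iff by blast
        next
          assume n: "n = 0"
          then have "l * Y ^ 3 = 0" using cub[OF q] by simp
          then show False using n False \<open>Y ^ 3 \<noteq> 0\<close> unfolding mult_eq_0_iff by blast
        qed
      qed
      then show ?thesis by blast
    next
      case nz: False
      define s where "s = csqrt (m\<^sup>2 - 4 * l * n)"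
      have s: "s\<^sup>2 = m\<^sup>2 - 4 * l * n" by (simp add: s_def)
      define t u where "t = (- m + s) / (2 * n)" and "u = (- m - s) / (2 * n)"
      have tu: "t + u = - m / n" "t * u = l / n"
      proof -
        show "t + u = - m / n" using nz by (simp add: t_def u_def field_simps)
        have "t * u = (m\<^sup>2 - s\<^sup>2) / (4 * n\<^sup>2)" using nz by (simp add: t_def u_def field_simps power2_eq_square)
        also have "\<dots> = (4 * l * n) / (4 * n\<^sup>2)" by (simp only: s diff_diff_eq2 add_diff_cancel_left')
        also have "\<dots> = l / n" using nz by (simp add: power2_eq_square)
        finally show "t * u = l / n" .
      qed
      have "Y = t * X \<or> Y = u * X"
        if q: "quintic a b c X Y = 0" "quintic a' b' c' X Y = 0" "(X, Y) \<noteq> (0, 0)" for X Y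
      proof -
        \<comment> \<open>The syzygy \<open>(X^2, X Y, Y^2)\<close> evaluated at (l, m, n), obtained
          up to the factor \<open>X ^ 3\<close>; as an equation for \<open>Y / X\<close> it has the
          roots \<open>t\<close> and \<open>u\<close>.\<close>
        have "X ^ 3 * (n * Y\<^sup>2 + m * (X * Y) + l * X\<^sup>2)
            = Y\<^sup>2 * (n * X ^ 3 + l * Y ^ 3) - (l * (Y ^ 5 - X ^ 5) - m * (X ^ 4 * Y))"
          by (simp add: eval_nat_numeral algebra_simps)
        then have "X ^ 3 * (n * Y\<^sup>2 + m * (X * Y) + l * X\<^sup>2) = 0"
          by (simp only: cub[OF q] eqs(2)[OF q(1,2)] mult_zero_right diff_self)
        then have quad: "n * Y\<^sup>2 + m * (X * Y) + l * X\<^sup>2 = 0" using XY[OF q] by simp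
        have "n * ((Y - t * X) * (Y - u * X)) = n * Y\<^sup>2 - n * (t + u) * (X * Y) + n * (t * u) * X\<^sup>2"
          by (simp add: power2_eq_square algebra_simps)
        also have "\<dots> = n * Y\<^sup>2 + m * (X * Y) + l * X\<^sup>2" unfolding tu using nz by simp
        finally have "n * ((Y - t * X) * (Y - u * X)) = 0" using quad by simp
        then show ?thesis using nz by simp
      qed
      then have "\<forall>X Y. quintic a b c X Y = 0 \<longrightarrow> quintic a' b' c' X Y = 0 \<longrightarrow> (X, Y) \<noteq> (0, 0) \<longrightarrow>
          X \<noteq> 0 \<and> (Y = t * X \<or> Y = u * X)"
        using XY by blast
      then show ?thesis by (intro disjI2 exI[of _ t] exI[of _ u])
    qed
  qed
qed

section \<open>Fixed divisors of the pencils in the net\<close>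

lemma linear_pencil_form:
  "homogeneous 1 (y - t *\<^sub>C x)" "\<not> vanishes (y - t *\<^sub>C x)"
proof -
  show "homogeneous 1 (y - t *\<^sub>C x)" by (intro homogeneous_diff homogeneous_scale x y)
  obtain p where p: "p \<in> C" "x (rep p) = 0" using linear_form_has_zero[OF x] by blast
  then have "(y - t *\<^sub>C x) (rep p) \<noteq> 0" using no_base_point[OF p(1)] by simp
  then show "\<not> vanishes (y - t *\<^sub>C x)" using p(1) by (auto simp: vanishes_def)
qed

text \<open>At \<open>p\<close> the cofactor of \<open>Y - t X\<close> has the value
  \<open>x (rep p) ^ 4\<close> times the derivative of \<open>quintic a b c 1\<close> at
  \<open>t\<close>. At a simple zero it is therefore a unit, and the linear factor carries the whole
  order.\<close>

lemma order_quintic_zero: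
  assumes p: "p \<in> C" and xp: "x (rep p) \<noteq> 0" and yp: "y (rep p) = t * x (rep p)"
    and 0: "quintic a b c 1 t = 0" and simple: "a + 5 * t ^ 4 * b - 4 * t ^ 3 * c \<noteq> 0"
  shows "\<not> vanishes (quintic_form a b c)" "order_at p (quintic_form a b c) = order_at p (y - t *\<^sub>C x)"
proof -
  define Q where "Q = a *\<^sub>C x ^ 4 + b *\<^sub>C (y ^ 4 + t *\<^sub>C (y ^ 3 * x) + t\<^sup>2 *\<^sub>C (y ^ 2 * x ^ 2) + t ^ 3 *\<^sub>C (y * x ^ 3) + t ^ 4 *\<^sub>C x ^ 4)
      - c *\<^sub>C (x * y ^ 3 + t *\<^sub>C (y ^ 2 * x ^ 2) + t\<^sup>2 *\<^sub>C (y * x ^ 3) + t ^ 3 *\<^sub>C x ^ 4)"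
  have xn: "homogeneous k (x ^ k)" "homogeneous k (y ^ k)" for k
    using homogeneous_power[OF x(1), of k] homogeneous_power[OF y(1), of k] by simp_all
  have "homogeneous 4 (x ^ 4)" "homogeneous 4 (y ^ 4)" "homogeneous 4 (y ^ 3 * x)" "homogeneous 4 (y ^ 2 * x ^ 2)"
    "homogeneous 4 (y * x ^ 3)" "homogeneous 4 (x * y ^ 3)"
    using xn homogeneous_mult[OF xn(2)[of 3] x(1)] homogeneous_mult[OF xn(2)[of 2] xn(1)[of 2]]
      homogeneous_mult[OF y(1) xn(1)[of 3]] homogeneous_mult[OF x(1) xn(2)[of 3]] by simp_all
  then have Q: "homogeneous 4 Q" unfolding Q_def by (intro homogeneous_diff homogeneous_add homogeneous_scale)
  have "Q (rep p) = x (rep p) ^ 4 * (a + 5 * t ^ 4 * b - 4 * t ^ 3 * c)"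
    unfolding Q_def by (simp add: yp eval_nat_numeral algebra_simps)
  then have Qp: "Q (rep p) \<noteq> 0" using xp simple by simp
  have "quintic_form a b c = (y - t *\<^sub>C x) * Q"
    unfolding quintic_form_def quintic_factor[OF 0] Q_def
    by (simp add: fun_eq_iff eval_nat_numeral algebra_simps)
  then show "\<not> vanishes (quintic_form a b c)" "order_at p (quintic_form a b c) = order_at p (y - t *\<^sub>C x)"
    using order_at_unit_mult[OF p linear_pencil_form Q Qp] by simp_all
qed

text \<open>The counterpart at the parameter (0, 1): without the middle term the form is
  \<open>x\<close> times a cofactor, which at \<open>p\<close> takes the nonzero value
  \<open>- c * y (rep p) ^ 4\<close>.\<close>

lemma order_quintic_infinity:
  assumes p: "p \<in> C" and xp: "x (rep p) = 0" and c: "c \<noteq> 0"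
  shows "\<not> vanishes (quintic_form a 0 c)" "order_at p (quintic_form a 0 c) = order_at p x"
proof -
  define Q where "Q = a *\<^sub>C (x ^ 3 * y) - c *\<^sub>C y ^ 4"
  have "homogeneous 4 (x ^ 3 * y)"
    by (rule homogeneous_cong_degree[OF homogeneous_mult[OF homogeneous_power[OF x(1)] y(1)]]) simp
  moreover have "homogeneous 4 (y ^ 4)" using homogeneous_power[OF y(1), of 4] by simp
  ultimately have Q: "homogeneous 4 Q" unfolding Q_def by (intro homogeneous_diff homogeneous_scale)
  have Qp: "Q (rep p) \<noteq> 0" using no_base_point[OF p] xp c by (simp add: Q_def)
  have "quintic_form a 0 c = x * Q"
    by (simp add: Q_def quintic_form_def quintic_def fun_eq_iff eval_nat_numeral algebra_simps)
  then show "\<not> vanishes (quintic_form a 0 c)" "order_at p (quintic_form a 0 c) = order_at p x"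
    using order_at_unit_mult[OF p x Q Qp] by simp_all
qed

text \<open>Fixed points of a pencil lie over at most two parameters of the quintic. Since the
  quintic is an immersion, at each of them some member of the pencil has only a simple zero in the
  parameter. So the fixed divisor is bounded by the divisors of two linear forms, the pullbacks of
  these parameters.\<close>

lemma base_order_le_order:
  assumes "(b * c' - c * b', c * a' - a * c', a * b' - b * a') \<noteq> (0, 0, 0)"
    and V': "quintic_section a b c \<in> V'" "quintic_section a' b' c' \<in> V'"
  shows "\<exists>f g. homogeneous 1 f \<and> \<not> vanishes f \<and> homogeneous 1 g \<and> \<not> vanishes g \<and>
    (\<forall>p\<in>C. base_order 5 V' p \<le> order_at p f + order_at p g)"
proof -
  have le: "base_order 5 V' p \<le> order_at p (quintic_form a b c)" if "\<not> vanishes (quintic_form a b c)" for p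
    using base_order_le[OF homogeneous_quintic_form that] V'(1) by (simp add: quintic_section_def)
  have le': "base_order 5 V' p \<le> order_at p (quintic_form a' b' c')" if "\<not> vanishes (quintic_form a' b' c')" for p
    using base_order_le[OF homogeneous_quintic_form that] V'(2) by (simp add: quintic_section_def)
  have free: "base_order 5 V' p = 0"
    if p: "p \<in> C" and nz: "quintic_form a b c (rep p) \<noteq> 0 \<or> quintic_form a' b' c' (rep p) \<noteq> 0" for p
  proof -
    have "order_at p F = 0 \<and> \<not> vanishes F" if "homogeneous 5 F" "F (rep p) \<noteq> 0" for F
    proof -
      have "\<not> vanishes F" using p that(2) by (auto simp: vanishes_def)
      then show ?thesis using order_at_eq_0_iff[OF p that(1)] that(2) by blast
    qed
    then show ?thesis using nz le[of p] le'[of p] homogeneous_quintic_form by (metis le_zero_eq)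
  qed
  have at_t: "base_order 5 V' p \<le> order_at p (y - t *\<^sub>C x)"
    if p: "p \<in> C" and xp: "x (rep p) \<noteq> 0" and yp: "y (rep p) = t * x (rep p)" for p t
  proof (cases "quintic a b c 1 t = 0 \<and> quintic a' b' c' 1 t = 0")
    case True
    then have "a + 5 * t ^ 4 * b - 4 * t ^ 3 * c \<noteq> 0 \<or> a' + 5 * t ^ 4 * b' - 4 * t ^ 3 * c' \<noteq> 0"
      using quintic_simple_zero[of a b c t a' b' c'] assms(1) by auto
    then show ?thesis
      using order_quintic_zero[OF p xp yp] True le[of p] le'[of p] by metis
  next
    case False
    have "quintic \<alpha> \<beta> \<gamma> (x (rep p)) (y (rep p)) = x (rep p) ^ 5 * quintic \<alpha> \<beta> \<gamma> 1 t" for \<alpha> \<beta> \<gamma>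
      using quintic_homogeneous[of \<alpha> \<beta> \<gamma> "x (rep p)" 1 t] by (simp add: yp mult.commute)
    then have "quintic_form a b c (rep p) \<noteq> 0 \<or> quintic_form a' b' c' (rep p) \<noteq> 0"
      using False xp by (auto simp: quintic_form_def)
    then show ?thesis using free[OF p] by simp
  qed
  have at_inf: "base_order 5 V' p \<le> order_at p x" if p: "p \<in> C" and xp: "x (rep p) = 0" for p
  proof (cases "b = 0 \<and> b' = 0")
    case True
    then have "c \<noteq> 0 \<or> c' \<noteq> 0" using assms(1) by auto
    then show ?thesis using order_quintic_infinity[OF p xp] True le[of p] le'[of p] by metis
  next
    case False
    then have "quintic_form a b c (rep p) \<noteq> 0 \<or> quintic_form a' b' c' (rep p) \<noteq> 0"
      using no_base_point[OF p] xp by (auto simp: quintic_form_def quintic_def)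
    then show ?thesis using free[OF p] by simp
  qed
  from quintic_base_points[OF assms(1)] show ?thesis
  proof
    assume *: "\<forall>X Y. quintic a b c X Y = 0 \<longrightarrow> quintic a' b' c' X Y = 0 \<longrightarrow> X = 0 \<or> Y = 0"
    have "base_order 5 V' p \<le> order_at p x + order_at p y" if p: "p \<in> C" for p
    proof (cases "quintic_form a b c (rep p) = 0 \<and> quintic_form a' b' c' (rep p) = 0")
      case True
      then have "x (rep p) = 0 \<or> y (rep p) = 0" using * by (simp add: quintic_form_def)
      moreover have "y - 0 *\<^sub>C x = y" by (simp add: fun_eq_iff)
      ultimately show ?thesis
        using at_inf[OF p] at_t[OF p, of 0] no_base_point[OF p] by (metis mult_zero_left trans_le_add1 trans_le_add2)
    next
      case False
      then show ?thesis using free[OF p] by auto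
    qed
    then show ?thesis using x y by blast
  next
    assume "\<exists>t u. \<forall>X Y. quintic a b c X Y = 0 \<longrightarrow> quintic a' b' c' X Y = 0 \<longrightarrow> (X, Y) \<noteq> (0, 0) \<longrightarrow>
      X \<noteq> 0 \<and> (Y = t * X \<or> Y = u * X)"
    then obtain t u where *: "\<And>X Y. quintic a b c X Y = 0 \<Longrightarrow> quintic a' b' c' X Y = 0 \<Longrightarrow> (X, Y) \<noteq> (0, 0) \<Longrightarrow>
      X \<noteq> 0 \<and> (Y = t * X \<or> Y = u * X)" by blast
    have "base_order 5 V' p \<le> order_at p (y - t *\<^sub>C x) + order_at p (y - u *\<^sub>C x)" if p: "p \<in> C" for p
    proof (cases "quintic_form a b c (rep p) = 0 \<and> quintic_form a' b' c' (rep p) = 0")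
      case True
      then have "x (rep p) \<noteq> 0 \<and> (y (rep p) = t * x (rep p) \<or> y (rep p) = u * x (rep p))"
        using *[of "x (rep p)" "y (rep p)"] no_base_point[OF p] by (auto simp: quintic_form_def)
      then show ?thesis using at_t[OF p] by (metis trans_le_add1 trans_le_add2)
    next
      case False
      then show ?thesis using free[OF p] by auto
    qed
    then show ?thesis using linear_pencil_form by blast
  qed
qed

text \<open>Only pencils occur, because a proper subspace of the net has dimension at most 2.
  Independence is recorded as a nonzero cross product of coefficient vectors, the form that
  \<open>quintic_base_points\<close> expects.\<close>

lemma two_independent:
  assumes V': "complex_vector.subspace V'" "V' \<subset> V" "2 \<le> complex_vector.dim V'"
  obtains a b c a' b' c' where "(b * c' - c * b', c * a' - a * c', a * b' - b * a') \<noteq> (0, 0, 0)"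
    "quintic_section a b c \<in> V'" "quintic_section a' b' c' \<in> V'" "complex_vector.dim V' = 2"
proof -
  obtain B where B: "B \<subseteq> V'" "complex_vector.independent B" "V' \<subseteq> complex_vector.span B" "card B = complex_vector.dim V'"
    by (rule complex_vector.basis_exists)
  have spanB: "complex_vector.span B = V'"
    using B(1,3) complex_vector.span_minimal[OF B(1) V'(1)] by blast
  obtain v where v: "v \<in> V" "v \<notin> V'" using V'(2) by blast
  have ind: "complex_vector.independent (insert v B)"
    using B(2) v(2) spanB by (simp add: complex_vector.independent_insert)
  have "insert v B \<subseteq> complex_vector.span V_basis"
    unfolding span_V_basis using v B(1) V'(2) by blast
  from complex_vector.independent_span_bound[OF card_V_basis(1) ind this]
  have fin: "finite (insert v B)" "card (insert v B) \<le> 3" by (simp_all only: card_V_basis(2))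
  have "v \<notin> B" using v(2) B(1) by blast
  then have card: "card B = 2" using fin B(4) V'(3) by simp
  then obtain v1 v2 where v12: "B = {v1, v2}" "v1 \<noteq> v2" by (metis card_2_iff)
  have mem: "v1 \<in> V'" "v2 \<in> V'" using B(1) v12 by auto
  obtain a b c where 1: "v1 = quintic_section a b c" using mem V'(2) by (blast elim: V_E)
  obtain a' b' c' where 2: "v2 = quintic_section a' b' c'" using mem V'(2) by (blast elim: V_E)
  have indep: "s = 0 \<and> u = 0" if "s * a + u * a' = 0" "s * b + u * b' = 0" "s * c + u * c' = 0" for s u
  proof (rule ccontr)
    assume nz: "\<not> (s = 0 \<and> u = 0)"
    have "s *\<^sub>C v1 + u *\<^sub>C v2 = quintic_section (s * a + u * a') (s * b + u * b') (s * c + u * c')"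
      unfolding 1 2 by (simp only: quintic_section_linear)
    also have "\<dots> = 0" unfolding that by (rule quintic_section_zero)
    finally have rel: "s *\<^sub>C v1 + u *\<^sub>C v2 = 0" .
    define w where "w = (\<lambda>v. if v = v1 then s else u)"
    have "(\<Sum>v\<in>B. w v *\<^sub>C v) = 0" using rel v12 by (simp add: w_def)
    moreover have "\<exists>v\<in>B. w v \<noteq> 0" using nz v12 by (auto simp: w_def)
    ultimately have "complex_vector.dependent B"
      using complex_vector.dependent_finite[of B] v12(1) by auto
    then show False using B(2) by simp
  qed
  have "(b * c' - c * b', c * a' - a * c', a * b' - b * a') \<noteq> (0, 0, 0)"
  proof
    assume "(b * c' - c * b', c * a' - a * c', a * b' - b * a') = (0, 0, 0)"
    then have z: "b * c' = c * b'" "c * a' = a * c'" "a * b' = b * a'" by auto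
    \<comment> \<open>When the cross product vanishes, \<open>a'\<close> times the first vector
      minus \<open>a\<close> times the second is zero; the other two coordinates give analogous
      relations.\<close>
    have "a' = 0 \<and> a = 0" using indep[of a' "- a"] z by (simp add: algebra_simps)
    moreover have "b' = 0 \<and> b = 0" using indep[of b' "- b"] z by (simp add: algebra_simps)
    moreover have "c' = 0 \<and> c = 0" using indep[of c' "- c"] z by (simp add: algebra_simps)
    ultimately show False using indep[of 1 0] by simp
  qed
  then show ?thesis
    by (rule that) (use 1 2 mem card B(4) in simp_all)
qed

lemma linearly_stable_V: "linearly_stable C (generated_subsheaf C V) V"
  unfolding linearly_stable_def
proof (intro allI impI, elim conjE)
  fix V' assume V': "complex_vector.subspace V'" "V' \<subset> V" "2 \<le> complex_vector.dim V'"
  obtain a b c a' b' c' where ind: "(b * c' - c * b', c * a' - a * c', a * b' - b * a') \<noteq> (0, 0, 0)"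
    "quintic_section a b c \<in> V'" "quintic_section a' b' c' \<in> V'" and dim: "complex_vector.dim V' = 2"
    by (rule two_independent[OF V'])
  obtain f g where fg: "homogeneous 1 f" "\<not> vanishes f" "homogeneous 1 g" "\<not> vanishes g"
    "\<forall>p\<in>C. base_order 5 V' p \<le> order_at p f + order_at p g"
    using base_order_le_order[OF ind] by blast
  have "(a, b, c) \<noteq> (0, 0, 0)" using ind(1) by auto
  then have nv: "\<not> vanishes (quintic_form a b c)" by (simp only: not_vanishes_quintic not_False_eq_True)
  then have "quintic_section a b c \<noteq> 0" by (simp add: quintic_section_def restrict_form_eq_0_iff)
  then have fs: "form_system 5 V'" using form_system_subspace ind(2) V'(2) by blast
  let ?P = "{p \<in> C. order_at p (quintic_form a b c) \<noteq> 0}"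
  define Q where "Q = ?P \<union> {p \<in> C. order_at p f \<noteq> 0} \<union> {p \<in> C. order_at p g \<noteq> 0}"
  have Q: "finite Q" "Q \<subseteq> C" "{p \<in> C. order_at p f \<noteq> 0} \<subseteq> Q" "{p \<in> C. order_at p g \<noteq> 0} \<subseteq> Q" "?P \<subseteq> Q"
    unfolding Q_def using order_at_eq_0_outside[OF fg(1,2)] order_at_eq_0_outside[OF fg(3,4)]
      order_at_eq_0_outside[OF homogeneous_quintic_form nv] by auto
  have "(\<Sum>p\<in>?P. base_order 5 V' p) \<le> (\<Sum>p\<in>Q. base_order 5 V' p)"
    by (rule sum_mono2[OF Q(1,5)]) simp
  also have "\<dots> \<le> (\<Sum>p\<in>Q. order_at p f + order_at p g)"
    by (rule sum_mono) (use fg(5) Q(2) in blast)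
  also have "\<dots> = form_degree f + form_degree g"
    by (simp only: sum.distrib form_degree_eq[OF Q(1,3,2)] form_degree_eq[OF Q(1,4,2)])
  also have "\<dots> = 2 * hyperplane_degree"
    by (simp add: form_degree_homogeneous[OF fg(1,2)] form_degree_homogeneous[OF fg(3,4)])
  finally have "(\<Sum>p\<in>?P. base_order 5 V' p) \<le> 2 * hyperplane_degree" .
  then have le: "int (\<Sum>p\<in>?P. base_order 5 V' p) \<le> 2 * int hyperplane_degree" by linarith
  have "bundle_degree C (generated_subsheaf C V') = int (5 * hyperplane_degree) - int (\<Sum>p\<in>?P. base_order 5 V' p)"
    by (rule generated_degree[OF fs homogeneous_quintic_form nv]) (use ind(2) in \<open>simp add: quintic_section_def\<close>)
  \<comment> \<open>With \<open>m = hyperplane_degree\<close> the pencil has degree at least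
    \<open>3 m\<close>. Its denominator \<open>r'\<close> is 1, while the net has ratio
    \<open>5 m / 2\<close>.\<close>
  then have "3 * int hyperplane_degree \<le> bundle_degree C (generated_subsheaf C V')" using le by linarith
  then have "real_of_int (3 * int hyperplane_degree) \<le> real_of_int (bundle_degree C (generated_subsheaf C V'))"
    by (simp only: of_int_le_iff)
  then show "real_of_int (bundle_degree C (generated_subsheaf C V)) / (real (complex_vector.dim V) - 1)
      < real_of_int (bundle_degree C (generated_subsheaf C V')) / (real (complex_vector.dim V') - 1)"
    using hyperplane_degree_pos by (simp add: degree_V dim_V dim)
qed

end

text \<open>The dual span bundle is identified with an explicit sheaf over open sets only, so the
  sheaf notions have to be insensitive to the values on other sets.\<close>

lemma module_sheaf_cong:
  assumes "\<And>U. zariski_open_in C U \<Longrightarrow> E U = E' U"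
  shows "module_sheaf C E \<longleftrightarrow> module_sheaf C E'"
proof -
  have "(\<forall>s W. s \<in> E U \<and> zariski_open_in C W \<and> W \<subseteq> U \<longrightarrow> s \<in> E W) \<longleftrightarrow>
      (\<forall>s W. s \<in> E' U \<and> zariski_open_in C W \<and> W \<subseteq> U \<longrightarrow> s \<in> E' W)" if "zariski_open_in C U" for U
    using assms that by blast
  moreover have "(\<exists>W. zariski_open_in C W \<and> p \<in> W \<and> W \<subseteq> U \<and> s \<in> E W) \<longleftrightarrow>
      (\<exists>W. zariski_open_in C W \<and> p \<in> W \<and> W \<subseteq> U \<and> s \<in> E' W)" for U s p
    using assms by blast
  ultimately show ?thesis
    unfolding module_sheaf_def by (intro all_cong1 imp_cong refl) (simp only: assms)
qed

lemma frame_cong: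
  assumes "\<And>U. zariski_open_in C U \<Longrightarrow> E U = E' U"
  shows "frame C r E U e \<longleftrightarrow> frame C r E' U e"
  unfolding frame_def by (intro conj_cong all_cong1 imp_cong refl) (simp_all only: assms)

context pencil
begin

section \<open>The dual span bundle\<close>

text \<open>Coordinates on \<open>V\<close>, recovered from the section itself, because sections of
  the dual span bundle are functions whose values are elements of \<open>V\<close>.\<close>

definition coeff0 :: "('n proj \<Rightarrow> complex) \<Rightarrow> complex"
  where "coeff0 v = (THE a. \<exists>b c. v = quintic_section a b c)"

definition coeff1 :: "('n proj \<Rightarrow> complex) \<Rightarrow> complex"
  where "coeff1 v = (THE b. \<exists>a c. v = quintic_section a b c)"

definition coeff2 :: "('n proj \<Rightarrow> complex) \<Rightarrow> complex"
  where "coeff2 v = (THE c. \<exists>a b. v = quintic_section a b c)"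

lemma coeff_quintic_section [simp]:
  "coeff0 (quintic_section a b c) = a" "coeff1 (quintic_section a b c) = b" "coeff2 (quintic_section a b c) = c"
  unfolding coeff0_def coeff1_def coeff2_def quintic_section_inject by auto

lemma quintic_section_coeff: "v \<in> V \<Longrightarrow> quintic_section (coeff0 v) (coeff1 v) (coeff2 v) = v"
  by (elim V_E) simp

lemma coeff_sum:
  assumes "finite B" "B \<subseteq> V"
  shows "(\<Sum>v\<in>B. a v *\<^sub>C v) = quintic_section (\<Sum>v\<in>B. a v * coeff0 v) (\<Sum>v\<in>B. a v * coeff1 v) (\<Sum>v\<in>B. a v * coeff2 v)"
  using assms
proof (induction B)
  case empty
  then show ?case by (simp add: quintic_section_zero)
next
  case (insert v B)
  then have "a v *\<^sub>C v = quintic_section (a v * coeff0 v) (a v * coeff1 v) (a v * coeff2 v)"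
    by (simp add: quintic_section_linear quintic_section_coeff)
  then show ?case
    using insert by (simp only: sum.insert quintic_section_linear insert_subset simp_thms)
qed

text \<open>A common form for the dual span bundle and its line subbundle: regular triples of
  coefficients subject to a condition \<open>R q\<close> in each fibre. Module and frame properties
  can then be proved once for both.\<close>

definition coefficient_sheaf ::
    "('n proj \<Rightarrow> complex \<Rightarrow> complex \<Rightarrow> complex \<Rightarrow> bool) \<Rightarrow> ('n, 'n proj \<Rightarrow> complex) fun_sheaf"
  where "coefficient_sheaf R U = {\<sigma>. regular_on C U (\<lambda>q. coeff0 (\<sigma> q)) \<and> regular_on C U (\<lambda>q. coeff1 (\<sigma> q)) \<and>
    regular_on C U (\<lambda>q. coeff2 (\<sigma> q)) \<and>
    (\<forall>q\<in>U. \<sigma> q \<in> V \<and> R q (coeff0 (\<sigma> q)) (coeff1 (\<sigma> q)) (coeff2 (\<sigma> q)))}"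

lemma coefficient_sheafI:
  assumes "regular_on C U a" "regular_on C U b" "regular_on C U c"
    "\<And>q. q \<in> U \<Longrightarrow> R q (a q) (b q) (c q)" "\<And>q. q \<in> U \<Longrightarrow> \<sigma> q = quintic_section (a q) (b q) (c q)"
  shows "\<sigma> \<in> coefficient_sheaf R U"
proof -
  have "regular_on C U (\<lambda>q. coeff0 (\<sigma> q))" "regular_on C U (\<lambda>q. coeff1 (\<sigma> q))" "regular_on C U (\<lambda>q. coeff2 (\<sigma> q))"
    using assms(1-3) by (simp_all add: assms(5) cong: regular_on_cong)
  then show ?thesis unfolding coefficient_sheaf_def using assms(4,5) by (simp add: V_I)
qed

lemma coefficient_sheafD:
  assumes "\<sigma> \<in> coefficient_sheaf R U"
  shows "regular_on C U (\<lambda>q. coeff0 (\<sigma> q))" "regular_on C U (\<lambda>q. coeff1 (\<sigma> q))" "regular_on C U (\<lambda>q. coeff2 (\<sigma> q))"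
    "q \<in> U \<Longrightarrow> \<sigma> q \<in> V" "q \<in> U \<Longrightarrow> R q (coeff0 (\<sigma> q)) (coeff1 (\<sigma> q)) (coeff2 (\<sigma> q))"
  using assms unfolding coefficient_sheaf_def by auto

lemma module_sheaf_coefficient:
  assumes R: "\<And>q. R q 0 0 0" "\<And>q a b c a' b' c'. R q a b c \<Longrightarrow> R q a' b' c' \<Longrightarrow> R q (a + a') (b + b') (c + c')"
    "\<And>q t a b c. R q a b c \<Longrightarrow> R q (t * a) (t * b) (t * c)"
  shows "module_sheaf C (coefficient_sheaf R)"
  unfolding module_sheaf_def
proof (intro allI impI conjI ballI; (elim conjE)?)
  fix U assume U: "opn U"
  show "t \<in> coefficient_sheaf R U" if "s \<in> coefficient_sheaf R U" and "\<forall>q\<in>U. s q = t q" for s t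
  proof -
    have eq: "t q = s q" if "q \<in> U" for q using \<open>\<forall>q\<in>U. s q = t q\<close> that by simp
    show ?thesis
      by (rule coefficient_sheafI[where a = "\<lambda>q. coeff0 (s q)" and b = "\<lambda>q. coeff1 (s q)" and c = "\<lambda>q. coeff2 (s q)"])
        (simp_all only: eq quintic_section_coeff coefficient_sheafD[OF \<open>s \<in> _\<close>])
  qed
  show "s \<in> coefficient_sheaf R W" if s: "s \<in> coefficient_sheaf R U" and W: "opn W" "W \<subseteq> U" for s W
    unfolding coefficient_sheaf_def
    using coefficient_sheafD[OF s] regular_on_mono[OF _ W] W(2) by auto
  show "s \<in> coefficient_sheaf R U"
    if s: "\<forall>p\<in>U. \<exists>W. opn W \<and> p \<in> W \<and> W \<subseteq> U \<and> s \<in> coefficient_sheaf R W" for s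
  proof -
    have "regular_on C U (\<lambda>q. coeff0 (s q))" "regular_on C U (\<lambda>q. coeff1 (s q))" "regular_on C U (\<lambda>q. coeff2 (s q))"
      by (rule regular_on_local, use s coefficient_sheafD(1-3) in meson)+
    moreover have "s q \<in> V \<and> R q (coeff0 (s q)) (coeff1 (s q)) (coeff2 (s q))" if q: "q \<in> U" for q
    proof -
      obtain W where "q \<in> W" "s \<in> coefficient_sheaf R W" using s q by blast
      then show ?thesis using coefficient_sheafD(4,5) by simp
    qed
    ultimately show ?thesis unfolding coefficient_sheaf_def by simp
  qed
  show "(\<lambda>q. 0) \<in> coefficient_sheaf R U"
    by (rule coefficient_sheafI[where a = "\<lambda>_. 0" and b = "\<lambda>_. 0" and c = "\<lambda>_. 0"])
      (simp_all only: regular_on_const[OF U] R(1) quintic_section_zero)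
  show "(\<lambda>q. s q + t q) \<in> coefficient_sheaf R U"
    if s: "s \<in> coefficient_sheaf R U" and t: "t \<in> coefficient_sheaf R U" for s t
    by (rule coefficient_sheafI[where a = "\<lambda>q. coeff0 (s q) + coeff0 (t q)"
          and b = "\<lambda>q. coeff1 (s q) + coeff1 (t q)" and c = "\<lambda>q. coeff2 (s q) + coeff2 (t q)"])
      (simp_all only: regular_on_add coefficient_sheafD[OF s] coefficient_sheafD[OF t] R(2)
        quintic_section_linear(1) quintic_section_coeff)
  show "(\<lambda>q. a q *\<^sub>C s q) \<in> coefficient_sheaf R U"
    if s: "s \<in> coefficient_sheaf R U" and a: "regular_on C U a" for a s
    by (rule coefficient_sheafI[where a = "\<lambda>q. a q * coeff0 (s q)"
          and b = "\<lambda>q. a q * coeff1 (s q)" and c = "\<lambda>q. a q * coeff2 (s q)"])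
      (simp_all only: regular_on_mult a coefficient_sheafD[OF s] R(3) quintic_section_linear(2) quintic_section_coeff)
qed

text \<open>The frame property is checked fibre by fibre: \<open>\<Lambda>\<close> gives explicit
  coordinates of a vector in the fibre, and open sets enter only through the regularity of these
  coordinates along sections.\<close>

lemma frame_coefficient:
  assumes U: "opn U" and e: "\<And>i. i < r \<Longrightarrow> e i \<in> coefficient_sheaf R U"
    and reg: "\<And>W \<sigma> i. opn W \<Longrightarrow> W \<subseteq> U \<Longrightarrow> \<sigma> \<in> coefficient_sheaf R W \<Longrightarrow> regular_on C W (\<lambda>q. \<Lambda> i q (\<sigma> q))"
    and expand: "\<And>q v. q \<in> U \<Longrightarrow> v \<in> V \<Longrightarrow> R q (coeff0 v) (coeff1 v) (coeff2 v) \<Longrightarrow> v = (\<Sum>i<r. \<Lambda> i q v *\<^sub>C e i q)"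
    and unique: "\<And>q a i. q \<in> U \<Longrightarrow> (\<Sum>i<r. a i *\<^sub>C e i q) = 0 \<Longrightarrow> i < r \<Longrightarrow> a i = 0"
  shows "frame C r (coefficient_sheaf R) U e"
proof (rule frameI[OF U])
  show "e i \<in> coefficient_sheaf R U" if "i < r" for i using e[OF that] .
  show "\<exists>W' a. opn W' \<and> p \<in> W' \<and> W' \<subseteq> W \<and> (\<forall>i<r. regular_on C W' (a i)) \<and> (\<forall>q\<in>W'. s q = (\<Sum>i<r. a i q *\<^sub>C e i q))"
    if W: "opn W" "W \<subseteq> U" and s: "s \<in> coefficient_sheaf R W" and p: "p \<in> W" for W s p
  proof (intro exI conjI allI impI ballI)
    show "opn W" "p \<in> W" "W \<subseteq> W" using W p by auto
    show "regular_on C W (\<lambda>q. \<Lambda> i q (s q))" for i by (rule reg[OF W s])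
    show "s q = (\<Sum>i<r. \<Lambda> i q (s q) *\<^sub>C e i q)" if "q \<in> W" for q
      by (rule expand[OF _ coefficient_sheafD(4)[OF s that] coefficient_sheafD(5)[OF s that]]) (use that W(2) in blast)
  qed
  show "a i q = 0" if "opn W" "W \<subseteq> U" "\<forall>i<r. regular_on C W (a i)" "\<forall>q\<in>W. (\<Sum>i<r. a i q *\<^sub>C e i q) = 0" "i < r" "q \<in> W"
    for W a i q
    using unique[of q "\<lambda>i. a i q" i] that by blast
qed

definition syzygy :: "'n proj \<Rightarrow> complex \<Rightarrow> complex \<Rightarrow> complex \<Rightarrow> bool"
  where "syzygy q a b c \<longleftrightarrow> quintic a b c (x (rep q)) (y (rep q)) = 0"

text \<open>The multiples of the syzygy \<open>(X\<^sup>2, XY, Y\<^sup>2)\<close>.\<close>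

definition conic_syzygy :: "'n proj \<Rightarrow> complex \<Rightarrow> complex \<Rightarrow> complex \<Rightarrow> bool"
  where "conic_syzygy q a b c \<longleftrightarrow> b * x (rep q) = a * y (rep q) \<and> c * x (rep q) = b * y (rep q)"

text \<open>The quintic equals \<open>X ^ 4 * (a Y - b X) + Y ^ 4 * (b Y - c X)\<close>, and both
  brackets are zero for a multiple of \<open>(X^2, X Y, Y^2)\<close>.\<close>

lemma conic_syzygy_imp_syzygy:
  assumes "conic_syzygy q a b c" shows "syzygy q a b c"
proof -
  have "quintic a b c X Y = X ^ 4 * (a * Y - b * X) + Y ^ 4 * (b * Y - c * X)" for X Y
    by (simp add: quintic_def eval_nat_numeral algebra_simps)
  then show ?thesis using assms by (simp add: syzygy_def conic_syzygy_def)
qed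

lemma module_sheaf_syzygy: "module_sheaf C (coefficient_sheaf syzygy)"
proof (rule module_sheaf_coefficient)
  have lin: "quintic (a + a') (b + b') (c + c') X Y = quintic a b c X Y + quintic a' b' c' X Y"
    "quintic (t * a) (t * b) (t * c) X Y = t * quintic a b c X Y" for t a b c a' b' c' X Y
    by (simp_all add: quintic_def algebra_simps)
  show "syzygy q 0 0 0" for q by (simp add: syzygy_def quintic_def)
  show "syzygy q (a + a') (b + b') (c + c')" if "syzygy q a b c" "syzygy q a' b' c'" for q a b c a' b' c'
    using that by (simp add: syzygy_def lin)
  show "syzygy q (t * a) (t * b) (t * c)" if "syzygy q a b c" for q t a b c
    using that by (simp add: syzygy_def lin)
qed

lemma module_sheaf_conic_syzygy: "module_sheaf C (coefficient_sheaf conic_syzygy)"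
  by (rule module_sheaf_coefficient) (simp_all add: conic_syzygy_def algebra_simps)

lemma dual_span_bundle_eq:
  assumes U: "opn U" shows "dual_span_bundle C V U = coefficient_sheaf syzygy U"
proof -
  have ev: "evaluation \<sigma> q = 0 \<longleftrightarrow> syzygy q (coeff0 (\<sigma> q)) (coeff1 (\<sigma> q)) (coeff2 (\<sigma> q))"
    if q: "q \<in> U" and v: "\<sigma> q \<in> V" for \<sigma> q
  proof -
    obtain a b c where \<sigma>: "\<sigma> q = quintic_section a b c" using v by (rule V_E)
    have "q \<in> C" using q open_in_subset[OF U] by blast
    then show ?thesis unfolding evaluation_def \<sigma> by (simp add: quintic_section_apply syzygy_def)
  qed
  have "\<sigma> \<in> coefficient_sheaf syzygy U" if "\<sigma> \<in> dual_span_bundle C V U" for \<sigma>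
  proof -
    from that obtain B a where B: "finite B" "B \<subseteq> V" and a: "\<forall>v\<in>B. regular_on C U (a v)"
      and \<sigma>: "\<forall>q\<in>U. \<sigma> q = (\<Sum>v\<in>B. a v q *\<^sub>C v)" and 0: "\<forall>q\<in>U. evaluation \<sigma> q = 0"
      unfolding dual_span_bundle_def trivial_bundle_def by blast
    have \<sigma>_eq: "\<sigma> q = quintic_section (\<Sum>v\<in>B. a v q * coeff0 v) (\<Sum>v\<in>B. a v q * coeff1 v) (\<Sum>v\<in>B. a v q * coeff2 v)"
      if "q \<in> U" for q
      using \<sigma> that coeff_sum[OF B, of "\<lambda>v. a v q"] by simp
    have reg: "regular_on C U (\<lambda>q. \<Sum>v\<in>B. a v q * k v)" for k
      by (rule regular_on_sum[OF U], rule regular_on_mult) (use a regular_on_const[OF U] in auto)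
    show ?thesis
    proof (rule coefficient_sheafI[OF reg reg reg _ \<sigma>_eq])
      fix q assume q: "q \<in> U"
      have "\<sigma> q \<in> V" unfolding \<sigma>_eq[OF q] by (rule V_I)
      then have "syzygy q (coeff0 (\<sigma> q)) (coeff1 (\<sigma> q)) (coeff2 (\<sigma> q))" using ev[of q \<sigma>] 0 q by blast
      then show "syzygy q (\<Sum>v\<in>B. a v q * coeff0 v) (\<Sum>v\<in>B. a v q * coeff1 v) (\<Sum>v\<in>B. a v q * coeff2 v)"
        unfolding \<sigma>_eq[OF q] coeff_quintic_section .
    qed
  qed
  moreover have "\<sigma> \<in> dual_span_bundle C V U" if \<sigma>: "\<sigma> \<in> coefficient_sheaf syzygy U" for \<sigma>
  proof -
    note D = coefficient_sheafD[OF \<sigma>]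
    \<comment> \<open>On the three basis sections the coefficient functions are 0 or 1, so this one
      expression selects the right coordinate for each of them.\<close>
    let ?a = "\<lambda>v q. coeff0 (\<sigma> q) * coeff0 v + coeff1 (\<sigma> q) * coeff1 v + coeff2 (\<sigma> q) * coeff2 v"
    have reg: "regular_on C U (?a v)" for v
      by (intro regular_on_add regular_on_mult D regular_on_const[OF U])
    have eq: "\<sigma> q = (\<Sum>v\<in>V_basis. ?a v q *\<^sub>C v)" if "q \<in> U" for q
    proof -
      have "quintic_section (coeff0 (\<sigma> q)) (coeff1 (\<sigma> q)) (coeff2 (\<sigma> q)) = (\<Sum>v\<in>V_basis. ?a v q *\<^sub>C v)"
        unfolding sum_V_basis by (subst quintic_section_basis) simp
      then show ?thesis by (simp only: quintic_section_coeff[OF D(4)[OF that]])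
    qed
    have "V_basis \<subseteq> V" by (auto simp: V_basis_def V_I)
    then have "\<sigma> \<in> trivial_bundle C V U"
      unfolding trivial_bundle_def
      by (intro CollectI exI[of _ V_basis] exI[of _ ?a] conjI ballI card_V_basis(1) reg eq)
    moreover have "evaluation \<sigma> q = 0" if "q \<in> U" for q
      using ev[of q \<sigma>] that D(4)[OF that] D(5)[OF that] by blast
    ultimately show ?thesis unfolding dual_span_bundle_def by blast
  qed
  ultimately show ?thesis by (intro subset_antisym subsetI)
qed

section \<open>Frames of the dual span bundle\<close>

abbreviation affine_x :: "'n proj set"
  where "affine_x \<equiv> {q \<in> C. x (rep q) \<noteq> 0}"

abbreviation affine_y :: "'n proj set"
  where "affine_y \<equiv> {q \<in> C. y (rep q) \<noteq> 0}"

definition slope_xy :: "'n proj \<Rightarrow> complex"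
  where "slope_xy q = y (rep q) / x (rep q)"

definition slope_yx :: "'n proj \<Rightarrow> complex"
  where "slope_yx q = x (rep q) / y (rep q)"

lemma open_affine: "opn affine_x" "opn affine_y"
  by (rule open_in_nonzero[OF x(1)], rule open_in_nonzero[OF y(1)])

lemma regular_slope:
  "opn W \<Longrightarrow> W \<subseteq> affine_x \<Longrightarrow> regular_on C W slope_xy" "opn W \<Longrightarrow> W \<subseteq> affine_y \<Longrightarrow> regular_on C W slope_yx"
  by (rule regular_on_quotient[OF _ y(1) x(1)], auto simp: slope_xy_def)
    (rule regular_on_quotient[OF _ x(1) y(1)], auto simp: slope_yx_def)

text \<open>The syzygies \<open>(X^2, X Y, Y^2)\<close> and \<open>(Y^3, 0, X^3)\<close>, divided by
  \<open>X ^ 2\<close> and \<open>X ^ 3\<close> and written in \<open>z = Y / X\<close>. The entry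
  with index 0 alone is the frame of the line subbundle.\<close>

definition frame_x :: "nat \<Rightarrow> 'n proj \<Rightarrow> 'n proj \<Rightarrow> complex"
  where "frame_x i q = (if i = 0 then quintic_section 1 (slope_xy q) (slope_xy q ^ 2) else quintic_section (slope_xy q ^ 3) 0 1)"

definition frame_y :: "nat \<Rightarrow> 'n proj \<Rightarrow> 'n proj \<Rightarrow> complex"
  where "frame_y i q = (if i = 0 then quintic_section (slope_yx q ^ 2) (slope_yx q) 1 else quintic_section 1 0 (slope_yx q ^ 3))"

lemma frame_x_eq:
  "frame_x 0 q = quintic_section 1 (slope_xy q) (slope_xy q ^ 2)" "frame_x 1 q = quintic_section (slope_xy q ^ 3) 0 1"
  by (simp_all add: frame_x_def)

lemma frame_y_eq:
  "frame_y 0 q = quintic_section (slope_yx q ^ 2) (slope_yx q) 1" "frame_y 1 q = quintic_section 1 0 (slope_yx q ^ 3)"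
  by (simp_all add: frame_y_def)

lemma syzygy_affine:
  assumes "x (rep q) \<noteq> 0"
  shows "syzygy q a b c \<longleftrightarrow> b = a * slope_xy q + b * slope_xy q ^ 5 - c * slope_xy q ^ 4"
    "conic_syzygy q a b c \<longleftrightarrow> b = a * slope_xy q \<and> c = b * slope_xy q"
proof -
  define X z where "X = x (rep q)" and "z = slope_xy q"
  have X: "X \<noteq> 0" and Y: "y (rep q) = X * z" using assms by (simp_all add: X_def z_def slope_xy_def)
  have "quintic a b c X (X * z) = X ^ 5 * (a * z + b * z ^ 5 - c * z ^ 4 - b)"
    by (simp add: quintic_def eval_nat_numeral algebra_simps)
  then have "syzygy q a b c \<longleftrightarrow> a * z + b * z ^ 5 - c * z ^ 4 - b = 0"
    using X by (simp add: syzygy_def Y X_def[symmetric])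
  then show "syzygy q a b c \<longleftrightarrow> b = a * slope_xy q + b * slope_xy q ^ 5 - c * slope_xy q ^ 4"
    unfolding z_def[symmetric] eq_iff_diff_eq_0[symmetric] by (rule trans) (rule eq_commute)
  have "b * X = a * (X * z) \<longleftrightarrow> b = a * z" "c * X = b * (X * z) \<longleftrightarrow> c = b * z" using X by auto
  then show "conic_syzygy q a b c \<longleftrightarrow> b = a * slope_xy q \<and> c = b * slope_xy q"
    by (simp only: conic_syzygy_def Y X_def[symmetric] z_def[symmetric])
qed

lemma syzygy_affine':
  assumes "y (rep q) \<noteq> 0"
  shows "syzygy q a b c \<longleftrightarrow> b = c * slope_yx q + b * slope_yx q ^ 5 - a * slope_yx q ^ 4"
    "conic_syzygy q a b c \<longleftrightarrow> b = c * slope_yx q \<and> a = b * slope_yx q"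
proof -
  define Y z where "Y = y (rep q)" and "z = slope_yx q"
  have Y: "Y \<noteq> 0" and X: "x (rep q) = Y * z" using assms by (simp_all add: Y_def z_def slope_yx_def)
  have "quintic a b c (Y * z) Y = Y ^ 5 * (b - (c * z + b * z ^ 5 - a * z ^ 4))"
    by (simp add: quintic_def eval_nat_numeral algebra_simps)
  then have "syzygy q a b c \<longleftrightarrow> b - (c * z + b * z ^ 5 - a * z ^ 4) = 0"
    using Y by (simp add: syzygy_def X Y_def[symmetric])
  then show "syzygy q a b c \<longleftrightarrow> b = c * slope_yx q + b * slope_yx q ^ 5 - a * slope_yx q ^ 4"
    unfolding z_def[symmetric] eq_iff_diff_eq_0[symmetric] .
  have "b * (Y * z) = a * Y \<longleftrightarrow> a = b * z" "c * (Y * z) = b * Y \<longleftrightarrow> b = c * z" using Y by auto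
  then show "conic_syzygy q a b c \<longleftrightarrow> b = c * slope_yx q \<and> a = b * slope_yx q"
    by (auto simp only: conic_syzygy_def X Y_def[symmetric] z_def[symmetric])
qed

lemma sum_frame:
  "(\<Sum>i<1. f i *\<^sub>C e i) = f 0 *\<^sub>C e 0" "(\<Sum>i<2. f i *\<^sub>C e i) = f 0 *\<^sub>C e 0 + f 1 *\<^sub>C e 1"
  for e :: "nat \<Rightarrow> 'v::complex_vector"
  by (simp_all add: numeral_2_eq_2)

lemma less_two_cases: "i < (2::nat) \<Longrightarrow> i = 0 \<or> i = 1"
  by linarith

lemma frame_x_combination:
  "\<alpha> *\<^sub>C frame_x 0 q + \<beta> *\<^sub>C frame_x 1 q
    = quintic_section (\<alpha> + \<beta> * slope_xy q ^ 3) (\<alpha> * slope_xy q) (\<alpha> * slope_xy q ^ 2 + \<beta>)"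
  unfolding frame_x_eq quintic_section_linear[symmetric] by simp

lemma frame_y_combination:
  "\<alpha> *\<^sub>C frame_y 0 q + \<beta> *\<^sub>C frame_y 1 q
    = quintic_section (\<alpha> * slope_yx q ^ 2 + \<beta>) (\<alpha> * slope_yx q) (\<alpha> + \<beta> * slope_yx q ^ 3)"
  unfolding frame_y_eq quintic_section_linear[symmetric] by simp

lemma combination_eq_0:
  fixes \<alpha> \<beta> z :: complex
  assumes "\<alpha> + \<beta> * z ^ 3 = 0" "\<alpha> * z = 0" "\<alpha> * z ^ 2 + \<beta> = 0"
  shows "\<alpha> = 0" "\<beta> = 0"
proof -
  have "\<alpha> * z ^ 2 = 0" using assms(2) by simp
  then show "\<beta> = 0" using assms(3) by (simp only: add_0)
  then show "\<alpha> = 0" using assms(1) by simp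
qed

text \<open>Solving \<open>(a, b, c) = \<alpha> (1, z, z\<^sup>2) + \<beta> (z\<^sup>3, 0, 1)\<close> for a syzygy \<open>(a, b, c)\<close>.\<close>

lemma combination_solve:
  fixes a b c z :: complex
  assumes "b = a * z + b * z ^ 5 - c * z ^ 4"
  defines "\<alpha> \<equiv> a + z ^ 4 * b - z ^ 3 * c"
  shows "\<alpha> + (c - z ^ 2 * \<alpha>) * z ^ 3 = a" "\<alpha> * z = b"
proof -
  have "\<alpha> * z = a * z + b * z ^ 5 - c * z ^ 4" by (simp add: \<alpha>_def eval_nat_numeral algebra_simps)
  then show z: "\<alpha> * z = b" using assms(1) by simp
  have "\<alpha> + (c - z ^ 2 * \<alpha>) * z ^ 3 = \<alpha> + c * z ^ 3 - (\<alpha> * z) * z ^ 4" by (simp add: eval_nat_numeral algebra_simps)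
  then show "\<alpha> + (c - z ^ 2 * \<alpha>) * z ^ 3 = a" unfolding z by (simp add: \<alpha>_def)
qed

lemma cube_mult: "z ^ 3 * z = (z :: complex) ^ 4"
  by (simp add: eval_nat_numeral)

lemma frame_syzygy_x: "frame C 2 (coefficient_sheaf syzygy) affine_x frame_x"
\<comment> \<open>Writing (a, b, c) as \<open>\<alpha> (1, z, z^2) + \<beta> (z^3, 0, 1)\<close>
  gives \<open>\<beta> = c - z^2 \<alpha>\<close> and
  \<open>\<alpha> = a - z^3 c + z^5 \<alpha>\<close>. Replacing \<open>z \<alpha>\<close> by
  \<open>b\<close> on the right yields an expression without division, regular also where
  \<open>z = 0\<close>.\<close>
proof (rule frame_coefficient[where \<Lambda> = "\<lambda>i q v. if i = 0 then coeff0 v + slope_xy q ^ 4 * coeff1 v - slope_xy q ^ 3 * coeff2 v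
      else coeff2 v - slope_xy q ^ 2 * (coeff0 v + slope_xy q ^ 4 * coeff1 v - slope_xy q ^ 3 * coeff2 v)"])
  note U = open_affine(1)
  note z = regular_slope(1)[OF U subset_refl]
  show "opn affine_x" by (rule U)
  show "frame_x i \<in> coefficient_sheaf syzygy affine_x" if "i < 2" for i
    using less_two_cases[OF that]
  proof
    assume i: "i = 0"
    show ?thesis unfolding i
      by (rule coefficient_sheafI[OF regular_on_const[OF U, of 1] z regular_on_power[OF U z, of 2]])
        (simp_all add: frame_x_eq syzygy_affine eval_nat_numeral)
  next
    assume i: "i = 1"
    show ?thesis unfolding i
      by (rule coefficient_sheafI[OF regular_on_power[OF U z, of 3] regular_on_const[OF U, of 0] regular_on_const[OF U, of 1]])
        (simp_all add: frame_x_eq[unfolded One_nat_def] syzygy_affine cube_mult)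
  qed
  show "regular_on C W (\<lambda>q. if i = 0 then coeff0 (\<sigma> q) + slope_xy q ^ 4 * coeff1 (\<sigma> q) - slope_xy q ^ 3 * coeff2 (\<sigma> q)
      else coeff2 (\<sigma> q) - slope_xy q ^ 2 * (coeff0 (\<sigma> q) + slope_xy q ^ 4 * coeff1 (\<sigma> q) - slope_xy q ^ 3 * coeff2 (\<sigma> q)))"
    if W: "opn W" "W \<subseteq> affine_x" and \<sigma>: "\<sigma> \<in> coefficient_sheaf syzygy W" for W \<sigma> and i :: nat
  proof -
    note r = regular_slope(1)[OF W] coefficient_sheafD(1-3)[OF \<sigma>] W(1)
    show ?thesis
      by (cases "i = 0"; simp only: simp_thms if_True if_False; intro regular_on_diff regular_on_add regular_on_mult regular_on_power r)
  qed
  show "v = (\<Sum>i<2. (if i = 0 then coeff0 v + slope_xy q ^ 4 * coeff1 v - slope_xy q ^ 3 * coeff2 v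
      else coeff2 v - slope_xy q ^ 2 * (coeff0 v + slope_xy q ^ 4 * coeff1 v - slope_xy q ^ 3 * coeff2 v)) *\<^sub>C frame_x i q)"
    if q: "q \<in> affine_x" and v: "v \<in> V" and s: "syzygy q (coeff0 v) (coeff1 v) (coeff2 v)" for q v
  proof -
    have "coeff1 v = coeff0 v * slope_xy q + coeff1 v * slope_xy q ^ 5 - coeff2 v * slope_xy q ^ 4"
      using s q by (simp only: syzygy_affine mem_Collect_eq simp_thms)
    note sol = combination_solve[OF this]
    have "\<alpha> * z\<^sup>2 + (c - z\<^sup>2 * \<alpha>) = c" for \<alpha> z c :: complex by (simp add: mult.commute)
    then show ?thesis
      by (simp only: sum_frame if_True if_False one_neq_zero simp_thms frame_x_combination sol quintic_section_coeff[OF v])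
  qed
  show "a i = 0" if "q \<in> affine_x" "(\<Sum>i<2. a i *\<^sub>C frame_x i q) = 0" "i < 2" for q a i
  proof -
    have "a 0 = 0" "a 1 = 0"
      using that(2) combination_eq_0[of "a 0" "a 1" "slope_xy q"]
      unfolding sum_frame frame_x_combination quintic_section_eq_0_iff by blast+
    then show ?thesis using less_two_cases[OF that(3)] by blast
  qed
qed

text \<open>Exchanging \<open>X\<close> and \<open>Y\<close> turns the quintic with coefficients (a,
  b, c) into minus the one with (c, b, a), so the other chart carries over with
  \<open>coeff0\<close> and \<open>coeff2\<close> exchanged.\<close>

lemma frame_syzygy_y: "frame C 2 (coefficient_sheaf syzygy) affine_y frame_y"
proof (rule frame_coefficient[where \<Lambda> = "\<lambda>i q v. if i = 0 then coeff2 v + slope_yx q ^ 4 * coeff1 v - slope_yx q ^ 3 * coeff0 v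
      else coeff0 v - slope_yx q ^ 2 * (coeff2 v + slope_yx q ^ 4 * coeff1 v - slope_yx q ^ 3 * coeff0 v)"])
  note U = open_affine(2)
  note z = regular_slope(2)[OF U subset_refl]
  show "opn affine_y" by (rule U)
  show "frame_y i \<in> coefficient_sheaf syzygy affine_y" if "i < 2" for i
    using less_two_cases[OF that]
  proof
    assume i: "i = 0"
    show ?thesis unfolding i
      by (rule coefficient_sheafI[OF regular_on_power[OF U z, of 2] z regular_on_const[OF U, of 1]])
        (simp_all add: frame_y_eq syzygy_affine' eval_nat_numeral)
  next
    assume i: "i = 1"
    show ?thesis unfolding i
      by (rule coefficient_sheafI[OF regular_on_const[OF U, of 1] regular_on_const[OF U, of 0] regular_on_power[OF U z, of 3]])
        (simp_all add: frame_y_eq[unfolded One_nat_def] syzygy_affine' cube_mult)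
  qed
  show "regular_on C W (\<lambda>q. if i = 0 then coeff2 (\<sigma> q) + slope_yx q ^ 4 * coeff1 (\<sigma> q) - slope_yx q ^ 3 * coeff0 (\<sigma> q)
      else coeff0 (\<sigma> q) - slope_yx q ^ 2 * (coeff2 (\<sigma> q) + slope_yx q ^ 4 * coeff1 (\<sigma> q) - slope_yx q ^ 3 * coeff0 (\<sigma> q)))"
    if W: "opn W" "W \<subseteq> affine_y" and \<sigma>: "\<sigma> \<in> coefficient_sheaf syzygy W" for W \<sigma> and i :: nat
  proof -
    note r = regular_slope(2)[OF W] coefficient_sheafD(1-3)[OF \<sigma>] W(1)
    show ?thesis
      by (cases "i = 0"; simp only: simp_thms if_True if_False; intro regular_on_diff regular_on_add regular_on_mult regular_on_power r)
  qed
  show "v = (\<Sum>i<2. (if i = 0 then coeff2 v + slope_yx q ^ 4 * coeff1 v - slope_yx q ^ 3 * coeff0 v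
      else coeff0 v - slope_yx q ^ 2 * (coeff2 v + slope_yx q ^ 4 * coeff1 v - slope_yx q ^ 3 * coeff0 v)) *\<^sub>C frame_y i q)"
    if q: "q \<in> affine_y" and v: "v \<in> V" and s: "syzygy q (coeff0 v) (coeff1 v) (coeff2 v)" for q v
  proof -
    have "coeff1 v = coeff2 v * slope_yx q + coeff1 v * slope_yx q ^ 5 - coeff0 v * slope_yx q ^ 4"
      using s q by (simp only: syzygy_affine' mem_Collect_eq simp_thms)
    note sol = combination_solve[OF this]
    have "\<alpha> * z\<^sup>2 + (c - z\<^sup>2 * \<alpha>) = c" for \<alpha> z c :: complex by (simp add: mult.commute)
    then show ?thesis
      by (simp only: sum_frame if_True if_False one_neq_zero simp_thms frame_y_combination sol quintic_section_coeff[OF v])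
  qed
  show "a i = 0" if "q \<in> affine_y" "(\<Sum>i<2. a i *\<^sub>C frame_y i q) = 0" "i < 2" for q a i
  proof -
    have "a 0 = 0" "a 1 = 0"
      using that(2) combination_eq_0[of "a 0" "a 1" "slope_yx q"]
      unfolding sum_frame frame_y_combination quintic_section_eq_0_iff by blast+
    then show ?thesis using less_two_cases[OF that(3)] by blast
  qed
qed

text \<open>A multiple of \<open>(1, z, z^2)\<close> is determined by its first entry, which is
  therefore the coordinate in this chart; in the other chart it is the last entry.\<close>

lemma frame_conic_x: "frame C 1 (coefficient_sheaf conic_syzygy) affine_x frame_x"
proof (rule frame_coefficient[where \<Lambda> = "\<lambda>_ _ v. coeff0 v"])
  note U = open_affine(1)
  note z = regular_slope(1)[OF U subset_refl]
  show "opn affine_x" by (rule U)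
  show "frame_x i \<in> coefficient_sheaf conic_syzygy affine_x" if "i < 1" for i
  proof -
    have i: "i = 0" using that by simp
    show ?thesis unfolding i
      by (rule coefficient_sheafI[OF regular_on_const[OF U, of 1] z regular_on_power[OF U z, of 2]])
        (simp_all add: frame_x_eq syzygy_affine eval_nat_numeral)
  qed
  show "regular_on C W (\<lambda>q. coeff0 (\<sigma> q))" if "\<sigma> \<in> coefficient_sheaf conic_syzygy W" for W \<sigma>
    by (rule coefficient_sheafD(1)[OF that])
  show "v = (\<Sum>i<1. coeff0 v *\<^sub>C frame_x i q)"
    if q: "q \<in> affine_x" and v: "v \<in> V" and s: "conic_syzygy q (coeff0 v) (coeff1 v) (coeff2 v)" for q v
  proof -
    have "coeff1 v = coeff0 v * slope_xy q \<and> coeff2 v = coeff1 v * slope_xy q"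
      using s q by (simp only: syzygy_affine mem_Collect_eq simp_thms)
    then have "quintic_section (coeff0 v * 1) (coeff0 v * slope_xy q) (coeff0 v * slope_xy q ^ 2) = v"
      using quintic_section_coeff[OF v] by (simp add: power2_eq_square mult.assoc)
    then show ?thesis unfolding sum_frame frame_x_eq quintic_section_linear(2) by simp
  qed
  show "a i = 0" if "(\<Sum>i<1. a i *\<^sub>C frame_x i q) = 0" "i < 1" for q a i
    using that unfolding sum_frame frame_x_eq quintic_section_linear(2)[symmetric] quintic_section_eq_0_iff by simp
qed

lemma frame_conic_y: "frame C 1 (coefficient_sheaf conic_syzygy) affine_y frame_y"
proof (rule frame_coefficient[where \<Lambda> = "\<lambda>_ _ v. coeff2 v"])
  note U = open_affine(2)
  note z = regular_slope(2)[OF U subset_refl]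
  show "opn affine_y" by (rule U)
  show "frame_y i \<in> coefficient_sheaf conic_syzygy affine_y" if "i < 1" for i
  proof -
    have i: "i = 0" using that by simp
    show ?thesis unfolding i
      by (rule coefficient_sheafI[OF regular_on_power[OF U z, of 2] z regular_on_const[OF U, of 1]])
        (simp_all add: frame_y_eq syzygy_affine' eval_nat_numeral)
  qed
  show "regular_on C W (\<lambda>q. coeff2 (\<sigma> q))" if "\<sigma> \<in> coefficient_sheaf conic_syzygy W" for W \<sigma>
    by (rule coefficient_sheafD(3)[OF that])
  show "v = (\<Sum>i<1. coeff2 v *\<^sub>C frame_y i q)"
    if q: "q \<in> affine_y" and v: "v \<in> V" and s: "conic_syzygy q (coeff0 v) (coeff1 v) (coeff2 v)" for q v
  proof -
    have "coeff1 v = coeff2 v * slope_yx q \<and> coeff0 v = coeff1 v * slope_yx q"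
      using s q by (simp only: syzygy_affine' mem_Collect_eq simp_thms)
    then have "quintic_section (coeff2 v * slope_yx q ^ 2) (coeff2 v * slope_yx q) (coeff2 v * 1) = v"
      using quintic_section_coeff[OF v] by (simp add: power2_eq_square mult.assoc)
    then show ?thesis unfolding sum_frame frame_y_eq quintic_section_linear(2) by simp
  qed
  show "a i = 0" if "(\<Sum>i<1. a i *\<^sub>C frame_y i q) = 0" "i < 1" for q a i
    using that unfolding sum_frame frame_y_eq quintic_section_linear(2)[symmetric] quintic_section_eq_0_iff by simp
qed

section \<open>Degree and instability of the dual span bundle\<close>

lemma vector_bundle_coefficient:
  assumes "module_sheaf C E" "frame C r E affine_x frame_x" "frame C r E affine_y frame_y"
  shows "vector_bundle_of_rank C r E"
  unfolding vector_bundle_of_rank_def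
proof (intro conjI ballI)
  fix p assume p: "p \<in> C"
  show "\<exists>U e. p \<in> U \<and> frame C r E U e"
  proof (cases "x (rep p) = 0")
    case True
    then have "p \<in> affine_y" using p no_base_point[OF p] by simp
    then show ?thesis using assms(3) by (intro exI conjI)
  next
    case False
    then have "p \<in> affine_x" using p by simp
    then show ?thesis using assms(2) by (intro exI conjI)
  qed
qed (rule assms(1))

text \<open>The two frames are related by a diagonal matrix with entries \<open>z ^ 2\<close> and
  \<open>z ^ 3\<close>. This is the splitting into the pullbacks of \<open>O(-2)\<close> and
  \<open>O(-3)\<close>, from which both degrees are read off.\<close>

lemma frame_transition:
  assumes "i < 2" "x (rep q) \<noteq> 0" "y (rep q) \<noteq> 0"
  shows "frame_x i q = slope_xy q ^ (2 + i) *\<^sub>C frame_y i q"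
proof -
  define z where "z = slope_xy q"
  have z: "z \<noteq> 0" "slope_yx q = 1 / z" using assms by (simp_all add: z_def slope_xy_def slope_yx_def)
  show ?thesis
    using less_two_cases[OF assms(1)]
  proof
    assume i: "i = 0"
    show ?thesis unfolding i frame_x_eq frame_y_eq quintic_section_linear(2)[symmetric] quintic_section_inject z(2)
      using z(1) by (simp add: z_def[symmetric] power2_eq_square)
  next
    assume i: "i = 1"
    show ?thesis unfolding i frame_x_eq frame_y_eq quintic_section_linear(2)[symmetric] quintic_section_inject z(2)
      using z(1) by (simp add: z_def[symmetric] eval_nat_numeral)
  qed
qed

text \<open>Leaving \<open>r\<close> open covers the dual span bundle, with exponent
  \<open>2 + 3\<close>, and the line subbundle, with exponent 2. The transition determinant is this
  power of \<open>y / x\<close>, so the frame over \<open>affine_x\<close> has poles exactly along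
  the zeros of \<open>x\<close>.\<close>

lemma frame_order_x:
  assumes E: "frame C r E affine_x frame_x" "frame C r E affine_y frame_y" and r: "r \<le> 2" and p: "p \<in> C"
  shows "has_frame_order_at C r E affine_x frame_x p (- int ((\<Sum>i<r. 2 + i) * order_at p x))"
proof (cases "x (rep p) = 0")
  case False
  then have "order_at p x = 0" using order_at_eq_0_iff[OF p x] by blast
  then have k: "- int ((\<Sum>i<r. 2 + i) * order_at p x) = 0" by simp
  show ?thesis
    unfolding k by (rule has_frame_order_atI[OF p _ E(1) frame_self_transition[OF E(1)] identity_rational_order[OF p]])
      (use False p in simp)
next
  case True
  define n where "n = (\<Sum>i<r. 2 + i)"
  have yp: "y (rep p) \<noteq> 0" using no_base_point[OF p] True by simp
  have z: "regular_on C (affine_y \<inter> affine_x) slope_xy"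
    by (rule regular_slope(1)[OF open_in_Int[OF open_affine(2,1)]]) blast
  let ?a = "\<lambda>i j q. if i = j then slope_xy q ^ (2 + i) else 0"
  have reg: "\<forall>i<r. \<forall>j<r. regular_on C (affine_y \<inter> affine_x) (?a i j)"
  proof (intro allI impI)
    fix i j
    show "regular_on C (affine_y \<inter> affine_x) (?a i j)"
    proof (cases "i = j")
      case True
      then show ?thesis
        using regular_on_power[OF open_in_Int[OF open_affine(2,1)] z, of "2 + i"] by simp
    next
      case False
      then show ?thesis
        using regular_on_const[OF open_in_Int[OF open_affine(2,1)], of 0] by simp
    qed
  qed
  have tr: "\<forall>i<r. \<forall>q\<in>affine_y \<inter> affine_x. frame_x i q = (\<Sum>j<r. ?a i j q *\<^sub>C frame_y j q)"
  proof (intro allI impI ballI)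
    fix i q assume i: "i < r" and q: "q \<in> affine_y \<inter> affine_x"
    have "(\<Sum>j<r. ?a i j q *\<^sub>C frame_y j q) = (\<Sum>j<r. if i = j then slope_xy q ^ (2 + i) *\<^sub>C frame_y j q else 0)"
      by (rule sum.cong) auto
    also have "\<dots> = slope_xy q ^ (2 + i) *\<^sub>C frame_y i q" using i by simp
    also have "\<dots> = frame_x i q" by (rule frame_transition[symmetric]) (use i r q in auto)
    finally show "frame_x i q = (\<Sum>j<r. ?a i j q *\<^sub>C frame_y j q)" by (rule sym)
  qed
  have det: "transition_det r ?a q = slope_xy q ^ n" for q
    unfolding n_def transition_det_diagonal[where c = "\<lambda>i q. slope_xy q ^ (2 + i)"] by (rule power_sum[symmetric])
  have hom: "homogeneous n (y ^ n)" "homogeneous n (x ^ n)"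
    using homogeneous_power[OF y(1), of n] homogeneous_power[OF x(1), of n] by (simp_all only: mult_1_right)
  have nv: "\<not> vanishes (y ^ n)" "\<not> vanishes (x ^ n)"
    using vanishes_power[OF y(1), of n] vanishes_power[OF x(1), of n] x(2) y(2) by blast+
  have "order_at p y = 0" using order_at_eq_0_iff[OF p y] yp by blast
  then have ord: "order_at p (y ^ n) = 0" "order_at p (x ^ n) = n * order_at p x"
    by (simp_all add: order_at_power[OF p y] order_at_power[OF p x])
  have "affine_x \<noteq> {}" using x(2) by (auto simp: vanishes_def)
  have rat: "rational_order p (transition_det r ?a) (- int (n * order_at p x))"
    by (rule rational_orderI[OF open_affine(1) \<open>affine_x \<noteq> {}\<close> hom nv])
      (simp_all add: det ord slope_xy_def power_divide)
  show ?thesis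
    unfolding n_def[symmetric] by (rule has_frame_order_atI[OF p _ E(2) reg tr rat]) (use yp p in simp)
qed

lemma degree_coefficient:
  assumes E: "module_sheaf C E" "frame C r E affine_x frame_x" "frame C r E affine_y frame_y" and r: "r \<le> 2"
  shows "bundle_degree C E = - int ((\<Sum>i<r. 2 + i) * hyperplane_degree)"
proof -
  let ?P = "{p \<in> C. order_at p x \<noteq> 0}"
  have ne: "affine_x \<noteq> {}" using x(2) by (auto simp: vanishes_def)
  have "bundle_degree C E = (\<Sum>p\<in>?P. - int ((\<Sum>i<r. 2 + i) * order_at p x))"
    by (rule bundle_degree_eq[OF vector_bundle_coefficient[OF E] E(2) ne frame_order_x[OF E(2,3) r] order_at_eq_0_outside[OF x]])
      auto
  also have "\<dots> = - int ((\<Sum>i<r. 2 + i) * (\<Sum>p\<in>?P. order_at p x))"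
    unfolding sum_negf by (simp add: sum_distrib_left)
  also have "(\<Sum>p\<in>?P. order_at p x) = hyperplane_degree"
    using form_degree_homogeneous[OF x] by (simp add: form_degree_def)
  finally show ?thesis .
qed

lemma dual_span_bundle_syzygy:
  "module_sheaf C (dual_span_bundle C V)" "frame C 2 (dual_span_bundle C V) affine_x frame_x"
  "frame C 2 (dual_span_bundle C V) affine_y frame_y"
proof -
  note eq = dual_span_bundle_eq
  show "module_sheaf C (dual_span_bundle C V)"
    by (rule module_sheaf_cong[where E' = "coefficient_sheaf syzygy", OF eq, THEN iffD2, OF _ module_sheaf_syzygy])
  show "frame C 2 (dual_span_bundle C V) affine_x frame_x" "frame C 2 (dual_span_bundle C V) affine_y frame_y"
    by (rule frame_cong[where E' = "coefficient_sheaf syzygy", OF eq, THEN iffD2, OF _ frame_syzygy_x]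
        frame_cong[where E' = "coefficient_sheaf syzygy", OF eq, THEN iffD2, OF _ frame_syzygy_y], assumption)+
qed

lemma unstable_dual_span_bundle: "unstable C (dual_span_bundle C V)"
proof -
  let ?M = "dual_span_bundle C V" and ?F = "coefficient_sheaf conic_syzygy"
  note M = dual_span_bundle_syzygy and F = module_sheaf_conic_syzygy frame_conic_x frame_conic_y
  have bundles: "vector_bundle_of_rank C 2 ?M" "vector_bundle_of_rank C 1 ?F"
    by (rule vector_bundle_coefficient[OF M], rule vector_bundle_coefficient[OF F])
  have rank: "bundle_rank C ?M = 2" "bundle_rank C ?F = 1"
    by (rule bundle_rank_eq[OF bundles(1)], rule bundle_rank_eq[OF bundles(2)])
  have sub: "subbundle C ?F ?M"
    unfolding subbundle_def rank
  proof (intro conjI allI impI ballI)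
    show "vector_bundle C ?F" unfolding vector_bundle_def by (rule exI[of _ 1]) (rule bundles(2))
    show "?F U \<subseteq> ?M U" if "opn U" for U
      unfolding dual_span_bundle_eq[OF that] coefficient_sheaf_def using conic_syzygy_imp_syzygy by blast
    fix p assume p: "p \<in> C"
    \<comment> \<open>The same family \<open>frame_x\<close> or \<open>frame_y\<close> serves both
      ranks, so near each point the subbundle is spanned by the first member of a frame of the dual
      span bundle.\<close>
    show "\<exists>U e. p \<in> U \<and> frame C 2 ?M U e \<and> frame C 1 ?F U e"
    proof (cases "x (rep p) = 0")
      case True
      then have "p \<in> affine_y" using p no_base_point[OF p] by simp
      then show ?thesis using M(3) F(3) by (intro exI conjI)
    next
      case False
      then have "p \<in> affine_x" using p by simp
      then show ?thesis using M(2) F(2) by (intro exI conjI)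
    qed
  qed
  have "bundle_degree C ?M = - int (5 * hyperplane_degree)" "bundle_degree C ?F = - int (2 * hyperplane_degree)"
    using degree_coefficient[OF M] degree_coefficient[OF F] by (simp_all add: numeral_2_eq_2)
  then have "slope C ?M < slope C ?F"
    unfolding slope_def rank using hyperplane_degree_pos by simp
  then have "\<not> semistable C ?M"
    unfolding semistable_def using sub rank by (metis less_numeral_extra(1) linorder_not_less one_less_numeral_iff semiring_norm(76))
  then show ?thesis unfolding unstable_def vector_bundle_def using bundles(1) by blast
qed

lemma linear_system_V: "linear_system C (generated_subsheaf C V) V"
  unfolding linear_system_def line_bundle_def generates_def global_sections_def
proof (intro conjI allI impI refl)
  show "vector_bundle_of_rank C 1 (generated_subsheaf C V)" by (rule generated_line_bundle[OF form_system_V])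
  show "complex_vector.subspace V" by (rule subspace_V)
  show "\<exists>B. finite B \<and> V = complex_vector.span B"
    using card_V_basis(1) span_V_basis by blast
  show "V \<subseteq> {s \<in> generated_subsheaf C V C. \<forall>p. p \<notin> C \<longrightarrow> s p = 0}"
  proof
    fix v assume v: "v \<in> V"
    then obtain a b c where "v = quintic_section a b c" by (rule V_E)
    then have "\<forall>p. p \<notin> C \<longrightarrow> v p = 0" by (simp add: quintic_section_apply)
    then show "v \<in> {s \<in> generated_subsheaf C V C. \<forall>p. p \<notin> C \<longrightarrow> s p = 0}"
      using generated_subsheaf_base[OF open_in_self v] by simp
  qed
qed

lemma V_not_complete: "V \<noteq> global_sections C (generated_subsheaf C V)"
proof
  assume V: "V = global_sections C (generated_subsheaf C V)"
  have hom: "homogeneous 5 (x ^ 5)" using homogeneous_power[OF x(1), of 5] by (simp only: mult_1_right)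
  have "restrict_form (x ^ 5) \<in> generated_subsheaf C V C"
  proof (rule generated_subsheafI)
    fix p assume p: "p \<in> C"
    \<comment> \<open>The sheaf generated by \<open>V\<close> contains all forms of degree 5: some
      member of the net is nonzero at \<open>p\<close>, and near \<open>p\<close> the form
      \<open>x ^ 5\<close> is a regular multiple of it.\<close>
    obtain a b c where nz: "quintic_form a b c (rep p) \<noteq> 0" using V_no_base_point[OF p] by blast
    let ?f = "quintic_form a b c" and ?v = "quintic_section a b c"
    let ?W = "{q \<in> C. ?f (rep q) \<noteq> 0}"
    have W: "opn ?W" by (rule open_in_nonzero[OF homogeneous_quintic_form])
    have reg: "regular_on C ?W (\<lambda>q. x (rep q) ^ 5 / ?f (rep q))"
      by (rule regular_on_quotient[OF W hom homogeneous_quintic_form[of a b c]]) simp_all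
    show "\<exists>W B a. opn W \<and> p \<in> W \<and> W \<subseteq> C \<and> finite B \<and> B \<subseteq> V \<and> (\<forall>v\<in>B. regular_on C W (a v)) \<and>
        (\<forall>q\<in>W. restrict_form (x ^ 5) q = (\<Sum>v\<in>B. a v q * v q))"
      by (rule exI[of _ ?W], rule exI[of _ "{?v}"], rule exI[of _ "\<lambda>_ q. x (rep q) ^ 5 / ?f (rep q)"])
        (use W reg p nz V_I in \<open>auto simp: restrict_form_def quintic_section_def\<close>)
  qed
  then have "restrict_form (x ^ 5) \<in> V"
    unfolding V[symmetric] by (subst V) (simp add: global_sections_def restrict_form_def)
  then obtain a b c where eq: "restrict_form (x ^ 5) = quintic_section a b c" by (rule V_E)
  have at: "x (rep p) ^ 5 = quintic a b c (x (rep p)) (y (rep p))" if "p \<in> C" for p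
    using fun_cong[OF eq, of p] that by (simp add: restrict_form_def quintic_section_apply)
  \<comment> \<open>At a zero of \<open>x\<close> the equation forces \<open>b = 0\<close>, at a
    zero of \<open>y\<close> it forces \<open>b = -1\<close>.\<close>
  obtain p t where p: "p \<in> C" "t \<noteq> 0" "x (rep p) = t * 0" "y (rep p) = t * 1"
    by (rule pencil_surjective[of 0 1]) auto
  obtain q u where q: "q \<in> C" "u \<noteq> 0" "x (rep q) = u * 1" "y (rep q) = u * 0"
    by (rule pencil_surjective[of 1 0]) auto
  show False using at[OF p(1)] at[OF q(1)] p q by (simp add: quintic_def)
qed

end

theorem proposition8p4:
  fixes C :: "'n::finite proj set"
  assumes "smooth_irreducible_projective_curve C"
  shows "\<exists>(L :: ('n, complex) fun_sheaf) V.
    linear_system C L V \<and> V \<noteq> global_sections C L \<and>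
    linearly_stable C L V \<and> unstable C (dual_span_bundle C V)"
proof -
  interpret curve C by unfold_locales (rule assms)
  obtain p where p: "p \<in> C" using infinite_curve by fastforce
  obtain x where x: "homogeneous 1 x" "\<forall>q\<in>{p}. x (rep q) \<noteq> 0"
    using linear_form_avoiding[of "{p}"] by auto
  then have nx: "\<not> vanishes x" using p by (auto simp: vanishes_def)
  \<comment> \<open>Avoiding the finitely many zeros of \<open>x\<close> excludes base points;
    \<open>p\<close> is added to the avoided set so that \<open>y\<close> is visibly nonzero on
    \<open>C\<close>.\<close>
  obtain y where y: "homogeneous 1 y" "\<forall>q\<in>insert p {q \<in> C. x (rep q) = 0}. y (rep q) \<noteq> 0"
    using linear_form_avoiding[of "insert p {q \<in> C. x (rep q) = 0}"] finite_zeros[OF x(1) nx] by auto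
  then have ny: "\<not> vanishes y" using p by (auto simp: vanishes_def)
  interpret pencil C x y
    by unfold_locales (use x(1) y nx ny in auto)
  show ?thesis
    using linear_system_V V_not_complete linearly_stable_V unstable_dual_span_bundle by (intro exI conjI)
qed

end
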